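(* Let $m,n\ge 1$ be integers, and let $A^0,A^1,\dots,A^n,L$ be real constant $m\times m$ matrices. Assume that conditions (A), (S), (S)$_1$ and (K) (all spelled out in the context; (S) and (S)$_1$ are required for one and the same matrix $S$) hold. Consider the Cauchy problem $$A^0u_t+\sum_{j=1}^nA^ju_{x_j}+Lu=0,\qquad u|_{t=0}=u_0,$$ for $u=u(t,x)\in\mathbb{R}^m$, $t>0$, $x\in\mathbb{R}^n$. Then there are constants $C,c>0$ such that the Fourier image $\hat u$ of the solution $u$ satisfies $$|\hat u(t,\xi)|\le Ce^{-c\,\eta(\xi)t}|\hat u_0(\xi)|,\qquad \eta(\xi):=\frac{|\xi|^2}{(1+|\xi|^2)^2},$$ for all $t\ge 0$ and $\xi\in\mathbb{R}^n$. Moreover, let $s\ge 0$ be an integer and suppose $u_0\in H^s(\mathbb{R}^n)\cap L^1(\mathbb{R}^n)$. Then, for all nonnegative integers $k,\ell$ with $k+\ell\le s$ and all $t\ge 0$, $$\|\partial_x^ku(t)\|_{L^2}\le C(1+t)^{-n/4-k/2}\|u_0\|_{L^1}+C(1+t)^{-\ell/2}\|\partial_x^{k+\ell}u_0\|_{L^2},$$ where $C>0$ is a constant independent of $t$ and $u_0$.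
   Context: Notation. $\langle\cdot,\cdot\rangle$ is the standard complex inner product on $\mathbb{C}^m$. For a matrix $X$ and a subspace $V\subset\mathbb{C}^m$, "$X\ge 0$ on $V$" means $\mathrm{Re}\,\langle Xz,z\rangle\ge 0$ for all $z\in V$, and "$X>0$ on $V$" means $\mathrm{Re}\,\langle Xz,z\rangle>0$ for all $0\ne z\in V$. For a real square matrix $X$, $X_1:=(X+X^T)/2$ and $X_2:=(X-X^T)/2$ are its symmetric and skew-symmetric parts. Kernels are taken in $\mathbb{C}^m$. For $\omega\in S^{n-1}$, $A(\omega):=\sum_{j=1}^nA^j\omega_j$. $\partial_x^k$ denotes the totality of all $k$-th order $x$-derivatives, and $H^s$ is the $L^2$-based Sobolev space. $\hat u(t,\xi)$ is the Fourier transform in $x$ of $u$; it solves $A^0\hat u_t+i|\xi|A(\omega)\hat u+L\hat u=0$, $\hat u(0,\xi)=\hat u_0(\xi)$, with $\omega=\xi/|\xi|$. The constants $C,c$ in the pointwise estimate do not depend on $t,\xi,u_0$. Condition (A): $A^0,A^1,\dots,A^n$ are real symmetric, $A^0>0$ on $\mathbb{C}^m$, $L$ is real (not necessarily symmetric) with $L\ge 0$ on $\mathbb{C}^m$, and $\mathrm{Ker}(L)\ne\{0\}$. Condition (S): there is a real constant matrix $S$ such that $(SA^0)^T=SA^0$, $(SL)_1+L_1\ge 0$ on $\mathbb{C}^m$, and $\mathrm{Ker}((SL)_1+L_1)=\mathrm{Ker}(L)$. Condition (S)$_1$: for each $\omega\in S^{n-1}$, the matrix $S$ in condition (S) satisfies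 $i(SA(\omega))_2\ge 0$ on $\mathrm{Ker}(L_1)$. Condition (K): there is a real matrix-valued function $K(\omega)\in C^\infty(S^{n-1})$ such that for each $\omega\in S^{n-1}$: $K(-\omega)=-K(\omega)$, $(K(\omega)A^0)^T=-K(\omega)A^0$, and $(K(\omega)A(\omega))_1>0$ on $\mathrm{Ker}(L)$. *)

theory Defs
  imports "HOL-Analysis.Analysis"
begin

section \<open>Matrices\<close>

definition cmat :: "real^'b^'a \<Rightarrow> complex^'b^'a" where
  "cmat X = map_matrix complex_of_real X"

definition cinner :: "complex^'m \<Rightarrow> complex^'m \<Rightarrow> complex" where
  "cinner z w = (\<Sum>i\<in>UNIV. z $ i * cnj (w $ i))"

definition nonneg_on :: "complex^'m^'m \<Rightarrow> (complex^'m) set \<Rightarrow> bool" where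
  "nonneg_on X V \<longleftrightarrow> (\<forall>z\<in>V. Re (cinner (X *v z) z) \<ge> 0)"

definition pos_on :: "complex^'m^'m \<Rightarrow> (complex^'m) set \<Rightarrow> bool" where
  "pos_on X V \<longleftrightarrow> (\<forall>z\<in>V. z \<noteq> 0 \<longrightarrow> Re (cinner (X *v z) z) > 0)"

definition sym_part :: "real^'m^'m \<Rightarrow> real^'m^'m" where
  "sym_part X = (1/2) *\<^sub>R (X + transpose X)"

definition skew_part :: "real^'m^'m \<Rightarrow> real^'m^'m" where
  "skew_part X = (1/2) *\<^sub>R (X - transpose X)"

definition cker :: "real^'m^'m \<Rightarrow> (complex^'m) set" where
  "cker X = {z. cmat X *v z = 0}"

definition symbol :: "('n::finite \<Rightarrow> real^'m^'m) \<Rightarrow> real^'n \<Rightarrow> real^'m^'m" where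
  "symbol A \<omega> = (\<Sum>j\<in>UNIV. (\<omega> $ j) *\<^sub>R A j)"


section \<open>Smooth functions\<close>

text \<open>Intended for open \<open>U\<close>: all iterated directional derivatives up to order \<open>k\<close>
  exist (as values of Frechet derivatives) and are continuous.\<close>

primrec Ck_on :: "nat \<Rightarrow> 'a::euclidean_space set \<Rightarrow> ('a \<Rightarrow> 'b::real_normed_vector) \<Rightarrow> bool" where
  "Ck_on 0 U f \<longleftrightarrow> continuous_on U f"
| "Ck_on (Suc k) U f \<longleftrightarrow> (\<forall>x\<in>U. f differentiable (at x)) \<and>
     (\<forall>v. Ck_on k U (\<lambda>x. frechet_derivative f (at x) v))"

definition Cinf_on :: "'a::euclidean_space set \<Rightarrow> ('a \<Rightarrow> 'b::real_normed_vector) \<Rightarrow> bool" where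
  "Cinf_on U f \<longleftrightarrow> (\<forall>k. Ck_on k U f)"

text \<open>Smoothness on the embedded submanifold \<open>sphere 0 1\<close>: local smooth extendability.\<close>

definition Cinf_on_sphere :: "('a::euclidean_space \<Rightarrow> 'b::real_normed_vector) \<Rightarrow> bool" where
  "Cinf_on_sphere f \<longleftrightarrow>
     (\<exists>U F. open U \<and> sphere 0 1 \<subseteq> U \<and> Cinf_on U F \<and> (\<forall>\<omega>\<in>sphere 0 1. F \<omega> = f \<omega>))"

definition test_function :: "(real^'n \<Rightarrow> real) \<Rightarrow> bool" where
  "test_function \<phi> \<longleftrightarrow> Cinf_on UNIV \<phi> \<and> compact (closure {x. \<phi> x \<noteq> 0})"

definition pderiv_at :: "'n \<Rightarrow> (real^'n \<Rightarrow> real) \<Rightarrow> real^'n \<Rightarrow> real" where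
  "pderiv_at j \<phi> x = frechet_derivative \<phi> (at x) (axis j 1)"

text \<open>A list \<open>[j\<^sub>1, \<dots>, j\<^sub>k]\<close> of coordinate directions stands for the \<open>k\<close>-th order derivative
  \<open>\<partial>\<^sub>j\<^sub>1 \<cdots> \<partial>\<^sub>j\<^sub>k\<close>.\<close>

definition pderivs :: "'n list \<Rightarrow> (real^'n \<Rightarrow> real) \<Rightarrow> real^'n \<Rightarrow> real" where
  "pderivs js \<phi> = foldr pderiv_at js \<phi>"


section \<open>Lebesgue and Sobolev spaces\<close>

definition in_L1 :: "(real^'n \<Rightarrow> 'b::euclidean_space) \<Rightarrow> bool" where
  "in_L1 f \<longleftrightarrow> integrable lborel f"

definition norm_L1 :: "(real^'n \<Rightarrow> 'b::euclidean_space) \<Rightarrow> real" where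
  "norm_L1 f = (\<integral>x. norm (f x) \<partial>lborel)"

definition in_L2 :: "(real^'n \<Rightarrow> 'b::euclidean_space) \<Rightarrow> bool" where
  "in_L2 f \<longleftrightarrow> f \<in> borel_measurable lborel \<and> integrable lborel (\<lambda>x. (norm (f x))\<^sup>2)"

definition norm_L2 :: "(real^'n \<Rightarrow> 'b::euclidean_space) \<Rightarrow> real" where
  "norm_L2 f = sqrt (\<integral>x. (norm (f x))\<^sup>2 \<partial>lborel)"

definition has_weak_deriv ::
  "(real^'n \<Rightarrow> 'b::euclidean_space) \<Rightarrow> 'n list \<Rightarrow> (real^'n \<Rightarrow> 'b) \<Rightarrow> bool" where
  "has_weak_deriv f js g \<longleftrightarrow> (\<forall>\<phi>. test_function \<phi> \<longrightarrow>
     (\<integral>x. pderivs js \<phi> x *\<^sub>R f x \<partial>lborel) = (-1) ^ length js *\<^sub>R (\<integral>x. \<phi> x *\<^sub>R g x \<partial>lborel))"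

definition in_Hs :: "nat \<Rightarrow> (real^'n \<Rightarrow> 'b::euclidean_space) \<Rightarrow> bool" where
  "in_Hs s f \<longleftrightarrow> in_L2 f \<and> (\<forall>js. length js \<le> s \<longrightarrow> (\<exists>g. in_L2 g \<and> has_weak_deriv f js g))"

text \<open>Determined up to null sets; only meaningful if \<open>f\<close> has a weak derivative in \<open>L\<^sup>2\<close>.\<close>

definition weak_deriv ::
  "'n list \<Rightarrow> (real^'n \<Rightarrow> 'b::euclidean_space) \<Rightarrow> real^'n \<Rightarrow> 'b" where
  "weak_deriv js f = (SOME g. in_L2 g \<and> has_weak_deriv f js g)"

text \<open>The \<open>L\<^sup>2\<close> norm of the totality of all \<open>k\<close>-th order derivatives; only meaningful on
  \<open>in_Hs k\<close>.\<close>

definition norm_L2_derivs :: "nat \<Rightarrow> (real^'n \<Rightarrow> 'b::euclidean_space) \<Rightarrow> real" where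
  "norm_L2_derivs k f =
     sqrt (\<Sum>js\<in>{js::'n list. length js = k}. (norm_L2 (weak_deriv js f))\<^sup>2)"


section \<open>Fourier transform\<close>

definition fourier_L1 :: "(real^'n \<Rightarrow> real^'m) \<Rightarrow> real^'n \<Rightarrow> complex^'m" where
  "fourier_L1 f \<xi> = (\<chi> i. of_real ((2 * pi) powr (- real CARD('n) / 2)) *
     (\<integral>x. cis (- (x \<bullet> \<xi>)) * complex_of_real (f x $ i) \<partial>lborel))"

text \<open>\<open>g\<close> represents the Fourier transform of \<open>f \<in> L\<^sup>2\<close>: it is the \<open>L\<^sup>2\<close> limit of the Fourier
  integrals of the truncations of \<open>f\<close> to large balls.\<close>

definition fourier_L2 :: "(real^'n \<Rightarrow> real^'m) \<Rightarrow> (real^'n \<Rightarrow> complex^'m) \<Rightarrow> bool" where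
  "fourier_L2 f g \<longleftrightarrow> in_L2 f \<and> in_L2 g \<and>
     ((\<lambda>R. \<integral>\<^sup>+ \<xi>. ennreal ((norm (fourier_L1 (\<lambda>x. indicator (cball 0 R) x *\<^sub>R f x) \<xi> - g \<xi>))\<^sup>2)
        \<partial>lborel) \<longlongrightarrow> 0) at_top"


section \<open>Structural conditions\<close>

definition cond_A ::
  "real^'m^'m \<Rightarrow> ('n::finite \<Rightarrow> real^'m^'m) \<Rightarrow> real^'m^'m \<Rightarrow> bool" where
  "cond_A A0 A L \<longleftrightarrow> transpose A0 = A0 \<and> (\<forall>j. transpose (A j) = A j) \<and>
     pos_on (cmat A0) UNIV \<and> nonneg_on (cmat L) UNIV \<and> cker L \<noteq> {0}"

definition cond_S :: "real^'m^'m \<Rightarrow> real^'m^'m \<Rightarrow> real^'m^'m \<Rightarrow> bool" where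
  "cond_S A0 L S \<longleftrightarrow> transpose (S ** A0) = S ** A0 \<and>
     nonneg_on (cmat (sym_part (S ** L) + sym_part L)) UNIV \<and>
     cker (sym_part (S ** L) + sym_part L) = cker L"

definition cond_S1 ::
  "('n::finite \<Rightarrow> real^'m^'m) \<Rightarrow> real^'m^'m \<Rightarrow> real^'m^'m \<Rightarrow> bool" where
  "cond_S1 A L S \<longleftrightarrow> (\<forall>\<omega>\<in>sphere 0 1.
     nonneg_on (map_matrix (\<lambda>a. \<i> * complex_of_real a) (skew_part (S ** symbol A \<omega>)))
       (cker (sym_part L)))"

definition cond_K ::
  "real^'m^'m \<Rightarrow> ('n::finite \<Rightarrow> real^'m^'m) \<Rightarrow> real^'m^'m \<Rightarrow> bool" where
  "cond_K A0 A L \<longleftrightarrow> (\<exists>K :: real^'n \<Rightarrow> real^'m^'m. Cinf_on_sphere K \<and>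
     (\<forall>\<omega>\<in>sphere 0 1. K (- \<omega>) = - K \<omega> \<and> transpose (K \<omega> ** A0) = - (K \<omega> ** A0) \<and>
        pos_on (cmat (sym_part (K \<omega> ** symbol A \<omega>))) (cker L)))"


section \<open>The Cauchy problem\<close>

text \<open>\<open>u\<close> is a solution in \<open>C([0,\<infinity>); L\<^sup>2)\<close> of
  \<open>A\<^sup>0 u\<^sub>t + \<Sum>\<^sub>j A\<^sup>j u\<^sub>x\<^sub>j + L u = 0\<close>, \<open>u(0) = u\<^sub>0\<close>, the equation being understood in the sense of
  distributions in \<open>x\<close> for every \<open>t > 0\<close>.  For \<open>u\<^sub>0 \<in> L\<^sup>2\<close> only, this is the natural
  meaning of the equation; solutions of higher regularity are solutions in this sense.\<close>

definition cauchy_solution ::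
  "real^'m^'m \<Rightarrow> ('n::finite \<Rightarrow> real^'m^'m) \<Rightarrow> real^'m^'m \<Rightarrow>
   (real^'n \<Rightarrow> real^'m) \<Rightarrow> (real \<Rightarrow> real^'n \<Rightarrow> real^'m) \<Rightarrow> bool" where
  "cauchy_solution A0 A L u0 u \<longleftrightarrow>
     in_L2 u0 \<and> (\<forall>t\<ge>0. in_L2 (u t)) \<and>
     (\<forall>t\<ge>0. ((\<lambda>r. norm_L2 (\<lambda>x. u r x - u t x)) \<longlongrightarrow> 0) (at t within {0..})) \<and>
     (AE x in lborel. u 0 x = u0 x) \<and>
     (\<forall>\<phi>. test_function \<phi> \<longrightarrow> (\<forall>t>0.
        ((\<lambda>r. \<integral>x. \<phi> x *\<^sub>R (A0 *v u r x) \<partial>lborel) has_vector_derivative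
          (\<Sum>j\<in>UNIV. \<integral>x. pderiv_at j \<phi> x *\<^sub>R (A j *v u t x) \<partial>lborel)
          - (\<integral>x. \<phi> x *\<^sub>R (L *v u t x) \<partial>lborel)) (at t)))"

text \<open>The equation \<open>A\<^sup>0 v\<^sub>t + i|\<xi>|A(\<omega>) v + L v = 0\<close> for \<open>t \<ge> 0\<close>, with \<open>\<omega> = \<xi>/|\<xi>\<close>; at \<open>\<xi> = 0\<close>,
  where \<open>\<omega>\<close> is irrelevant, division by zero yields \<open>\<omega> = 0\<close>.\<close>

definition fourier_ode ::
  "real^'m^'m \<Rightarrow> ('n::finite \<Rightarrow> real^'m^'m) \<Rightarrow> real^'m^'m \<Rightarrow> real^'n \<Rightarrow>
   (real \<Rightarrow> complex^'m) \<Rightarrow> bool" where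
  "fourier_ode A0 A L \<xi> v \<longleftrightarrow> (\<forall>t\<ge>0. \<exists>v'.
     (v has_vector_derivative v') (at t within {0..}) \<and>
     cmat A0 *v v' + (\<i> * of_real (norm \<xi>)) *s (cmat (symbol A (\<xi> /\<^sub>R norm \<xi>)) *v v t)
       + cmat L *v v t = 0)"

text \<open>Fourier transforms of \<open>L\<^sup>2\<close> functions are determined up to null sets only.  Given a
  representative \<open>u0h\<close> of the transform of the initial datum, the Fourier image \<open>uh\<close> of
  \<open>u\<close> is the one that starts from \<open>u0h\<close> and solves the transformed system for every \<open>\<xi>\<close>.\<close>

definition fourier_image ::
  "real^'m^'m \<Rightarrow> ('n::finite \<Rightarrow> real^'m^'m) \<Rightarrow> real^'m^'m \<Rightarrow> (real \<Rightarrow> real^'n \<Rightarrow> real^'m) \<Rightarrow>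
   (real^'n \<Rightarrow> complex^'m) \<Rightarrow> (real \<Rightarrow> real^'n \<Rightarrow> complex^'m) \<Rightarrow> bool" where
  "fourier_image A0 A L u u0h uh \<longleftrightarrow>
     (\<forall>t\<ge>0. fourier_L2 (u t) (uh t)) \<and>
     (\<forall>\<xi>. uh 0 \<xi> = u0h \<xi> \<and> fourier_ode A0 A L \<xi> (\<lambda>t. uh t \<xi>))"

definition eta :: "real^'n \<Rightarrow> real" where
  "eta \<xi> = (norm \<xi>)\<^sup>2 / (1 + (norm \<xi>)\<^sup>2)\<^sup>2"

end

theory Submission
  imports Defs "HOL-Probability.Characteristic_Functions"
begin

text \<open>For a single frequency \<open>\<xi>\<close> with \<open>r = |\<xi>|\<close>, pair the transformed system with \<open>v\<close>, apply \<open>S + 1\<close>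
  and pair with \<open>v\<close>, and apply \<open>-i r K(\<omega>)\<close> and pair with \<open>v\<close>. Summed with the weights \<open>1\<close>,
  \<open>\<epsilon> / (1 + r\<^sup>2)\<close> and \<open>\<kappa> \<epsilon> / (1 + r\<^sup>2)\<^sup>2\<close>, the three identities form a Lyapunov functional
  equivalent to \<open>|v|\<^sup>2\<close> whose dissipation is at least a multiple of \<open>\<eta>(\<xi>) |v|\<^sup>2\<close>.

  To see that the transform of a distributional solution follows the flow of the transformed system,
  test the equation with cut-off plane waves: the transform of \<open>bump (x/R) u\<close> solves the system at
  each single \<open>\<xi>\<close> up to a forcing term which is \<open>O(1/R)\<close> in \<open>L\<^sup>2\<close>, and \<open>R \<rightarrow> \<infinity>\<close>. Here Bessel's
  inequality is enough, so neither density of test functions nor the full Plancherel theorem enters.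
  Weak derivatives correspond to multiplication by powers of \<open>\<xi>\<close>; the decay then follows by splitting
  into \<open>|\<xi>| \<le> 1\<close>, where \<open>\<eta> \<ge> |\<xi>|\<^sup>2 / 4\<close>, and \<open>|\<xi>| \<ge> 1\<close>, where \<open>\<eta> \<ge> 1 / (4 |\<xi>|\<^sup>2)\<close>.\<close>

section \<open>Smooth functions\<close>

text \<open>The obstacle is that \<open>L\<close> need not be symmetric. Pairing the system with
  \<open>v\<close> controls only the distance a of \<open>v\<close> to Ker(L_1), a space that may
  exceed Ker(L). The multiplier \<open>S\<close> recovers the distance b to Ker(L), but brings in
  the term r Re<i S A(\<omega>) v, v>, whose sign is known only on Ker(L_1); off that space it costs
  a multiple of r a |v|. Absorbing this first-order error into a^2 and the part of |v|^2 produced by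
  \<open>K\<close> forces the weight \<rho> = 1/(1+r^2), whereas the errors of the \<open>K\<close>
  identity, of size (r^2+r) b |v|, force \<rho>^2. What survives is (r \<rho>)^2 |v|^2 = \<eta>
  |v|^2, so the rate degenerates at infinity too, and high frequencies decay only at the price of
  derivatives of the data. A solution is merely continuous in time with values in L^2, so u(t) in
  H^k has to be proved: weak derivatives are constructed from the transform, and they must be shown
  unique because the norm of the derivatives is defined through a choice.\<close>

lemma Ck_on_continuous: "Ck_on k U f \<Longrightarrow> continuous_on U f"
  by (cases k) (auto intro: differentiable_imp_continuous_on differentiable_at_imp_differentiable_on)

lemma Ck_on_Suc_imp: "Ck_on (Suc k) U f \<Longrightarrow> Ck_on k U f"
proof (induction k arbitrary: f)
  case 0
  then show ?case using Ck_on_continuous[of "Suc 0"] by auto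
next
  case (Suc k)
  have "Ck_on k U (\<lambda>x. frechet_derivative f (at x) v)" for v
    using Suc.prems Ck_on.simps(2)[of "Suc k" U f] by (intro Suc.IH) blast
  then show ?case using Suc.prems Ck_on.simps(2)[of "Suc k" U f] Ck_on.simps(2)[of k U f] by blast
qed

lemma Ck_on_SucI:
  assumes "\<And>x. (f has_derivative f' x) (at x)" and "\<And>v. Ck_on k UNIV (\<lambda>x. f' x v)"
  shows "Ck_on (Suc k) UNIV f"
proof -
  have "frechet_derivative f (at x) = f' x" for x
    using assms(1) by (metis frechet_derivative_at)
  then show ?thesis using assms by (auto simp: differentiable_def)
qed

lemma Ck_on_const: "Ck_on k UNIV (\<lambda>x. c)"
proof (induction k arbitrary: c)
  case (Suc k)
  show ?case by (rule Ck_on_SucI[where f'="\<lambda>x v. 0"]) (auto simp: Suc)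
qed simp

lemma Ck_on_linear:
  assumes "bounded_linear f" shows "Ck_on k UNIV f"
proof (cases k)
  case 0
  then show ?thesis using linear_continuous_on[OF assms] by simp
next
  case (Suc m)
  show ?thesis unfolding Suc
    by (rule Ck_on_SucI[where f'="\<lambda>x. f"]) (auto simp: assms Ck_on_const bounded_linear_imp_has_derivative)
qed

lemma Ck_on_add:
  "Ck_on k UNIV f \<Longrightarrow> Ck_on k UNIV g \<Longrightarrow> Ck_on k UNIV (\<lambda>x. f x + g x)"
proof (induction k arbitrary: f g)
  case 0
  then show ?case by (simp add: continuous_on_add)
next
  case (Suc k)
  show ?case
  proof (rule Ck_on_SucI)
    show "((\<lambda>x. f x + g x) has_derivative (\<lambda>v. frechet_derivative f (at x) v + frechet_derivative g (at x) v)) (at x)" for x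
      using Suc.prems by (auto intro!: has_derivative_add simp: frechet_derivative_works[symmetric])
  qed (use Suc in auto)
qed

lemma Ck_on_mult:
  fixes f g :: "'a::euclidean_space \<Rightarrow> real"
  shows "Ck_on k UNIV f \<Longrightarrow> Ck_on k UNIV g \<Longrightarrow> Ck_on k UNIV (\<lambda>x. f x * g x)"
proof (induction k arbitrary: f g)
  case 0
  then show ?case by (simp add: continuous_on_mult)
next
  case (Suc k)
  show ?case
  proof (rule Ck_on_SucI)
    show "((\<lambda>x. f x * g x) has_derivative (\<lambda>v. f x * frechet_derivative g (at x) v + frechet_derivative f (at x) v * g x)) (at x)" for x
      using Suc.prems by (auto intro!: has_derivative_mult simp: frechet_derivative_works[symmetric])
    show "Ck_on k UNIV (\<lambda>x. f x * frechet_derivative g (at x) v + frechet_derivative f (at x) v * g x)" for v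
      using Suc.prems by (intro Ck_on_add Suc.IH) (auto intro: Ck_on_Suc_imp)
  qed
qed

text \<open>The outer function is given by a whole family closed under differentiation, so that the
  induction needs no separate calculus for functions of one real variable.\<close>

lemma Ck_on_compose_family:
  fixes h :: "'i \<Rightarrow> real \<Rightarrow> real" and q :: "'a::euclidean_space \<Rightarrow> real"
  assumes h: "\<And>i y. (h i has_field_derivative h (d i) y) (at y)"
    and q: "\<And>k. Ck_on k UNIV q"
  shows "Ck_on k UNIV (\<lambda>x. h i (q x))"
proof (induction k arbitrary: i)
  case 0
  have "continuous_on UNIV (h i)"
    using h by (meson DERIV_continuous_on has_field_derivative_at_within)
  moreover have "continuous_on UNIV q" using q Ck_on_continuous by blast
  ultimately show ?case
    by (simp add: continuous_on_compose2)
next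
  case (Suc k)
  show ?case
  proof (rule Ck_on_SucI)
    have "q differentiable at x" for x using q[of "Suc 0"] by auto
    then have "(q has_derivative frechet_derivative q (at x)) (at x)" for x
      by (simp add: frechet_derivative_works[symmetric])
    then show "((\<lambda>x. h i (q x)) has_derivative (\<lambda>v. h (d i) (q x) * frechet_derivative q (at x) v)) (at x)" for x
      using has_derivative_compose[of q _ x UNIV "h i" "\<lambda>v. h (d i) (q x) * v"] h[of i "q x"]
      by (simp add: has_field_derivative_def)
    show "Ck_on k UNIV (\<lambda>x. h (d i) (q x) * frechet_derivative q (at x) v)" for v
      using q[of "Suc k"] by (intro Ck_on_mult Suc.IH) auto
  qed
qed

text \<open>The polynomial factor makes the family closed under differentiation: every derivative of
  exp (-1/y), extended by 0, is again a polynomial in 1/y times exp (-1/y). This is the shape that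
  \<open>Ck_on_compose_family\<close> asks for.\<close>

definition flat :: "real poly \<Rightarrow> real \<Rightarrow> real" where
  "flat p y = (if 0 < y then poly p (1 / y) * exp (- (1 / y)) else 0)"

lemma poly_times_exp_tendsto_0: "((\<lambda>y::real. poly p y * exp (- y)) \<longlongrightarrow> 0) at_top"
proof -
  have "((\<lambda>y::real. \<Sum>i\<le>degree p. coeff p i * (y ^ i / exp y)) \<longlongrightarrow> (\<Sum>i\<le>degree p. coeff p i * 0)) at_top"
    by (intro tendsto_intros tendsto_power_div_exp_0)
  then show ?thesis
    by (simp add: poly_altdef sum_distrib_right exp_minus divide_inverse mult.assoc)
qed

lemma flat_tendsto_0: "(flat p \<longlongrightarrow> 0) (at 0)"
proof -
  have "((\<lambda>y. poly p (inverse y) * exp (- inverse y)) \<longlongrightarrow> 0) (at_right 0)"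
    by (rule filterlim_compose[OF poly_times_exp_tendsto_0 filterlim_inverse_at_top_right])
  then have "(flat p \<longlongrightarrow> 0) (at_right 0)"
    by (rule Lim_transform_eventually)
       (auto simp: eventually_at_filter flat_def inverse_eq_divide)
  moreover have "(flat p \<longlongrightarrow> 0) (at_left 0)"
    by (rule Lim_transform_eventually[OF tendsto_const]) (auto simp: eventually_at_filter flat_def)
  ultimately show ?thesis using filterlim_split_at by blast
qed

text \<open>With s = 1/y one has d/dy = - s^2 d/ds, and d/ds of p(s) e^{-s} is (p' - p)(s)
  e^{-s}.\<close>

definition flat_deriv :: "real poly \<Rightarrow> real poly" where
  "flat_deriv p = monom 1 2 * (p - pderiv p)"

lemma flat_has_field_derivative: "(flat p has_field_derivative flat (flat_deriv p) y) (at y)"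
proof -
  consider "y > 0" | "y < 0" | "y = 0" by linarith
  then show ?thesis
  proof cases
    case 1
    have "((\<lambda>y. poly p (1 / y) * exp (- (1 / y))) has_field_derivative flat (flat_deriv p) y) (at y)"
    proof -
      have d: "((\<lambda>y. 1 / y) has_field_derivative - (1 / y\<^sup>2)) (at y)"
        using 1 by (auto intro!: derivative_eq_intros simp: power2_eq_square)
      have "((\<lambda>y. poly p (1 / y)) has_field_derivative poly (pderiv p) (1 / y) * - (1 / y\<^sup>2)) (at y)"
        using DERIV_chain2[where f="poly p" and g="\<lambda>y. 1 / y", OF poly_DERIV d] .
      moreover have "((\<lambda>y. exp (- (1 / y))) has_field_derivative exp (- (1 / y)) * (1 / y\<^sup>2)) (at y)"
        using DERIV_fun_exp[OF DERIV_minus[OF d]] by simp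
      ultimately have *: "((\<lambda>y. poly p (1 / y) * exp (- (1 / y))) has_field_derivative
          poly (pderiv p) (1 / y) * - (1 / y\<^sup>2) * exp (- (1 / y)) + exp (- (1 / y)) * (1 / y\<^sup>2) * poly p (1 / y)) (at y)"
        by (rule DERIV_mult)
      show ?thesis
        by (rule DERIV_cong[OF *]) (use 1 in \<open>simp add: flat_def flat_deriv_def poly_monom algebra_simps power_divide\<close>)
    qed
    moreover have e: "\<forall>\<^sub>F z in nhds y. poly p (1 / z) * exp (- (1 / z)) = flat p z"
      using 1 eventually_nhds_in_open[of "{0<..}" y] by (auto elim!: eventually_mono simp: flat_def)
    ultimately show ?thesis by (simp only: DERIV_cong_ev[OF refl e refl])
  next
    case 2
    have "((\<lambda>y. 0) has_field_derivative flat (flat_deriv p) y) (at y)"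
      using 2 by (simp add: flat_def)
    moreover have e: "\<forall>\<^sub>F z in nhds y. 0 = flat p z"
      using 2 eventually_nhds_in_open[of "{..<0}" y] by (auto elim!: eventually_mono simp: flat_def)
    ultimately show ?thesis by (simp only: DERIV_cong_ev[OF refl e refl])
  next
    case 3
    \<comment> \<open>The difference quotient of \<open>flat p\<close> at 0 is itself a flat
      function, with s p(s) in place of p(s), so its limit needs no new estimate.\<close>
    have "(flat (monom 1 1 * p) \<longlongrightarrow> 0) (at 0)" by (rule flat_tendsto_0)
    moreover have "flat (monom 1 1 * p) z = (flat p (0 + z) - flat p 0) / z" if "z \<noteq> 0" for z
      using that by (auto simp: flat_def poly_monom)
    ultimately have "((\<lambda>z. (flat p (0 + z) - flat p 0) / z) \<longlongrightarrow> 0) (at 0)"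
      by (subst Lim_cong_within[where g="flat (monom 1 1 * p)"]) auto
    then have "(flat p has_field_derivative 0) (at 0)" by (simp add: DERIV_def)
    then show ?thesis using 3 by (simp add: flat_def)
  qed
qed

lemma Ck_on_norm_square: "Ck_on k UNIV (\<lambda>x::'a::euclidean_space. (norm x)\<^sup>2)"
proof (cases k)
  case 0
  then show ?thesis by (simp add: continuous_intros)
next
  case (Suc m)
  show ?thesis unfolding Suc power2_norm_eq_inner
  proof (rule Ck_on_SucI)
    show "((\<lambda>x::'a. x \<bullet> x) has_derivative (\<lambda>v. x \<bullet> v + v \<bullet> x)) (at x)" for x
      by (rule has_derivative_inner) (rule has_derivative_ident)+
    show "Ck_on m UNIV (\<lambda>x::'a. x \<bullet> v + v \<bullet> x)" for v
      by (intro Ck_on_linear bounded_linear_add bounded_linear_inner_left bounded_linear_inner_right)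
  qed
qed

text \<open>Dividing by \<open>flat 1 1\<close> gives the value 1 at the origin, so that the scaled
  cut-offs \<open>bump (x /\<^sub>R R)\<close> tend to 1 as R grows. The squared norm keeps the
  function smooth at the origin.\<close>

definition bump :: "'a::euclidean_space \<Rightarrow> real" where
  "bump x = flat 1 (1 - (norm x)\<^sup>2) / flat 1 1"

lemma flat_1_pos: "flat 1 1 > 0" by (simp add: flat_def)

lemma Ck_on_bump: "Ck_on k UNIV (bump :: 'a::euclidean_space \<Rightarrow> real)"
proof -
  have *: "Ck_on k UNIV (\<lambda>x::'a. 1 + (-1) * (norm x)\<^sup>2)" for k
    by (intro Ck_on_add Ck_on_mult Ck_on_const Ck_on_norm_square)
  have "Ck_on k UNIV (\<lambda>x::'a. (1 / flat 1 1) * flat 1 (1 + (-1) * (norm x)\<^sup>2))"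
    by (rule Ck_on_mult[OF Ck_on_const Ck_on_compose_family[where h=flat and d=flat_deriv and i=1,
          OF flat_has_field_derivative *]])
  then show ?thesis by (simp add: bump_def[abs_def])
qed

lemma bump_0 [simp]: "bump 0 = 1"
  using flat_1_pos by (simp add: bump_def)

lemma bump_nonneg: "bump x \<ge> 0"
  by (auto simp: bump_def flat_def)

lemma bump_le_1: "bump x \<le> 1"
proof (cases "(norm x)\<^sup>2 < 1")
  case True
  then have "1 / (1 - (norm x)\<^sup>2) \<ge> 1" by simp
  then show ?thesis using True by (simp add: bump_def flat_def)
next
  case False
  then show ?thesis by (simp add: bump_def flat_def)
qed

lemma bump_eq_0: "norm x \<ge> 1 \<Longrightarrow> bump x = 0"
  by (drule one_le_power[of "norm x" 2]) (simp add: bump_def flat_def not_less)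

lemma Ck_on_compose_linear:
  assumes L: "bounded_linear L"
  shows "Ck_on k UNIV f \<Longrightarrow> Ck_on k UNIV (\<lambda>x. f (L x))"
proof (induction k arbitrary: f)
  case 0
  then show ?case
    using linear_continuous_on[OF L] by (auto intro: continuous_on_compose2[of UNIV f])
next
  case (Suc k)
  show ?case
  proof (rule Ck_on_SucI)
    fix x
    have "(f has_derivative frechet_derivative f (at (L x))) (at (L x))"
      using Suc.prems by (simp add: frechet_derivative_works[symmetric])
    then show "((\<lambda>x. f (L x)) has_derivative (\<lambda>v. frechet_derivative f (at (L x)) (L v))) (at x)"
      by (rule has_derivative_compose[OF bounded_linear_imp_has_derivative[OF L]])
  qed (use Suc in auto)
qed

text \<open>Differentiating a cosine shifts its phase by \<pi>/2, so the shifted cosines form a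
  family closed under differentiation, with the successor as index map.\<close>

lemma Ck_on_cos:
  fixes q :: "'a::euclidean_space \<Rightarrow> real"
  shows "(\<And>k. Ck_on k UNIV q) \<Longrightarrow> Ck_on k UNIV (\<lambda>x. cos (q x))"
proof -
  assume q: "\<And>k. Ck_on k UNIV q"
  have "((\<lambda>y. cos (y + real i * (pi / 2))) has_field_derivative cos (y + real (Suc i) * (pi / 2))) (at y)" for i y
  proof -
    have "((\<lambda>y. cos (y + real i * (pi / 2))) has_field_derivative - sin (y + real i * (pi / 2))) (at y)"
      by (auto intro!: derivative_eq_intros)
    moreover have "- sin (y + real i * (pi / 2)) = cos (y + real (Suc i) * (pi / 2))"
      using minus_sin_cos_eq[of "y + real i * (pi / 2)"] by (simp add: algebra_simps add_divide_distrib)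
    ultimately show ?thesis by (simp only:)
  qed
  from Ck_on_compose_family[where h="\<lambda>i y. cos (y + real i * (pi / 2))" and d=Suc and i=0, OF this q]
  show ?thesis by simp
qed

section \<open>Test functions and cut-off plane waves\<close>

lemma closure_support_bounded:
  fixes f :: "'a::euclidean_space \<Rightarrow> real"
  shows "compact (closure {x. f x \<noteq> 0}) \<longleftrightarrow> (\<exists>B. \<forall>x. f x \<noteq> 0 \<longrightarrow> norm x \<le> B)"
  by (auto simp: compact_closure bounded_iff)

lemma test_function_iff:
  "test_function \<phi> \<longleftrightarrow> (\<forall>k. Ck_on k UNIV \<phi>) \<and> (\<exists>B. \<forall>x. \<phi> x \<noteq> 0 \<longrightarrow> norm x \<le> B)"
  unfolding test_function_def Cinf_on_def closure_support_bounded ..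

lemma test_function_has_derivative:
  "test_function \<phi> \<Longrightarrow> (\<phi> has_derivative frechet_derivative \<phi> (at x)) (at x)"
  using Ck_on.simps(2)[of 0 UNIV \<phi>] by (auto simp: test_function_iff frechet_derivative_works[symmetric])

lemma frechet_derivative_zero_outside:
  fixes \<phi> :: "'a::euclidean_space \<Rightarrow> real"
  assumes "\<forall>x. \<phi> x \<noteq> 0 \<longrightarrow> norm x \<le> B" and "norm x > B"
  shows "frechet_derivative \<phi> (at x) v = 0"
proof -
  have "open {x::'a. norm x > B}" by (simp add: open_Collect_less continuous_intros)
  have "(\<phi> has_derivative (\<lambda>v. 0)) (at x)"
  proof (rule has_derivative_transform_within_open)
    show "((\<lambda>x. 0) has_derivative (\<lambda>v. 0)) (at x)" by simp
    show "open {x::'a. norm x > B}" by fact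
  qed (use assms in force)+
  then show ?thesis using frechet_derivative_at[of \<phi> "\<lambda>v. 0" x] by (metis)
qed

lemma test_function_pderiv_at:
  assumes "test_function \<phi>" shows "test_function (pderiv_at j \<phi>)"
proof -
  obtain B where B: "\<forall>x. \<phi> x \<noteq> 0 \<longrightarrow> norm x \<le> B"
    using assms by (auto simp: test_function_iff)
  have "pderiv_at j \<phi> x \<noteq> 0 \<longrightarrow> norm x \<le> B" for x
    using frechet_derivative_zero_outside[OF B] by (force simp: pderiv_at_def)
  moreover have "Ck_on k UNIV (pderiv_at j \<phi>)" for k
    using assms Ck_on.simps(2)[of k UNIV \<phi>] by (simp add: test_function_iff pderiv_at_def[abs_def])
  ultimately show ?thesis by (auto simp: test_function_iff)
qed

lemma test_function_pderivs: "test_function \<phi> \<Longrightarrow> test_function (pderivs js \<phi>)"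
  unfolding pderivs_def by (induction js) (auto intro: test_function_pderiv_at)

lemma test_function_mult_smooth:
  assumes "test_function \<phi>" "\<And>k. Ck_on k UNIV g" shows "test_function (\<lambda>x. \<phi> x * g x)"
  using assms by (auto simp: test_function_iff intro!: Ck_on_mult)

lemma test_function_scale:
  assumes "test_function \<phi>" "R > 0" shows "test_function (\<lambda>x. \<phi> (x /\<^sub>R R))"
proof -
  obtain B where "\<forall>x. \<phi> x \<noteq> 0 \<longrightarrow> norm x \<le> B"
    using assms by (auto simp: test_function_iff)
  then have "\<forall>x. \<phi> (x /\<^sub>R R) \<noteq> 0 \<longrightarrow> norm x \<le> B * R"
    using assms(2) by (auto simp: field_simps)
  moreover have "Ck_on k UNIV (\<lambda>x. \<phi> (x /\<^sub>R R))" for k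
    by (rule Ck_on_compose_linear[OF bounded_linear_scaleR_right])
       (use assms(1) in \<open>simp add: test_function_iff\<close>)
  ultimately show ?thesis unfolding test_function_iff by blast
qed

lemma test_function_bump: "test_function bump"
  unfolding test_function_iff
  by (auto intro!: Ck_on_bump exI[of _ 1]) (meson bump_eq_0 linear)

lemma test_function_continuous: "test_function \<phi> \<Longrightarrow> continuous_on UNIV \<phi>"
  by (auto simp: test_function_iff intro: Ck_on_continuous)

lemma test_function_measurable [measurable_dest]: "test_function \<phi> \<Longrightarrow> \<phi> \<in> borel_measurable borel"
  using test_function_continuous borel_measurable_continuous_onI by blast

lemma continuous_compact_support_bounded:
  fixes f :: "'a::euclidean_space \<Rightarrow> 'b::real_normed_vector"
  assumes "continuous_on UNIV f" "\<And>x. f x \<noteq> 0 \<Longrightarrow> norm x \<le> B"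
  shows "\<exists>M\<ge>0. \<forall>x. norm (f x) \<le> M"
proof -
  have "bounded (f ` cball 0 B)"
    using assms(1) by (intro compact_imp_bounded compact_continuous_image) (auto intro: continuous_on_subset)
  then obtain M where "\<forall>y\<in>f ` cball 0 B. norm y \<le> M" by (auto simp: bounded_iff)
  then have "norm (f x) \<le> max M 0" for x
    using assms(2)[of x] by (cases "f x = 0") (auto intro: max.coboundedI1)
  then show ?thesis by (intro exI[of _ "max M 0"]) auto
qed

lemma test_function_bounded: "test_function \<phi> \<Longrightarrow> \<exists>M\<ge>0. \<forall>x. \<bar>\<phi> x\<bar> \<le> M"
  using continuous_compact_support_bounded[of \<phi>] test_function_continuous[of \<phi>]
  by (force simp: test_function_iff)

text \<open>Test functions are real valued, so a complex exponential is represented by a cosine with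
  a free phase: the phases 0 and \<pi>/2 give the real and the imaginary part of exp (- i x
  \<bullet> \<xi>), and differentiation of the oscillating factor shifts the phase by \<pi>/2. Sine
  and cosine thus need no separate treatment.\<close>

definition wave :: "('a::euclidean_space \<Rightarrow> real) \<Rightarrow> real \<Rightarrow> 'a \<Rightarrow> real \<Rightarrow> 'a \<Rightarrow> real" where
  "wave \<psi> R \<xi> a x = \<psi> (x /\<^sub>R R) * cos (x \<bullet> \<xi> + a)"

lemma test_function_wave:
  assumes "test_function \<psi>" "R > 0" shows "test_function (wave \<psi> R \<xi> a)"
proof -
  have *: "Ck_on k UNIV (\<lambda>x. x \<bullet> \<xi> + a)" for k
    by (rule Ck_on_add[OF Ck_on_linear[OF bounded_linear_inner_left] Ck_on_const])
  have "Ck_on k UNIV (\<lambda>x. cos (x \<bullet> \<xi> + a))" for k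
    by (rule Ck_on_cos[OF *])
  then show ?thesis unfolding wave_def[abs_def]
    by (rule test_function_mult_smooth[OF test_function_scale[OF assms]])
qed

lemma pderiv_at_wave:
  assumes "test_function \<psi>"
  shows "pderiv_at j (wave \<psi> R \<xi> a) x =
    (1 / R) * wave (pderiv_at j \<psi>) R \<xi> a x + \<xi> $ j * wave \<psi> R \<xi> (a + pi / 2) x"
proof -
  have d: "((\<lambda>x. \<psi> (x /\<^sub>R R)) has_derivative (\<lambda>v. frechet_derivative \<psi> (at (x /\<^sub>R R)) (v /\<^sub>R R))) (at x)"
    using has_derivative_compose[OF bounded_linear_imp_has_derivative[OF bounded_linear_scaleR_right[of "inverse R"]]
        test_function_has_derivative[OF assms]] .
  interpret D: bounded_linear "frechet_derivative \<psi> (at (x /\<^sub>R R))"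
    using test_function_has_derivative[OF assms] by (rule has_derivative_bounded_linear)
  have "((\<lambda>x. cos (x \<bullet> \<xi> + a)) has_derivative (\<lambda>v. - sin (x \<bullet> \<xi> + a) * (v \<bullet> \<xi>))) (at x)"
    by (auto intro!: derivative_eq_intros)
  from has_derivative_mult[OF d this]
  have "(wave \<psi> R \<xi> a has_derivative
     (\<lambda>v. \<psi> (x /\<^sub>R R) * (- sin (x \<bullet> \<xi> + a) * (v \<bullet> \<xi>)) +
          frechet_derivative \<psi> (at (x /\<^sub>R R)) (v /\<^sub>R R) * cos (x \<bullet> \<xi> + a))) (at x)"
    unfolding wave_def[abs_def] .
  from frechet_derivative_at[OF this, symmetric]
  have "pderiv_at j (wave \<psi> R \<xi> a) x = \<psi> (x /\<^sub>R R) * (- sin (x \<bullet> \<xi> + a) * (axis j 1 \<bullet> \<xi>)) +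
          inverse R * frechet_derivative \<psi> (at (x /\<^sub>R R)) (axis j 1) * cos (x \<bullet> \<xi> + a)"
    by (simp add: pderiv_at_def D.scaleR)
  moreover have "axis j 1 \<bullet> \<xi> = \<xi> $ j" by (simp add: inner_axis')
  moreover have "cos (x \<bullet> \<xi> + (a + pi / 2)) = - sin (x \<bullet> \<xi> + a)"
    using minus_sin_cos_eq[of "x \<bullet> \<xi> + a"] by (simp add: add.assoc)
  ultimately show ?thesis
    unfolding wave_def pderiv_at_def by (simp add: field_simps)
qed

section \<open>Square integrable functions and Gaussian integrals\<close>

text \<open>Fatou's lemma, in the form in which a uniform bound passes to an almost everywhere
  limit.\<close>

lemma nn_integral_limit_le:
  fixes u :: "nat \<Rightarrow> 'a \<Rightarrow> ennreal"
  assumes [measurable]: "\<And>k. u k \<in> borel_measurable M"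
    and lim: "AE x in M. (\<lambda>k. u k x) \<longlonglongrightarrow> v x" and le: "\<And>k. (\<integral>\<^sup>+x. u k x \<partial>M) \<le> B"
  shows "(\<integral>\<^sup>+x. v x \<partial>M) \<le> B"
proof -
  have "(\<integral>\<^sup>+x. v x \<partial>M) = (\<integral>\<^sup>+x. liminf (\<lambda>k. u k x) \<partial>M)"
    by (rule nn_integral_cong_AE) (use lim in \<open>eventually_elim, simp add: lim_imp_Liminf\<close>)
  also have "\<dots> \<le> liminf (\<lambda>k. \<integral>\<^sup>+x. u k x \<partial>M)"
    by (rule nn_integral_liminf) simp
  also have "\<dots> \<le> limsup (\<lambda>k. \<integral>\<^sup>+x. u k x \<partial>M)" by (simp add: Liminf_le_Limsup)
  also have "\<dots> \<le> B" by (intro Limsup_bounded always_eventually allI le)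
  finally show ?thesis .
qed

text \<open>The squared L^2 norm with values in the extended reals, so that inequalities can be
  proved first and finiteness deduced from them.\<close>

definition nsq :: "('a::euclidean_space \<Rightarrow> 'b::real_normed_vector) \<Rightarrow> ennreal" where
  "nsq f = (\<integral>\<^sup>+x. ennreal ((norm (f x))\<^sup>2) \<partial>lborel)"

lemma nsq_integrable_iff:
  assumes "f \<in> borel_measurable borel"
  shows "integrable lborel (\<lambda>x. (norm (f x))\<^sup>2) \<longleftrightarrow> nsq f < \<infinity>"
  using assms by (simp add: integrable_iff_bounded nsq_def)

lemma nsq_eq_integral:
  assumes "integrable lborel (\<lambda>x. (norm (f x))\<^sup>2)"
  shows "nsq f = ennreal (\<integral>x. (norm (f x))\<^sup>2 \<partial>lborel)"
  unfolding nsq_def by (rule nn_integral_eq_integral) (use assms in auto)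

lemma nsq_mono: "(\<And>x. norm (f x) \<le> norm (g x)) \<Longrightarrow> nsq f \<le> nsq g"
  unfolding nsq_def by (intro nn_integral_mono ennreal_leI power_mono) auto

lemma nsq_cmult:
  fixes f :: "'a::euclidean_space \<Rightarrow> 'b::real_normed_vector"
  assumes "f \<in> borel_measurable borel" and "\<And>x. norm (g x) \<le> C * norm (f x)" "C \<ge> 0"
  shows "nsq g \<le> ennreal (C\<^sup>2) * nsq f"
proof -
  have "nsq g \<le> (\<integral>\<^sup>+x. ennreal (C\<^sup>2) * ennreal ((norm (f x))\<^sup>2) \<partial>lborel)"
    unfolding nsq_def
  proof (rule nn_integral_mono)
    fix x
    have "(norm (g x))\<^sup>2 \<le> (C * norm (f x))\<^sup>2" by (intro power_mono assms) auto
    then show "ennreal ((norm (g x))\<^sup>2) \<le> ennreal (C\<^sup>2) * ennreal ((norm (f x))\<^sup>2)"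
      by (simp add: ennreal_mult[symmetric] power_mult_distrib ennreal_leI)
  qed
  also have "\<dots> = ennreal (C\<^sup>2) * nsq f"
    unfolding nsq_def using assms by (intro nn_integral_cmult) measurable
  finally show ?thesis .
qed

text \<open>From (p + q)^2 \<le> 2 p^2 + 2 q^2. The factor 2 takes the place of Minkowski's
  inequality; only finiteness, boundedness and convergence to 0 are ever drawn from it.\<close>

lemma nsq_add_le:
  fixes f g :: "'a::euclidean_space \<Rightarrow> 'b::real_normed_vector"
  assumes "f \<in> borel_measurable borel" "g \<in> borel_measurable borel" and "\<And>x. norm (h x) \<le> norm (f x) + norm (g x)"
  shows "nsq h \<le> 2 * nsq f + 2 * nsq g"
proof -
  have "nsq h \<le> (\<integral>\<^sup>+x. 2 * ennreal ((norm (f x))\<^sup>2) + 2 * ennreal ((norm (g x))\<^sup>2) \<partial>lborel)"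
    unfolding nsq_def
  proof (rule nn_integral_mono)
    fix x
    have "(norm (h x))\<^sup>2 \<le> (norm (f x) + norm (g x))\<^sup>2" by (intro power_mono assms) auto
    also have "\<dots> \<le> 2 * (norm (f x))\<^sup>2 + 2 * (norm (g x))\<^sup>2"
      using sum_squares_bound[of "norm (f x)" "norm (g x)"] by (simp add: power2_sum)
    finally have "ennreal ((norm (h x))\<^sup>2) \<le> ennreal (2 * (norm (f x))\<^sup>2 + 2 * (norm (g x))\<^sup>2)" by (rule ennreal_leI)
    then show "ennreal ((norm (h x))\<^sup>2) \<le> 2 * ennreal ((norm (f x))\<^sup>2) + 2 * ennreal ((norm (g x))\<^sup>2)"
      by (simp add: ennreal_plus ennreal_mult')
  qed
  also have "\<dots> = 2 * nsq f + 2 * nsq g"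
    unfolding nsq_def using assms by (simp add: nn_integral_add nn_integral_cmult)
  finally show ?thesis .
qed

lemma integrable_mult_L2:
  fixes f g :: "'a::euclidean_space \<Rightarrow> 'b::{real_normed_algebra,second_countable_topology,banach}"
  assumes [measurable]: "f \<in> borel_measurable borel" "g \<in> borel_measurable borel"
    and "nsq f < \<infinity>" "nsq g < \<infinity>"
  shows "integrable lborel (\<lambda>x. f x * g x)"
proof (rule Bochner_Integration.integrable_bound)
  show "integrable lborel (\<lambda>x. (norm (f x))\<^sup>2 + (norm (g x))\<^sup>2)"
    using assms by (intro Bochner_Integration.integrable_add) (simp_all add: nsq_integrable_iff)
  have "norm (f x * g x) \<le> (norm (f x))\<^sup>2 + (norm (g x))\<^sup>2" for x
    using norm_mult_ineq[of "f x" "g x"] sum_squares_bound[of "norm (f x)" "norm (g x)"]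
      mult_nonneg_nonneg[OF norm_ge_zero[of "f x"] norm_ge_zero[of "g x"]] by linarith
  then show "AE x in lborel. norm (f x * g x) \<le> norm ((norm (f x))\<^sup>2 + (norm (g x))\<^sup>2)"
    by (intro AE_I2) (simp)
qed simp

lemma Cauchy_Schwarz_integral:
  fixes f g :: "'a::euclidean_space \<Rightarrow> real"
  assumes [measurable]: "f \<in> borel_measurable borel" "g \<in> borel_measurable borel"
    and f: "integrable lborel (\<lambda>x. (f x)\<^sup>2)" and g: "integrable lborel (\<lambda>x. (g x)\<^sup>2)"
  shows "(\<integral>x. \<bar>f x * g x\<bar> \<partial>lborel) \<le> sqrt (\<integral>x. (f x)\<^sup>2 \<partial>lborel) * sqrt (\<integral>x. (g x)\<^sup>2 \<partial>lborel)"
proof -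
  define p q where "p = sqrt (\<integral>x. (f x)\<^sup>2 \<partial>lborel)" and "q = sqrt (\<integral>x. (g x)\<^sup>2 \<partial>lborel)"
  have pq: "0 \<le> p" "0 \<le> q" by (auto simp: p_def q_def)
  have bound: "(\<integral>x. \<bar>f x * g x\<bar> \<partial>lborel) \<le> (p + d) * (q + d)" if "d > 0" for d
  proof -
    \<comment> \<open>Young's inequality |f g| \<le> (a/2) f^2 + g^2/(2a) is optimal at a = q/p. The
      shift by d > 0 avoids dividing by a vanishing norm, and d tends to 0 at the end.\<close>
    define a where "a = (q + d) / (p + d)"
    have a: "a > 0" using that pq by (simp add: a_def)
    have "(\<integral>x. \<bar>f x * g x\<bar> \<partial>lborel) \<le> (\<integral>x. a / 2 * (f x)\<^sup>2 + 1 / (2 * a) * (g x)\<^sup>2 \<partial>lborel)"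
    proof (rule integral_mono')
      show "integrable lborel (\<lambda>x. a / 2 * (f x)\<^sup>2 + 1 / (2 * a) * (g x)\<^sup>2)" using f g by auto
      fix x
      have "0 \<le> (a * \<bar>f x\<bar> - \<bar>g x\<bar>)\<^sup>2" by simp
      then have "2 * (a * \<bar>f x * g x\<bar>) \<le> a\<^sup>2 * (f x)\<^sup>2 + (g x)\<^sup>2"
        by (simp add: power2_diff power_mult_distrib abs_mult)
      then show "\<bar>f x * g x\<bar> \<le> a / 2 * (f x)\<^sup>2 + 1 / (2 * a) * (g x)\<^sup>2"
        using a by (simp add: field_simps power2_eq_square)
      show "0 \<le> a / 2 * (f x)\<^sup>2 + 1 / (2 * a) * (g x)\<^sup>2" using a by simp
    qed
    also have "\<dots> = a / 2 * p\<^sup>2 + 1 / (2 * a) * q\<^sup>2"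
      using f g by (simp add: p_def q_def)
    also have "\<dots> \<le> a / 2 * (p + d)\<^sup>2 + 1 / (2 * a) * (q + d)\<^sup>2"
      using a pq that by (intro add_mono mult_left_mono power_mono) auto
    also have "\<dots> = (p + d) * (q + d)"
    proof -
      have "Q / P / 2 * P\<^sup>2 + 1 / (2 * (Q / P)) * Q\<^sup>2 = P * Q" if "P \<noteq> 0" "Q \<noteq> 0" for P Q :: real
        using that by (simp add: field_simps power2_eq_square)
      moreover have "p + d \<noteq> 0" "q + d \<noteq> 0" using pq that by auto
      ultimately show ?thesis unfolding a_def by blast
    qed
    finally show ?thesis .
  qed
  have "((\<lambda>d. (p + d) * (q + d)) \<longlongrightarrow> (p + 0) * (q + 0)) (at_right 0)"
    by (intro tendsto_intros)
  moreover have "\<forall>\<^sub>F d in at_right 0. (\<integral>x. \<bar>f x * g x\<bar> \<partial>lborel) \<le> (p + d) * (q + d)"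
    using bound by (auto simp: eventually_at_filter)
  ultimately have "(\<integral>x. \<bar>f x * g x\<bar> \<partial>lborel) \<le> (p + 0) * (q + 0)"
    by (rule tendsto_lowerbound) simp
  then show ?thesis by (simp add: p_def q_def)
qed

section \<open>Product integrals and Gaussian integrals\<close>

lemma
  fixes f :: "'a::euclidean_space \<Rightarrow> complex" and g :: "'b::euclidean_space \<Rightarrow> complex"
  assumes f: "integrable lborel f" and g: "integrable lborel g"
  shows integrable_pair_mult: "integrable (lborel \<Otimes>\<^sub>M lborel) (\<lambda>(x, y). f x * g y)"
    and integral_pair_mult: "(\<integral>(x, y). f x * g y \<partial>(lborel \<Otimes>\<^sub>M lborel)) = (\<integral>x. f x \<partial>lborel) * (\<integral>y. g y \<partial>lborel)"
proof -
  have [measurable]: "f \<in> borel_measurable borel" "g \<in> borel_measurable borel"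
    using f g by (auto dest: borel_measurable_integrable)
  show *: "integrable (lborel \<Otimes>\<^sub>M lborel) (\<lambda>(x, y). f x * g y)"
  proof (rule lborel_pair.Fubini_integrable)
    show "integrable lborel (\<lambda>x. \<integral>y. norm (case (x, y) of (x, y) \<Rightarrow> f x * g y) \<partial>lborel)"
      using f by (simp add: norm_mult)
  qed (use g in \<open>auto simp: split_beta\<close>)
  show "(\<integral>(x, y). f x * g y \<partial>(lborel \<Otimes>\<^sub>M lborel)) = (\<integral>x. f x \<partial>lborel) * (\<integral>y. g y \<partial>lborel)"
    by (subst lborel_pair.integral_fst[OF *, symmetric]) simp
qed

lemma
  fixes g :: "'a::euclidean_space \<Rightarrow> real \<Rightarrow> complex"
  assumes g: "\<And>b. b \<in> Basis \<Longrightarrow> integrable lborel (g b)"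
  shows integrable_lborel_prod: "integrable lborel (\<lambda>x::'a. \<Prod>b\<in>Basis. g b (x \<bullet> b))"
    and integral_lborel_prod: "(\<integral>x. (\<Prod>b\<in>Basis. g b ((x::'a) \<bullet> b)) \<partial>lborel) = (\<Prod>b\<in>Basis. (\<integral>t. g b t \<partial>lborel))"
proof -
  interpret P: product_sigma_finite "\<lambda>b::'a. lborel :: real measure" ..
  let ?T = "\<lambda>f. \<Sum>b\<in>Basis. f b *\<^sub>R b :: 'a"
  have [measurable]: "g b \<in> borel_measurable borel" if "b \<in> Basis" for b
    using g[OF that] by (auto dest: borel_measurable_integrable)
  have eq: "(\<Prod>b\<in>Basis. g b (?T f \<bullet> b)) = (\<Prod>b\<in>Basis. g b (f b))" for f
    by (intro prod.cong) (auto simp: inner_sum_left_Basis)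
  have T[measurable]: "?T \<in> measurable (\<Pi>\<^sub>M b\<in>Basis. lborel) borel" by measurable
  have F[measurable]: "(\<lambda>x::'a. \<Prod>b\<in>Basis. g b (x \<bullet> b)) \<in> borel_measurable borel" by measurable
  have l: "(lborel :: 'a measure) = distr (\<Pi>\<^sub>M b\<in>Basis. lborel) borel ?T" by (rule lborel_eq)
  show "integrable lborel (\<lambda>x::'a. \<Prod>b\<in>Basis. g b (x \<bullet> b))"
    unfolding l integrable_distr_eq[OF T F] eq
    by (rule P.product_integrable_prod) (auto intro: g)
  show "(\<integral>x. (\<Prod>b\<in>Basis. g b ((x::'a) \<bullet> b)) \<partial>lborel) = (\<Prod>b\<in>Basis. (\<integral>t. g b t \<partial>lborel))"
    unfolding l integral_distr[OF T F] eq
    by (rule P.product_integral_prod) (auto intro: g)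
qed

text \<open>Rescaling by the square root of \<epsilon> turns the integral into the characteristic
  function of the standard normal distribution at - z/s.\<close>

lemma
  fixes \<epsilon> z :: real
  assumes \<epsilon>: "\<epsilon> > 0"
  shows integrable_gauss_real: "integrable lborel (\<lambda>t. cis (- (t * z)) * complex_of_real (exp (- \<epsilon> * t\<^sup>2 / 2)))"
    and integral_gauss_real: "(\<integral>t. cis (- (t * z)) * complex_of_real (exp (- \<epsilon> * t\<^sup>2 / 2)) \<partial>lborel) =
      complex_of_real (sqrt (2 * pi / \<epsilon>) * exp (- z\<^sup>2 / (2 * \<epsilon>)))"
proof -
  define s where "s = sqrt \<epsilon>"
  have s: "s > 0" "s\<^sup>2 = \<epsilon>" using \<epsilon> by (auto simp: s_def)
  define F where "F x = std_normal_density x *\<^sub>R iexp (- (z / s) * x)" for x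
  have F_int: "integrable lborel F"
    unfolding F_def
    by (rule Bochner_Integration.integrable_bound[OF integrable_normal_density[of 1 0]])
       (auto simp: F_def)
  have "(\<integral>x. F x \<partial>lborel) = char std_normal_distribution (- (z / s))"
    unfolding char_def F_def by (subst integral_density) (auto simp: normal_density_nonneg)
  then have F_val: "(\<integral>x. F x \<partial>lborel) = complex_of_real (exp (- (z / s)\<^sup>2 / 2))"
    by (simp add: char_std_normal_distribution)
  have F_sub: "cis (- (t * z)) * complex_of_real (exp (- \<epsilon> * t\<^sup>2 / 2)) = complex_of_real (sqrt (2 * pi)) * F (0 + s * t)" for t
    using s by (simp add: F_def std_normal_density_def cis_conv_exp scaleR_conv_of_real power_mult_distrib mult.commute[of t])
  show "integrable lborel (\<lambda>t. cis (- (t * z)) * complex_of_real (exp (- \<epsilon> * t\<^sup>2 / 2)))"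
    unfolding F_sub
    by (intro integrable_mult_right lborel_integrable_real_affine F_int) (use s in auto)
  have "s *\<^sub>R (\<integral>t. F (0 + s * t) \<partial>lborel) = complex_of_real (exp (- (z / s)\<^sup>2 / 2))"
    using lborel_integral_real_affine[of s F 0] s F_val by simp
  then have "(\<integral>t. F (0 + s * t) \<partial>lborel) = complex_of_real (exp (- (z / s)\<^sup>2 / 2) / s)"
    using s by (simp add: scaleR_conv_of_real field_simps)
  then show "(\<integral>t. cis (- (t * z)) * complex_of_real (exp (- \<epsilon> * t\<^sup>2 / 2)) \<partial>lborel) =
      complex_of_real (sqrt (2 * pi / \<epsilon>) * exp (- z\<^sup>2 / (2 * \<epsilon>)))"
    unfolding F_sub using s
    by (simp add: real_sqrt_divide s_def[symmetric] power_divide mult.commute[of 2])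
qed

lemma cis_sum: "finite A \<Longrightarrow> cis (\<Sum>a\<in>A. f a) = (\<Prod>a\<in>A. cis (f a))"
  by (induction rule: finite_induct) (auto simp flip: cis_mult)

lemma
  fixes z :: "'a::euclidean_space"
  assumes \<epsilon>: "\<epsilon> > 0"
  shows integrable_gauss: "integrable lborel (\<lambda>x::'a. cis (- (x \<bullet> z)) * complex_of_real (exp (- \<epsilon> * (norm x)\<^sup>2 / 2)))"
    and integral_gauss: "(\<integral>x. cis (- (x \<bullet> z)) * complex_of_real (exp (- \<epsilon> * (norm x)\<^sup>2 / 2)) \<partial>lborel) =
      complex_of_real ((2 * pi / \<epsilon>) powr (DIM('a) / 2) * exp (- (norm z)\<^sup>2 / (2 * \<epsilon>)))"
proof -
  let ?g = "\<lambda>b t. cis (- (t * (z \<bullet> b))) * complex_of_real (exp (- \<epsilon> * t\<^sup>2 / 2))"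
  have nrm: "(norm x)\<^sup>2 = (\<Sum>b\<in>Basis. (x \<bullet> b)\<^sup>2)" for x :: 'a
    unfolding power2_norm_eq_inner by (subst euclidean_inner) (simp add: power2_eq_square)
  have eq: "cis (- (x \<bullet> z)) * complex_of_real (exp (- \<epsilon> * (norm x)\<^sup>2 / 2)) = (\<Prod>b\<in>Basis. ?g b (x \<bullet> b))" for x
  proof -
    have "cis (- (x \<bullet> z)) = (\<Prod>b\<in>Basis. cis (- ((x \<bullet> b) * (z \<bullet> b))))"
      by (subst euclidean_inner) (simp add: sum_negf[symmetric] cis_sum)
    moreover have "exp (- \<epsilon> * (norm x)\<^sup>2 / 2) = (\<Prod>b\<in>Basis. exp (- \<epsilon> * (x \<bullet> b)\<^sup>2 / 2))"
      by (simp add: nrm exp_sum[symmetric] sum_distrib_left sum_divide_distrib sum_negf)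
    ultimately show ?thesis by (simp add: prod.distrib)
  qed
  show "integrable lborel (\<lambda>x::'a. cis (- (x \<bullet> z)) * complex_of_real (exp (- \<epsilon> * (norm x)\<^sup>2 / 2)))"
    unfolding eq using \<epsilon> by (intro integrable_lborel_prod integrable_gauss_real)
  have "(\<integral>x. cis (- (x \<bullet> z)) * complex_of_real (exp (- \<epsilon> * (norm x)\<^sup>2 / 2)) \<partial>lborel) =
      (\<Prod>b\<in>(Basis::'a set). complex_of_real (sqrt (2 * pi / \<epsilon>) * exp (- (z \<bullet> b)\<^sup>2 / (2 * \<epsilon>))))"
    unfolding eq using \<epsilon> by (subst integral_lborel_prod) (auto intro!: integrable_gauss_real simp only: integral_gauss_real)
  also have "\<dots> = complex_of_real ((sqrt (2 * pi / \<epsilon>)) ^ DIM('a) * exp (- (norm z)\<^sup>2 / (2 * \<epsilon>)))"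
    by (simp add: prod.distrib nrm exp_sum[symmetric] sum_divide_distrib sum_negf flip: of_real_prod)
  also have "(sqrt (2 * pi / \<epsilon>)) ^ DIM('a) = (2 * pi / \<epsilon>) powr (DIM('a) / 2)"
    using \<epsilon> by (simp add: powr_half_sqrt[symmetric] powr_realpow[symmetric] powr_powr)
  finally show "(\<integral>x. cis (- (x \<bullet> z)) * complex_of_real (exp (- \<epsilon> * (norm x)\<^sup>2 / 2)) \<partial>lborel) =
      complex_of_real ((2 * pi / \<epsilon>) powr (DIM('a) / 2) * exp (- (norm z)\<^sup>2 / (2 * \<epsilon>)))" .
qed

section \<open>The Fourier transform on \<open>L\<^sup>1 \<inter> L\<^sup>2\<close>\<close>

text \<open>The density of the centred normal distribution with covariance \<epsilon> times the
  identity. It arises as the transform of the weight exp (- \<epsilon> |\<xi>|^2 / 2), and it serves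
  as an approximate identity as \<epsilon> tends to 0.\<close>

definition gker :: "real \<Rightarrow> 'a::euclidean_space \<Rightarrow> real" where
  "gker \<epsilon> z = (2 * pi * \<epsilon>) powr (- real DIM('a) / 2) * exp (- (norm z)\<^sup>2 / (2 * \<epsilon>))"

lemma gker_measurable [measurable]: "gker \<epsilon> \<in> borel_measurable borel"
  unfolding gker_def[abs_def] by measurable

lemma gker_nonneg: "gker \<epsilon> z \<ge> 0" by (simp add: gker_def)

lemma
  assumes \<epsilon>: "\<epsilon> > 0"
  shows integrable_gker: "integrable lborel (gker \<epsilon> :: 'a::euclidean_space \<Rightarrow> real)"
    and integral_gker: "(\<integral>z. gker \<epsilon> (z::'a) \<partial>lborel) = 1"
proof -
  let ?e = "\<lambda>x::'a. exp (- (norm x)\<^sup>2 / (2 * \<epsilon>))"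
  have "- (1 / \<epsilon>) * (norm x)\<^sup>2 / 2 = - (norm x)\<^sup>2 / (2 * \<epsilon>)" for x :: 'a by simp
  with integrable_gauss[of "1/\<epsilon>" "0::'a"] integral_gauss[of "1/\<epsilon>" "0::'a"] \<epsilon>
  have i: "integrable lborel (\<lambda>x. complex_of_real (?e x))"
    and v: "(\<integral>x. complex_of_real (?e x) \<partial>lborel) = complex_of_real ((2 * pi * \<epsilon>) powr (DIM('a) / 2))"
    by (simp_all add: mult_ac)
  from i have i': "integrable lborel ?e" by (simp only: complex_of_real_integrable_eq)
  then show "integrable lborel (gker \<epsilon> :: 'a \<Rightarrow> real)" unfolding gker_def[abs_def] by simp
  have "(\<integral>x. ?e x \<partial>lborel) = (2 * pi * \<epsilon>) powr (DIM('a) / 2)"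
    using v by (simp only: integral_complex_of_real of_real_eq_iff)
  then show "(\<integral>z. gker \<epsilon> (z::'a) \<partial>lborel) = 1"
    unfolding gker_def[abs_def] using \<epsilon> by (simp flip: powr_add)
qed

lemma nn_integral_lborel_translate:
  fixes f :: "'a::euclidean_space \<Rightarrow> ennreal"
  assumes [measurable]: "f \<in> borel_measurable borel"
  shows "(\<integral>\<^sup>+x. f (c + x) \<partial>lborel) = (\<integral>\<^sup>+x. f x \<partial>lborel)"
proof -
  have "(\<integral>\<^sup>+x. f x \<partial>lborel) = (\<integral>\<^sup>+x. f x \<partial>distr lborel borel ((+) c))"
    by (simp add: lborel_distr_plus)
  also have "\<dots> = (\<integral>\<^sup>+x. f (c + x) \<partial>lborel)" by (rule nn_integral_distr) auto
  finally show ?thesis by simp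
qed

lemma nn_integral_gker:
  fixes y :: "'a::euclidean_space"
  assumes "\<epsilon> > 0" shows "(\<integral>\<^sup>+x. ennreal (gker \<epsilon> (x - y)) \<partial>lborel) = 1"
proof -
  have "(\<integral>\<^sup>+x. ennreal (gker \<epsilon> (x - y)) \<partial>lborel) = (\<integral>\<^sup>+x. ennreal (gker \<epsilon> (- y + x)) \<partial>lborel)" by simp
  also have "\<dots> = (\<integral>\<^sup>+x. ennreal (gker \<epsilon> (x::'a)) \<partial>lborel)"
    by (rule nn_integral_lborel_translate[of "\<lambda>x::'a. ennreal (gker \<epsilon> x)"]) simp
  also have "\<dots> = 1" using assms
    by (subst nn_integral_eq_integral) (auto simp: integrable_gker integral_gker gker_nonneg)
  finally show ?thesis .
qed

lemma gker_commute: "gker \<epsilon> (x - y) = gker \<epsilon> (y - x)"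
  by (simp add: gker_def norm_minus_commute)

lemma nn_integral_gker': "\<epsilon> > 0 \<Longrightarrow> (\<integral>\<^sup>+y. ennreal (gker \<epsilon> (x - y)) \<partial>lborel) = 1"
  by (subst gker_commute) (rule nn_integral_gker)

text \<open>Scalar version of \<open>fourier_L1\<close> with the same unitary normalisation, for
  complex integrands: vector-valued statements are reduced to it componentwise, and the inverse
  transform of \<open>h\<close> appears as \<open>ft h (- x)\<close>.\<close>

definition ft :: "(real^'n \<Rightarrow> complex) \<Rightarrow> real^'n \<Rightarrow> complex" where
  "ft f \<xi> = of_real ((2 * pi) powr (- real CARD('n) / 2)) * (\<integral>x. cis (- (x \<bullet> \<xi>)) * f x \<partial>lborel)"

lemma fourier_L1_nth: "fourier_L1 f \<xi> $ i = ft (\<lambda>x. complex_of_real (f x $ i)) \<xi>"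
  by (simp add: fourier_L1_def ft_def)

lemma cis_inner_measurable [measurable]: "(\<lambda>x. cis (- (x \<bullet> \<xi>))) \<in> borel_measurable borel"
  by (intro borel_measurable_continuous_onI continuous_intros)

lemma integrable_cis_mult:
  assumes "integrable lborel f"
  shows "integrable lborel (\<lambda>x. cis (x \<bullet> \<xi>) * f x)" "integrable lborel (\<lambda>x. cis (- (x \<bullet> \<xi>)) * f x)"
proof -
  have [measurable]: "f \<in> borel_measurable borel" using assms by (auto dest: borel_measurable_integrable)
  have m[measurable]: "(\<lambda>x::'a. cis (x \<bullet> \<xi>)) \<in> borel_measurable borel" for \<xi>
    by (intro borel_measurable_continuous_onI continuous_intros)
  show "integrable lborel (\<lambda>x. cis (x \<bullet> \<xi>) * f x)" for \<xi>
    by (rule Bochner_Integration.integrable_bound[OF assms]) (auto simp: norm_mult)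
  from this[of "- \<xi>"] show "integrable lborel (\<lambda>x. cis (- (x \<bullet> \<xi>)) * f x)" by simp
qed

lemma ft_continuous:
  assumes f: "integrable lborel f" shows "continuous_on UNIV (ft f)"
proof -
  have [measurable]: "f \<in> borel_measurable borel" using f by (auto dest: borel_measurable_integrable)
  have "(\<lambda>k. \<integral>x. cis (- (x \<bullet> X k)) * f x \<partial>lborel) \<longlonglongrightarrow> (\<integral>x. cis (- (x \<bullet> \<xi>)) * f x \<partial>lborel)"
    if "X \<longlonglongrightarrow> \<xi>" for X \<xi>
  proof (rule integral_dominated_convergence[where w="\<lambda>x. norm (f x)"])
    show "AE x in lborel. (\<lambda>k. cis (- (x \<bullet> X k)) * f x) \<longlonglongrightarrow> cis (- (x \<bullet> \<xi>)) * f x"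
      by (intro AE_I2 tendsto_intros that)
  qed (use f in \<open>auto simp: norm_mult dest: borel_measurable_integrable\<close>)
  then have "(\<lambda>k. ft f (X k)) \<longlonglongrightarrow> ft f \<xi>" if "X \<longlonglongrightarrow> \<xi>" for X \<xi>
    unfolding ft_def using that by (intro tendsto_intros)
  then show ?thesis by (auto simp: continuous_on_sequentially comp_def)
qed

lemma ft_measurable [measurable]: "integrable lborel f \<Longrightarrow> ft f \<in> borel_measurable borel"
  by (intro borel_measurable_continuous_onI ft_continuous)

lemma ft_norm_le:
  fixes f :: "real^'n \<Rightarrow> complex"
  shows "norm (ft f \<xi>) \<le> (2 * pi) powr (- real CARD('n) / 2) * (\<integral>x. norm (f x) \<partial>lborel)"
proof -
  have "norm (\<integral>x. cis (- (x \<bullet> \<xi>)) * f x \<partial>lborel) \<le> (\<integral>x. norm (cis (- (x \<bullet> \<xi>)) * f x) \<partial>lborel)"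
    by (rule integral_norm_bound)
  then show ?thesis by (simp add: ft_def norm_mult mult_left_mono)
qed

lemma ft_cnj: "ft (\<lambda>x. cnj (f x)) (- \<xi>) = cnj (ft f \<xi>)"
proof -
  have "cnj (\<integral>x. cis (- (x \<bullet> \<xi>)) * f x \<partial>lborel) = (\<integral>x. cis (x \<bullet> \<xi>) * cnj (f x) \<partial>lborel)"
    using Bochner_Integration.integral_cnj[where M=lborel and f="\<lambda>x. cis (- (x \<bullet> \<xi>)) * f x"] by (simp add: cis_cnj)
  then show ?thesis by (simp add: ft_def)
qed

lemma ft_diff:
  "integrable lborel f \<Longrightarrow> integrable lborel g \<Longrightarrow> ft (\<lambda>x. f x - g x) \<xi> = ft f \<xi> - ft g \<xi>"
  by (simp add: ft_def right_diff_distrib Bochner_Integration.integral_diff integrable_cis_mult)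

text \<open>The Gaussian weight makes the triple integral absolutely convergent, and the \<open>\<xi>\<close>-integral
  is then carried out first.\<close>

lemma gauss_pairing:
  fixes f g :: "real^'n \<Rightarrow> complex"
  assumes f: "integrable lborel f" and g: "integrable lborel g" and \<epsilon>: "\<epsilon> > 0"
  shows "(\<integral>\<xi>. ft f \<xi> * ft g (- \<xi>) * complex_of_real (exp (- \<epsilon> * (norm \<xi>)\<^sup>2 / 2)) \<partial>lborel) =
    (\<integral>(x, y). f x * g y * complex_of_real (gker \<epsilon> (x - y)) \<partial>(lborel \<Otimes>\<^sub>M lborel))"
proof -
  define c where "c = complex_of_real ((2 * pi) powr (- real CARD('n) / 2))"
  define E where "E \<xi> = complex_of_real (exp (- \<epsilon> * (norm \<xi>)\<^sup>2 / 2))" for \<xi> :: "real^'n"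
  define F where "F w = f (fst w) * g (snd w)" for w
  define z where "z w = fst w - snd w" for w :: "(real^'n) \<times> (real^'n)"
  have [measurable]: "f \<in> borel_measurable borel" "g \<in> borel_measurable borel"
    using f g by (auto dest: borel_measurable_integrable)
  have E: "integrable lborel E"
    using integrable_gauss[OF \<epsilon>, of "0::real^'n"] by (simp add: E_def[abs_def])
  have F: "integrable lborel F"
    using integrable_pair_mult[OF f g] by (simp add: F_def[abs_def] lborel_prod split_beta')
  have [measurable]: "E \<in> borel_measurable borel" "F \<in> borel_measurable borel"
    using E F by (auto dest: borel_measurable_integrable)
  have z_meas[measurable]: "z \<in> borel_measurable borel"
    unfolding z_def[abs_def] by (intro borel_measurable_continuous_onI continuous_intros)
  have cis_meas: "(\<lambda>(w, \<xi>). cis (- (\<xi> \<bullet> z w))) \<in> borel_measurable (lborel \<Otimes>\<^sub>M lborel)"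
  proof -
    have "(\<lambda>(w, \<xi>). - (\<xi> \<bullet> z w)) \<in> borel_measurable (lborel \<Otimes>\<^sub>M lborel)" by measurable
    moreover have "cis \<in> borel_measurable borel"
      by (intro borel_measurable_continuous_onI continuous_intros)
    ultimately show ?thesis
      using measurable_compose[where g=cis and N=borel] by (simp add: split_beta')
  qed
  have H: "integrable (lborel \<Otimes>\<^sub>M lborel) (\<lambda>(w, \<xi>). F w * (cis (- (\<xi> \<bullet> z w)) * E \<xi>))"
  proof (rule Bochner_Integration.integrable_bound[OF integrable_pair_mult[OF F E]])
    show "(\<lambda>(w, \<xi>). F w * (cis (- (\<xi> \<bullet> z w)) * E \<xi>)) \<in> borel_measurable (lborel \<Otimes>\<^sub>M lborel)"
      using cis_meas by (simp add: split_beta')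
  qed (auto simp: norm_mult split_beta)
  have "c\<^sup>2 * (\<integral>w. (\<integral>\<xi>. F w * (cis (- (\<xi> \<bullet> z w)) * E \<xi>) \<partial>lborel) \<partial>lborel) =
    (\<integral>w. F w * complex_of_real (gker \<epsilon> (z w)) \<partial>lborel)"
  proof -
    have "c\<^sup>2 * (\<integral>\<xi>. cis (- (\<xi> \<bullet> z w)) * E \<xi> \<partial>lborel) = complex_of_real (gker \<epsilon> (z w))" for w
    proof -
      have "((2 * pi) powr (- real CARD('n) / 2))\<^sup>2 * (2 * pi / \<epsilon>) powr (real CARD('n) / 2)
        = (2 * pi) powr (- real CARD('n)) * ((2 * pi) powr (real CARD('n) / 2) / \<epsilon> powr (real CARD('n) / 2))"
        using \<epsilon> by (simp add: power2_eq_square powr_divide flip: powr_add)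
      also have "\<dots> = (2 * pi * \<epsilon>) powr (- real CARD('n) / 2)"
        using \<epsilon> by (simp add: powr_mult powr_minus field_simps flip: powr_add)
      finally have k: "((2 * pi) powr (- real CARD('n) / 2))\<^sup>2 * (2 * pi / \<epsilon>) powr (real CARD('n) / 2)
        = (2 * pi * \<epsilon>) powr (- real CARD('n) / 2)" .
      show ?thesis
        unfolding E_def integral_gauss[OF \<epsilon>] c_def gker_def using k
        by (simp flip: of_real_mult of_real_power mult.assoc)
    qed
    then have "c\<^sup>2 * (\<integral>\<xi>. F w * (cis (- (\<xi> \<bullet> z w)) * E \<xi>) \<partial>lborel) = F w * complex_of_real (gker \<epsilon> (z w))" for w
      by (simp add: mult.left_commute)
    then show ?thesis by (simp flip: integral_mult_right_zero)
  qed
  moreover have "c\<^sup>2 * (\<integral>\<xi>. (\<integral>w. F w * (cis (- (\<xi> \<bullet> z w)) * E \<xi>) \<partial>lborel) \<partial>lborel) =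
     (\<integral>\<xi>. ft f \<xi> * ft g (- \<xi>) * E \<xi> \<partial>lborel)"
  proof -
    have "(\<integral>w. F w * (cis (- (\<xi> \<bullet> z w)) * E \<xi>) \<partial>lborel) =
      (\<integral>x. cis (- (x \<bullet> \<xi>)) * f x \<partial>lborel) * (\<integral>y. cis (y \<bullet> \<xi>) * g y \<partial>lborel) * E \<xi>" for \<xi>
    proof -
      have "(\<integral>w. F w * (cis (- (\<xi> \<bullet> z w)) * E \<xi>) \<partial>lborel) =
        (\<integral>w. (cis (- (fst w \<bullet> \<xi>)) * f (fst w)) * (cis (snd w \<bullet> \<xi>) * g (snd w)) * E \<xi> \<partial>lborel)"
      proof (intro Bochner_Integration.integral_cong refl)
        fix w
        have "cis (- (\<xi> \<bullet> z w)) = cis (- (fst w \<bullet> \<xi>)) * cis (snd w \<bullet> \<xi>)"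
          by (simp add: z_def inner_diff_right inner_commute cis_mult)
        then show "F w * (cis (- (\<xi> \<bullet> z w)) * E \<xi>) =
          (cis (- (fst w \<bullet> \<xi>)) * f (fst w)) * (cis (snd w \<bullet> \<xi>) * g (snd w)) * E \<xi>"
          by (simp add: F_def)
      qed
      also have "\<dots> = (\<integral>w. (cis (- (fst w \<bullet> \<xi>)) * f (fst w)) * (cis (snd w \<bullet> \<xi>) * g (snd w)) \<partial>lborel) * E \<xi>"
        by simp
      also have "(\<integral>w. (cis (- (fst w \<bullet> \<xi>)) * f (fst w)) * (cis (snd w \<bullet> \<xi>) * g (snd w)) \<partial>lborel) =
        (\<integral>x. cis (- (x \<bullet> \<xi>)) * f x \<partial>lborel) * (\<integral>y. cis (y \<bullet> \<xi>) * g y \<partial>lborel)"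
        using integral_pair_mult[OF integrable_cis_mult(2)[OF f, of \<xi>] integrable_cis_mult(1)[OF g, of \<xi>]]
        by (simp add: lborel_prod split_beta')
      finally show ?thesis .
    qed
    note eq = this
    have "(\<integral>\<xi>. ft f \<xi> * ft g (- \<xi>) * E \<xi> \<partial>lborel) =
      (\<integral>\<xi>. c\<^sup>2 * (\<integral>w. F w * (cis (- (\<xi> \<bullet> z w)) * E \<xi>) \<partial>lborel) \<partial>lborel)"
      unfolding eq by (intro Bochner_Integration.integral_cong refl)
        (simp add: ft_def power2_eq_square c_def)
    then show ?thesis by simp
  qed
  moreover have "(\<integral>w. (\<integral>\<xi>. F w * (cis (- (\<xi> \<bullet> z w)) * E \<xi>) \<partial>lborel) \<partial>lborel) =
      (\<integral>\<xi>. (\<integral>w. F w * (cis (- (\<xi> \<bullet> z w)) * E \<xi>) \<partial>lborel) \<partial>lborel)"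
    by (rule lborel_pair.Fubini_integral[symmetric, OF H])
  ultimately show ?thesis
    by (simp add: E_def F_def z_def lborel_prod split_beta')
qed


lemma exp_gauss_tendsto_1:
  "(\<lambda>k. exp (- (1 / real (Suc k)) * r / 2)) \<longlonglongrightarrow> (1::real)"
proof -
  have "(\<lambda>k. exp (- (1 / real (Suc k)) * r / 2)) \<longlonglongrightarrow> exp (- 0 * r / 2)"
    by (intro tendsto_intros LIMSEQ_Suc[OF lim_1_over_n]) auto
  then show ?thesis by simp
qed

text \<open>Taking the conjugate of \<open>f\<close> as second factor in
  \<open>gauss_pairing\<close> writes the Gaussian-weighted norm of the transform as a double
  integral of f(x) cnj (f(y)) against \<open>gker\<close>. Since 2 |f(x) f(y)| \<le> |f(x)|^2 +
  |f(y)|^2 and the kernel has mass 1 in each variable, it is at most \<open>nsq f\<close>; Fatou's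
  lemma removes the weight.\<close>

theorem Bessel:
  fixes f :: "real^'n \<Rightarrow> complex"
  assumes f: "integrable lborel f"
  shows "nsq (ft f) \<le> nsq f"
proof -
  have [measurable]: "f \<in> borel_measurable borel" using f by (auto dest: borel_measurable_integrable)
  have [measurable]: "ft f \<in> borel_measurable borel" using f by simp
  define K where "K = (2 * pi) powr (- real CARD('n) / 2) * (\<integral>x. norm (f x) \<partial>lborel)"
  have K: "norm (ft f \<xi>) \<le> K" for \<xi> unfolding K_def by (rule ft_norm_le)
  have weighted: "(\<integral>\<^sup>+\<xi>. ennreal ((norm (ft f \<xi>))\<^sup>2 * exp (- \<epsilon> * (norm \<xi>)\<^sup>2 / 2)) \<partial>lborel) \<le> nsq f"
    if \<epsilon>: "\<epsilon> > 0" for \<epsilon>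
  proof -
    define I where "I = (\<integral>(x, y). f x * cnj (f y) * complex_of_real (gker \<epsilon> (x - y)) \<partial>(lborel \<Otimes>\<^sub>M lborel))"
    define h where "h \<xi> = (norm (ft f \<xi>))\<^sup>2 * exp (- \<epsilon> * (norm \<xi>)\<^sup>2 / 2)" for \<xi>
    have "integrable lborel (\<lambda>\<xi>. complex_of_real (exp (- \<epsilon> * (norm (\<xi>::real^'n))\<^sup>2 / 2)))"
      using integrable_gauss[OF \<epsilon>, of 0] by simp
    then have e: "integrable lborel (\<lambda>\<xi>. exp (- \<epsilon> * (norm (\<xi>::real^'n))\<^sup>2 / 2))"
      by (simp only: complex_of_real_integrable_eq)
    have h: "integrable lborel h"
    proof (rule Bochner_Integration.integrable_bound)
      show "integrable lborel (\<lambda>\<xi>. K\<^sup>2 * exp (- \<epsilon> * (norm (\<xi>::real^'n))\<^sup>2 / 2))" using e by simp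
      show "AE \<xi> in lborel. norm (h \<xi>) \<le> norm (K\<^sup>2 * exp (- \<epsilon> * (norm \<xi>)\<^sup>2 / 2))"
        using K by (auto simp: h_def abs_mult intro!: mult_right_mono power_mono)
    qed (simp add: h_def[abs_def])
    have "complex_of_real (\<integral>\<xi>. h \<xi> \<partial>lborel) = I"
    proof -
      have "ft f \<xi> * ft (\<lambda>x. cnj (f x)) (- \<xi>) * complex_of_real (exp (- \<epsilon> * (norm \<xi>)\<^sup>2 / 2)) = complex_of_real (h \<xi>)" for \<xi>
        by (simp add: ft_cnj h_def complex_norm_square[symmetric])
      then show ?thesis
        using gauss_pairing[OF f _ \<epsilon>, of "\<lambda>x. cnj (f x)"] f by (simp add: I_def)
    qed
    then have "(\<integral>\<xi>. h \<xi> \<partial>lborel) = norm I"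
      using Bochner_Integration.integral_nonneg[of lborel h] by (metis abs_of_nonneg h_def integral_nonneg_AE AE_I2 exp_ge_zero mult_nonneg_nonneg norm_of_real zero_le_power2)
    then have "(\<integral>\<^sup>+\<xi>. ennreal (h \<xi>) \<partial>lborel) = ennreal (norm I)"
      using nn_integral_eq_integral[OF h] by (simp add: h_def[abs_def])
    also have "\<dots> \<le> (\<integral>\<^sup>+(x, y). ennreal (norm (f x) * norm (f y) * gker \<epsilon> (x - y)) \<partial>(lborel \<Otimes>\<^sub>M lborel))"
    \<comment> \<open>Integrability over the product is left open here: if it fails,
      \<open>I\<close> is 0 by convention and the bound is trivial.\<close>
    proof (cases "integrable (lborel \<Otimes>\<^sub>M lborel) (\<lambda>(x, y). f x * cnj (f y) * complex_of_real (gker \<epsilon> (x - y)))")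
      case True
      from integral_norm_bound_ennreal[OF this] show ?thesis
        by (simp add: I_def split_beta' norm_mult gker_nonneg)
    qed (simp add: I_def not_integrable_integral_eq)
    also have "\<dots> \<le> (\<integral>\<^sup>+(x, y). ennreal ((norm (f x))\<^sup>2 / 2) * ennreal (gker \<epsilon> (x - y)) +
        ennreal ((norm (f y))\<^sup>2 / 2) * ennreal (gker \<epsilon> (x - y)) \<partial>(lborel \<Otimes>\<^sub>M lborel))"
    proof (rule nn_integral_mono, clarify)
      fix x y
      have "norm (f x) * norm (f y) * gker \<epsilon> (x - y) \<le> ((norm (f x))\<^sup>2 / 2 + (norm (f y))\<^sup>2 / 2) * gker \<epsilon> (x - y)"
        using sum_squares_bound[of "norm (f x)" "norm (f y)"] by (intro mult_right_mono gker_nonneg) auto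
      then have "ennreal (norm (f x) * norm (f y) * gker \<epsilon> (x - y)) \<le>
         ennreal ((norm (f x))\<^sup>2 / 2 * gker \<epsilon> (x - y) + (norm (f y))\<^sup>2 / 2 * gker \<epsilon> (x - y))"
        by (intro ennreal_leI) (simp add: distrib_right)
      then show "ennreal (norm (f x) * norm (f y) * gker \<epsilon> (x - y)) \<le>
        ennreal ((norm (f x))\<^sup>2 / 2) * ennreal (gker \<epsilon> (x - y)) + ennreal ((norm (f y))\<^sup>2 / 2) * ennreal (gker \<epsilon> (x - y))"
        by (subst (1 2) ennreal_mult[symmetric]) (simp_all only: ennreal_plus[symmetric] gker_nonneg zero_le_power2 zero_le_divide_iff zero_le_numeral mult_nonneg_nonneg simp_thms)
    qed
    also have "\<dots> = (\<integral>\<^sup>+(x, y). ennreal ((norm (f x))\<^sup>2 / 2) * ennreal (gker \<epsilon> (x - y)) \<partial>(lborel \<Otimes>\<^sub>M lborel)) +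
       (\<integral>\<^sup>+(x, y). ennreal ((norm (f y))\<^sup>2 / 2) * ennreal (gker \<epsilon> (x - y)) \<partial>(lborel \<Otimes>\<^sub>M lborel))"
      unfolding split_beta' by (rule nn_integral_add) measurable
    also have "(\<integral>\<^sup>+(x, y). ennreal ((norm (f x))\<^sup>2 / 2) * ennreal (gker \<epsilon> (x - y)) \<partial>(lborel \<Otimes>\<^sub>M lborel)) =
      (\<integral>\<^sup>+x. (\<integral>\<^sup>+y. ennreal ((norm (f x))\<^sup>2 / 2) * ennreal (gker \<epsilon> (x - y)) \<partial>lborel) \<partial>lborel)"
      by (subst lborel.nn_integral_fst[symmetric]) auto
    also have "\<dots> = (\<integral>\<^sup>+x. ennreal ((norm (f x))\<^sup>2 / 2) \<partial>lborel)"
      using \<epsilon> by (simp add: nn_integral_cmult nn_integral_gker')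
    also have "(\<integral>\<^sup>+(x, y). ennreal ((norm (f y))\<^sup>2 / 2) * ennreal (gker \<epsilon> (x - y)) \<partial>(lborel \<Otimes>\<^sub>M lborel)) =
      (\<integral>\<^sup>+y. (\<integral>\<^sup>+x. ennreal ((norm (f y))\<^sup>2 / 2) * ennreal (gker \<epsilon> (x - y)) \<partial>lborel) \<partial>lborel)"
      by (subst lborel_pair.nn_integral_snd[symmetric]) auto
    also have "\<dots> = (\<integral>\<^sup>+x. ennreal ((norm (f x))\<^sup>2 / 2) \<partial>lborel)"
      using \<epsilon> by (simp add: nn_integral_cmult nn_integral_gker)
    also have "(\<integral>\<^sup>+x. ennreal ((norm (f x))\<^sup>2 / 2) \<partial>lborel) + (\<integral>\<^sup>+x. ennreal ((norm (f x))\<^sup>2 / 2) \<partial>lborel) = nsq f"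
      unfolding nsq_def by (subst nn_integral_add[symmetric]) (auto simp flip: ennreal_plus)
    finally show ?thesis by (simp add: h_def)
  qed
  show ?thesis unfolding nsq_def[of "ft f"]
  proof (rule nn_integral_limit_le)
    show "AE \<xi> in lborel. (\<lambda>k. ennreal ((norm (ft f \<xi>))\<^sup>2 * exp (- (1 / real (Suc k)) * (norm \<xi>)\<^sup>2 / 2)))
      \<longlonglongrightarrow> ennreal ((norm (ft f \<xi>))\<^sup>2)"
      using tendsto_mult[OF tendsto_const exp_gauss_tendsto_1]
      by (intro AE_I2 tendsto_ennrealI) fastforce
    show "(\<integral>\<^sup>+\<xi>. ennreal ((norm (ft f \<xi>))\<^sup>2 * exp (- (1 / real (Suc k)) * (norm \<xi>)\<^sup>2 / 2)) \<partial>lborel) \<le> nsq f" for k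
      by (rule weighted) simp
  qed simp
qed

text \<open>The substitution x = y + sqrt \<epsilon> z moves \<epsilon> from the kernel into the
  argument of \<open>h\<close>, which makes dominated convergence applicable as \<epsilon> tends to
  0.\<close>

lemma integral_mult_gker:
  fixes h :: "'a::euclidean_space \<Rightarrow> complex"
  assumes \<epsilon>: "\<epsilon> > 0" and [measurable]: "h \<in> borel_measurable borel"
  shows "(\<integral>x. h x * complex_of_real (gker \<epsilon> (x - y)) \<partial>lborel) =
    (\<integral>z. h (y + sqrt \<epsilon> *\<^sub>R z) * complex_of_real (gker 1 z) \<partial>lborel)"
proof -
  define s where "s = sqrt \<epsilon>"
  have s: "s > 0" "s\<^sup>2 = \<epsilon>" using \<epsilon> by (auto simp: s_def)
  define F where "F x = h x * complex_of_real (gker \<epsilon> (x - y))" for x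
  have [measurable]: "F \<in> borel_measurable borel" unfolding F_def[abs_def] by measurable
  have "\<epsilon> powr (- real DIM('a) / 2) * s ^ DIM('a) = 1"
    using \<epsilon> by (simp add: s_def powr_half_sqrt[symmetric] powr_realpow[symmetric] powr_powr flip: powr_add)
  then have g: "s ^ DIM('a) * gker \<epsilon> (s *\<^sub>R z) = gker 1 z" for z :: 'a
    using s \<epsilon> by (simp add: gker_def powr_mult power_mult_distrib field_simps)
  have "(\<integral>x. F x \<partial>lborel) = (\<integral>x. F x \<partial>density (distr lborel borel (\<lambda>x. y + s *\<^sub>R x)) (\<lambda>_. \<bar>s\<bar> ^ DIM('a)))"
    by (rule arg_cong[OF lborel_affine]) (use s in simp)
  also have "\<dots> = (\<integral>z. (s ^ DIM('a)) *\<^sub>R F (y + s *\<^sub>R z) \<partial>lborel)"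
    using s by (subst integral_density) (auto simp: integral_distr)
  also have "\<dots> = (\<integral>z. h (y + s *\<^sub>R z) * complex_of_real (gker 1 z) \<partial>lborel)"
    by (intro Bochner_Integration.integral_cong refl)
       (simp add: F_def scaleR_conv_of_real g[symmetric])
  finally show ?thesis by (simp add: F_def s_def)
qed

lemma gker_le: "\<epsilon> > 0 \<Longrightarrow> gker \<epsilon> (z::'a::euclidean_space) \<le> (2 * pi * \<epsilon>) powr (- real DIM('a) / 2)"
  by (simp add: gker_def mult_left_le)

text \<open>The Gaussian-weighted pairing \<open>L\<close> has two limits. On the frequency side the
  weight tends to 1 and the product of the transforms is integrable, by Bessel applied to both
  factors. On the space side \<open>gauss_pairing\<close> turns it into the pairing of
  \<open>f\<close> with Gaussian averages \<open>P\<close> of \<open>\<psi>\<close>, which are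
  bounded by \<open>M\<close> and converge pointwise because \<open>\<psi>\<close> is
  continuous.\<close>

theorem Parseval:
  fixes \<psi> f :: "real^'n \<Rightarrow> complex"
  assumes \<psi>: "integrable lborel \<psi>" "continuous_on UNIV \<psi>" "\<And>x. norm (\<psi> x) \<le> M" "nsq \<psi> < \<infinity>"
    and f: "integrable lborel f" "nsq f < \<infinity>"
  shows "(\<integral>\<xi>. ft \<psi> \<xi> * ft f (- \<xi>) \<partial>lborel) = (\<integral>x. \<psi> x * f x \<partial>lborel)"
proof -
  have [measurable]: "f \<in> borel_measurable borel" "\<psi> \<in> borel_measurable borel"
    using \<psi> f by (auto dest: borel_measurable_integrable)
  have cnj_int: "integrable lborel (\<lambda>x. cnj (f x))" using f by simp
  have f_minus: "ft f (- \<xi>) = cnj (ft (\<lambda>x. cnj (f x)) \<xi>)" for \<xi>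
    using ft_cnj[of "\<lambda>x. cnj (f x)" "\<xi>"] by simp
  have prod: "integrable lborel (\<lambda>\<xi>. ft \<psi> \<xi> * ft f (- \<xi>))"
  proof (rule integrable_mult_L2)
    show "nsq (ft \<psi>) < \<infinity>" using Bessel[OF \<psi>(1)] \<psi>(4) by simp
    have "nsq (\<lambda>\<xi>. ft f (- \<xi>)) = nsq (ft (\<lambda>x. cnj (f x)))" by (simp add: nsq_def f_minus)
    also have "\<dots> \<le> nsq f" using Bessel[OF cnj_int] by (simp add: nsq_def)
    finally show "nsq (\<lambda>\<xi>. ft f (- \<xi>)) < \<infinity>" using f(2) by simp
    show "(\<lambda>\<xi>. ft f (- \<xi>)) \<in> borel_measurable borel" unfolding f_minus using ft_measurable[OF cnj_int]
      by (rule borel_measurable_continuous_on[OF continuous_on_cnj[OF continuous_on_id]])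
  qed (use \<psi> in simp)
  define \<epsilon> where "\<epsilon> k = 1 / real (Suc k)" for k
  have \<epsilon>: "\<epsilon> k > 0" for k by (simp add: \<epsilon>_def)
  define L where "L k = (\<integral>\<xi>. ft \<psi> \<xi> * ft f (- \<xi>) * complex_of_real (exp (- \<epsilon> k * (norm \<xi>)\<^sup>2 / 2)) \<partial>lborel)" for k
  have "L \<longlonglongrightarrow> (\<integral>\<xi>. ft \<psi> \<xi> * ft f (- \<xi>) \<partial>lborel)"
    unfolding L_def
  proof (rule integral_dominated_convergence[where w="\<lambda>\<xi>. norm (ft \<psi> \<xi> * ft f (- \<xi>))"])
    have "(\<lambda>k. complex_of_real (exp (- \<epsilon> k * (norm \<xi>)\<^sup>2 / 2))) \<longlonglongrightarrow> complex_of_real 1" for \<xi> :: "real^'n"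
      unfolding \<epsilon>_def by (intro tendsto_of_real exp_gauss_tendsto_1)
    from tendsto_mult[OF tendsto_const this]
    show "AE \<xi> in lborel. (\<lambda>k. ft \<psi> \<xi> * ft f (- \<xi>) * complex_of_real (exp (- \<epsilon> k * (norm \<xi>)\<^sup>2 / 2))) \<longlonglongrightarrow> ft \<psi> \<xi> * ft f (- \<xi>)"
      by (intro AE_I2) fastforce
    show "AE \<xi> in lborel. norm (ft \<psi> \<xi> * ft f (- \<xi>) * complex_of_real (exp (- \<epsilon> k * (norm \<xi>)\<^sup>2 / 2))) \<le> norm (ft \<psi> \<xi> * ft f (- \<xi>))" for k
      using \<epsilon>[of k] by (intro AE_I2) (auto simp: norm_mult intro!: mult_left_le mult_nonneg_nonneg)
    show "(\<lambda>\<xi>. ft \<psi> \<xi> * ft f (- \<xi>)) \<in> borel_measurable lborel"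
      using prod by (rule borel_measurable_integrable)
    then show "(\<lambda>\<xi>. ft \<psi> \<xi> * ft f (- \<xi>) * complex_of_real (exp (- \<epsilon> k * (norm \<xi>)\<^sup>2 / 2))) \<in> borel_measurable lborel" for k
      by (rule borel_measurable_times) measurable
  qed (use prod in simp)
  moreover have "L \<longlonglongrightarrow> (\<integral>x. \<psi> x * f x \<partial>lborel)"
  proof -
    define P where "P k y = (\<integral>x. \<psi> x * complex_of_real (gker (\<epsilon> k) (x - y)) \<partial>lborel)" for k y
    have P_eq: "P k y = (\<integral>z. \<psi> (y + sqrt (\<epsilon> k) *\<^sub>R z) * complex_of_real (gker 1 z) \<partial>lborel)" for k y
      unfolding P_def by (rule integral_mult_gker[OF \<epsilon>]) simp
    have g1: "integrable lborel (\<lambda>z::real^'n. M * gker 1 z)" by (simp add: integrable_gker)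
    have P_bound: "norm (P k y) \<le> M" for k y
    proof -
      have "norm (P k y) \<le> (\<integral>z. M * gker 1 (z::real^'n) \<partial>lborel)"
        unfolding P_eq
        by (rule order_trans[OF integral_norm_bound integral_mono'[OF g1]])
           (use \<psi>(3) order_trans[OF norm_ge_zero \<psi>(3)] in \<open>auto simp: norm_mult gker_nonneg intro!: mult_right_mono\<close>)
      then show ?thesis by (simp add: integral_gker)
    qed
    have P_lim: "(\<lambda>k. P k y) \<longlonglongrightarrow> \<psi> y" for y
    proof -
      have "(\<lambda>k. \<integral>z. \<psi> (y + sqrt (\<epsilon> k) *\<^sub>R z) * complex_of_real (gker 1 z) \<partial>lborel) \<longlonglongrightarrow>
         (\<integral>z. \<psi> y * complex_of_real (gker 1 (z::real^'n)) \<partial>lborel)"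
      proof (rule integral_dominated_convergence[where w="\<lambda>z. M * gker 1 z"])
        have "isCont \<psi> y" using \<psi>(2) by (simp add: continuous_on_eq_continuous_at)
        moreover have "(\<lambda>k. y + sqrt (\<epsilon> k) *\<^sub>R z) \<longlonglongrightarrow> y + sqrt 0 *\<^sub>R z" for z :: "real^'n"
          unfolding \<epsilon>_def by (intro tendsto_intros LIMSEQ_Suc lim_1_over_n)
        ultimately have "(\<lambda>k. \<psi> (y + sqrt (\<epsilon> k) *\<^sub>R z)) \<longlonglongrightarrow> \<psi> y" for z
          using isCont_tendsto_compose[of y \<psi> "\<lambda>k. y + sqrt (\<epsilon> k) *\<^sub>R z" sequentially] by simp
        then show "AE z in lborel. (\<lambda>k. \<psi> (y + sqrt (\<epsilon> k) *\<^sub>R z) * complex_of_real (gker 1 z)) \<longlonglongrightarrow> \<psi> y * complex_of_real (gker 1 z)"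
          by (intro AE_I2 tendsto_intros)
      qed (use \<psi>(3) g1 in \<open>auto simp: norm_mult gker_nonneg intro!: mult_right_mono\<close>)
      also have "(\<integral>z. \<psi> y * complex_of_real (gker 1 (z::real^'n)) \<partial>lborel) = \<psi> y"
        using integral_gker[where ?'a="real^'n", of 1] by simp
      finally show ?thesis by (simp add: P_eq)
    qed
    have L_eq: "L k = (\<integral>y. f y * P k y \<partial>lborel)" for k
    proof -
      let ?h = "\<lambda>x y. \<psi> x * f y * complex_of_real (gker (\<epsilon> k) (x - y))"
      have "integrable (lborel \<Otimes>\<^sub>M lborel) (case_prod ?h)"
      proof (rule Bochner_Integration.integrable_bound)
        define c where "c = (2 * pi * \<epsilon> k) powr (- real DIM(real^'n) / 2)"
        show "integrable (lborel \<Otimes>\<^sub>M lborel) (\<lambda>w. complex_of_real c * (case w of (x, y) \<Rightarrow> \<psi> x * f y))"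
          using integrable_pair_mult[OF \<psi>(1) f(1)] by simp
        have "gker (\<epsilon> k) z \<le> c" for z :: "real^'n" unfolding c_def by (rule gker_le[OF \<epsilon>])
        then show "AE w in lborel \<Otimes>\<^sub>M lborel. norm (case_prod ?h w) \<le> norm (complex_of_real c * (case w of (x, y) \<Rightarrow> \<psi> x * f y))"
          by (intro AE_I2) (auto simp: norm_mult gker_nonneg c_def mult.commute[of _ "gker _ _"] intro!: mult_right_mono)
      qed simp
      from lborel_pair.integral_snd[OF this] have "L k = (\<integral>y. \<integral>x. ?h x y \<partial>lborel \<partial>lborel)"
        unfolding L_def gauss_pairing[OF \<psi>(1) f(1) \<epsilon>] by simp
      also have "\<dots> = (\<integral>y. f y * P k y \<partial>lborel)"
        unfolding P_def by (simp flip: integral_mult_right_zero add: mult_ac)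
      finally show ?thesis .
    qed
    have "(\<lambda>k. \<integral>y. f y * P k y \<partial>lborel) \<longlonglongrightarrow> (\<integral>y. f y * \<psi> y \<partial>lborel)"
    proof (rule integral_dominated_convergence[where w="\<lambda>y. norm (f y) * M"])
      show "AE y in lborel. (\<lambda>k. f y * P k y) \<longlonglongrightarrow> f y * \<psi> y" by (intro AE_I2 tendsto_intros P_lim)
      show "(\<lambda>y. f y * P k y) \<in> borel_measurable lborel" for k
        unfolding P_def by measurable
    qed (use P_bound f in \<open>auto simp: norm_mult intro!: mult_left_mono\<close>)
    then show ?thesis by (simp add: L_eq[abs_def] mult.commute)
  qed
  ultimately show ?thesis by (rule LIMSEQ_unique)
qed

section \<open>Quadratic forms on \<open>\<complex>\<^sup>m\<close>\<close>

text \<open>All structural conditions concern real parts only, so the estimates run in the real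
  inner product of the underlying Euclidean space; multiplication by i becomes a skew-adjoint
  isometry there.\<close>

lemma inner_complex_vec: "Re (cinner z w) = z \<bullet> w"
  by (simp add: cinner_def inner_vec_def inner_complex_def)

lemma cmat_nth: "(cmat X *v z) $ i = (\<Sum>j\<in>UNIV. complex_of_real (X $ i $ j) * z $ j)"
  by (simp add: cmat_def matrix_vector_mult_def map_matrix_def)

lemma cmat_mult: "cmat (X ** Y) *v z = cmat X *v (cmat Y *v z)"
proof -
  have "cmat (X ** Y) = cmat X ** cmat Y"
    by (simp add: cmat_def map_matrix_def matrix_matrix_mult_def vec_eq_iff)
  then show ?thesis by (simp add: matrix_vector_mul_assoc)
qed

lemma cmat_add: "cmat (X + Y) *v z = cmat X *v z + cmat Y *v z"
  by (simp add: vec_eq_iff cmat_nth sum.distrib distrib_right)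

lemma cmat_uminus: "cmat (- X) *v z = - (cmat X *v z)"
  by (simp add: vec_eq_iff cmat_nth sum_negf)

lemma cmat_scaleR: "cmat (r *\<^sub>R X) *v z = r *\<^sub>R (cmat X *v z)"
  by (simp add: vec_eq_iff cmat_nth scaleR_sum_right) (simp add: scaleR_conv_of_real mult.assoc)

lemma cmat_mult_i: "cmat X *v (\<i> *s z) = \<i> *s (cmat X *v z)"
  by (simp add: vector_scalar_commute)

lemma cmat_linear: "linear (\<lambda>z. cmat X *v z)"
  by (rule linearI) (auto simp: vec_eq_iff cmat_nth sum.distrib distrib_left scaleR_sum_right)

lemma cmat_add_right: "cmat X *v (z + w) = cmat X *v z + cmat X *v w"
  by (rule linear_add[OF cmat_linear])

lemma cmat_scaleR_right: "cmat X *v (r *\<^sub>R z) = r *\<^sub>R (cmat X *v z)"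
  by (rule linear_scale[OF cmat_linear])

lemma cmat_uminus_right: "cmat X *v (- z) = - (cmat X *v z)"
  by (rule linear_neg[OF cmat_linear])

lemma inner_cmat_left: "(cmat X *v z) \<bullet> w = z \<bullet> (cmat (transpose X) *v w)"
proof -
  have "(cmat X *v z) \<bullet> w = (\<Sum>i\<in>UNIV. \<Sum>j\<in>UNIV. X $ i $ j * (z $ j \<bullet> w $ i))"
    by (simp add: inner_vec_def cmat_nth inner_sum_left flip: scaleR_conv_of_real)
  also have "\<dots> = (\<Sum>j\<in>UNIV. \<Sum>i\<in>UNIV. X $ i $ j * (z $ j \<bullet> w $ i))" by (rule sum.swap)
  also have "\<dots> = z \<bullet> (cmat (transpose X) *v w)"
    by (simp add: inner_vec_def cmat_nth inner_sum_right transpose_def flip: scaleR_conv_of_real)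
  finally show ?thesis .
qed

lemma inner_i_left: "(\<i> *s z) \<bullet> w = - (z \<bullet> (\<i> *s w))"
  by (simp add: inner_vec_def inner_complex_def sum_negf[symmetric] vector_scalar_mult_def)

lemma norm_i_smult: "norm (\<i> *s (z :: complex^'m)) = norm z"
  by (simp add: norm_vec_def norm_mult)

lemma i_smult_linear: "linear (\<lambda>z. \<i> *s (z :: complex^'m))"
  by (rule linearI) (auto simp: vec_eq_iff distrib_left)

lemmas i_smult_bounded_linear = linear_conv_bounded_linear[THEN iffD1, OF i_smult_linear]

lemma i_i_smult: "\<i> *s (\<i> *s (z :: complex^'m)) = - z"
  by (simp add: vec_eq_iff)

lemma i_of_real_smult: "(\<i> * of_real r) *s (z :: complex^'m) = r *\<^sub>R (\<i> *s z)"
  by (simp add: vec_eq_iff) (simp add: scaleR_conv_of_real)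

text \<open>The entrywise sum dominates the operator norm on complex vectors and depends
  continuously on the matrix, which is what compactness of the sphere requires.\<close>

definition mat_bound :: "real^'b^'a \<Rightarrow> real" where
  "mat_bound X = (\<Sum>i\<in>UNIV. \<Sum>j\<in>UNIV. \<bar>X $ i $ j\<bar>)"

lemma mat_bound_nonneg: "mat_bound X \<ge> 0"
  by (auto simp: mat_bound_def intro!: sum_nonneg)

lemma norm_cmat_le: "norm (cmat X *v z) \<le> mat_bound X * norm z"
proof -
  have "norm (cmat X *v z) \<le> (\<Sum>i\<in>UNIV. norm ((cmat X *v z) $ i))"
    unfolding norm_vec_def by (rule L2_set_le_sum) simp
  also have "\<dots> \<le> (\<Sum>i\<in>UNIV. \<Sum>j\<in>UNIV. \<bar>X $ i $ j\<bar> * norm z)"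
    unfolding cmat_nth
    by (intro sum_mono order_trans[OF norm_sum])
       (auto simp: norm_mult intro!: mult_left_mono Finite_Cartesian_Product.norm_nth_le)
  finally show ?thesis by (simp add: mat_bound_def sum_distrib_right)
qed

lemma continuous_on_mat_bound:
  assumes "continuous_on U X" shows "continuous_on U (\<lambda>x. mat_bound (X x))"
  unfolding mat_bound_def
  by (intro continuous_intros continuous_on_sum continuous_on_rabs continuous_on_component assms)

lemma continuous_on_cmat [continuous_intros]:
  assumes "continuous_on U X" "continuous_on U z"
  shows "continuous_on U (\<lambda>x. cmat (X x) *v z x)"
proof -
  have "continuous_on U (\<lambda>x. \<chi> i. \<Sum>j\<in>UNIV. complex_of_real (X x $ i $ j) * z x $ j)"
    by (intro continuous_on_vec_lambda continuous_on_sum continuous_on_mult continuous_on_of_real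
        continuous_on_component assms)
  moreover have "(\<lambda>x. cmat (X x) *v z x) = (\<lambda>x. \<chi> i. \<Sum>j\<in>UNIV. complex_of_real (X x $ i $ j) * z x $ j)"
    by (auto simp: vec_eq_iff cmat_nth)
  ultimately show ?thesis by (simp only:)
qed

lemma continuous_on_symbol: "continuous_on U (symbol A)"
  unfolding symbol_def[abs_def]
  by (intro continuous_on_sum continuous_on_scaleR continuous_on_component continuous_on_id continuous_on_const)

lemma continuous_on_matrix_mult:
  fixes X :: "'c::topological_space \<Rightarrow> real^'b^'a" and Y :: "'c \<Rightarrow> real^'d^'b"
  assumes "continuous_on U X" "continuous_on U Y"
  shows "continuous_on U (\<lambda>x. X x ** Y x)"
  unfolding matrix_matrix_mult_def
  by (intro continuous_on_vec_lambda continuous_on_sum continuous_on_mult continuous_on_component assms)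

lemma cmat_zero_right [simp]: "cmat X *v 0 = 0"
  by (simp add: vec_eq_iff cmat_nth)

lemma subspace_cker: "subspace (cker X)"
  by (auto simp: subspace_def cker_def cmat_add_right cmat_scaleR_right)

lemma closed_cker: "closed (cker X)"
proof -
  have "cker X = (\<lambda>z. cmat X *v z) -` {0}" by (auto simp: cker_def)
  moreover have "continuous_on UNIV (\<lambda>z. cmat X *v z)" by (intro continuous_intros)
  ultimately show ?thesis by (simp add: continuous_closed_vimage continuous_on_eq_continuous_at)
qed

lemma inner_cmat_sym_part: "(cmat (sym_part X) *v z) \<bullet> z = (cmat X *v z) \<bullet> z"
proof -
  have "(cmat (transpose X) *v z) \<bullet> z = (cmat X *v z) \<bullet> z"
    using inner_cmat_left[of X z z] by (simp add: inner_commute)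
  then show ?thesis by (simp add: sym_part_def cmat_scaleR cmat_add inner_add_left)
qed

text \<open>A real symmetric matrix is Hermitian, so <Xz, z> is real and i times it has real part
  0.\<close>

lemma inner_i_symmetric:
  assumes "transpose X = X" shows "(\<i> *s (cmat X *v z)) \<bullet> z = 0"
proof -
  have "(\<i> *s (cmat X *v z)) \<bullet> z = - ((cmat X *v z) \<bullet> (\<i> *s z))" by (rule inner_i_left)
  also have "\<dots> = - (z \<bullet> (\<i> *s (cmat X *v z)))" by (simp add: inner_cmat_left assms cmat_mult_i)
  finally show ?thesis by (simp add: inner_commute)
qed

text \<open>This translates (S)_1, a condition on the skew part, into one on the quadratic form of i
  S A(\<omega>) that appears in the energy identity.\<close>

lemma inner_i_skew_part: "(\<i> *s (cmat (skew_part X) *v z)) \<bullet> z = (\<i> *s (cmat X *v z)) \<bullet> z"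
proof -
  have "X = sym_part X + skew_part X"
    by (simp add: sym_part_def skew_part_def algebra_simps flip: scaleR_left.add)
  then have "\<i> *s (cmat X *v z) = \<i> *s (cmat (sym_part X) *v z) + \<i> *s (cmat (skew_part X) *v z)"
    by (metis cmat_add linear_add[OF i_smult_linear])
  moreover have "transpose (sym_part X) = sym_part X"
    by (simp add: sym_part_def transpose_def vec_eq_iff add.commute)
  ultimately show ?thesis using inner_i_symmetric[of "sym_part X" z] by (simp add: inner_add_left)
qed

lemma i_map_matrix: "map_matrix (\<lambda>a. \<i> * complex_of_real a) X *v z = \<i> *s (cmat X *v z)"
proof -
  have "(map_matrix (\<lambda>a. \<i> * complex_of_real a) X *v z) $ i = (\<Sum>j\<in>UNIV. \<i> * complex_of_real (X $ i $ j) * z $ j)" for i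
    by (simp add: matrix_vector_mult_def map_matrix_def)
  then show ?thesis by (simp add: vec_eq_iff cmat_nth sum_distrib_left mult.assoc)
qed

text \<open>A zero of a nonnegative quadratic form is a minimum, so the gradient \<open>P w\<close>
  has to vanish; otherwise a small step against it makes the form negative.\<close>

lemma psd_zero:
  fixes P :: "'a::real_inner \<Rightarrow> 'a"
  assumes P: "linear P" and sym: "\<And>x y. P x \<bullet> y = x \<bullet> P y" and nn: "\<And>x. P x \<bullet> x \<ge> 0"
    and w: "P w \<bullet> w = 0"
  shows "P w = 0"
proof (rule ccontr)
  assume "P w \<noteq> 0"
  define a b where "a = P w \<bullet> P w" and "b = P (P w) \<bullet> P w"
  have a: "a > 0" using \<open>P w \<noteq> 0\<close> by (simp add: a_def)
  have b: "b \<ge> 0" using nn by (simp add: b_def)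
  \<comment> \<open>With this step length the value 2 t a + t^2 b becomes t (a - t), a product of a
    negative and a positive factor. The summand 1 covers b = 0.\<close>
  define t where "t = - a / (b + 1)"
  have "0 \<le> P (w + t *\<^sub>R P w) \<bullet> (w + t *\<^sub>R P w)" by (rule nn)
  also have "\<dots> = 2 * t * a + t\<^sup>2 * b"
    using w sym[of "P w" w]
    by (simp add: linear_add[OF P] linear_scale[OF P] inner_add_left inner_add_right a_def b_def power2_eq_square algebra_simps)
  also have "\<dots> = t * (a - t)"
  proof -
    have "t * (b + 1) = - a" using b by (simp add: t_def)
    then have "t * b = - a - t" by (simp add: algebra_simps)
    then have "t * (t * b) = t * (- a - t)" by simp
    then show ?thesis by (simp add: power2_eq_square algebra_simps)
  qed
  also have "\<dots> < 0"
  proof -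
    have "t < 0" using a b by (simp add: t_def divide_neg_pos)
    then show ?thesis using a by (intro mult_neg_pos) auto
  qed
  finally show False by simp
qed

text \<open>Here \<open>q\<close> is the component of \<open>z\<close> orthogonal to the kernel, and
  the form takes the same value at \<open>z\<close> and at \<open>q\<close>. By
  \<open>psd_zero\<close> it is positive on the compact unit sphere of the orthogonal complement,
  hence bounded below there by some \<open>c\<close>.\<close>

lemma psd_coercive:
  fixes M :: "real^'m^'m"
  assumes sym: "transpose M = M" and nn: "nonneg_on (cmat M) UNIV"
  obtains c where "c > 0"
    "\<And>z. \<exists>q. z - q \<in> cker M \<and> norm q \<le> norm z \<and> (cmat M *v z) \<bullet> z \<ge> c * (norm q)\<^sup>2"
proof -
  let ?P = "\<lambda>z. cmat M *v z"
  have nn': "?P z \<bullet> z \<ge> 0" for z using nn by (auto simp: nonneg_on_def inner_complex_vec)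
  have sym': "?P x \<bullet> y = x \<bullet> ?P y" for x y by (simp add: inner_cmat_left sym)
  define W where "W = {w. \<forall>v\<in>cker M. orthogonal w v}"
  define T where "T = sphere 0 1 \<inter> W"
  have "closed W" unfolding W_def orthogonal_def Ball_def
    by (intro closed_Collect_all closed_Collect_imp closed_Collect_eq continuous_intros open_Collect_const)
  then have "compact T" unfolding T_def by (intro compact_Int_closed) auto
  have pos: "?P w \<bullet> w > 0" if "w \<in> T" for w
  proof (rule ccontr)
    assume "\<not> ?thesis"
    then have "?P w = 0" using psd_zero[OF cmat_linear sym' nn', of w] nn'[of w] by linarith
    then have "orthogonal w w" using that by (auto simp: T_def W_def cker_def)
    then show False using that by (auto simp: T_def orthogonal_self)
  qed
  obtain c where c: "c > 0" "\<And>w. w \<in> T \<Longrightarrow> ?P w \<bullet> w \<ge> c"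
  proof (cases "T = {}")
    case True
    then show ?thesis using that[of 1] by auto
  next
    case False
    have "continuous_on T (\<lambda>w. ?P w \<bullet> w)" by (intro continuous_intros)
    from continuous_attains_inf[OF \<open>compact T\<close> False this] show ?thesis
      using that pos by blast
  qed
  have "\<exists>q. z - q \<in> cker M \<and> norm q \<le> norm z \<and> ?P z \<bullet> z \<ge> c * (norm q)\<^sup>2" for z
  proof -
    obtain y q where y: "y \<in> span (cker M)" and q: "\<And>u. u \<in> span (cker M) \<Longrightarrow> orthogonal q u" and z: "z = y + q"
      using orthogonal_subspace_decomp_exists[of "cker M" z] by metis
    have y': "y \<in> cker M" using y subspace_cker by (metis span_eq_iff)
    have "orthogonal y q" using q[OF y] by (simp add: orthogonal_commute)
    then have "(norm z)\<^sup>2 = (norm y)\<^sup>2 + (norm q)\<^sup>2" unfolding z by (rule norm_add_Pythagorean)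
    then have "(norm q)\<^sup>2 \<le> (norm z)\<^sup>2" by simp
    then have "norm q \<le> norm z" by (rule power2_le_imp_le) simp
    moreover have "?P z \<bullet> z = ?P q \<bullet> q"
    proof -
      have "?P y = 0" using y' by (simp add: cker_def)
      moreover from this have "?P q \<bullet> y = 0" by (simp only: sym'[of q y] inner_zero_right)
      ultimately show ?thesis by (simp add: z cmat_add_right inner_add_right)
    qed
    moreover have "?P q \<bullet> q \<ge> c * (norm q)\<^sup>2"
    proof (cases "q = 0")
      case False
      have "q /\<^sub>R norm q \<in> T"
        using q False by (auto simp: T_def W_def orthogonal_def intro: span_base)
      from c(2)[OF this] have "c \<le> (?P q \<bullet> q) / (norm q)\<^sup>2"
        by (simp add: cmat_scaleR_right power2_eq_square divide_inverse mult_ac)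
      then show ?thesis using False by (simp add: field_simps)
    qed simp
    moreover have "z - q \<in> cker M" using y' by (simp add: z)
    ultimately show ?thesis by metis
  qed
  with c(1) show ?thesis using that by blast
qed

text \<open>Compactness of the sphere of directions times the unit sphere of the kernel makes the
  constant independent of \<open>\<omega>\<close>; continuity in \<open>\<omega>\<close> is the only
  regularity of the family that enters.\<close>

lemma pos_uniform:
  fixes X :: "real^'n \<Rightarrow> real^'m^'m"
  assumes X: "continuous_on (sphere 0 1) X" and pos: "\<And>\<omega>. \<omega> \<in> sphere 0 1 \<Longrightarrow> pos_on (cmat (X \<omega>)) (cker M)"
  obtains c where "c > 0" "\<And>\<omega> p. \<omega> \<in> sphere 0 1 \<Longrightarrow> p \<in> cker M \<Longrightarrow> (cmat (X \<omega>) *v p) \<bullet> p \<ge> c * (norm p)\<^sup>2"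
proof -
  let ?T = "sphere (0::real^'n) 1 \<times> (sphere 0 1 \<inter> cker M)"
  let ?f = "\<lambda>w. (cmat (X (fst w)) *v snd w) \<bullet> snd w"
  have "compact ?T" by (intro compact_Times compact_Int_closed closed_cker) auto
  have cont: "continuous_on ?T ?f"
    by (intro continuous_intros continuous_on_compose2[OF X]) auto
  obtain c where c: "c > 0" "\<And>w. w \<in> ?T \<Longrightarrow> ?f w \<ge> c"
  proof (cases "?T = {}")
    case True
    show ?thesis by (rule that[of 1]) (use True in auto)
  next
    case False
    obtain w where w: "w \<in> ?T" "\<And>y. y \<in> ?T \<Longrightarrow> ?f w \<le> ?f y"
      using continuous_attains_inf[OF \<open>compact ?T\<close> False cont] by blast
    have "?f w > 0" using pos w(1) by (auto simp: pos_on_def inner_complex_vec) (metis norm_zero zero_neq_one)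
    then show ?thesis using w that by blast
  qed
  show ?thesis
  proof (rule that[OF c(1)])
    fix \<omega> p assume \<omega>: "\<omega> \<in> sphere (0::real^'n) 1" and p: "p \<in> cker M"
    show "(cmat (X \<omega>) *v p) \<bullet> p \<ge> c * (norm p)\<^sup>2"
    proof (cases "p = 0")
      case False
      have "(\<omega>, p /\<^sub>R norm p) \<in> ?T"
        using \<omega> p False by (auto simp: subspace_scale[OF subspace_cker])
      from c(2)[OF this] have "c \<le> ((cmat (X \<omega>) *v p) \<bullet> p) / (norm p)\<^sup>2"
        by (simp add: cmat_scaleR_right power2_eq_square divide_inverse mult_ac)
      then show ?thesis using False by (simp add: field_simps)
    qed simp
  qed
qed

section \<open>The energy estimate at a single frequency\<close>

text \<open>In the application a and b are the sizes of the components of \<open>v\<close> off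
  Ker(L_1) and off Ker(L), w = |v|, and \<open>D1\<close>, \<open>D2\<close>, \<open>D3\<close> are
  the dissipations of the three identities. With s = r \<rho>, so that s^2 = \<eta>, each cross term
  is split by Young's inequality and costs a quarter of \<kappa> e c s^2 w^2, leaving the half that
  is claimed. \<open>\<kappa>\<close> is chosen so that the b^2 produced in the third identity is
  exactly the b^2 gained in the second, and the bound on \<open>e\<close> makes the a w term
  affordable.\<close>

lemma dissipation_lower_bound:
  fixes c C e r a b w D1 D2 D3 :: real
  defines "\<rho> \<equiv> 1 / (1 + r\<^sup>2)" and "\<kappa> \<equiv> c\<^sup>2 / (4 * C\<^sup>2)"
  assumes c: "0 < c" "0 < C" and e: "0 < e" "e \<le> \<kappa> * c\<^sup>2 / C\<^sup>2"
    and nn: "0 \<le> r"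
    and D1: "D1 \<ge> c * a\<^sup>2" and D2: "D2 \<ge> c * b\<^sup>2 - C * r * a * w"
    and D3: "D3 \<ge> c * r\<^sup>2 * w\<^sup>2 - C * (r\<^sup>2 + r) * b * w"
  shows "D1 + e * \<rho> * D2 + \<kappa> * e * \<rho>\<^sup>2 * D3 \<ge> \<kappa> * e * c / 2 * (r\<^sup>2 / (1 + r\<^sup>2)\<^sup>2) * w\<^sup>2"
proof -
  have d: "1 + r\<^sup>2 > 0" by (simp add: add_pos_nonneg)
  have \<rho>: "0 < \<rho>" "\<rho> \<le> 1" using d by (simp_all add: \<rho>_def)
  have \<kappa>: "\<kappa> > 0" using c by (simp add: \<kappa>_def)
  define s where "s = r * \<rho>"
  have s2: "s\<^sup>2 = r\<^sup>2 / (1 + r\<^sup>2)\<^sup>2" by (simp add: s_def \<rho>_def power_mult_distrib power_divide)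
  have "r\<^sup>2 * \<rho> \<le> 1" using d by (simp add: \<rho>_def)
  then have "r\<^sup>2 * \<rho> * \<rho> \<le> 1 * \<rho>" using \<rho> by (intro mult_right_mono) auto
  then have s_le: "s\<^sup>2 \<le> \<rho>" by (simp add: s_def power2_eq_square mult_ac)
  have \<rho>_le: "\<rho>\<^sup>2 \<le> \<rho>" using \<rho> by (simp add: power2_eq_square mult_left_le)
  have sum_le: "(s + \<rho>)\<^sup>2 \<le> 4 * \<rho>"
    using sum_squares_bound[of s \<rho>] s_le \<rho>_le by (simp add: power2_sum)
  \<comment> \<open>Young's inequality as a completed square, scaled so that the full c a^2 of
    \<open>D1\<close> is spent; since the remainder is quadratic in \<open>e\<close>, it is small
    relative to the gain, which is linear in \<open>e\<close>.\<close>
  have "0 \<le> (2 * c * a - e * C * s * w)\<^sup>2 / (4 * c)" using c by simp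
  also have "\<dots> = c * a\<^sup>2 - e * C * s * a * w + e\<^sup>2 * C\<^sup>2 / (4 * c) * (s\<^sup>2 * w\<^sup>2)"
    using c by (simp add: field_simps power2_eq_square)
  finally have 1: "c * a\<^sup>2 - e * C * s * a * w \<ge> - (e\<^sup>2 * C\<^sup>2 / (4 * c) * (s\<^sup>2 * w\<^sup>2))" by simp
  have "0 \<le> (c * s * w / 2 - C * (s + \<rho>) * b)\<^sup>2 / c" using c by simp
  also have "\<dots> = c / 4 * (s\<^sup>2 * w\<^sup>2) + C\<^sup>2 / c * ((s + \<rho>)\<^sup>2 * b\<^sup>2) - C * (s * (s + \<rho>)) * b * w"
    using c by (simp add: field_simps power2_eq_square)
  finally have "C * (s * (s + \<rho>)) * b * w \<le> c / 4 * (s\<^sup>2 * w\<^sup>2) + C\<^sup>2 / c * ((s + \<rho>)\<^sup>2 * b\<^sup>2)" by simp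
  also have "\<dots> \<le> c / 4 * (s\<^sup>2 * w\<^sup>2) + C\<^sup>2 / c * (4 * \<rho> * b\<^sup>2)"
    using c sum_le by (intro add_left_mono mult_left_mono mult_right_mono) auto
  finally have 2: "C * (s * (s + \<rho>)) * b * w \<le> c / 4 * (s\<^sup>2 * w\<^sup>2) + C\<^sup>2 / c * (4 * \<rho> * b\<^sup>2)" .
  have 2: "\<kappa> * e * (C * (s * (s + \<rho>)) * b * w) \<le> \<kappa> * e * (c / 4 * (s\<^sup>2 * w\<^sup>2)) + e * c * \<rho> * b\<^sup>2"
  proof -
    have "\<kappa> * e * (C * (s * (s + \<rho>)) * b * w) \<le> \<kappa> * e * (c / 4 * (s\<^sup>2 * w\<^sup>2) + C\<^sup>2 / c * (4 * \<rho> * b\<^sup>2))"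
      using \<kappa> e 2 by (intro mult_left_mono) auto
    also have "\<dots> = \<kappa> * e * (c / 4 * (s\<^sup>2 * w\<^sup>2)) + e * c * \<rho> * b\<^sup>2"
      using c by (simp add: \<kappa>_def field_simps power2_eq_square)
    finally show ?thesis .
  qed
  have 3: "e\<^sup>2 * C\<^sup>2 / (4 * c) * (s\<^sup>2 * w\<^sup>2) \<le> \<kappa> * e * c / 4 * (s\<^sup>2 * w\<^sup>2)"
  proof (rule mult_right_mono)
    have "e * (e * C\<^sup>2) \<le> e * (\<kappa> * c\<^sup>2)"
      using e c by (intro mult_left_mono) (auto simp: field_simps)
    then show "e\<^sup>2 * C\<^sup>2 / (4 * c) \<le> \<kappa> * e * c / 4"
      using c by (simp add: field_simps power2_eq_square)
  qed simp
  have "e * \<rho> * D2 \<ge> e * \<rho> * (c * b\<^sup>2 - C * r * a * w)"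
    using e \<rho> D2 by (intro mult_left_mono) auto
  then have 4: "e * \<rho> * D2 \<ge> e * c * \<rho> * b\<^sup>2 - e * C * s * a * w"
    by (simp add: s_def algebra_simps)
  have "\<kappa> * e * \<rho>\<^sup>2 * D3 \<ge> \<kappa> * e * \<rho>\<^sup>2 * (c * r\<^sup>2 * w\<^sup>2 - C * (r\<^sup>2 + r) * b * w)"
    using e \<kappa> D3 by (intro mult_left_mono) auto
  then have 5: "\<kappa> * e * \<rho>\<^sup>2 * D3 \<ge> \<kappa> * e * c * (s\<^sup>2 * w\<^sup>2) - \<kappa> * e * (C * (s * (s + \<rho>)) * b * w)"
    by (simp add: s_def algebra_simps power2_eq_square)
  show ?thesis using D1 1 2 3 4 5 unfolding s2[symmetric] by (simp add: algebra_simps)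
qed

lemma exp_decay_of_derivative:
  fixes E :: "real \<Rightarrow> real"
  assumes cont: "continuous_on {0..} E"
    and deriv: "\<And>t. t > 0 \<Longrightarrow> (E has_real_derivative E' t) (at t)"
    and le: "\<And>t. t > 0 \<Longrightarrow> E' t \<le> - k * E t" and t: "t \<ge> 0"
  shows "E t \<le> exp (- k * t) * E 0"
proof (cases "t = 0")
  case False
  with t have t: "0 < t" by simp
  let ?F = "\<lambda>t. exp (k * t) * E t"
  have "?F t \<le> ?F 0"
  proof (rule DERIV_nonpos_imp_decreasing_open[OF less_imp_le[OF t]])
    fix x :: real assume x: "0 < x" "x < t"
    have "(?F has_real_derivative (exp (k * x) * k) * E x + E' x * exp (k * x)) (at x)"
      by (rule DERIV_mult[OF _ deriv[OF x(1)]]) (auto intro!: derivative_eq_intros)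
    moreover have "(exp (k * x) * k) * E x + E' x * exp (k * x) = exp (k * x) * (k * E x + E' x)"
      by (simp add: algebra_simps)
    moreover have "exp (k * x) * (k * E x + E' x) \<le> 0"
      using le[OF x(1)] by (intro mult_nonneg_nonpos) auto
    ultimately show "\<exists>y. (?F has_real_derivative y) (at x) \<and> y \<le> 0" by metis
  next
    have "continuous_on {0..t} E" using cont by (rule continuous_on_subset) auto
    then show "continuous_on {0..t} ?F" by (intro continuous_intros)
  qed
  then have "exp (- k * t) * ?F t \<le> exp (- k * t) * E 0" by (intro mult_left_mono) auto
  then show ?thesis by (simp add: mult.assoc[symmetric] flip: exp_add)
qed simp

lemma quadratic_form_derivative:
  fixes P :: "'a::euclidean_space \<Rightarrow> 'a"
  assumes P: "linear P" and sym: "\<And>x y. P x \<bullet> y = x \<bullet> P y"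
    and v: "(v has_vector_derivative v') (at t)"
  shows "((\<lambda>t. P (v t) \<bullet> v t) has_real_derivative 2 * (P v' \<bullet> v t)) (at t)"
proof -
  have bl: "bounded_linear P" using P by (simp add: linear_conv_bounded_linear)
  have "((\<lambda>t. P (v t) \<bullet> v t) has_vector_derivative (P (v t) \<bullet> v' + P v' \<bullet> v t)) (at t)"
    by (rule bounded_bilinear.has_vector_derivative[OF bounded_bilinear_inner
        bounded_linear.has_vector_derivative[OF bl v] v])
  moreover have "P (v t) \<bullet> v' + P v' \<bullet> v t = 2 * (P v' \<bullet> v t)"
    using sym[of v' "v t"] by (simp add: inner_commute)
  ultimately show ?thesis by (simp add: has_real_derivative_iff_has_vector_derivative)
qed

lemma fourier_ode_iff:
  "fourier_ode A0 A L \<xi> v \<longleftrightarrow> (\<forall>t\<ge>0. \<exists>v'. (v has_vector_derivative v') (at t within {0..}) \<and>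
     cmat A0 *v v' + \<i> *s (cmat (symbol A \<xi>) *v v t) + cmat L *v v t = 0)"
proof -
  have 1: "norm \<xi> *\<^sub>R symbol A (\<xi> /\<^sub>R norm \<xi>) = symbol A \<xi>"
    by (cases "\<xi> = 0") (auto simp: symbol_def scaleR_sum_right simp flip: mult.assoc)
  have "(\<i> * of_real (norm \<xi>)) *s (cmat (symbol A (\<xi> /\<^sub>R norm \<xi>)) *v z) = \<i> *s (cmat (symbol A \<xi>) *v z)" for z
    by (simp only: i_of_real_smult cmat_scaleR linear_scale[OF i_smult_linear] flip: 1)
  then show ?thesis by (simp add: fourier_ode_def)
qed

lemma fourier_ode_has_derivative:
  assumes "fourier_ode A0 A L \<xi> v"
  obtains v' where "\<And>t. t \<ge> 0 \<Longrightarrow> (v has_vector_derivative v' t) (at t within {0..})"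
    "\<And>t. t > 0 \<Longrightarrow> (v has_vector_derivative v' t) (at t)"
    "\<And>t. t \<ge> 0 \<Longrightarrow> cmat A0 *v v' t = - (\<i> *s (cmat (symbol A \<xi>) *v v t) + cmat L *v v t)"
    "continuous_on {0..} v"
proof -
  obtain v' where v': "\<And>t. t \<ge> 0 \<Longrightarrow> (v has_vector_derivative v' t) (at t within {0..})"
    and eq': "\<And>t. t \<ge> 0 \<Longrightarrow> cmat A0 *v v' t + \<i> *s (cmat (symbol A \<xi>) *v v t) + cmat L *v v t = 0"
    using assms unfolding fourier_ode_iff by metis
  show ?thesis
  proof (rule that[of v'])
    show "(v has_vector_derivative v' t) (at t)" if "t > 0" for t
      using v'[of t] that at_within_interior[of t "{0..}"] by (simp add: interior_real_atLeast)
    show "cmat A0 *v v' t = - (\<i> *s (cmat (symbol A \<xi>) *v v t) + cmat L *v v t)" if "t \<ge> 0" for t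
      using eq'[OF that] by (simp add: add.assoc add_eq_0_iff2)
    show "continuous_on {0..} v"
      using v' by (auto simp: continuous_on_eq_continuous_within intro: has_vector_derivative_continuous)
  qed (rule v')
qed

text \<open>For \<open>\<xi> = 0\<close> the direction \<open>\<omega>\<close> below is an arbitrary unit vector.\<close>

lemma polar_symbol:
  fixes \<xi> :: "real^'n"
  obtains \<omega> where "\<omega> \<in> sphere 0 1" "symbol A \<xi> = norm \<xi> *\<^sub>R symbol A \<omega>"
proof (cases "\<xi> = 0")
  case True
  obtain \<omega> :: "real^'n" where "norm \<omega> = 1" using vector_choose_size[of 1] by auto
  with True show ?thesis using that[of \<omega>] by (auto simp: symbol_def)
next
  case False
  show ?thesis
  proof (rule that[of "\<xi> /\<^sub>R norm \<xi>"])
    show "symbol A \<xi> = norm \<xi> *\<^sub>R symbol A (\<xi> /\<^sub>R norm \<xi>)"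
      using False by (simp add: symbol_def scaleR_sum_right flip: mult.assoc)
  qed (use False in simp)
qed

text \<open>A form whose sign is known only on a subspace is evaluated at the nearby point v - q of
  that subspace. The difference consists of three terms, each at most k |q| |v|; for the one
  quadratic in q this uses |q| \<le> |v|.\<close>

lemma inner_remainder:
  fixes B :: "'a::real_inner \<Rightarrow> 'a"
  assumes B: "linear B" "\<And>z. norm (B z) \<le> k * norm z" "k \<ge> 0" and q: "norm q \<le> norm v"
  shows "\<bar>B v \<bullet> v - B (v - q) \<bullet> (v - q)\<bar> \<le> 3 * k * norm q * norm v"
proof -
  have "B v \<bullet> v - B (v - q) \<bullet> (v - q) = B q \<bullet> v + B v \<bullet> q - B q \<bullet> q"
    by (simp add: linear_diff[OF B(1)] inner_diff_left inner_diff_right)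
  moreover have "\<bar>B x \<bullet> y\<bar> \<le> k * norm x * norm y" for x y
    using Cauchy_Schwarz_ineq2[of "B x" y] mult_right_mono[OF B(2)[of x] norm_ge_zero[of y]] by linarith
  note this[of q v] this[of v q] this[of q q]
  moreover have "k * norm q * norm q \<le> k * norm q * norm v"
    using q B(3) by (intro mult_left_mono) auto
  ultimately show ?thesis by (simp add: mult_ac)
qed

lemma Cinf_on_sphere_continuous:
  assumes "Cinf_on_sphere K" shows "continuous_on (sphere 0 1) K"
proof -
  obtain U F where F: "sphere 0 1 \<subseteq> U" "Cinf_on U F" "\<forall>\<omega>\<in>sphere 0 1. F \<omega> = K \<omega>"
    using assms by (auto simp: Cinf_on_sphere_def)
  then have "continuous_on U F" using Ck_on_continuous[of 0 U F] by (simp only: Cinf_on_def)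
  then have "continuous_on (sphere 0 1) F" using F(1) by (rule continuous_on_subset)
  then show ?thesis using F(3) by (simp cong: continuous_on_cong_simp)
qed


lemma mat_bound_on_sphere:
  fixes X :: "real^'n \<Rightarrow> real^'b^'a"
  assumes "continuous_on (sphere 0 1) X"
  obtains k where "k \<ge> 0" "\<And>\<omega>. \<omega> \<in> sphere 0 1 \<Longrightarrow> mat_bound (X \<omega>) \<le> k"
proof -
  have "compact ((\<lambda>\<omega>. mat_bound (X \<omega>)) ` sphere 0 1)"
    by (intro compact_continuous_image continuous_on_mat_bound assms) auto
  then obtain k where "\<forall>y\<in>(\<lambda>\<omega>. mat_bound (X \<omega>)) ` sphere 0 1. norm y \<le> k"
    using compact_imp_bounded bounded_iff by blast
  then have "mat_bound (X \<omega>) \<le> max k 0" if "\<omega> \<in> sphere 0 1" for \<omega>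
    using that by (force intro!: max.coboundedI1)
  then show ?thesis using that[of "max k 0"] by auto
qed

lemma transpose_symbol:
  assumes "\<And>j. transpose (A j) = A j" shows "transpose (symbol A \<xi>) = symbol A \<xi>"
proof -
  have "A j $ i $ k = A j $ k $ i" for i j k
    using arg_cong[OF assms[of j], of "\<lambda>X. X $ k $ i"] by (simp add: transpose_def)
  then show ?thesis by (simp add: vec_eq_iff transpose_def symbol_def)
qed

text \<open>An instance of \<open>pos_uniform\<close> with a constant family and the zero matrix,
  whose kernel is the whole space.\<close>

lemma cond_A_coercive:
  fixes A :: "'n::finite \<Rightarrow> real^'m^'m"
  assumes "cond_A A0 A L"
  obtains c where "c > 0" "\<And>z. (cmat A0 *v z) \<bullet> z \<ge> c * (norm z)\<^sup>2"
proof (rule pos_uniform[of "\<lambda>_::real^'n. A0" "0 :: real^'m^'m"])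
  show "pos_on (cmat A0) (cker 0)" using assms by (auto simp: cond_A_def pos_on_def)
  fix c assume "0 < c" and c: "\<And>\<omega> p. \<omega> \<in> sphere (0::real^'n) 1 \<Longrightarrow> p \<in> cker (0::real^'m^'m) \<Longrightarrow> c * (norm p)\<^sup>2 \<le> (cmat A0 *v p) \<bullet> p"
  obtain \<omega> :: "real^'n" where \<omega>: "norm \<omega> = 1" using vector_choose_size[of 1] by auto
  have p: "p \<in> cker (0::real^'m^'m)" for p by (simp add: cker_def vec_eq_iff cmat_nth)
  show thesis by (rule that[OF \<open>0 < c\<close>]) (use c[of \<omega>] \<omega> p in simp)
qed auto

theorem pointwise_decay:
  fixes A0 L S :: "real^'m^'m" and A :: "'n::finite \<Rightarrow> real^'m^'m"
  assumes A: "cond_A A0 A L" and S: "cond_S A0 L S" and S1: "cond_S1 A L S" and K: "cond_K A0 A L"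
  obtains C c where "C > 0" "c > 0"
    "\<And>\<xi> v t. fourier_ode A0 A L \<xi> v \<Longrightarrow> t \<ge> 0 \<Longrightarrow> norm (v t) \<le> C * exp (- c * eta \<xi> * t) * norm (v 0)"
proof -
  obtain K :: "real^'n \<Rightarrow> real^'m^'m" where K_smooth: "Cinf_on_sphere K"
    and K_skew: "\<And>\<omega>. \<omega> \<in> sphere 0 1 \<Longrightarrow> transpose (K \<omega> ** A0) = - (K \<omega> ** A0)"
    and K_pos: "\<And>\<omega>. \<omega> \<in> sphere 0 1 \<Longrightarrow> pos_on (cmat (sym_part (K \<omega> ** symbol A \<omega>))) (cker L)"
    using K unfolding cond_K_def by blast
  have K_cont: "continuous_on (sphere 0 1) K" by (rule Cinf_on_sphere_continuous[OF K_smooth])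
  have symA0: "transpose A0 = A0" and symA: "transpose (symbol A \<xi>) = symbol A \<xi>" for \<xi>
    using A by (auto simp: cond_A_def intro: transpose_symbol)
  have symSA0: "transpose (S ** A0 + A0) = S ** A0 + A0"
  proof -
    have "transpose (S ** A0 + A0) = transpose (S ** A0) + transpose A0"
      by (simp add: transpose_def vec_eq_iff)
    then show ?thesis using S symA0 by (simp add: cond_S_def)
  qed
  have sym_sym_part: "transpose (sym_part X) = sym_part X" for X :: "real^'m^'m"
    by (simp add: sym_part_def transpose_def vec_eq_iff add.commute)
  let ?M = "sym_part (S ** L) + sym_part L"
  \<comment> \<open>Two different decompositions are needed: the form of \<open>L\<close> controls
    only the component off Ker(L_1), where (S)_1 has its sign, while the form of \<open>?M\<close>
    controls the component off Ker(L), where (K) is positive. That the kernel of \<open>?M\<close>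
    is Ker(L) is part of (S).\<close>
  obtain c1 where c1: "c1 > 0" "\<And>z. \<exists>q. z - q \<in> cker (sym_part L) \<and> norm q \<le> norm z \<and>
      (cmat (sym_part L) *v z) \<bullet> z \<ge> c1 * (norm q)\<^sup>2"
  proof (rule psd_coercive[of "sym_part L"])
    show "nonneg_on (cmat (sym_part L)) UNIV"
      using A by (simp add: cond_A_def nonneg_on_def inner_complex_vec inner_cmat_sym_part)
  qed (use sym_sym_part in auto)
  obtain c2 where c2: "c2 > 0" "\<And>z. \<exists>q. z - q \<in> cker ?M \<and> norm q \<le> norm z \<and> (cmat ?M *v z) \<bullet> z \<ge> c2 * (norm q)\<^sup>2"
  proof (rule psd_coercive[of ?M])
    have "transpose ?M = transpose (sym_part (S ** L)) + transpose (sym_part L)"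
      by (simp add: transpose_def vec_eq_iff)
    then show "transpose ?M = ?M" by (simp only: sym_sym_part)
    show "nonneg_on (cmat ?M) UNIV" using S by (simp add: cond_S_def)
  qed auto
  obtain c0 where c0: "c0 > 0" "\<And>z. (cmat A0 *v z) \<bullet> z \<ge> c0 * (norm z)\<^sup>2"
    using cond_A_coercive[OF A] by blast
  obtain c3 where c3: "c3 > 0" "\<And>\<omega> p. \<omega> \<in> sphere 0 1 \<Longrightarrow> p \<in> cker L \<Longrightarrow>
      (cmat (K \<omega> ** symbol A \<omega>) *v p) \<bullet> p \<ge> c3 * (norm p)\<^sup>2"
  proof (rule pos_uniform[of "\<lambda>\<omega>. K \<omega> ** symbol A \<omega>" L])
    show "pos_on (cmat (K \<omega> ** symbol A \<omega>)) (cker L)" if "\<omega> \<in> sphere 0 1" for \<omega>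
      using K_pos[OF that] by (simp add: pos_on_def inner_complex_vec inner_cmat_sym_part)
  qed (auto intro!: continuous_on_matrix_mult K_cont continuous_on_symbol)
  obtain k1 where k1: "k1 \<ge> 0" "\<And>\<omega>. \<omega> \<in> sphere (0::real^'n) 1 \<Longrightarrow> mat_bound (S ** symbol A \<omega>) \<le> k1"
    by (rule mat_bound_on_sphere[of "\<lambda>\<omega>. S ** symbol A \<omega>"])
       (auto intro!: continuous_on_matrix_mult continuous_on_symbol)
  obtain k3 where k3: "k3 \<ge> 0" "\<And>\<omega>. \<omega> \<in> sphere (0::real^'n) 1 \<Longrightarrow> mat_bound (K \<omega> ** symbol A \<omega>) \<le> k3"
    by (rule mat_bound_on_sphere[of "\<lambda>\<omega>. K \<omega> ** symbol A \<omega>"])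
       (auto intro!: continuous_on_matrix_mult continuous_on_symbol K_cont)
  obtain k4 where k4: "k4 \<ge> 0" "\<And>\<omega>. \<omega> \<in> sphere (0::real^'n) 1 \<Longrightarrow> mat_bound (K \<omega> ** L) \<le> k4"
    by (rule mat_bound_on_sphere[of "\<lambda>\<omega>. K \<omega> ** L"])
       (auto intro!: continuous_on_matrix_mult K_cont)
  obtain k5 where k5: "k5 \<ge> 0" "\<And>\<omega>. \<omega> \<in> sphere (0::real^'n) 1 \<Longrightarrow> mat_bound (K \<omega> ** A0) \<le> k5"
    by (rule mat_bound_on_sphere[of "\<lambda>\<omega>. K \<omega> ** A0"])
       (auto intro!: continuous_on_matrix_mult K_cont)
  define k6 where "k6 = mat_bound (S ** A0 + A0)"
  have k6: "k6 \<ge> 0" by (simp add: k6_def mat_bound_nonneg)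
  define c where "c = min (min c0 c1) (min c2 c3)"
  have c: "c > 0" "c \<le> c0" "c \<le> c1" "c \<le> c2" "c \<le> c3" using c0 c1 c2 c3 by (auto simp: c_def)
  \<comment> \<open>One constant for all errors: 3 \<open>k1\<close> comes from leaving Ker(L_1) in
    the \<open>S\<close> identity, 2 \<open>c\<close> + 3 \<open>k3\<close> from leaving Ker(L) in
    the \<open>K\<close> identity, and \<open>k4\<close> from the zero-order term
    \<open>K L\<close>.\<close>
  define C where "C = 3 * k1 + 2 * c + 3 * k3 + k4"
  have C: "C > 0" "3 * k1 \<le> C" "2 * c + 3 * k3 \<le> C" "k4 \<le> C" using c k1 k3 k4 by (auto simp: C_def)
  define \<kappa> where "\<kappa> = c\<^sup>2 / (4 * C\<^sup>2)"
  have \<kappa>: "\<kappa> > 0" using c C by (simp add: \<kappa>_def)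
  \<comment> \<open>The first bound is the one needed by \<open>dissipation_lower_bound\<close>; the
    second keeps the \<open>S\<close> and \<open>K\<close> parts of the functional below half of the
    coercivity of \<open>A0\<close>.\<close>
  define e where "e = min (\<kappa> * c\<^sup>2 / C\<^sup>2) (c / (2 * (k6 + \<kappa> * k5 + 1)))"
  have kk: "k6 + \<kappa> * k5 + 1 > 0" using k5 k6 \<kappa> by (simp add: add_nonneg_pos)
  have e: "e > 0" "e \<le> \<kappa> * c\<^sup>2 / C\<^sup>2" using \<kappa> c C kk by (auto simp: e_def)
  have e': "e * (k6 + \<kappa> * k5) \<le> c / 2"
  proof -
    have "e * (k6 + \<kappa> * k5) \<le> e * (k6 + \<kappa> * k5 + 1)" using e by (intro mult_left_mono) auto
    also have "\<dots> \<le> (c / (2 * (k6 + \<kappa> * k5 + 1))) * (k6 + \<kappa> * k5 + 1)"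
      using kk by (intro mult_right_mono) (auto simp: e_def)
    also have "\<dots> = c / 2"
    proof -
      have "c / (2 * x) * x = c / 2" if "x > 0" for x :: real using that by simp
      from this[OF kk] show ?thesis .
    qed
    finally show ?thesis .
  qed
  define U where "U = mat_bound A0 + c / 2"
  have U: "U > 0" using c by (simp add: U_def mat_bound_nonneg add_nonneg_pos)
  \<comment> \<open>The energy decreases at least at rate \<kappa> e c \<eta> |v|^2 and is at most U
    |v|^2, so the quotient is the exponential rate.\<close>
  define k where "k = \<kappa> * e * c / U"
  have k: "k > 0" using \<kappa> e c U by (simp add: k_def)
  have main: "c / 2 * (norm (v t))\<^sup>2 \<le> exp (- (k * eta \<xi>) * t) * (U * (norm (v 0))\<^sup>2)"
    if ode: "fourier_ode A0 A L \<xi> v" and t: "t \<ge> 0" for \<xi> v t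
  proof -
    define r where "r = norm \<xi>"
    define \<rho> where "\<rho> = 1 / (1 + r\<^sup>2)"
    have r: "r \<ge> 0" by (simp add: r_def)
    have d: "1 + r\<^sup>2 > 0" by (simp add: add_pos_nonneg)
    have \<rho>: "0 < \<rho>" "\<rho> \<le> 1" using d by (simp_all add: \<rho>_def)
    have "r * \<rho> \<le> 1"
    proof -
      have "r \<le> 1 + r\<^sup>2" using sum_squares_bound[of r 1] r by (simp add: power2_eq_square)
      then show ?thesis using d by (simp add: \<rho>_def)
    qed
    then have "(r * \<rho>) * \<rho> \<le> 1 * 1" using \<rho> r by (intro mult_mono) auto
    then have r\<rho>: "0 \<le> \<rho>\<^sup>2 * r" "\<rho>\<^sup>2 * r \<le> 1" using r \<rho> by (simp_all add: power2_eq_square mult_ac)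
    obtain \<omega> where \<omega>: "\<omega> \<in> sphere 0 1" and sym_eq: "symbol A \<xi> = r *\<^sub>R symbol A \<omega>"
      using polar_symbol[of A \<xi>] by (auto simp: r_def)
    from ode obtain v' where v': "\<And>t. t > 0 \<Longrightarrow> (v has_vector_derivative v' t) (at t)"
      and eq: "\<And>t. t \<ge> 0 \<Longrightarrow> cmat A0 *v v' t = - (\<i> *s (cmat (symbol A \<xi>) *v v t) + cmat L *v v t)"
      and cont: "continuous_on {0..} v"
      by (rule fourier_ode_has_derivative) blast
    \<comment> \<open>\<open>K A0\<close> is real and skew, so i \<open>K A0\<close> is self-adjoint
      and E = P v \<bullet> v has derivative 2 (P v' \<bullet> v). The factor r in the last weight
      is harmless because \<rho>^2 r \<le> 1.\<close>
    define P where "P z = cmat A0 *v z + (e * \<rho>) *\<^sub>R (cmat (S ** A0 + A0) *v z)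
        - (\<kappa> * e * \<rho>\<^sup>2 * r) *\<^sub>R (\<i> *s (cmat (K \<omega> ** A0) *v z))" for z
    have P: "linear P"
      unfolding P_def[abs_def]
      by (intro linear_compose_sub linear_compose_add linear_compose_scale_right cmat_linear
          linear_compose[OF cmat_linear i_smult_linear, unfolded comp_def])
    have P_sym: "P x \<bullet> y = x \<bullet> P y" for x y
    proof -
      have "(\<i> *s (cmat (K \<omega> ** A0) *v x)) \<bullet> y = x \<bullet> (\<i> *s (cmat (K \<omega> ** A0) *v y))"
        by (simp add: inner_i_left[of "cmat (K \<omega> ** A0) *v x"] inner_cmat_left K_skew[OF \<omega>] cmat_uminus cmat_mult_i)
      then show ?thesis
        by (simp add: P_def inner_add_left inner_add_right inner_diff_left inner_diff_right
            inner_cmat_left[of A0] inner_cmat_left[of "S ** A0 + A0"] symA0 symSA0)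
    qed
    define E where "E t = P (v t) \<bullet> v t" for t
    have E_bounds: "c / 2 * (norm z)\<^sup>2 \<le> P z \<bullet> z" "P z \<bullet> z \<le> U * (norm z)\<^sup>2" for z
    proof -
      have b: "\<bar>x \<bullet> z\<bar> \<le> m * (norm z)\<^sup>2" if "norm x \<le> m * norm z" for x m
        using Cauchy_Schwarz_ineq2[of x z] mult_right_mono[OF that norm_ge_zero[of z]]
        by (simp add: power2_eq_square mult_ac)
      have 1: "\<bar>(cmat (S ** A0 + A0) *v z) \<bullet> z\<bar> \<le> k6 * (norm z)\<^sup>2"
        unfolding k6_def by (rule b[OF norm_cmat_le])
      have 2: "\<bar>(\<i> *s (cmat (K \<omega> ** A0) *v z)) \<bullet> z\<bar> \<le> k5 * (norm z)\<^sup>2"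
        by (rule b) (use norm_cmat_le[of "K \<omega> ** A0" z] mult_right_mono[OF k5(2)[OF \<omega>] norm_ge_zero[of z]] in \<open>simp add: norm_i_smult\<close>)
      have 3: "\<bar>(cmat A0 *v z) \<bullet> z\<bar> \<le> mat_bound A0 * (norm z)\<^sup>2"
        by (rule b[OF norm_cmat_le])
      let ?x = "(cmat (S ** A0 + A0) *v z) \<bullet> z" and ?y = "(\<i> *s (cmat (K \<omega> ** A0) *v z)) \<bullet> z"
      have "\<bar>(e * \<rho>) * ?x\<bar> \<le> e * (k6 * (norm z)\<^sup>2)"
      proof -
        have "e * \<rho> \<le> e * 1" using e \<rho> by (intro mult_left_mono) auto
        moreover have "0 \<le> e * \<rho>" using e \<rho> by simp
        ultimately show ?thesis unfolding abs_mult[of "e * \<rho>"] using 1 by (intro mult_mono) auto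
      qed
      moreover have "\<bar>(\<kappa> * e * \<rho>\<^sup>2 * r) * ?y\<bar> \<le> (\<kappa> * e) * (k5 * (norm z)\<^sup>2)"
      proof -
        have "\<kappa> * e * \<rho>\<^sup>2 * r \<le> \<kappa> * e * 1" unfolding mult.assoc[of "\<kappa> * e"]
          using r\<rho> \<kappa> e by (intro mult_left_mono) auto
        moreover have "0 \<le> \<kappa> * e * \<rho>\<^sup>2 * r" using r \<kappa> e by simp
        ultimately show ?thesis unfolding abs_mult[of "\<kappa> * e * \<rho>\<^sup>2 * r"] using 2
          by (intro mult_mono) auto
      qed
      moreover have "(e * (k6 + \<kappa> * k5)) * (norm z)\<^sup>2 \<le> c / 2 * (norm z)\<^sup>2"
        using e' by (intro mult_right_mono) auto
      then have "e * (k6 * (norm z)\<^sup>2) + \<kappa> * e * (k5 * (norm z)\<^sup>2) \<le> c / 2 * (norm z)\<^sup>2"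
        by (simp add: algebra_simps)
      moreover have "c * (norm z)\<^sup>2 \<le> (cmat A0 *v z) \<bullet> z"
        using c0(2)[of z] mult_right_mono[OF c(2), of "(norm z)\<^sup>2"] by simp
      moreover have "P z \<bullet> z = (cmat A0 *v z) \<bullet> z + (e * \<rho>) * ?x - (\<kappa> * e * \<rho>\<^sup>2 * r) * ?y"
        by (simp add: P_def inner_add_left inner_diff_left)
      ultimately show "c / 2 * (norm z)\<^sup>2 \<le> P z \<bullet> z" "P z \<bullet> z \<le> U * (norm z)\<^sup>2"
        using 3 by (simp_all add: U_def abs_le_iff distrib_right)
    qed
    have dissipation: "P (v' t) \<bullet> v t \<le> - (\<kappa> * e * c / 2 * eta \<xi> * (norm (v t))\<^sup>2)" if t: "t > 0" for t
    proof -
      define z where "z = v t"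
      define w where "w = norm z"
      have w: "w \<ge> 0" by (simp add: w_def)
      define Y where "Y = cmat (symbol A \<omega>) *v z"
      define T where "T = r *\<^sub>R (\<i> *s Y) + cmat L *v z"
      have v'T: "cmat A0 *v v' t = - T"
        using eq[of t] t linear_scale[OF i_smult_linear]
        by (simp add: T_def Y_def z_def sym_eq cmat_scaleR)
      define D1 D2 D3 where "D1 = T \<bullet> z" and "D2 = (cmat S *v T + T) \<bullet> z"
        and "D3 = - r * ((\<i> *s (cmat (K \<omega>) *v T)) \<bullet> z)"
      have "P (v' t) \<bullet> z = - (D1 + e * \<rho> * D2 + \<kappa> * e * \<rho>\<^sup>2 * D3)"
        by (simp add: P_def cmat_add cmat_mult v'T cmat_uminus_right D1_def D2_def D3_def
            linear_neg[OF i_smult_linear] inner_add_left inner_diff_left algebra_simps)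
      moreover
      have LD: "D1 = (cmat L *v z) \<bullet> z"
        using inner_i_symmetric[OF symA, of \<omega> z] by (simp add: D1_def T_def Y_def inner_add_left)
      obtain q1 where q1: "z - q1 \<in> cker (sym_part L)" "norm q1 \<le> norm z"
        "(cmat (sym_part L) *v z) \<bullet> z \<ge> c1 * (norm q1)\<^sup>2" using c1(2) by blast
      obtain q2 where q2: "z - q2 \<in> cker L" "norm q2 \<le> norm z" "(cmat ?M *v z) \<bullet> z \<ge> c2 * (norm q2)\<^sup>2"
        using c2(2)[of z] S by (auto simp: cond_S_def)
      define a b where "a = norm q1" and "b = norm q2"
      have b: "0 \<le> b" "b \<le> w" using q2 by (auto simp: b_def w_def)
      have a: "0 \<le> a" by (simp add: a_def)
      have D1: "c * a\<^sup>2 \<le> D1"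
        using q1(3) mult_right_mono[OF c(3), of "a\<^sup>2"] by (simp add: LD inner_cmat_sym_part a_def)
      have D2: "c * b\<^sup>2 - C * r * a * w \<le> D2"
      proof -
        let ?B = "\<lambda>z. \<i> *s (cmat (S ** symbol A \<omega>) *v z)"
        have lB: "linear ?B" using linear_compose[OF cmat_linear i_smult_linear] by (simp add: comp_def)
        have nB: "norm (?B x) \<le> k1 * norm x" for x
          using norm_cmat_le[of "S ** symbol A \<omega>" x] mult_right_mono[OF k1(2)[OF \<omega>] norm_ge_zero[of x]]
          by (simp add: norm_i_smult)
        \<comment> \<open>The point z - q1 lies in Ker(L_1), the one place where (S)_1 gives a sign;
          passing back to z costs 3 k1 a w.\<close>
        have "?B (z - q1) \<bullet> (z - q1) \<ge> 0"
          using S1 \<omega> q1(1) unfolding cond_S1_def nonneg_on_def inner_complex_vec i_map_matrix inner_i_skew_part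
          by blast
        with inner_remainder[OF lB nB k1(1) q1(2)] have "?B z \<bullet> z \<ge> - (3 * k1 * a * w)"
          by (simp add: a_def w_def)
        moreover have "3 * k1 * (a * w) \<le> C * (a * w)" using C a w by (intro mult_right_mono) auto
        ultimately have "?B z \<bullet> z \<ge> - (C * a * w)" by (simp add: mult.assoc)
        then have "r * (?B z \<bullet> z) \<ge> r * - (C * a * w)" using r by (intro mult_left_mono) auto
        moreover have "c * b\<^sup>2 \<le> (cmat ?M *v z) \<bullet> z"
          using q2(3) mult_right_mono[OF c(4), of "b\<^sup>2"] by (simp add: b_def)
        \<comment> \<open>Multiplying by S + 1 rather than by S adds the form of L_1 and completes
          (SL)_1 to the matrix \<open>?M\<close> of condition (S). The transport term of the summand
          1 drops out, since A(\<omega>) is symmetric.\<close>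
        moreover have "D2 = r * (?B z \<bullet> z) + (cmat ?M *v z) \<bullet> z"
          using LD by (simp add: D2_def D1_def T_def Y_def cmat_add cmat_add_right cmat_scaleR_right cmat_mult_i
              cmat_mult inner_add_left inner_cmat_sym_part)
        ultimately show ?thesis by (simp add: algebra_simps)
      qed
      have D3: "c * r\<^sup>2 * w\<^sup>2 - C * (r\<^sup>2 + r) * b * w \<le> D3"
      proof -
        let ?B = "\<lambda>z. cmat (K \<omega> ** symbol A \<omega>) *v z"
        have nB: "norm (?B x) \<le> k3 * norm x" for x
          using norm_cmat_le[of "K \<omega> ** symbol A \<omega>" x] mult_right_mono[OF k3(2)[OF \<omega>] norm_ge_zero[of x]]
          by simp
        define p where "p = norm (z - q2)"
        have "c3 * p\<^sup>2 \<le> ?B (z - q2) \<bullet> (z - q2)" unfolding p_def by (rule c3(2)[OF \<omega> q2(1)])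
        moreover have "c * p\<^sup>2 \<le> c3 * p\<^sup>2" using c by (intro mult_right_mono) auto
        moreover have "c * p\<^sup>2 \<ge> c * (w\<^sup>2 - 2 * (b * w))"
        proof (rule mult_left_mono)
          have "w - b \<le> p" using norm_triangle_ineq2[of z q2] by (simp add: w_def b_def p_def)
          then have "(w - b)\<^sup>2 \<le> p\<^sup>2" using b by (intro power_mono) auto
          then have "w\<^sup>2 - 2 * (b * w) + b\<^sup>2 \<le> p\<^sup>2" by (simp add: power2_diff mult_ac)
          then show "w\<^sup>2 - 2 * (b * w) \<le> p\<^sup>2" using zero_le_power2[of b] by linarith
        qed (use c in simp)
        ultimately have "?B z \<bullet> z \<ge> c * (w\<^sup>2 - 2 * (b * w)) - 3 * k3 * b * w"
          using inner_remainder[OF cmat_linear nB k3(1) q2(2)] by (simp add: b_def w_def)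
        moreover have "(2 * c + 3 * k3) * (b * w) \<le> C * (b * w)" using C b w by (intro mult_right_mono) auto
        ultimately have "?B z \<bullet> z \<ge> c * w\<^sup>2 - C * (b * w)" by (simp add: algebra_simps)
        then have 1: "r\<^sup>2 * (?B z \<bullet> z) \<ge> r\<^sup>2 * (c * w\<^sup>2 - C * (b * w))" by (intro mult_left_mono) auto
        \<comment> \<open>The zero-order term does not see the component in Ker(L), so its
          contribution to the \<open>K\<close> identity is bounded by b instead of w.\<close>
        have "cmat L *v z = cmat L *v q2"
          using q2(1) by (simp add: cker_def linear_diff[OF cmat_linear])
        then have "cmat (K \<omega>) *v (cmat L *v z) = cmat (K \<omega> ** L) *v q2" by (simp add: cmat_mult)
        then have "norm (\<i> *s (cmat (K \<omega>) *v (cmat L *v z))) \<le> k4 * b"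
          using norm_cmat_le[of "K \<omega> ** L" q2] mult_right_mono[OF k4(2)[OF \<omega>] norm_ge_zero[of q2]]
          by (simp add: norm_i_smult b_def)
        from mult_right_mono[OF this w]
        have "(\<i> *s (cmat (K \<omega>) *v (cmat L *v z))) \<bullet> z \<le> k4 * b * w"
          using norm_cauchy_schwarz[of "\<i> *s (cmat (K \<omega>) *v (cmat L *v z))" z]
          unfolding w_def by linarith
        also have "k4 * (b * w) \<le> C * (b * w)" using C b w by (intro mult_right_mono) auto
        then have "k4 * b * w \<le> C * b * w" by (simp add: mult.assoc)
        finally have 2: "r * ((\<i> *s (cmat (K \<omega>) *v (cmat L *v z))) \<bullet> z) \<le> r * (C * b * w)"
          using r by (intro mult_left_mono) auto
        \<comment> \<open>The factor - i r of the multiplier meets the factor i r of the transport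
          term, which makes the product real: this is the source of the dissipation r^2 <K
          A(\<omega>) z, z>.\<close>
        have "D3 = r\<^sup>2 * (?B z \<bullet> z) - r * ((\<i> *s (cmat (K \<omega>) *v (cmat L *v z))) \<bullet> z)"
          by (simp add: D3_def T_def Y_def cmat_add_right cmat_scaleR_right cmat_mult_i i_i_smult cmat_mult
              linear_add[OF i_smult_linear] linear_scale[OF i_smult_linear] inner_add_left power2_eq_square algebra_simps)
        with 1 2 show ?thesis by (simp add: algebra_simps)
      qed
      have "D1 + e * \<rho> * D2 + \<kappa> * e * \<rho>\<^sup>2 * D3 \<ge> \<kappa> * e * c / 2 * (r\<^sup>2 / (1 + r\<^sup>2)\<^sup>2) * w\<^sup>2"
        using dissipation_lower_bound[OF c(1) C(1) e(1) e(2)[unfolded \<kappa>_def] r D1 D2 D3]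
        by (simp add: \<kappa>_def \<rho>_def)
      ultimately show ?thesis by (simp add: z_def w_def r_def eta_def)
    qed
    have eta: "eta \<xi> \<ge> 0" by (simp add: eta_def)
    have "E t \<le> exp (- (k * eta \<xi>) * t) * E 0"
    proof (rule exp_decay_of_derivative[OF _ _ _ t])
      have "bounded_linear P" using P by (simp add: linear_conv_bounded_linear)
      from bounded_linear.continuous_on[OF this cont] show "continuous_on {0..} E"
        unfolding E_def by (rule continuous_on_inner[OF _ cont])
      show "(E has_real_derivative 2 * (P (v' t) \<bullet> v t)) (at t)" if "t > 0" for t
        unfolding E_def by (rule quadratic_form_derivative[OF P P_sym v'[OF that]])
      fix t :: real assume t: "t > 0"
      have "k * eta \<xi> * E t \<le> k * eta \<xi> * (U * (norm (v t))\<^sup>2)"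
        using E_bounds(2) k eta unfolding E_def by (intro mult_left_mono) auto
      also have "\<dots> = \<kappa> * e * c * eta \<xi> * (norm (v t))\<^sup>2" using U by (simp add: k_def)
      finally show "2 * (P (v' t) \<bullet> v t) \<le> - (k * eta \<xi>) * E t"
        using dissipation[OF t] by simp
    qed
    also have "\<dots> \<le> exp (- (k * eta \<xi>) * t) * (U * (norm (v 0))\<^sup>2)"
      using E_bounds(2) unfolding E_def by (intro mult_left_mono) auto
    finally show ?thesis using E_bounds(1)[of "v t"] unfolding E_def by linarith
  qed
  show ?thesis
  proof (rule that)
    \<comment> \<open>The energy is comparable to the square of the norm, so passing to the norm
      takes a square root of the constant and halves the rate.\<close>
    show "sqrt (2 * U / c) > 0" "k / 2 > 0" using U c k by auto
    fix \<xi> v and t :: real assume *: "fourier_ode A0 A L \<xi> v" "t \<ge> 0"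
    have "(norm (v t))\<^sup>2 \<le> 2 * U / c * exp (- (k * eta \<xi>) * t) * (norm (v 0))\<^sup>2"
      using main[OF *] c by (simp add: field_simps)
    also have "\<dots> = (sqrt (2 * U / c) * exp (- (k / 2) * eta \<xi> * t) * norm (v 0))\<^sup>2"
    proof -
      have "(sqrt (2 * U / c))\<^sup>2 = 2 * U / c" using U c by simp
      moreover have "(exp (- (k / 2) * eta \<xi> * t))\<^sup>2 = exp (- (k * eta \<xi>) * t)"
        by (simp add: power2_eq_square flip: exp_add)
      ultimately show ?thesis by (simp only: power_mult_distrib)
    qed
    finally show "norm (v t) \<le> sqrt (2 * U / c) * exp (- (k / 2) * eta \<xi> * t) * norm (v 0)"
      by (rule power2_le_imp_le) (use U c in simp)
  qed
qed

section \<open>The flow of the transformed system\<close>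

lemma cond_A_inverse:
  assumes "cond_A A0 A L"
  obtains B where "A0 ** B = mat 1" "B ** A0 = mat 1"
proof -
  have "x = 0" if x: "A0 *v x = 0" for x
  proof (rule ccontr)
    assume "x \<noteq> 0"
    let ?z = "\<chi> i. complex_of_real (x $ i)"
    have "(cmat A0 *v ?z) $ i = complex_of_real ((A0 *v x) $ i)" for i
      unfolding cmat_nth by (simp add: matrix_vector_mult_def)
    then have "cmat A0 *v ?z = 0" using x by (simp add: vec_eq_iff)
    moreover have "?z \<noteq> 0" using \<open>x \<noteq> 0\<close> by (auto simp: vec_eq_iff)
    ultimately show False using assms by (auto simp: cond_A_def pos_on_def inner_complex_vec)
  qed
  then obtain B where "B ** A0 = mat 1" using matrix_left_invertible_ker[of A0] by blast
  then show ?thesis using that matrix_left_right_inverse by blast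
qed

lemma cmat_mat_1: "cmat (mat 1) *v z = z"
  by (simp add: vec_eq_iff cmat_nth mat_def if_distrib[where f=complex_of_real] if_distrib[where f="\<lambda>x. x * _"] cong: if_cong)

text \<open>With \<open>B = A0\<inverse>\<close> the transformed system reads \<open>v' = gen B A L \<xi> v\<close>, with flow
  \<open>flow B A L \<xi> t = exp (t gen)\<close>.\<close>

definition gen :: "real^'m^'m \<Rightarrow> ('n::finite \<Rightarrow> real^'m^'m) \<Rightarrow> real^'m^'m \<Rightarrow> real^'n \<Rightarrow> complex^'m \<Rightarrow> complex^'m" where
  "gen B A L \<xi> z = - (cmat B *v (\<i> *s (cmat (symbol A \<xi>) *v z) + cmat L *v z))"

definition flow :: "real^'m^'m \<Rightarrow> ('n::finite \<Rightarrow> real^'m^'m) \<Rightarrow> real^'m^'m \<Rightarrow> real^'n \<Rightarrow> real \<Rightarrow> complex^'m \<Rightarrow> complex^'m" where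
  "flow B A L \<xi> t z = (\<Sum>k. (t ^ k / fact k) *\<^sub>R (gen B A L \<xi> ^^ k) z)"

lemma gen_linear: "linear (gen B A L \<xi>)"
  unfolding gen_def[abs_def]
  by (intro linearI) (auto simp: cmat_add_right cmat_scaleR_right linear_add[OF i_smult_linear]
      linear_scale[OF i_smult_linear] scaleR_add_right algebra_simps)

lemma gen_continuous: "continuous_on UNIV (\<lambda>w. gen B A L (fst w) (snd w))"
proof -
  have "continuous_on UNIV (\<lambda>z::complex^'m. \<i> *s z)"
    by (rule linear_continuous_on[OF i_smult_bounded_linear])
  then have 1: "continuous_on UNIV (\<lambda>w. \<i> *s (f w))" if "continuous_on UNIV f" for f :: "'c::topological_space \<Rightarrow> complex^'m"
    using that continuous_on_compose2 by blast
  show ?thesis unfolding gen_def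
    by (intro continuous_on_minus continuous_on_cmat continuous_on_add 1 continuous_on_const continuous_on_snd
        continuous_on_id continuous_on_compose2[OF continuous_on_symbol continuous_on_fst[OF continuous_on_id] subset_UNIV])
qed

lemma gen_power_linear: "linear (gen B A L \<xi> ^^ k)"
proof (induction k)
  case (Suc k)
  then show ?case using linear_compose[OF Suc gen_linear] by (simp add: comp_def)
qed (simp add: linear_id[unfolded id_def] id_def)

lemma gen_power_bound: "\<exists>M\<ge>0. \<forall>k z. norm ((gen B A L \<xi> ^^ k) z) \<le> M ^ k * norm z"
proof -
  obtain M where M: "M > 0" "\<And>z. norm (gen B A L \<xi> z) \<le> M * norm z"
    using linear_bounded_pos[OF gen_linear] by blast
  have "norm ((gen B A L \<xi> ^^ k) z) \<le> M ^ k * norm z" for k z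
  proof (induction k)
    case (Suc k)
    have "norm ((gen B A L \<xi> ^^ Suc k) z) \<le> M * norm ((gen B A L \<xi> ^^ k) z)" using M(2) by simp
    also have "\<dots> \<le> M * (M ^ k * norm z)" using M(1) Suc by (intro mult_left_mono) auto
    finally show ?case by simp
  qed simp
  then show ?thesis using M(1) by (intro exI[of _ M]) auto
qed

lemma flow_summable: "summable (\<lambda>k. (t ^ k / fact k) *\<^sub>R (gen B A L \<xi> ^^ k) z)"
proof -
  obtain M where M: "M \<ge> 0" "\<And>k z. norm ((gen B A L \<xi> ^^ k) z) \<le> M ^ k * norm z"
    using gen_power_bound by blast
  show ?thesis
  proof (rule summable_comparison_test')
    show "summable (\<lambda>k. inverse (fact k) * (\<bar>t\<bar> * M) ^ k * norm z)"
      by (intro summable_mult2 summable_exp)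
    fix k
    have "norm ((t ^ k / fact k) *\<^sub>R (gen B A L \<xi> ^^ k) z) = \<bar>t\<bar> ^ k / fact k * norm ((gen B A L \<xi> ^^ k) z)"
      by (simp add: power_abs)
    also have "\<dots> \<le> \<bar>t\<bar> ^ k / fact k * (M ^ k * norm z)" by (intro mult_left_mono M) auto
    finally show "norm ((t ^ k / fact k) *\<^sub>R (gen B A L \<xi> ^^ k) z) \<le> inverse (fact k) * (\<bar>t\<bar> * M) ^ k * norm z"
      by (simp add: power_mult_distrib field_simps)
  qed
qed

lemma flow_0 [simp]: "flow B A L \<xi> 0 z = z"
proof -
  have "(\<Sum>k. (0 ^ k / fact k) *\<^sub>R (gen B A L \<xi> ^^ k) z) = (\<Sum>k\<in>{0}. (0 ^ k / fact k) *\<^sub>R (gen B A L \<xi> ^^ k) z)"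
    by (rule suminf_finite) auto
  then show ?thesis by (simp add: flow_def)
qed

lemma flow_diff: "flow B A L \<xi> t (z - w) = flow B A L \<xi> t z - flow B A L \<xi> t w"
  unfolding flow_def suminf_diff[OF flow_summable flow_summable]
  by (simp add: linear_diff[OF gen_power_linear] scaleR_diff_right)

text \<open>Componentwise the flow is a scalar power series, so that termwise differentiation of
  everywhere convergent complex power series applies and then restricts to real time.\<close>

lemma flow_nth:
  "flow B A L \<xi> t z $ i = (\<Sum>k. ((gen B A L \<xi> ^^ k) z $ i / fact k) * complex_of_real t ^ k)"
proof -
  have eq: "((t ^ k / fact k) *\<^sub>R (gen B A L \<xi> ^^ k) z) $ i = ((gen B A L \<xi> ^^ k) z $ i / fact k) * complex_of_real t ^ k" for k
    by simp (simp add: scaleR_conv_of_real)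
  from bounded_linear.suminf[OF bounded_linear_vec_nth[of i] flow_summable[of t B A L \<xi> z]]
  show ?thesis by (simp only: flow_def eq)
qed

lemma gen_flow: "gen B A L \<xi> (flow B A L \<xi> t z) $ i =
  (\<Sum>k. ((gen B A L \<xi> ^^ Suc k) z $ i / fact k) * complex_of_real t ^ k)"
proof -
  have bl: "bounded_linear (\<lambda>z. gen B A L \<xi> z $ i)"
    using bounded_linear_compose[OF bounded_linear_vec_nth] gen_linear linear_conv_bounded_linear by blast
  have "gen B A L \<xi> ((t ^ k / fact k) *\<^sub>R (gen B A L \<xi> ^^ k) z) $ i = ((gen B A L \<xi> ^^ Suc k) z $ i / fact k) * complex_of_real t ^ k" for k
    by (simp add: linear_scale[OF gen_linear]) (simp add: scaleR_conv_of_real)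
  with bounded_linear.suminf[OF bl flow_summable[of t B A L \<xi> z]] show ?thesis
    by (simp only: flow_def)
qed

lemma bounded_linear_axis: "bounded_linear (axis i :: 'b::real_normed_vector \<Rightarrow> 'b^'m)"
proof (rule bounded_linear_intro[where K=1])
  fix x :: 'b
  have "norm (axis i x :: 'b^'m) \<le> (\<Sum>j\<in>UNIV. norm ((axis i x :: 'b^'m) $ j))"
    unfolding norm_vec_def by (rule L2_set_le_sum) simp
  also have "\<dots> = norm x" by (simp add: axis_def if_distrib[where f=norm] cong: if_cong)
  finally show "norm (axis i x :: 'b^'m) \<le> norm x * 1" by simp
qed (auto simp: vec_eq_iff axis_def)

lemma has_vector_derivative_vecI:
  fixes f :: "real \<Rightarrow> 'b::real_normed_vector^'m"
  assumes "\<And>i. ((\<lambda>t. f t $ i) has_vector_derivative f' $ i) F"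
  shows "(f has_vector_derivative f') F"
proof -
  have sum_axis: "x = (\<Sum>i\<in>UNIV. axis i (x $ i))" for x :: "'b^'m"
    by (simp add: vec_eq_iff axis_def)
  have "((\<lambda>t. \<Sum>i\<in>UNIV. axis i (f t $ i)) has_vector_derivative (\<Sum>i\<in>UNIV. axis i (f' $ i))) F"
    by (intro has_vector_derivative_sum bounded_linear.has_vector_derivative[OF bounded_linear_axis] assms)
  then show ?thesis by (simp only: sum_axis[symmetric])
qed

lemma flow_has_vector_derivative:
  "((\<lambda>t. flow B A L \<xi> t z) has_vector_derivative gen B A L \<xi> (flow B A L \<xi> t z)) (at t within S)"
proof (rule has_vector_derivative_vecI)
  fix i
  let ?c = "\<lambda>k. (gen B A L \<xi> ^^ k) z $ i / fact k"
  obtain M where M: "M \<ge> 0" "\<And>k z. norm ((gen B A L \<xi> ^^ k) z) \<le> M ^ k * norm z"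
    using gen_power_bound by blast
  have s: "summable (\<lambda>k. ?c k * y ^ k)" for y :: complex
  proof (rule summable_comparison_test')
    show "summable (\<lambda>k. inverse (fact k) * (M * norm y) ^ k * norm z)"
      by (intro summable_mult2 summable_exp)
    fix k
    have "norm (?c k * y ^ k) \<le> (M ^ k * norm z) / fact k * norm y ^ k"
      using order_trans[OF Finite_Cartesian_Product.norm_nth_le M(2)]
      by (auto simp: norm_mult norm_divide norm_power intro!: mult_right_mono divide_right_mono)
    then show "norm (?c k * y ^ k) \<le> inverse (fact k) * (M * norm y) ^ k * norm z"
      by (simp add: power_mult_distrib field_simps)
  qed
  have "diffs ?c k = (gen B A L \<xi> ^^ Suc k) z $ i / fact k" for k
    by (simp add: diffs_def fact_reduce field_simps del: of_nat_Suc)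
  then have "(\<Sum>k. diffs ?c k * complex_of_real t ^ k) = gen B A L \<xi> (flow B A L \<xi> t z) $ i"
    by (simp only: gen_flow)
  with termdiffs_strong_converges_everywhere[OF s, of "complex_of_real t"]
  have "((\<lambda>x. \<Sum>k. ?c k * x ^ k) has_field_derivative gen B A L \<xi> (flow B A L \<xi> t z) $ i) (at (complex_of_real t))"
    by simp
  from has_vector_derivative_real_field[OF this]
  show "((\<lambda>t. flow B A L \<xi> t z $ i) has_vector_derivative gen B A L \<xi> (flow B A L \<xi> t z) $ i) (at t within S)"
    by (simp only: flow_nth)
qed

lemma cmat_gen:
  assumes "A0 ** B = mat 1"
  shows "cmat A0 *v gen B A L \<xi> z = - (\<i> *s (cmat (symbol A \<xi>) *v z) + cmat L *v z)"
  by (simp add: gen_def cmat_uminus_right cmat_mat_1 assms flip: cmat_mult)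

lemma fourier_ode_flow:
  assumes "A0 ** B = mat 1"
  shows "fourier_ode A0 A L \<xi> (\<lambda>t. flow B A L \<xi> t z)"
  unfolding fourier_ode_iff
proof (intro allI impI exI conjI)
  fix t :: real
  show "((\<lambda>t. flow B A L \<xi> t z) has_vector_derivative gen B A L \<xi> (flow B A L \<xi> t z)) (at t within {0..})"
    by (rule flow_has_vector_derivative)
qed (simp add: cmat_gen[OF assms])

text \<open>The partial sums are measurable because \<open>gen\<close> is jointly continuous in the
  frequency and the vector, and the flow is their pointwise limit.\<close>

lemma flow_measurable:
  assumes [measurable]: "f \<in> borel_measurable borel"
  shows "(\<lambda>\<xi>. flow B A L \<xi> t (f \<xi>)) \<in> borel_measurable borel"
proof -
  have m[measurable]: "(\<lambda>\<xi>. (gen B A L \<xi> ^^ k) (f \<xi>)) \<in> borel_measurable borel" for k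
  proof (induction k)
    case (Suc k)
    have "(\<lambda>\<xi>. gen B A L \<xi> ((gen B A L \<xi> ^^ k) (f \<xi>))) \<in> borel_measurable borel"
      by (rule borel_measurable_continuous_Pair[OF _ Suc gen_continuous]) simp
    then show ?case by simp
  qed simp
  show ?thesis
  proof (rule borel_measurable_LIMSEQ_metric)
    show "(\<lambda>N. \<Sum>k<N. (t ^ k / fact k) *\<^sub>R (gen B A L \<xi> ^^ k) (f \<xi>)) \<longlonglongrightarrow> flow B A L \<xi> t (f \<xi>)" for \<xi>
      unfolding flow_def by (rule summable_LIMSEQ[OF flow_summable])
  qed measurable
qed

section \<open>The Fourier transform of vector-valued integrable functions\<close>

lemma nsq_vec:
  fixes F :: "'a::euclidean_space \<Rightarrow> 'b::real_normed_vector^'m"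
  assumes "\<And>i. (\<lambda>x. F x $ i) \<in> borel_measurable borel"
  shows "nsq F = (\<Sum>i\<in>UNIV. nsq (\<lambda>x. F x $ i))"
proof -
  have "nsq F = (\<integral>\<^sup>+x. (\<Sum>i\<in>UNIV. ennreal ((norm (F x $ i))\<^sup>2)) \<partial>lborel)"
    by (simp add: nsq_def norm_vec_def L2_set_def sum_nonneg sum_ennreal)
  also have "\<dots> = (\<Sum>i\<in>UNIV. nsq (\<lambda>x. F x $ i))"
    unfolding nsq_def using assms by (subst nn_integral_sum) auto
  finally show ?thesis .
qed

lemma integrable_component:
  fixes f :: "real^'n \<Rightarrow> real^'m"
  assumes "integrable lborel f" shows "integrable lborel (\<lambda>x. complex_of_real (f x $ i))"
  using integrable_bounded_linear[OF bounded_linear_vec_nth assms, of i] by simp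

lemma borel_measurable_vecI:
  fixes F :: "'a::topological_space \<Rightarrow> 'b::{euclidean_space}^'m"
  assumes "\<And>i. (\<lambda>x. F x $ i) \<in> borel_measurable borel" shows "F \<in> borel_measurable borel"
proof -
  have eq: "(\<lambda>x. \<Sum>i\<in>UNIV. axis i (F x $ i)) = F"
    by (auto simp: vec_eq_iff axis_def)
  have "(\<lambda>x. axis i (F x $ i) :: 'b^'m) \<in> borel_measurable borel" for i
    by (rule borel_measurable_continuous_on[OF linear_continuous_on[OF bounded_linear_axis] assms])
  then have "(\<lambda>x. \<Sum>i\<in>UNIV. axis i (F x $ i) :: 'b^'m) \<in> borel_measurable borel"
    by (intro borel_measurable_sum)
  then show ?thesis by (simp only: eq)
qed

lemma borel_measurable_vec_nth [measurable]:
  fixes f :: "'a \<Rightarrow> 'b::euclidean_space^'m"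
  shows "f \<in> borel_measurable M \<Longrightarrow> (\<lambda>x. f x $ i) \<in> borel_measurable M"
  by (rule borel_measurable_continuous_on[OF linear_continuous_on[OF bounded_linear_vec_nth]])

lemma fourier_L1_continuous:
  fixes f :: "real^'n \<Rightarrow> real^'m"
  assumes "integrable lborel f" shows "continuous_on UNIV (fourier_L1 f)"
proof -
  have "continuous_on UNIV (\<lambda>\<xi>. \<chi> i. fourier_L1 f \<xi> $ i)"
    unfolding fourier_L1_nth
    by (intro continuous_on_vec_lambda ft_continuous integrable_component assms)
  then show ?thesis by simp
qed

lemma fourier_L1_measurable [measurable]:
  fixes f :: "real^'n \<Rightarrow> real^'m"
  shows "integrable lborel f \<Longrightarrow> fourier_L1 f \<in> borel_measurable borel"
  by (intro borel_measurable_continuous_onI fourier_L1_continuous)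

lemma fourier_L1_Bessel:
  fixes f :: "real^'n \<Rightarrow> real^'m"
  assumes f: "integrable lborel f" shows "nsq (fourier_L1 f) \<le> nsq f"
proof -
  have [measurable]: "f \<in> borel_measurable borel" using f by (auto dest: borel_measurable_integrable)
  have "nsq (fourier_L1 f) = (\<Sum>i\<in>UNIV. nsq (\<lambda>\<xi>. fourier_L1 f \<xi> $ i))"
    by (rule nsq_vec) (use f in measurable)
  also have "\<dots> \<le> (\<Sum>i\<in>UNIV. nsq (\<lambda>x. complex_of_real (f x $ i)))"
    unfolding fourier_L1_nth by (intro sum_mono Bessel integrable_component f)
  also have "\<dots> = (\<Sum>i\<in>UNIV. nsq (\<lambda>x. f x $ i))" by (simp add: nsq_def)
  also have "\<dots> = nsq f" by (rule nsq_vec[symmetric]) measurable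
  finally show ?thesis .
qed

lemma fourier_L1_diff:
  fixes f g :: "real^'n \<Rightarrow> real^'m"
  assumes "integrable lborel f" "integrable lborel g"
  shows "fourier_L1 (\<lambda>x. f x - g x) \<xi> = fourier_L1 f \<xi> - fourier_L1 g \<xi>"
  by (simp add: vec_eq_iff fourier_L1_nth ft_diff integrable_component assms)

lemma fourier_L1_norm_le:
  fixes f :: "real^'n \<Rightarrow> real^'m"
  assumes f: "integrable lborel f"
  shows "norm (fourier_L1 f \<xi>) \<le> (2 * pi) powr (- real CARD('n) / 2) * real CARD('m) * norm_L1 f"
proof -
  let ?c = "(2 * pi) powr (- real CARD('n) / 2)"
  have "norm (fourier_L1 f \<xi> $ i) \<le> ?c * norm_L1 f" for i
  proof -
    have "(\<integral>x. norm (complex_of_real (f x $ i)) \<partial>lborel) \<le> norm_L1 f"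
      unfolding norm_L1_def
    proof (rule integral_mono)
      show "integrable lborel (\<lambda>x. norm (complex_of_real (f x $ i)))"
        by (intro integrable_norm integrable_component f)
      show "norm (complex_of_real (f x $ i)) \<le> norm (f x)" for x
        using Finite_Cartesian_Product.norm_nth_le[of "f x" i] by simp
    qed (use f in simp)
    then show ?thesis unfolding fourier_L1_nth
      by (intro order_trans[OF ft_norm_le] mult_left_mono) auto
  qed
  then have "(\<Sum>i\<in>UNIV. norm (fourier_L1 f \<xi> $ i)) \<le> (\<Sum>i\<in>(UNIV::'m set). ?c * norm_L1 f)"
    by (intro sum_mono)
  moreover have "norm (fourier_L1 f \<xi>) \<le> (\<Sum>i\<in>UNIV. norm (fourier_L1 f \<xi> $ i))"
    unfolding norm_vec_def by (rule L2_set_le_sum) simp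
  ultimately show ?thesis by (simp add: mult_ac)
qed

section \<open>The localised equation\<close>

lemma in_L2_iff: "in_L2 f \<longleftrightarrow> f \<in> borel_measurable borel \<and> nsq f < \<infinity>"
  by (auto simp: in_L2_def nsq_integrable_iff)

lemma norm_L2_nonneg: "norm_L2 f \<ge> 0"
  by (simp add: norm_L2_def)

lemma nsq_eq_norm_L2: "in_L2 f \<Longrightarrow> nsq f = ennreal ((norm_L2 f)\<^sup>2)"
  unfolding in_L2_def norm_L2_def by (simp add: nsq_eq_integral)

lemma in_L2_diff:
  assumes "in_L2 f" "in_L2 g" shows "in_L2 (\<lambda>x. f x - g x)"
proof -
  have "nsq (\<lambda>x. f x - g x) \<le> 2 * nsq f + 2 * nsq g"
    using assms by (intro nsq_add_le) (auto simp: in_L2_iff norm_triangle_ineq4)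
  also have "\<dots> < \<infinity>" using assms by (simp add: in_L2_iff ennreal_mult_less_top)
  finally show ?thesis using assms by (auto simp: in_L2_iff)
qed

lemma nsq_bounded_support_finite:
  fixes \<phi> :: "'a::euclidean_space \<Rightarrow> real"
  assumes "\<And>x. \<phi> x \<noteq> 0 \<Longrightarrow> norm x \<le> B" "\<And>x. \<bar>\<phi> x\<bar> \<le> M"
  shows "nsq \<phi> < \<infinity>"
proof -
  have "nsq \<phi> \<le> (\<integral>\<^sup>+x. ennreal (M\<^sup>2) * indicator (cball (0::'a) B) x \<partial>lborel)"
    unfolding nsq_def
  proof (rule nn_integral_mono)
    fix x
    have "(\<phi> x)\<^sup>2 \<le> M\<^sup>2" using assms(2)[of x] by (simp add: abs_le_square_iff[symmetric])
    then show "ennreal ((norm (\<phi> x))\<^sup>2) \<le> ennreal (M\<^sup>2) * indicator (cball 0 B) x"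
      using assms(1)[of x] by (cases "\<phi> x = 0") (auto simp: ennreal_leI)
  qed
  also have "\<dots> = ennreal (M\<^sup>2) * emeasure lborel (cball (0::'a) B)" by (rule nn_integral_cmult_indicator) simp
  also have "\<dots> < \<infinity>" by (simp add: ennreal_mult_less_top emeasure_bounded_finite[OF bounded_cball, unfolded infinity_ennreal_def])
  finally show ?thesis .
qed

lemma nsq_test_function:
  assumes "test_function \<phi>" shows "nsq \<phi> < \<infinity>"
proof -
  obtain B where "\<And>x. \<phi> x \<noteq> 0 \<Longrightarrow> norm x \<le> B" using assms by (auto simp: test_function_iff)
  moreover obtain M where "\<And>x. \<bar>\<phi> x\<bar> \<le> M" using test_function_bounded[OF assms] by blast
  ultimately show ?thesis by (rule nsq_bounded_support_finite)
qed

lemma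
  fixes f :: "real^'n \<Rightarrow> 'b::euclidean_space"
  assumes \<phi>: "\<phi> \<in> borel_measurable borel" "nsq \<phi> < \<infinity>" and f: "in_L2 f"
  shows integrable_scaleR_L2: "integrable lborel (\<lambda>x. \<phi> x *\<^sub>R f x)"
    and norm_L1_scaleR_L2: "norm_L1 (\<lambda>x. \<phi> x *\<^sub>R f x) \<le> norm_L2 \<phi> * norm_L2 f"
proof -
  have [measurable]: "\<phi> \<in> borel_measurable borel" "f \<in> borel_measurable borel" using \<phi> f by (auto simp: in_L2_iff)
  have "nsq (\<lambda>x. norm (f x)) < \<infinity>" using f by (simp add: nsq_def in_L2_iff)
  then have "integrable lborel (\<lambda>x. \<phi> x * norm (f x))"
    using \<phi> by (intro integrable_mult_L2) auto
  then show "integrable lborel (\<lambda>x. \<phi> x *\<^sub>R f x)"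
    by (rule Bochner_Integration.integrable_bound) (auto simp: abs_mult)
  have "(\<integral>x. \<bar>\<phi> x * norm (f x)\<bar> \<partial>lborel) \<le> sqrt (\<integral>x. (\<phi> x)\<^sup>2 \<partial>lborel) * sqrt (\<integral>x. (norm (f x))\<^sup>2 \<partial>lborel)"
    using \<phi> f nsq_integrable_iff[of \<phi>] by (intro Cauchy_Schwarz_integral) (auto simp: in_L2_def)
  then show "norm_L1 (\<lambda>x. \<phi> x *\<^sub>R f x) \<le> norm_L2 \<phi> * norm_L2 f"
    by (simp add: norm_L1_def norm_L2_def abs_mult)
qed

lemma test_function_integrable:
  fixes f :: "real^'n \<Rightarrow> 'b::euclidean_space"
  assumes "test_function \<phi>" "in_L2 f" shows "integrable lborel (\<lambda>x. \<phi> x *\<^sub>R f x)"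
  using assms by (intro integrable_scaleR_L2 nsq_test_function) (auto intro: test_function_measurable)

definition cut :: "(real^'n \<Rightarrow> real) \<Rightarrow> real \<Rightarrow> (real^'n \<Rightarrow> 'b::euclidean_space) \<Rightarrow> real^'n \<Rightarrow> 'b" where
  "cut \<psi> R f x = \<psi> (x /\<^sub>R R) *\<^sub>R f x"

lemma cut_integrable: "test_function \<psi> \<Longrightarrow> R > 0 \<Longrightarrow> in_L2 f \<Longrightarrow> integrable lborel (cut \<psi> R f)"
  unfolding cut_def[abs_def] by (intro test_function_integrable test_function_scale)

lemma cut_diff: "cut \<psi> R f x - cut \<psi> R g x = cut \<psi> R (\<lambda>x. f x - g x) x"
  by (simp add: cut_def scaleR_diff_right)

lemma nsq_cut_le:
  assumes "test_function \<psi>" and "in_L2 f" and "\<And>x. \<bar>\<psi> x\<bar> \<le> M" and "M \<ge> 0"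
  shows "nsq (cut \<psi> R f) \<le> ennreal (M\<^sup>2) * nsq f"
  by (rule nsq_cmult) (use assms in \<open>auto simp: cut_def in_L2_iff intro!: mult_right_mono\<close>)

text \<open>Cauchy-Schwarz on the bounded support of the cut-off turns an L^2 bound into an L^1
  bound. \<open>K\<close> may grow with \<open>R\<close>, but it is the same for all frequencies, so
  L^2 continuity in time makes the transforms continuous in time uniformly in
  \<open>\<xi>\<close>.\<close>

lemma fourier_cut_bound:
  fixes \<psi> :: "real^'n \<Rightarrow> real"
  assumes \<psi>: "test_function \<psi>" and R: "R > 0"
  obtains K where "K \<ge> 0" "\<And>f :: real^'n \<Rightarrow> real^'m. \<And>\<xi>. in_L2 f \<Longrightarrow> norm (fourier_L1 (cut \<psi> R f) \<xi>) \<le> K * norm_L2 f"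
proof -
  let ?c = "(2 * pi) powr (- real CARD('n) / 2) * real CARD('m)"
  have t: "test_function (\<lambda>x. \<psi> (x /\<^sub>R R))" by (rule test_function_scale[OF \<psi> R])
  show ?thesis
  proof (rule that)
    show "?c * norm_L2 (\<lambda>x. \<psi> (x /\<^sub>R R)) \<ge> 0" by (simp add: norm_L2_nonneg)
    fix f :: "real^'n \<Rightarrow> real^'m" and \<xi> assume f: "in_L2 f"
    have "norm (fourier_L1 (cut \<psi> R f) \<xi>) \<le> ?c * norm_L1 (cut \<psi> R f)"
      by (rule fourier_L1_norm_le[OF cut_integrable[OF \<psi> R f]])
    also have "norm_L1 (cut \<psi> R f) \<le> norm_L2 (\<lambda>x. \<psi> (x /\<^sub>R R)) * norm_L2 f"
      unfolding cut_def[abs_def]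
      by (rule norm_L1_scaleR_L2[OF test_function_measurable[OF t] nsq_test_function[OF t] f])
    finally show "norm (fourier_L1 (cut \<psi> R f) \<xi>) \<le> ?c * norm_L2 (\<lambda>x. \<psi> (x /\<^sub>R R)) * norm_L2 f"
      by (simp add: mult_left_mono mult.assoc)
  qed
qed

definition cvec :: "real^'m \<Rightarrow> complex^'m" where
  "cvec x = (\<chi> i. complex_of_real (x $ i))"

lemma cvec_linear: "linear cvec"
  by (rule linearI) (simp_all add: cvec_def vec_eq_iff scaleR_conv_of_real[where 'a=complex])

lemmas cvec_bounded_linear = linear_conv_bounded_linear[THEN iffD1, OF cvec_linear]

lemma cmat_cvec: "cmat X *v cvec x = cvec (X *v x)"
  unfolding vec_eq_iff cmat_nth by (simp add: cvec_def matrix_vector_mult_def)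

text \<open>The real integrals for the phases 0 and \<pi>/2 are combined into one complex vector,
  according to exp (- i y) = cos y + i cos (y + \<pi>/2).\<close>

definition wave_pair :: "(real \<Rightarrow> real^'m) \<Rightarrow> complex^'m" where
  "wave_pair V = cvec (V 0) + \<i> *s cvec (V (pi / 2))"

lemma wave_plus_pi: "wave \<psi> R \<xi> (a + pi) x = - wave \<psi> R \<xi> a x"
  by (simp add: wave_def flip: add.assoc)

lemma integrable_cos_scaleR:
  fixes f :: "'a::euclidean_space \<Rightarrow> 'b::euclidean_space"
  assumes "integrable lborel f" shows "integrable lborel (\<lambda>x. cos (x \<bullet> \<xi> + a) *\<^sub>R f x)"
proof (rule Bochner_Integration.integrable_bound[OF assms])
  show "(\<lambda>x. cos (x \<bullet> \<xi> + a) *\<^sub>R f x) \<in> borel_measurable lborel"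
    using borel_measurable_integrable[OF assms] by measurable
qed (auto intro!: AE_I2 mult_left_le_one_le abs_cos_le_one)

lemma ft_of_real:
  fixes f :: "real^'n \<Rightarrow> real"
  assumes f: "integrable lborel f"
  shows "ft (\<lambda>x. complex_of_real (f x)) \<xi> = of_real ((2 * pi) powr (- real CARD('n) / 2)) *
    (complex_of_real (\<integral>x. cos (x \<bullet> \<xi>) * f x \<partial>lborel) + \<i> * complex_of_real (\<integral>x. cos (x \<bullet> \<xi> + pi / 2) * f x \<partial>lborel))"
proof -
  have c: "integrable lborel (\<lambda>x. complex_of_real (cos (x \<bullet> \<xi> + a) * f x))" for a
    using integrable_cos_scaleR[OF f, of \<xi> a] by (simp only: complex_of_real_integrable_eq real_scaleR_def)
  have s: "cos (y + pi / 2) = - sin y" for y :: real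
    using minus_sin_cos_eq[of y] by simp
  have eq: "cis (- (x \<bullet> \<xi>)) * complex_of_real (f x) =
    complex_of_real (cos (x \<bullet> \<xi> + 0) * f x) + \<i> * complex_of_real (cos (x \<bullet> \<xi> + pi / 2) * f x)" for x
    unfolding s by (simp add: complex_eq_iff)
  show ?thesis
    unfolding ft_def eq Bochner_Integration.integral_add[OF c integrable_mult_right[OF c]]
    by (simp only: integral_mult_right_zero integral_complex_of_real add_0_right)
qed

lemma fourier_L1_wave_pair:
  fixes f :: "real^'n \<Rightarrow> real^'m"
  assumes f: "integrable lborel f"
  shows "fourier_L1 f \<xi> = ((2 * pi) powr (- real CARD('n) / 2)) *\<^sub>R
    wave_pair (\<lambda>a. \<integral>x. cos (x \<bullet> \<xi> + a) *\<^sub>R f x \<partial>lborel)"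
proof -
  have nth: "(\<integral>x. cos (x \<bullet> \<xi> + a) *\<^sub>R f x \<partial>lborel) $ i = (\<integral>x. cos (x \<bullet> \<xi> + a) * f x $ i \<partial>lborel)" for a i
    using integral_bounded_linear[OF bounded_linear_vec_nth[of i] integrable_cos_scaleR[OF f, of \<xi> a]] by simp
  show ?thesis
    unfolding vec_eq_iff fourier_L1_nth
    using ft_of_real[OF integrable_bounded_linear[OF bounded_linear_vec_nth f]]
    by (simp add: wave_pair_def cvec_def nth[of 0, simplified] nth scaleR_conv_of_real[where 'a=complex])
qed

lemma fourier_L1_cut:
  fixes f :: "real^'n \<Rightarrow> real^'m"
  assumes \<psi>: "test_function \<psi>" "R > 0" and f: "in_L2 f"
  shows "fourier_L1 (cut \<psi> R f) \<xi> = ((2 * pi) powr (- real CARD('n) / 2)) *\<^sub>R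
    wave_pair (\<lambda>a. \<integral>x. wave \<psi> R \<xi> a x *\<^sub>R f x \<partial>lborel)"
  unfolding fourier_L1_wave_pair[OF cut_integrable[OF assms]] by (simp add: wave_def cut_def mult.commute)

lemma integral_scaleR_matrix:
  fixes f :: "real^'n \<Rightarrow> real^'m"
  assumes "integrable lborel (\<lambda>x. \<phi> x *\<^sub>R f x)"
  shows "(\<integral>x. \<phi> x *\<^sub>R (X *v f x) \<partial>lborel) = X *v (\<integral>x. \<phi> x *\<^sub>R f x \<partial>lborel)"
  using integral_bounded_linear[OF matrix_vector_mul_bounded_linear[of X] assms]
  by (simp add: matrix_vector_mult_scaleR)

text \<open>These are the terms in which the space derivative falls on the cut-off; differentiating
  x/R produces the factor 1/R.\<close>

definition forcing :: "('n::finite \<Rightarrow> real^'m^'m) \<Rightarrow> real \<Rightarrow> (real^'n \<Rightarrow> real^'m) \<Rightarrow> real^'n \<Rightarrow> complex^'m" where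
  "forcing A R f \<xi> = (\<Sum>j\<in>UNIV. cmat (A j) *v ((1 / R) *\<^sub>R fourier_L1 (cut (pderiv_at j bump) R f) \<xi>))"

lemma cvec_sum: "cvec (sum f I) = (\<Sum>j\<in>I. cvec (f j))"
  by (rule linear_sum[OF cvec_linear])

lemma cmat_symbol: "cmat (symbol A \<xi>) *v z = (\<Sum>j\<in>UNIV. \<xi> $ j *\<^sub>R (cmat (A j) *v z))"
proof -
  have "cmat (\<Sum>j\<in>I. \<xi> $ j *\<^sub>R A j) *v z = (\<Sum>j\<in>I. \<xi> $ j *\<^sub>R (cmat (A j) *v z))" if "finite I" for I
    using that by induction (simp_all add: cmat_add cmat_scaleR, simp add: vec_eq_iff cmat_nth)
  then show ?thesis by (simp add: symbol_def)
qed

text \<open>Testing the equation with the localised waves \<open>bump (x/R) cos (x \<bullet> \<xi> + a)\<close> gives the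
  transformed equation for \<open>bump (\<sqdot>/R) u\<close> at every single \<open>\<xi>\<close>, up to a forcing term of size \<open>1/R\<close>.\<close>

lemma localized_ode:
  fixes u :: "real \<Rightarrow> real^'n \<Rightarrow> real^'m"
  assumes sol: "cauchy_solution A0 A L u0 u" and B: "B ** A0 = mat 1" and R: "R > 0" and t: "t > 0"
  shows "((\<lambda>t. fourier_L1 (cut bump R (u t)) \<xi>) has_vector_derivative
    gen B A L \<xi> (fourier_L1 (cut bump R (u t)) \<xi>) + cmat B *v forcing A R (u t) \<xi>) (at t)"
proof -
  define c where "c = (2 * pi) powr (- real CARD('n) / 2)"
  define V where "V \<psi> t a = (\<integral>x. wave \<psi> R \<xi> a x *\<^sub>R u t x \<partial>lborel)" for \<psi> t a
  define W where "W t = fourier_L1 (cut bump R (u t)) \<xi>" for t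
  have L2: "in_L2 (u t)" if "t \<ge> 0" for t using sol that by (auto simp: cauchy_solution_def)
  have tb: "test_function (bump :: real^'n \<Rightarrow> real)" by (rule test_function_bump)
  have tp: "test_function (pderiv_at j (bump :: real^'n \<Rightarrow> real))" for j by (rule test_function_pderiv_at[OF tb])
  have int: "integrable lborel (\<lambda>x. wave \<psi> R \<xi> a x *\<^sub>R u t x)" if "test_function \<psi>" "t \<ge> 0" for \<psi> a t
    by (rule test_function_integrable[OF test_function_wave[OF that(1) R] L2[OF that(2)]])
  have W: "W t = c *\<^sub>R wave_pair (V bump t)" if "t \<ge> 0" for t
    unfolding W_def c_def V_def by (rule fourier_L1_cut[OF tb R L2[OF that]])
  define D where "D a = (\<Sum>j\<in>UNIV. A j *v ((1 / R) *\<^sub>R V (pderiv_at j bump) t a + \<xi> $ j *\<^sub>R V bump t (a + pi / 2)))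
    - L *v V bump t a" for a
  have deriv: "((\<lambda>r. A0 *v V bump r a) has_vector_derivative D a) (at t)" for a
  proof -
    let ?\<phi> = "wave bump R \<xi> a"
    have "((\<lambda>r. \<integral>x. ?\<phi> x *\<^sub>R (A0 *v u r x) \<partial>lborel) has_vector_derivative
          (\<Sum>j\<in>UNIV. \<integral>x. pderiv_at j ?\<phi> x *\<^sub>R (A j *v u t x) \<partial>lborel)
          - (\<integral>x. ?\<phi> x *\<^sub>R (L *v u t x) \<partial>lborel)) (at t)"
      using sol test_function_wave[OF tb R] t unfolding cauchy_solution_def by blast
    moreover have "(\<integral>x. pderiv_at j ?\<phi> x *\<^sub>R (A j *v u t x) \<partial>lborel) =
        A j *v ((1 / R) *\<^sub>R V (pderiv_at j bump) t a + \<xi> $ j *\<^sub>R V bump t (a + pi / 2))" for j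
    proof -
      have eq: "pderiv_at j ?\<phi> x *\<^sub>R u t x = (1 / R) *\<^sub>R (wave (pderiv_at j bump) R \<xi> a x *\<^sub>R u t x) +
          \<xi> $ j *\<^sub>R (wave bump R \<xi> (a + pi / 2) x *\<^sub>R u t x)" for x
        unfolding pderiv_at_wave[OF tb] by (simp add: scaleR_add_left)
      have "integrable lborel (\<lambda>x. pderiv_at j ?\<phi> x *\<^sub>R u t x)"
        unfolding eq using int[OF tp] int[OF tb] t by (intro Bochner_Integration.integrable_add integrable_scaleR_right) auto
      then have "(\<integral>x. pderiv_at j ?\<phi> x *\<^sub>R (A j *v u t x) \<partial>lborel) = A j *v (\<integral>x. pderiv_at j ?\<phi> x *\<^sub>R u t x \<partial>lborel)"
        by (rule integral_scaleR_matrix)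
      also have "(\<integral>x. pderiv_at j ?\<phi> x *\<^sub>R u t x \<partial>lborel) = (1 / R) *\<^sub>R V (pderiv_at j bump) t a + \<xi> $ j *\<^sub>R V bump t (a + pi / 2)"
      proof -
        have i1: "integrable lborel (\<lambda>x. (1 / R) *\<^sub>R (wave (pderiv_at j bump) R \<xi> a x *\<^sub>R u t x))"
          using int[OF tp] t by (intro integrable_scaleR_right) auto
        have i2: "integrable lborel (\<lambda>x. \<xi> $ j *\<^sub>R (wave bump R \<xi> (a + pi / 2) x *\<^sub>R u t x))"
          using int[OF tb] t by (intro integrable_scaleR_right) auto
        show ?thesis unfolding eq V_def Bochner_Integration.integral_add[OF i1 i2] by (simp only: integral_scaleR_right)
      qed
      finally show ?thesis .
    qed
    moreover have "(\<integral>x. ?\<phi> x *\<^sub>R (L *v u t x) \<partial>lborel) = L *v V bump t a"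
      unfolding V_def using int[OF tb] t by (intro integral_scaleR_matrix) auto
    ultimately have dv: "((\<lambda>r. \<integral>x. ?\<phi> x *\<^sub>R (A0 *v u r x) \<partial>lborel) has_vector_derivative D a) (at t)"
      by (simp add: D_def)
    have eq0: "(\<integral>x. ?\<phi> x *\<^sub>R (A0 *v u r x) \<partial>lborel) = A0 *v V bump r a" if "r > 0" for r
      unfolding V_def using int[OF tb] that by (intro integral_scaleR_matrix) auto
    show ?thesis
      by (rule has_vector_derivative_transform_within_open[OF dv, of "{0<..}"]) (use t eq0 in auto)
  qed
  have B': "B *v (A0 *v x) = x" for x by (simp add: matrix_vector_mul_assoc B)
  have "((\<lambda>r. B *v (A0 *v V bump r a)) has_vector_derivative B *v D a) (at t)" for a
    by (rule bounded_linear.has_vector_derivative[OF matrix_vector_mul_bounded_linear deriv])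
  then have Vd: "((\<lambda>r. V bump r a) has_vector_derivative B *v D a) (at t)" for a
    by (simp only: B')
  have "((\<lambda>r. c *\<^sub>R wave_pair (V bump r)) has_vector_derivative c *\<^sub>R wave_pair (\<lambda>a. B *v D a)) (at t)"
    unfolding wave_pair_def
    by (intro bounded_linear.has_vector_derivative[OF bounded_linear_scaleR_right] has_vector_derivative_add
        bounded_linear.has_vector_derivative[OF i_smult_bounded_linear] bounded_linear.has_vector_derivative[OF cvec_bounded_linear] Vd)
  then have "(W has_vector_derivative c *\<^sub>R wave_pair (\<lambda>a. B *v D a)) (at t)"
    by (rule has_vector_derivative_transform_within_open[of _ _ _ "{0<..}"]) (use t W in auto)
  moreover have "c *\<^sub>R wave_pair (\<lambda>a. B *v D a) = gen B A L \<xi> (W t) + cmat B *v forcing A R (u t) \<xi>"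
  proof -
    \<comment> \<open>A phase shift by \<pi> changes the sign, hence a shift by \<pi>/2 acts on the
      paired complex vector as multiplication by - i. In this way the derivative of the cosine
      becomes the factor in front of the symbol.\<close>
    have pi2: "V bump t (pi / 2 + pi / 2) = - V bump t 0"
      using wave_plus_pi[of bump R \<xi> 0] by (simp add: V_def)
    have Wt: "W t = c *\<^sub>R (cvec (V bump t 0) + \<i> *s cvec (V bump t (pi / 2)))"
      using W t by (simp add: wave_pair_def)
    have "c *\<^sub>R wave_pair (\<lambda>a. B *v D a) = cmat B *v (c *\<^sub>R (cvec (D 0) + \<i> *s cvec (D (pi / 2))))"
      by (simp add: wave_pair_def cmat_cvec cmat_scaleR_right cmat_add_right cmat_mult_i)
    moreover have "c *\<^sub>R (cvec (D 0) + \<i> *s cvec (D (pi / 2))) =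
      - (\<i> *s (cmat (symbol A \<xi>) *v W t) + cmat L *v W t) + forcing A R (u t) \<xi>"
    proof -
      let ?V = "\<lambda>j. V (pderiv_at j bump) t"
      have F: "fourier_L1 (cut (pderiv_at j bump) R (u t)) \<xi> = c *\<^sub>R (cvec (?V j 0) + \<i> *s cvec (?V j (pi / 2)))" for j
        using fourier_L1_cut[OF tp R L2, of t] t unfolding c_def V_def wave_pair_def by simp
      have DD: "cvec (D a) = (\<Sum>j\<in>UNIV. (1 / R) *\<^sub>R (cmat (A j) *v cvec (?V j a)) + \<xi> $ j *\<^sub>R (cmat (A j) *v cvec (V bump t (a + pi / 2))))
          - cmat L *v cvec (V bump t a)" for a
        by (simp add: D_def linear_diff[OF cvec_linear] cvec_sum cmat_cvec[symmetric] linear_add[OF cvec_linear]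
            linear_scale[OF cvec_linear] cmat_add_right cmat_scaleR_right)
      have "c *\<^sub>R (cvec (D 0) + \<i> *s cvec (D (pi / 2))) =
        (\<Sum>j\<in>UNIV. cmat (A j) *v ((1 / R) *\<^sub>R (c *\<^sub>R (cvec (?V j 0) + \<i> *s cvec (?V j (pi / 2)))))) +
        (\<Sum>j\<in>UNIV. \<xi> $ j *\<^sub>R (cmat (A j) *v (c *\<^sub>R (cvec (V bump t (pi / 2)) - \<i> *s cvec (V bump t 0)))))
        - cmat L *v (c *\<^sub>R (cvec (V bump t 0) + \<i> *s cvec (V bump t (pi / 2))))"
        unfolding DD pi2
        by (simp add: linear_neg[OF cvec_linear] linear_diff[OF i_smult_linear] linear_sum[OF i_smult_linear]
            linear_add[OF i_smult_linear] linear_scale[OF i_smult_linear] linear_neg[OF i_smult_linear]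
            cmat_add_right cmat_scaleR_right cmat_uminus_right cmat_mult_i linear_diff[OF cmat_linear]
            scaleR_add_right scaleR_diff_right scaleR_sum_right sum.distrib sum_subtractf algebra_simps sum_negf)
      also have "c *\<^sub>R (cvec (V bump t (pi / 2)) - \<i> *s cvec (V bump t 0)) = - (\<i> *s W t)"
        by (simp add: Wt linear_scale[OF i_smult_linear] linear_add[OF i_smult_linear] i_i_smult scaleR_diff_right scaleR_add_right)
      also have "(\<Sum>j\<in>UNIV. \<xi> $ j *\<^sub>R (cmat (A j) *v (- (\<i> *s W t)))) = - (\<i> *s (cmat (symbol A \<xi>) *v W t))"
        unfolding cmat_symbol[symmetric] by (simp add: cmat_uminus_right cmat_mult_i)
      finally show ?thesis by (simp add: forcing_def F Wt)
    qed
    ultimately show ?thesis by (simp add: gen_def cmat_add_right cmat_uminus_right linear_diff[OF cmat_linear])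
  qed
  ultimately show ?thesis by (simp add: W_def[abs_def])
qed


lemma forced_gronwall:
  fixes E g :: "real \<Rightarrow> real"
  assumes E: "continuous_on {0..t} E" and g: "continuous_on {0..t} g" "\<And>s. s \<in> {0..t} \<Longrightarrow> g s \<ge> 0"
    and deriv: "\<And>s. 0 < s \<Longrightarrow> s < t \<Longrightarrow> (E has_real_derivative E' s) (at s)"
    and le: "\<And>s. 0 < s \<Longrightarrow> s < t \<Longrightarrow> E' s \<le> k * E s + g s"
    and E0: "E 0 = 0" and k: "k \<ge> 0" and t: "t \<ge> 0"
  shows "E t \<le> exp (k * t) * integral {0..t} g"
proof -
  let ?F = "\<lambda>s. exp (- k * s) * E s - integral {0..s} g"
  have "?F t \<le> ?F 0"
  proof (rule DERIV_nonpos_imp_decreasing_open[OF t])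
    fix s :: real assume s: "0 < s" "s < t"
    have "((\<lambda>x. integral {0..x} g) has_real_derivative g s) (at s within {0..t})"
      using s by (intro integral_has_real_derivative g) auto
    then have 1: "((\<lambda>x. integral {0..x} g) has_real_derivative g s) (at s)"
      using s at_within_interior[of s "{0..t}"] by simp
    have "((\<lambda>s. exp (- k * s) * E s) has_real_derivative (exp (- k * s) * - k) * E s + E' s * exp (- k * s)) (at s)"
      by (rule DERIV_mult[OF _ deriv[OF s]]) (auto intro!: derivative_eq_intros)
    from DERIV_diff[OF this 1]
    have "(?F has_real_derivative (exp (- k * s) * - k) * E s + E' s * exp (- k * s) - g s) (at s)" .
    moreover have "(exp (- k * s) * - k) * E s + E' s * exp (- k * s) - g s \<le> 0"
    proof -
      have "exp (- k * s) * (E' s - k * E s) \<le> exp (- k * s) * g s"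
        using le[OF s] by (intro mult_left_mono) auto
      also have "\<dots> \<le> 1 * g s" using g(2)[of s] s k by (intro mult_right_mono) auto
      finally show ?thesis by (simp add: algebra_simps)
    qed
    ultimately show "\<exists>y. (?F has_real_derivative y) (at s) \<and> y \<le> 0" by blast
  next
    show "continuous_on {0..t} ?F"
      by (intro continuous_on_diff continuous_on_mult E continuous_intros
          indefinite_integral_continuous_1 integrable_continuous_interval g)
  qed
  then have "exp (k * t) * (exp (- k * t) * E t) \<le> exp (k * t) * integral {0..t} g"
    using E0 by (intro mult_left_mono) auto
  then show ?thesis by (simp add: mult.assoc[symmetric] flip: exp_add)
qed

lemma nn_integral_Icc:
  fixes g :: "real \<Rightarrow> real"
  assumes g: "continuous_on {0..t} g" "\<And>s. s \<in> {0..t} \<Longrightarrow> g s \<ge> 0"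
  shows "(\<integral>\<^sup>+s. ennreal (indicator {0..t} s * g s) \<partial>lborel) = ennreal (integral {0..t} g)"
proof -
  have si: "set_integrable lborel {0..t} g" by (rule borel_integrable_atLeastAtMost'[OF g(1)])
  then have "integrable lborel (\<lambda>s. indicator {0..t} s * g s)" by (simp add: set_integrable_def)
  then have "(\<integral>\<^sup>+s. ennreal (indicator {0..t} s * g s) \<partial>lborel) = ennreal (\<integral>s. indicator {0..t} s * g s \<partial>lborel)"
    by (rule nn_integral_eq_integral) (use g(2) in \<open>auto simp: indicator_def\<close>)
  also have "(\<integral>s. indicator {0..t} s * g s \<partial>lborel) = integral {0..t} g"
    using set_borel_integral_eq_integral(2)[OF si] by (simp add: set_lebesgue_integral_def)
  finally show ?thesis .
qed

text \<open>The increment is split into a change of time at fixed frequency, small uniformly in the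
  frequency by \<open>fourier_cut_bound\<close>, and a change of frequency at fixed time. Joint
  continuity later makes the forcing measurable in (s, \<xi>), so that the order of integration can
  be exchanged.\<close>

lemma fourier_cut_jointly_continuous:
  fixes u :: "real \<Rightarrow> real^'n \<Rightarrow> real^'m"
  assumes \<psi>: "test_function \<psi>" "R > 0" and L2: "\<And>t. t \<ge> 0 \<Longrightarrow> in_L2 (u t)"
    and cont: "\<And>t. t \<ge> 0 \<Longrightarrow> ((\<lambda>r. norm_L2 (\<lambda>x. u r x - u t x)) \<longlongrightarrow> 0) (at t within {0..})"
  shows "continuous_on ({0..} \<times> UNIV) (\<lambda>w. fourier_L1 (cut \<psi> R (u (fst w))) (snd w))"
proof -
  let ?H = "\<lambda>t \<xi>. fourier_L1 (cut \<psi> R (u t)) \<xi>"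
  obtain K where K: "K \<ge> 0" "\<And>f :: real^'n \<Rightarrow> real^'m. \<And>\<xi>. in_L2 f \<Longrightarrow> norm (fourier_L1 (cut \<psi> R f) \<xi>) \<le> K * norm_L2 f"
    using fourier_cut_bound[OF \<psi>] by blast
  show ?thesis unfolding continuous_on_sequentially comp_def
  proof (intro ballI allI impI, elim conjE)
    fix X and p :: "real \<times> (real^'n)"
    assume p: "p \<in> {0..} \<times> UNIV" and X: "\<forall>n. X n \<in> {0..} \<times> UNIV" "X \<longlonglongrightarrow> p"
    let ?m = "\<lambda>r. norm_L2 (\<lambda>x. u r x - u (fst p) x)"
    have p0: "fst p \<ge> 0" and X0: "fst (X n) \<ge> 0" for n using p X(1) by (auto simp: mem_Times_iff)
    have "?m (fst p) = 0" by (simp add: norm_L2_def)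
    then have "continuous (at (fst p) within {0..}) ?m"
      using cont[OF p0] by (simp add: continuous_within)
    moreover have "(\<lambda>n. fst (X n)) \<longlonglongrightarrow> fst p" by (intro tendsto_fst X)
    ultimately have "(\<lambda>n. ?m (fst (X n))) \<longlonglongrightarrow> ?m (fst p)"
      using X0 by (intro continuous_within_tendsto_compose'[of "fst p" "{0..}" ?m]) auto
    then have "(\<lambda>n. K * ?m (fst (X n))) \<longlonglongrightarrow> K * 0"
      using \<open>?m (fst p) = 0\<close> by (intro tendsto_mult tendsto_const) simp
    then have lim0: "(\<lambda>n. K * ?m (fst (X n))) \<longlonglongrightarrow> 0" by simp
    have "(\<lambda>n. ?H (fst (X n)) (snd (X n)) - ?H (fst p) (snd (X n))) \<longlonglongrightarrow> 0"
    proof (rule tendsto_norm_zero_cancel, rule tendsto_0_le[OF lim0, of _ 1])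
      show "\<forall>\<^sub>F n in sequentially. norm (norm (?H (fst (X n)) (snd (X n)) - ?H (fst p) (snd (X n)))) \<le> norm (K * ?m (fst (X n))) * 1"
      proof (intro always_eventually allI)
        fix n
        have "?H (fst (X n)) (snd (X n)) - ?H (fst p) (snd (X n)) = fourier_L1 (cut \<psi> R (\<lambda>x. u (fst (X n)) x - u (fst p) x)) (snd (X n))"
          using fourier_L1_diff[OF cut_integrable[OF \<psi> L2[OF X0[of n]]] cut_integrable[OF \<psi> L2[OF p0]]]
          by (simp add: cut_diff)
        then show "norm (norm (?H (fst (X n)) (snd (X n)) - ?H (fst p) (snd (X n)))) \<le> norm (K * ?m (fst (X n))) * 1"
          using K(2)[OF in_L2_diff[OF L2[OF X0[of n]] L2[OF p0]]] K(1) by (simp add: norm_L2_nonneg abs_mult)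
      qed
    qed
    moreover have "(\<lambda>n. ?H (fst p) (snd (X n))) \<longlonglongrightarrow> ?H (fst p) (snd p)"
      using fourier_L1_continuous[OF cut_integrable[OF \<psi> L2[OF p0]]] tendsto_snd[OF X(2)]
      by (auto simp: continuous_on_sequentially comp_def)
    ultimately have "(\<lambda>n. ?H (fst (X n)) (snd (X n)) - ?H (fst p) (snd (X n)) + ?H (fst p) (snd (X n))) \<longlonglongrightarrow> 0 + ?H (fst p) (snd p)"
      by (rule tendsto_add)
    then show "(\<lambda>n. ?H (fst (X n)) (snd (X n))) \<longlonglongrightarrow> ?H (fst p) (snd p)" by simp
  qed
qed

text \<open>Continuity in time bounds the norm near each instant, and the bisection principle glues
  the local bounds over a compact interval.\<close>

lemma nsq_locally_bounded:
  fixes u :: "real \<Rightarrow> real^'n \<Rightarrow> real^'m"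
  assumes L2: "\<And>t. t \<ge> 0 \<Longrightarrow> in_L2 (u t)"
    and cont: "\<And>t. t \<ge> 0 \<Longrightarrow> ((\<lambda>r. norm_L2 (\<lambda>x. u r x - u t x)) \<longlongrightarrow> 0) (at t within {0..})"
    and t: "t \<ge> 0"
  obtains M where "\<And>s. s \<in> {0..t} \<Longrightarrow> nsq (u s) \<le> ennreal M"
proof -
  define P where "P a b \<longleftrightarrow> (\<exists>M. \<forall>s\<in>{a..b} \<inter> {0..}. nsq (u s) \<le> ennreal M)" for a b
  have "P 0 t" using t
  proof (induction rule: Bolzano)
    case (trans a b c)
    then obtain M N where "\<forall>s\<in>{a..b} \<inter> {0..}. nsq (u s) \<le> ennreal M" "\<forall>s\<in>{b..c} \<inter> {0..}. nsq (u s) \<le> ennreal N"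
      by (auto simp: P_def)
    then have "\<forall>s\<in>{a..c} \<inter> {0..}. nsq (u s) \<le> ennreal (max M N)"
      by (metis (no_types, lifting) Int_iff atLeastAtMost_iff ennreal_leI linear max.cobounded1 max.cobounded2 order_trans)
    then show ?case by (auto simp: P_def)
  next
    case (local x)
    then have x: "x \<ge> 0" by simp
    have "\<forall>\<^sub>F r in at x within {0..}. norm_L2 (\<lambda>y. u r y - u x y) < 1"
      using order_tendstoD(2)[OF cont[OF x], of 1] by simp
    then obtain d where d: "d > 0" "\<And>r. r \<ge> 0 \<Longrightarrow> r \<noteq> x \<Longrightarrow> dist r x < d \<Longrightarrow> norm_L2 (\<lambda>y. u r y - u x y) < 1"
      unfolding eventually_at by auto
    have bound: "nsq (u r) \<le> ennreal (2 * (norm_L2 (u x))\<^sup>2 + 2)" if r: "r \<ge> 0" "dist r x < d" for r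
    proof -
      have n1: "norm_L2 (\<lambda>y. u r y - u x y) \<le> 1"
        using d(2)[OF r(1) _ r(2)] by (cases "r = x") (auto simp: norm_L2_def)
      have "nsq (u r) \<le> 2 * nsq (u x) + 2 * nsq (\<lambda>y. u r y - u x y)"
        using L2[OF x] L2[OF r(1)] in_L2_diff[OF L2[OF r(1)] L2[OF x]] norm_triangle_ineq
        by (intro nsq_add_le) (auto simp: in_L2_iff norm_triangle_sub)
      also have "nsq (\<lambda>y. u r y - u x y) \<le> ennreal 1"
        using power_le_one[OF norm_L2_nonneg n1, of 2] by (simp add: nsq_eq_norm_L2[OF in_L2_diff[OF L2[OF r(1)] L2[OF x]]])
      then have "2 * nsq (u x) + 2 * nsq (\<lambda>y. u r y - u x y) \<le> 2 * nsq (u x) + 2 * ennreal 1"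
        by (intro add_left_mono mult_left_mono) auto
      also have "\<dots> = ennreal (2 * (norm_L2 (u x))\<^sup>2 + 2)"
        by (simp add: nsq_eq_norm_L2[OF L2[OF x]] ennreal_mult' ennreal_plus)
      finally show ?thesis .
    qed
    show ?case
    proof (intro exI[of _ d] conjI allI impI d(1))
      fix a b assume ab: "a \<le> x \<and> x \<le> b \<and> b - a < d"
      then have "\<forall>s\<in>{a..b} \<inter> {0..}. nsq (u s) \<le> ennreal (2 * (norm_L2 (u x))\<^sup>2 + 2)"
        by (intro ballI bound) (auto simp: dist_real_def)
      then show "P a b" unfolding P_def by blast
    qed
  qed
  then obtain M where "\<forall>s\<in>{0..t} \<inter> {0..}. nsq (u s) \<le> ennreal M" unfolding P_def by blast
  then show ?thesis by (intro that[of M]) auto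
qed

lemma nsq_sum_le:
  fixes F :: "'j \<Rightarrow> 'a::euclidean_space \<Rightarrow> 'b::real_normed_vector"
  assumes fin: "finite J" and "\<And>j. j \<in> J \<Longrightarrow> F j \<in> borel_measurable borel" and le: "\<And>x. norm (g x) \<le> a * (\<Sum>j\<in>J. norm (F j x))" and a: "a \<ge> 0"
  shows "nsq g \<le> ennreal (a\<^sup>2 * card J) * (\<Sum>j\<in>J. nsq (F j))"
proof -
  have "nsq g \<le> (\<integral>\<^sup>+x. ennreal (a\<^sup>2 * card J) * (\<Sum>j\<in>J. ennreal ((norm (F j x))\<^sup>2)) \<partial>lborel)"
    unfolding nsq_def
  proof (rule nn_integral_mono)
    fix x
    have "(norm (g x))\<^sup>2 \<le> (a * (\<Sum>j\<in>J. norm (F j x)))\<^sup>2" by (intro power_mono le) auto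
    also have "\<dots> \<le> a\<^sup>2 * ((\<Sum>j\<in>J. (norm (F j x))\<^sup>2) * card J)"
      unfolding power_mult_distrib by (intro mult_left_mono sum_squared_le_sum_of_squares) auto
    finally have "ennreal ((norm (g x))\<^sup>2) \<le> ennreal ((a\<^sup>2 * card J) * (\<Sum>j\<in>J. (norm (F j x))\<^sup>2))"
      by (intro ennreal_leI) (simp add: mult_ac)
    also have "\<dots> = ennreal (a\<^sup>2 * card J) * (\<Sum>j\<in>J. ennreal ((norm (F j x))\<^sup>2))"
      by (simp add: ennreal_mult sum_nonneg sum_ennreal)
    finally show "ennreal ((norm (g x))\<^sup>2) \<le> ennreal (a\<^sup>2 * card J) * (\<Sum>j\<in>J. ennreal ((norm (F j x))\<^sup>2))" .
  qed
  also have "\<dots> = ennreal (a\<^sup>2 * card J) * (\<Sum>j\<in>J. nsq (F j))"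
    unfolding nsq_def using assms(2) by (subst nn_integral_cmult, simp) (subst nn_integral_sum, auto)
  finally show ?thesis .
qed

text \<open>Bessel's inequality for each localised function
  \<open>cut (pderiv_at j bump) R f\<close>; the derivatives of the cut-off are bounded, so the
  factor 1/R is all that depends on R.\<close>

lemma nsq_forcing:
  fixes A :: "'n::finite \<Rightarrow> real^'m^'m"
  obtains C where "C \<ge> 0" "\<And>R (f :: real^'n \<Rightarrow> real^'m). R > 0 \<Longrightarrow> in_L2 f \<Longrightarrow> nsq (forcing A R f) \<le> ennreal (C / R\<^sup>2) * nsq f"
proof -
  have tp: "test_function (pderiv_at j (bump :: real^'n \<Rightarrow> real))" for j
    by (rule test_function_pderiv_at[OF test_function_bump])
  have "\<exists>M. \<forall>j. M j \<ge> 0 \<and> (\<forall>x. \<bar>pderiv_at j (bump :: real^'n \<Rightarrow> real) x\<bar> \<le> M j)"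
    using test_function_bounded[OF tp] by metis
  then obtain M where M: "\<And>j. M j \<ge> 0" "\<And>j x. \<bar>pderiv_at j (bump :: real^'n \<Rightarrow> real) x\<bar> \<le> M j" by blast
  define a where "a = (\<Sum>j\<in>UNIV. mat_bound (A j))"
  have a: "a \<ge> 0" "mat_bound (A j) \<le> a" for j
    unfolding a_def by (auto intro!: sum_nonneg mat_bound_nonneg member_le_sum)
  show ?thesis
  proof (rule that)
    let ?C = "a\<^sup>2 * real CARD('n) * (\<Sum>j\<in>UNIV. (M j)\<^sup>2)"
    show "?C \<ge> 0" by (intro mult_nonneg_nonneg sum_nonneg) auto
    fix R :: real and f :: "real^'n \<Rightarrow> real^'m" assume R: "R > 0" and f: "in_L2 f"
    let ?F = "\<lambda>j. fourier_L1 (cut (pderiv_at j bump) R f)"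
    have "nsq (forcing A R f) \<le> ennreal ((a / R)\<^sup>2 * card (UNIV :: 'n set)) * (\<Sum>j\<in>UNIV. nsq (?F j))"
    proof (rule nsq_sum_le)
      show "?F j \<in> borel_measurable borel" for j by (rule fourier_L1_measurable[OF cut_integrable[OF tp R f]])
      show "norm (forcing A R f \<xi>) \<le> a / R * (\<Sum>j\<in>UNIV. norm (?F j \<xi>))" for \<xi>
      proof -
        have "norm (forcing A R f \<xi>) \<le> (\<Sum>j\<in>UNIV. a * (1 / R * norm (?F j \<xi>)))"
          unfolding forcing_def
        proof (rule order_trans[OF norm_sum], rule sum_mono)
          fix j
          have "norm (cmat (A j) *v ((1 / R) *\<^sub>R ?F j \<xi>)) \<le> mat_bound (A j) * norm ((1 / R) *\<^sub>R ?F j \<xi>)" by (rule norm_cmat_le)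
          also have "\<dots> \<le> a * norm ((1 / R) *\<^sub>R ?F j \<xi>)" by (intro mult_right_mono a) auto
          finally show "norm (cmat (A j) *v ((1 / R) *\<^sub>R ?F j \<xi>)) \<le> a * (1 / R * norm (?F j \<xi>))" using R by simp
        qed
        then show ?thesis by (simp add: sum_distrib_left)
      qed
      show "a / R \<ge> 0" using a R by simp
    qed simp
    also have "\<dots> \<le> ennreal ((a / R)\<^sup>2 * card (UNIV :: 'n set)) * (ennreal (\<Sum>j\<in>UNIV. (M j)\<^sup>2) * nsq f)"
    proof (rule mult_left_mono)
      have "(\<Sum>j\<in>UNIV. nsq (?F j)) \<le> (\<Sum>j\<in>UNIV. ennreal ((M j)\<^sup>2) * nsq f)"
        by (intro sum_mono order_trans[OF fourier_L1_Bessel[OF cut_integrable[OF tp R f]]] nsq_cut_le tp f M)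
      also have "\<dots> = ennreal (\<Sum>j\<in>UNIV. (M j)\<^sup>2) * nsq f"
        by (simp add: sum_distrib_right[symmetric] sum_ennreal)
      finally show "(\<Sum>j\<in>UNIV. nsq (?F j)) \<le> ennreal (\<Sum>j\<in>UNIV. (M j)\<^sup>2) * nsq f" .
    qed simp
    also have "\<dots> = ennreal (?C / R\<^sup>2) * nsq f"
    proof -
      have "?C / R\<^sup>2 = ((a / R)\<^sup>2 * card (UNIV :: 'n set)) * (\<Sum>j\<in>UNIV. (M j)\<^sup>2)"
        by (simp add: power_divide)
      then have "ennreal (?C / R\<^sup>2) = ennreal ((a / R)\<^sup>2 * card (UNIV :: 'n set)) * ennreal (\<Sum>j\<in>UNIV. (M j)\<^sup>2)"
        by (simp only: ennreal_mult sum_nonneg zero_le_power2 mult_nonneg_nonneg of_nat_0_le_iff)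
      then show ?thesis by (simp only: mult.assoc)
    qed
    finally show "nsq (forcing A R f) \<le> ennreal (?C / R\<^sup>2) * nsq f" .
  qed
qed

text \<open>At each frequency the defect starts from 0 and solves the transformed system with the
  forcing term. The energy <A0 w, w> together with Gronwall's inequality bounds it by the time
  integral of the squared forcing; integrating over the frequencies and exchanging the integrals
  leaves a bound O(1/R^2). The constant may depend on \<open>t\<close>, since only R tends to
  infinity.\<close>

lemma nsq_defect:
  fixes u :: "real \<Rightarrow> real^'n \<Rightarrow> real^'m"
  assumes A: "cond_A A0 A L" and B: "A0 ** B = mat 1" "B ** A0 = mat 1"
    and sol: "cauchy_solution A0 A L u0 u" and t: "t \<ge> 0"
  obtains C where "C \<ge> 0" "\<And>R. R > 0 \<Longrightarrow>
    nsq (\<lambda>\<xi>. fourier_L1 (cut bump R (u t)) \<xi> - flow B A L \<xi> t (fourier_L1 (cut bump R (u 0)) \<xi>)) \<le> ennreal (C / R\<^sup>2)"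
proof -
  have L2: "in_L2 (u t)" if "t \<ge> 0" for t using sol that by (auto simp: cauchy_solution_def)
  have cont: "((\<lambda>r. norm_L2 (\<lambda>x. u r x - u t x)) \<longlongrightarrow> 0) (at t within {0..})" if "t \<ge> 0" for t
    using sol that by (auto simp: cauchy_solution_def)
  have tb: "test_function (bump :: real^'n \<Rightarrow> real)" by (rule test_function_bump)
  have tp: "test_function (pderiv_at j (bump :: real^'n \<Rightarrow> real))" for j by (rule test_function_pderiv_at[OF tb])
  obtain M where M: "\<And>s. s \<in> {0..t} \<Longrightarrow> nsq (u s) \<le> ennreal M"
    using nsq_locally_bounded[OF L2 cont t] by blast
  obtain c0 where c0: "c0 > 0" "\<And>z. (cmat A0 *v z) \<bullet> z \<ge> c0 * (norm z)\<^sup>2"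
    using cond_A_coercive[OF A] by blast
  obtain CF where CF: "CF \<ge> 0" "\<And>R (f :: real^'n \<Rightarrow> real^'m). R > 0 \<Longrightarrow> in_L2 f \<Longrightarrow> nsq (forcing A R f) \<le> ennreal (CF / R\<^sup>2) * nsq f"
    using nsq_forcing[of A] by blast
  have symA0: "transpose A0 = A0" and symA: "transpose (symbol A \<xi>) = symbol A \<xi>" for \<xi>
    using A by (auto simp: cond_A_def intro: transpose_symbol)
  have Lnn: "(cmat L *v z) \<bullet> z \<ge> 0" for z
    using A by (auto simp: cond_A_def nonneg_on_def inner_complex_vec)
  \<comment> \<open>The inverse coercivity constant of \<open>A0\<close>: it turns |w|^2, left over
    from Young's inequality for the forcing, into a multiple of the energy.\<close>
  define k where "k = 1 / c0"
  have k: "k > 0" using c0 by (simp add: k_def)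
  define N where "N = max M 0"
  show ?thesis
  proof (rule that)
    show "exp (k * t) / c0 * (CF * N * t) \<ge> 0" using c0 CF t by (auto simp: N_def)
    fix R :: real assume R: "R > 0"
    define W where "W s \<xi> = fourier_L1 (cut bump R (u s)) \<xi>" for s \<xi>
    define w where "w s \<xi> = W s \<xi> - flow B A L \<xi> s (W 0 \<xi>)" for s \<xi>
    define G where "G s \<xi> = forcing A R (u s) \<xi>" for s \<xi>
    have W_cont: "continuous_on ({0..} \<times> UNIV) (\<lambda>w. W (fst w) (snd w))"
      unfolding W_def by (rule fourier_cut_jointly_continuous[OF tb R L2 cont])
    have G_cont: "continuous_on ({0..} \<times> UNIV) (\<lambda>w. G (fst w) (snd w))"
      unfolding G_def forcing_def
      by (intro continuous_on_sum continuous_on_cmat continuous_on_const continuous_on_scaleR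
          fourier_cut_jointly_continuous[OF tp R L2 cont])
    have cont_slice: "continuous_on {0..} (\<lambda>s. H s \<xi>)" if "continuous_on ({0..} \<times> UNIV) (\<lambda>w. H (fst w) (snd w))"
      for H :: "real \<Rightarrow> real^'n \<Rightarrow> complex^'m" and \<xi>
    proof -
      have "continuous_on {0..} (\<lambda>s. (s, \<xi>))" by (intro continuous_intros)
      from continuous_on_compose2[OF that this] show ?thesis by auto
    qed
    have g_cont: "continuous_on {0..} (\<lambda>s. (norm (G s \<xi>))\<^sup>2)" for \<xi>
      by (intro continuous_intros cont_slice G_cont)
    have w_bound: "(norm (w t \<xi>))\<^sup>2 \<le> exp (k * t) / c0 * integral {0..t} (\<lambda>s. (norm (G s \<xi>))\<^sup>2)" for \<xi>
    proof -
      define w' where "w' s = gen B A L \<xi> (w s \<xi>) + cmat B *v G s \<xi>" for s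
      have dw: "((\<lambda>s. w s \<xi>) has_vector_derivative w' s) (at s)" if "s > 0" for s
      proof -
        have "((\<lambda>s. w s \<xi>) has_vector_derivative (gen B A L \<xi> (W s \<xi>) + cmat B *v G s \<xi>) - gen B A L \<xi> (flow B A L \<xi> s (W 0 \<xi>))) (at s)"
          unfolding w_def W_def G_def
          by (intro has_vector_derivative_diff localized_ode[OF sol B(2) R that] flow_has_vector_derivative)
        then show ?thesis by (simp add: w'_def w_def linear_diff[OF gen_linear] algebra_simps)
      qed
      have Aw': "cmat A0 *v w' s = - (\<i> *s (cmat (symbol A \<xi>) *v w s \<xi>) + cmat L *v w s \<xi>) + G s \<xi>" for s
        unfolding w'_def cmat_add_right cmat_gen[OF B(1)] by (simp add: B cmat_mat_1 flip: cmat_mult)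
      let ?E = "\<lambda>s. (cmat A0 *v w s \<xi>) \<bullet> w s \<xi>"
      have "?E t \<le> exp (k * t) * integral {0..t} (\<lambda>s. (norm (G s \<xi>))\<^sup>2)"
      proof (rule forced_gronwall[OF _ _ _ _ _ _ less_imp_le[OF k] t])
        have fl: "continuous_on {0..} (\<lambda>s. flow B A L \<xi> s (W 0 \<xi>))"
          unfolding continuous_on_eq_continuous_within
          by (intro ballI has_vector_derivative_continuous[OF flow_has_vector_derivative])
        have "continuous_on {0..} (\<lambda>s. w s \<xi>)"
          unfolding w_def by (rule continuous_on_diff[OF cont_slice[OF W_cont] fl])
        then have "continuous_on {0..t} (\<lambda>s. w s \<xi>)" by (rule continuous_on_subset) auto
        then show "continuous_on {0..t} ?E" by (intro continuous_on_inner continuous_on_cmat continuous_on_const)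
        show "continuous_on {0..t} (\<lambda>s. (norm (G s \<xi>))\<^sup>2)" by (rule continuous_on_subset[OF g_cont]) auto
        show "?E 0 = 0" by (simp add: w_def)
        fix s assume s: "0 < s" "s < t"
        show "(?E has_real_derivative 2 * ((cmat A0 *v w' s) \<bullet> w s \<xi>)) (at s)"
          by (rule quadratic_form_derivative[OF cmat_linear _ dw[OF s(1)]]) (simp add: inner_cmat_left symA0)
        have "(cmat A0 *v w' s) \<bullet> w s \<xi> = - ((cmat L *v w s \<xi>) \<bullet> w s \<xi>) + G s \<xi> \<bullet> w s \<xi>"
          using inner_i_symmetric[OF symA, of \<xi> "w s \<xi>"] by (simp add: Aw' inner_add_left inner_diff_left)
        then have "2 * ((cmat A0 *v w' s) \<bullet> w s \<xi>) \<le> 2 * (norm (G s \<xi>) * norm (w s \<xi>))"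
          using Lnn[of "w s \<xi>"] norm_cauchy_schwarz[of "G s \<xi>" "w s \<xi>"] by linarith
        also have "\<dots> \<le> (norm (G s \<xi>))\<^sup>2 + (norm (w s \<xi>))\<^sup>2"
          using sum_squares_bound[of "norm (G s \<xi>)" "norm (w s \<xi>)"] by simp
        also have "(norm (w s \<xi>))\<^sup>2 \<le> k * ?E s" using c0 by (simp add: k_def field_simps)
        finally show "2 * ((cmat A0 *v w' s) \<bullet> w s \<xi>) \<le> k * ?E s + (norm (G s \<xi>))\<^sup>2" by simp
      qed auto
      with c0(2)[of "w t \<xi>"] have "c0 * (norm (w t \<xi>))\<^sup>2 \<le> exp (k * t) * integral {0..t} (\<lambda>s. (norm (G s \<xi>))\<^sup>2)"
        by linarith
      then show ?thesis using c0(1) by (simp add: field_simps)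
    qed
    define h where "h = (\<lambda>(s, \<xi>). ennreal (indicator {0..t} s * (norm (G s \<xi>))\<^sup>2))"
    have h_meas: "h \<in> borel_measurable (lborel \<Otimes>\<^sub>M lborel)"
    proof -
      have "continuous_on ({0..t} \<times> UNIV) (\<lambda>w. (norm (G (fst w) (snd w)))\<^sup>2)"
        by (intro continuous_intros continuous_on_subset[OF G_cont]) auto
      moreover have "{0..t} \<times> (UNIV :: (real^'n) set) \<in> sets borel"
        by (intro borel_closed closed_Times) auto
      ultimately have "(\<lambda>w. indicator ({0..t} \<times> UNIV) w *\<^sub>R (norm (G (fst w) (snd w)))\<^sup>2) \<in> borel_measurable borel"
        using borel_measurable_continuous_on_indicator by blast
      then have "(\<lambda>w. ennreal (indicator ({0..t} \<times> UNIV) w *\<^sub>R (norm (G (fst w) (snd w)))\<^sup>2)) \<in> borel_measurable (lborel \<Otimes>\<^sub>M lborel)"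
        by (simp add: lborel_prod)
      moreover have "h = (\<lambda>w. ennreal (indicator ({0..t} \<times> UNIV) w *\<^sub>R (norm (G (fst w) (snd w)))\<^sup>2))"
        by (auto simp: h_def indicator_def)
      ultimately show ?thesis by simp
    qed
    have "nsq (w t) \<le> (\<integral>\<^sup>+\<xi>. ennreal (exp (k * t) / c0) * (\<integral>\<^sup>+s. h (s, \<xi>) \<partial>lborel) \<partial>lborel)"
      unfolding nsq_def
    proof (rule nn_integral_mono)
      fix \<xi>
      have gc: "continuous_on {0..t} (\<lambda>s. (norm (G s \<xi>))\<^sup>2)" by (rule continuous_on_subset[OF g_cont]) auto
      have "ennreal ((norm (w t \<xi>))\<^sup>2) \<le> ennreal (exp (k * t) / c0 * integral {0..t} (\<lambda>s. (norm (G s \<xi>))\<^sup>2))"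
        by (rule ennreal_leI[OF w_bound])
      also have "\<dots> = ennreal (exp (k * t) / c0) * ennreal (integral {0..t} (\<lambda>s. (norm (G s \<xi>))\<^sup>2))"
        using c0(1) by (intro ennreal_mult integral_nonneg integrable_continuous_interval gc) auto
      also have "ennreal (integral {0..t} (\<lambda>s. (norm (G s \<xi>))\<^sup>2)) = (\<integral>\<^sup>+s. h (s, \<xi>) \<partial>lborel)"
        unfolding h_def using nn_integral_Icc[OF gc] by simp
      finally show "ennreal ((norm (w t \<xi>))\<^sup>2) \<le> ennreal (exp (k * t) / c0) * (\<integral>\<^sup>+s. h (s, \<xi>) \<partial>lborel)" .
    qed
    also have "\<dots> = ennreal (exp (k * t) / c0) * (\<integral>\<^sup>+\<xi>. (\<integral>\<^sup>+s. h (s, \<xi>) \<partial>lborel) \<partial>lborel)"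
      by (rule nn_integral_cmult) (use h_meas in measurable)
    also have "(\<integral>\<^sup>+\<xi>. (\<integral>\<^sup>+s. h (s, \<xi>) \<partial>lborel) \<partial>lborel) = (\<integral>\<^sup>+s. (\<integral>\<^sup>+\<xi>. h (s, \<xi>) \<partial>lborel) \<partial>lborel)"
      by (rule lborel_pair.Fubini[OF h_meas])
    also have "\<dots> \<le> (\<integral>\<^sup>+s. ennreal (CF / R\<^sup>2 * N) * indicator {0..t} s \<partial>lborel)"
    proof (rule nn_integral_mono)
      fix s :: real
      show "(\<integral>\<^sup>+\<xi>. h (s, \<xi>) \<partial>lborel) \<le> ennreal (CF / R\<^sup>2 * N) * indicator {0..t} s"
      proof (cases "s \<in> {0..t}")
        case True
        then have "(\<integral>\<^sup>+\<xi>. h (s, \<xi>) \<partial>lborel) = nsq (forcing A R (u s))" by (simp add: h_def nsq_def G_def)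
        also have "\<dots> \<le> ennreal (CF / R\<^sup>2) * nsq (u s)" using True by (intro CF(2) R L2) auto
        also have "\<dots> \<le> ennreal (CF / R\<^sup>2) * ennreal N"
          using M[OF True] by (intro mult_left_mono order_trans[OF M[OF True]] ennreal_leI) (auto simp: N_def)
        also have "\<dots> = ennreal (CF / R\<^sup>2 * N)" using CF(1) by (intro ennreal_mult[symmetric]) (auto simp: N_def)
        finally show ?thesis using True by simp
      qed (simp add: h_def)
    qed
    also have "\<dots> = ennreal (CF / R\<^sup>2 * N) * ennreal t"
      using t by (subst nn_integral_cmult_indicator) auto
    finally have "nsq (w t) \<le> ennreal (exp (k * t) / c0) * (ennreal (CF / R\<^sup>2 * N) * ennreal t)"
      by (simp add: mult_left_mono)
    also have "\<dots> = ennreal (exp (k * t) / c0 * (CF / R\<^sup>2 * N * t))"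
    proof -
      have "ennreal x * (ennreal y * ennreal z) = ennreal (x * (y * z))" if "x \<ge> 0" "y \<ge> 0" "z \<ge> 0" for x y z
        using that by (simp add: ennreal_mult)
      then show ?thesis using c0(1) CF(1) t by (simp add: N_def)
    qed
    also have "exp (k * t) / c0 * (CF / R\<^sup>2 * N * t) = (exp (k * t) / c0 * (CF * N * t)) / R\<^sup>2" by simp
    finally show "nsq (\<lambda>\<xi>. fourier_L1 (cut bump R (u t)) \<xi> - flow B A L \<xi> t (fourier_L1 (cut bump R (u 0)) \<xi>)) \<le>
        ennreal ((exp (k * t) / c0 * (CF * N * t)) / R\<^sup>2)"
      by (simp add: w_def[abs_def] W_def[abs_def])
  qed
qed

section \<open>The Fourier image of a solution\<close>

lemma ennreal_tendsto_0_le: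
  fixes f g :: "'a \<Rightarrow> ennreal"
  assumes "\<forall>\<^sub>F x in F. f x \<le> g x" "(g \<longlongrightarrow> 0) F" shows "(f \<longlongrightarrow> 0) F"
  by (rule tendsto_sandwich[where f="\<lambda>_. 0" and h=g]) (use assms in auto)

lemma nsq_fourier_L1_diff:
  fixes f g :: "real^'n \<Rightarrow> real^'m"
  assumes "integrable lborel f" "integrable lborel g"
  shows "nsq (\<lambda>\<xi>. fourier_L1 f \<xi> - fourier_L1 g \<xi>) \<le> nsq (\<lambda>x. f x - g x)"
  using fourier_L1_Bessel[OF Bochner_Integration.integrable_diff[OF assms]]
  unfolding fourier_L1_diff[OF assms, symmetric] .

lemma truncation_integrable:
  fixes f :: "real^'n \<Rightarrow> 'b::euclidean_space"
  assumes "in_L2 f" shows "integrable lborel (\<lambda>x. indicat_real (cball 0 R) x *\<^sub>R f x)"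
proof (rule integrable_scaleR_L2[OF _ _ assms])
  show "nsq (indicat_real (cball (0::real^'n) R)) < \<infinity>"
    by (rule nsq_bounded_support_finite[where B=R and M=1]) (auto simp: indicator_def split: if_splits)
qed (auto intro!: borel_measurable_indicator borel_closed)

lemma nsq_dominated_tendsto_0:
  fixes s :: "real \<Rightarrow> 'a::euclidean_space \<Rightarrow> 'b::{banach,second_countable_topology}"
  assumes "\<And>R. s R \<in> borel_measurable borel" and f: "f \<in> borel_measurable borel" "nsq f < \<infinity>"
    and lim: "\<And>x. ((\<lambda>R. s R x) \<longlongrightarrow> 0) at_top" and le: "\<forall>\<^sub>F R in at_top. \<forall>x. norm (s R x) \<le> norm (f x)"
  shows "((\<lambda>R. nsq (s R)) \<longlongrightarrow> 0) at_top"
proof -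
  have fi: "integrable lborel (\<lambda>x. (norm (f x))\<^sup>2)" using f by (simp add: nsq_integrable_iff)
  have "((\<lambda>R. \<integral>x. (norm (s R x))\<^sup>2 \<partial>lborel) \<longlongrightarrow> (\<integral>x. 0 \<partial>(lborel :: 'a measure))) at_top"
  proof (rule integral_dominated_convergence_at_top[OF _ _ fi])
    show "AE x in lborel. ((\<lambda>R. (norm (s R x))\<^sup>2) \<longlongrightarrow> 0) at_top"
      using tendsto_power[OF tendsto_norm_zero[OF lim], where n=2] by (intro AE_I2) simp
    show "\<forall>\<^sub>F R in at_top. AE x in lborel. norm ((norm (s R x))\<^sup>2) \<le> (norm (f x))\<^sup>2"
      using le by eventually_elim (auto intro: power_mono)
  qed (use assms in measurable)
  from tendsto_ennrealI[OF this]
  have "((\<lambda>R. ennreal (\<integral>x. (norm (s R x))\<^sup>2 \<partial>lborel)) \<longlongrightarrow> 0) at_top" by simp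
  moreover have "\<forall>\<^sub>F R in at_top. ennreal (\<integral>x. (norm (s R x))\<^sup>2 \<partial>lborel) = nsq (s R)"
    using le
  proof eventually_elim
    case (elim R)
    then have "nsq (s R) \<le> nsq f" by (intro nsq_mono) auto
    then have "nsq (s R) < \<infinity>" using f(2) by simp
    then show ?case using nsq_integrable_iff[OF assms(1), of R] nsq_eq_integral[of "s R"] by simp
  qed
  ultimately show ?thesis by (rule Lim_transform_eventually)
qed

lemma bump_scaled_tendsto: "((\<lambda>R. bump (x /\<^sub>R R)) \<longlongrightarrow> 1) at_top"
proof -
  have "((\<lambda>R. x /\<^sub>R R) \<longlongrightarrow> 0 *\<^sub>R x) at_top"
    by (intro tendsto_intros tendsto_inverse_0_at_top filterlim_ident)
  moreover have "isCont bump (0 *\<^sub>R x)"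
    using Ck_on_continuous[OF Ck_on_bump] by (metis UNIV_I continuous_on_eq_continuous_at open_UNIV)
  ultimately have "((\<lambda>R. bump (x /\<^sub>R R)) \<longlongrightarrow> bump (0 *\<^sub>R x)) at_top"
    by (intro isCont_tendsto_compose[where g=bump])
  then show ?thesis by simp
qed

lemma indicator_cball_tendsto: "((\<lambda>R. indicat_real (cball 0 R) (x::'a::euclidean_space)) \<longlongrightarrow> 1) at_top"
proof (rule tendsto_eventually)
  show "\<forall>\<^sub>F R in at_top. indicat_real (cball 0 R) x = 1"
    using eventually_ge_at_top[of "norm x"] by eventually_elim (simp add: indicator_def)
qed

lemma cut_bump_measurable [measurable]:
  fixes f :: "real^'n \<Rightarrow> 'b::euclidean_space"
  assumes "f \<in> borel_measurable borel" shows "cut bump R f \<in> borel_measurable borel"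
proof -
  have [measurable]: "(bump :: real^'n \<Rightarrow> real) \<in> borel_measurable borel"
    by (rule test_function_measurable[OF test_function_bump])
  have "(\<lambda>x::real^'n. bump (x /\<^sub>R R)) \<in> borel_measurable borel"
    by (rule measurable_compose[where g=bump and N=borel]) measurable
  then show ?thesis unfolding cut_def[abs_def] using assms by (intro borel_measurable_scaleR)
qed

lemma truncation_measurable [measurable]:
  fixes f :: "'a::euclidean_space \<Rightarrow> 'b::euclidean_space"
  shows "f \<in> borel_measurable borel \<Longrightarrow> (\<lambda>x. indicat_real (cball 0 R) x *\<^sub>R f x) \<in> borel_measurable borel"
  by (intro borel_measurable_scaleR borel_measurable_indicator borel_closed closed_cball)

text \<open>\<open>fourier_L2\<close> is defined by sharp truncations to balls, but the equation can
  be tested only with smooth cut-offs. The two localisations differ by a function dominated by |f|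
  that tends to 0 pointwise.\<close>

lemma nsq_cut_error:
  fixes f :: "real^'n \<Rightarrow> 'b::euclidean_space"
  assumes f: "in_L2 f"
  shows "((\<lambda>R. nsq (\<lambda>x. indicat_real (cball 0 R) x *\<^sub>R f x - cut bump R f x)) \<longlongrightarrow> 0) at_top"
proof (rule nsq_dominated_tendsto_0)
  have [measurable]: "f \<in> borel_measurable borel" using f by (simp add: in_L2_iff)
  show "(\<lambda>x. indicat_real (cball 0 R) x *\<^sub>R f x - cut bump R f x) \<in> borel_measurable borel" for R
    by (intro borel_measurable_diff truncation_measurable cut_bump_measurable) simp_all
  show "((\<lambda>R. indicat_real (cball 0 R) x *\<^sub>R f x - cut bump R f x) \<longlongrightarrow> 0) at_top" for x
  proof -
    have "((\<lambda>R. indicat_real (cball 0 R) x *\<^sub>R f x - bump (x /\<^sub>R R) *\<^sub>R f x) \<longlongrightarrow> 1 *\<^sub>R f x - 1 *\<^sub>R f x) at_top"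
      by (intro tendsto_diff tendsto_scaleR tendsto_const indicator_cball_tendsto bump_scaled_tendsto)
    then show ?thesis by (simp add: cut_def)
  qed
  have "\<bar>indicat_real (cball 0 R) x - bump (x /\<^sub>R R)\<bar> \<le> 1" for R and x :: "real^'n"
    using bump_nonneg[of "x /\<^sub>R R"] bump_le_1[of "x /\<^sub>R R"] by (auto simp: indicator_def)
  from mult_right_mono[OF this norm_ge_zero]
  show "\<forall>\<^sub>F R in at_top. \<forall>x. norm (indicat_real (cball 0 R) x *\<^sub>R f x - cut bump R f x) \<le> norm (f x)"
    by (intro always_eventually allI) (simp add: cut_def flip: scaleR_diff_left)
qed (use f in \<open>auto simp: in_L2_iff\<close>)

lemma fourier_ode_norm_le:
  assumes "cond_A A0 A L" "cond_S A0 L S" "cond_S1 A L S" "cond_K A0 A L" and B: "A0 ** B = mat 1"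
  obtains C where "C > 0" "\<And>\<xi> t z. t \<ge> 0 \<Longrightarrow> norm (flow B A L \<xi> t z) \<le> C * norm z"
proof -
  obtain C c where C: "C > 0" "c > 0"
    "\<And>\<xi> v t. fourier_ode A0 A L \<xi> v \<Longrightarrow> t \<ge> 0 \<Longrightarrow> norm (v t) \<le> C * exp (- c * eta \<xi> * t) * norm (v 0)"
    using pointwise_decay[OF assms(1-4)] by blast
  have "norm (flow B A L \<xi> t z) \<le> C * norm z" if t: "t \<ge> 0" for \<xi> t z
  proof -
    have "norm (flow B A L \<xi> t z) \<le> C * exp (- c * eta \<xi> * t) * norm z"
      using C(3)[OF fourier_ode_flow[OF B] t] by simp
    also have "\<dots> \<le> C * 1 * norm z"
      using C t by (intro mult_right_mono mult_left_mono) (auto simp: eta_def)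
    finally show ?thesis by simp
  qed
  with C(1) show ?thesis using that by blast
qed

text \<open>Four replacements, each with an error that vanishes as R grows: the sharp truncation of
  u(t) by the smooth one, its transform by the flow of the localised datum
  (\<open>nsq_defect\<close>), the smooth truncation of the datum by the sharp one, and the latter
  by \<open>u0h\<close>. The last two happen under the flow, which is linear and bounded uniformly
  in the frequency.\<close>

theorem fourier_L2_flow:
  fixes u :: "real \<Rightarrow> real^'n \<Rightarrow> real^'m"
  assumes A: "cond_A A0 A L" and S: "cond_S A0 L S" "cond_S1 A L S" and K: "cond_K A0 A L"
    and B: "A0 ** B = mat 1" "B ** A0 = mat 1"
    and sol: "cauchy_solution A0 A L u0 u" and u0h: "fourier_L2 u0 u0h" and t: "t \<ge> 0"
  shows "fourier_L2 (u t) (\<lambda>\<xi>. flow B A L \<xi> t (u0h \<xi>))"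
proof -
  have L2: "in_L2 (u t)" if "t \<ge> 0" for t using sol that by (auto simp: cauchy_solution_def)
  have tb: "test_function (bump :: real^'n \<Rightarrow> real)" by (rule test_function_bump)
  obtain Cf where Cf: "Cf > 0" "\<And>\<xi> t z. t \<ge> 0 \<Longrightarrow> norm (flow B A L \<xi> t z) \<le> Cf * norm z"
    using fourier_ode_norm_le[OF A S K B(1)] by blast
  obtain Cd where Cd: "Cd \<ge> 0" "\<And>R. R > 0 \<Longrightarrow>
    nsq (\<lambda>\<xi>. fourier_L1 (cut bump R (u t)) \<xi> - flow B A L \<xi> t (fourier_L1 (cut bump R (u 0)) \<xi>)) \<le> ennreal (Cd / R\<^sup>2)"
    using nsq_defect[OF A B sol t] by blast
  have u0: "in_L2 u0" and u0h_L2: "in_L2 u0h" using u0h by (auto simp: fourier_L2_def)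
  have [measurable]: "u0h \<in> borel_measurable borel" using u0h_L2 by (simp add: in_L2_iff)
  let ?v = "\<lambda>\<xi>. flow B A L \<xi> t (u0h \<xi>)"
  have v_meas[measurable]: "?v \<in> borel_measurable borel" by (rule flow_measurable) simp
  have v_L2: "in_L2 ?v"
  proof -
    have "nsq ?v \<le> ennreal (Cf\<^sup>2) * nsq u0h" using Cf t by (intro nsq_cmult) auto
    also have "\<dots> < \<infinity>" using u0h_L2 by (simp add: in_L2_iff ennreal_mult_less_top)
    finally show ?thesis by (simp add: in_L2_iff)
  qed
  define tr where "tr R f x = indicat_real (cball 0 R) x *\<^sub>R f x" for R and f :: "real^'n \<Rightarrow> real^'m" and x
  have tr_int: "in_L2 f \<Longrightarrow> integrable lborel (tr R f)" for R f
    unfolding tr_def[abs_def] by (rule truncation_integrable)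
  \<comment> \<open>The initial value is attained only almost everywhere, but the transform is an
    integral and does not notice.\<close>
  have u0_eq: "fourier_L1 (cut bump R (u 0)) \<xi> = fourier_L1 (cut bump R u0) \<xi>" for R \<xi>
  proof -
    have "AE x in lborel. u 0 x = u0 x" using sol by (simp add: cauchy_solution_def)
    then have "(\<integral>x. cis (- (x \<bullet> \<xi>)) * complex_of_real (cut bump R (u 0) x $ i) \<partial>lborel) =
        (\<integral>x. cis (- (x \<bullet> \<xi>)) * complex_of_real (cut bump R u0 x $ i) \<partial>lborel)" for i
    proof (intro integral_cong_AE)
      have m: "cut bump R f \<in> borel_measurable borel" if "in_L2 f" for f :: "real^'n \<Rightarrow> real^'m"
        using that by (simp add: in_L2_iff cut_bump_measurable)
      show "(\<lambda>x. cis (- (x \<bullet> \<xi>)) * complex_of_real (cut bump R (u 0) x $ i)) \<in> borel_measurable lborel"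
           "(\<lambda>x. cis (- (x \<bullet> \<xi>)) * complex_of_real (cut bump R u0 x $ i)) \<in> borel_measurable lborel"
        using m[OF L2[of 0]] m[OF u0] by (auto intro!: borel_measurable_times borel_measurable_of_real borel_measurable_vec_nth)
    qed (auto simp: cut_def elim!: eventually_mono)
    then show ?thesis by (simp add: fourier_L1_def)
  qed
  have "((\<lambda>R. nsq (\<lambda>\<xi>. fourier_L1 (tr R (u t)) \<xi> - ?v \<xi>)) \<longlongrightarrow> 0) at_top"
  proof (rule ennreal_tendsto_0_le)
    let ?b = "\<lambda>R. 2 * nsq (\<lambda>x. tr R (u t) x - cut bump R (u t) x) + 2 * (2 * ennreal (Cd / R\<^sup>2) +
       2 * (ennreal (Cf\<^sup>2) * (2 * nsq (\<lambda>x. tr R u0 x - cut bump R u0 x) + 2 * nsq (\<lambda>\<xi>. fourier_L1 (tr R u0) \<xi> - u0h \<xi>))))"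
    show "\<forall>\<^sub>F R in at_top. nsq (\<lambda>\<xi>. fourier_L1 (tr R (u t)) \<xi> - ?v \<xi>) \<le> ?b R"
      using eventually_gt_at_top[of 0]
    proof eventually_elim
      case (elim R)
      define W0 where "W0 \<xi> = fourier_L1 (cut bump R u0) \<xi>" for \<xi>
      have ci: "integrable lborel (cut bump R f)" if "in_L2 f" for f :: "real^'n \<Rightarrow> real^'m"
        by (rule cut_integrable[OF tb elim that])
      have [measurable]: "W0 \<in> borel_measurable borel" unfolding W0_def[abs_def] by (rule fourier_L1_measurable[OF ci[OF u0]])
      have [measurable]: "fourier_L1 (tr R (u t)) \<in> borel_measurable borel" "fourier_L1 (cut bump R (u t)) \<in> borel_measurable borel"
        "fourier_L1 (tr R u0) \<in> borel_measurable borel"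
        using tr_int ci L2[OF t] u0 by (auto intro: fourier_L1_measurable)
      have [measurable]: "(\<lambda>\<xi>. flow B A L \<xi> t (W0 \<xi>)) \<in> borel_measurable borel" by (rule flow_measurable) simp
      have [measurable]: "(\<lambda>\<xi>. flow B A L \<xi> t (W0 \<xi> - u0h \<xi>)) \<in> borel_measurable borel" by (rule flow_measurable) simp
      let ?a = "\<lambda>\<xi>. fourier_L1 (tr R (u t)) \<xi> - fourier_L1 (cut bump R (u t)) \<xi>"
      let ?d = "\<lambda>\<xi>. fourier_L1 (cut bump R (u t)) \<xi> - flow B A L \<xi> t (W0 \<xi>)"
      let ?e = "\<lambda>\<xi>. flow B A L \<xi> t (W0 \<xi> - u0h \<xi>)"
      have diff: "nsq (\<lambda>\<xi>. fourier_L1 (tr R f) \<xi> - fourier_L1 (cut bump R f) \<xi>) \<le> nsq (\<lambda>x. tr R f x - cut bump R f x)" if "in_L2 f" for f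
        by (rule nsq_fourier_L1_diff[OF tr_int[OF that] ci[OF that]])
      have "nsq (\<lambda>\<xi>. fourier_L1 (tr R (u t)) \<xi> - ?v \<xi>) \<le> 2 * nsq ?a + 2 * nsq (\<lambda>\<xi>. ?d \<xi> + ?e \<xi>)"
      proof (rule nsq_add_le)
        fix \<xi>
        have "fourier_L1 (tr R (u t)) \<xi> - ?v \<xi> = ?a \<xi> + (?d \<xi> + ?e \<xi>)" by (simp add: flow_diff)
        then show "norm (fourier_L1 (tr R (u t)) \<xi> - ?v \<xi>) \<le> norm (?a \<xi>) + norm (?d \<xi> + ?e \<xi>)"
          by (metis norm_triangle_ineq)
      qed measurable
      also have "\<dots> \<le> 2 * nsq (\<lambda>x. tr R (u t) x - cut bump R (u t) x) + 2 * (2 * nsq ?d + 2 * nsq ?e)"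
        by (intro add_mono mult_left_mono diff L2 t nsq_add_le norm_triangle_ineq) auto
      also have "\<dots> \<le> ?b R"
      proof (intro add_left_mono mult_left_mono add_mono)
        show "nsq ?d \<le> ennreal (Cd / R\<^sup>2)" using Cd(2)[OF elim] by (simp add: u0_eq W0_def)
        have "nsq ?e \<le> ennreal (Cf\<^sup>2) * nsq (\<lambda>\<xi>. W0 \<xi> - u0h \<xi>)"
          using Cf t by (intro nsq_cmult) auto
        also have "\<dots> \<le> ennreal (Cf\<^sup>2) * (2 * nsq (\<lambda>\<xi>. fourier_L1 (tr R u0) \<xi> - W0 \<xi>) + 2 * nsq (\<lambda>\<xi>. fourier_L1 (tr R u0) \<xi> - u0h \<xi>))"
        proof (intro mult_left_mono nsq_add_le)
          fix \<xi>
          show "norm (W0 \<xi> - u0h \<xi>) \<le> norm (fourier_L1 (tr R u0) \<xi> - W0 \<xi>) + norm (fourier_L1 (tr R u0) \<xi> - u0h \<xi>)"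
            using norm_triangle_ineq4[of "fourier_L1 (tr R u0) \<xi> - u0h \<xi>" "fourier_L1 (tr R u0) \<xi> - W0 \<xi>"] by (simp add: add.commute)
        qed auto
        also have "\<dots> \<le> ennreal (Cf\<^sup>2) * (2 * nsq (\<lambda>x. tr R u0 x - cut bump R u0 x) + 2 * nsq (\<lambda>\<xi>. fourier_L1 (tr R u0) \<xi> - u0h \<xi>))"
          unfolding W0_def by (intro mult_left_mono add_right_mono diff u0) auto
        finally show "nsq ?e \<le> \<dots>" .
      qed auto
      finally show ?case .
    qed
    have l: "((\<lambda>R. nsq (\<lambda>x. tr R f x - cut bump R f x)) \<longlongrightarrow> 0) at_top" if "in_L2 f" for f
      unfolding tr_def by (rule nsq_cut_error[OF that])
    have l0: "((\<lambda>R. nsq (\<lambda>\<xi>. fourier_L1 (tr R u0) \<xi> - u0h \<xi>)) \<longlongrightarrow> 0) at_top"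
      using u0h unfolding fourier_L2_def nsq_def tr_def[abs_def] by simp
    have "((\<lambda>R. Cd / R\<^sup>2) \<longlongrightarrow> 0) at_top"
      by (intro tendsto_divide_0[OF tendsto_const] filterlim_at_top_imp_at_infinity filterlim_pow_at_top filterlim_ident) simp
    then have l1: "((\<lambda>R. ennreal (Cd / R\<^sup>2)) \<longlongrightarrow> 0) at_top" using tendsto_ennrealI[of "\<lambda>R. Cd / R\<^sup>2" 0 at_top] by simp
    have "(?b \<longlongrightarrow> 2 * 0 + 2 * (2 * 0 + 2 * (ennreal (Cf\<^sup>2) * (2 * 0 + 2 * 0)))) at_top"
      by (intro tendsto_add ennreal_tendsto_cmult l L2 t u0 l0 l1) auto
    then show "(?b \<longlongrightarrow> 0) at_top" by simp
  qed
  then show ?thesis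
    using L2[OF t] v_L2 unfolding fourier_L2_def nsq_def tr_def[abs_def] by simp
qed

lemma truncation_nsq_tendsto:
  fixes h :: "'a::euclidean_space \<Rightarrow> 'b::euclidean_space"
  assumes "h \<in> borel_measurable borel" "nsq h < \<infinity>"
  shows "((\<lambda>R. nsq (\<lambda>x. indicat_real (cball 0 R) x *\<^sub>R h x - h x)) \<longlongrightarrow> 0) at_top"
proof (rule nsq_dominated_tendsto_0)
  show "((\<lambda>R. indicat_real (cball 0 R) x *\<^sub>R h x - h x) \<longlongrightarrow> 0) at_top" for x
    using tendsto_diff[OF tendsto_scaleR[OF indicator_cball_tendsto[of x] tendsto_const[of "h x"]] tendsto_const[of "h x"]] by simp
  show "\<forall>\<^sub>F R in at_top. \<forall>x. norm (indicat_real (cball 0 R) x *\<^sub>R h x - h x) \<le> norm (h x)"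
    by (intro always_eventually allI) (simp add: indicator_def)
qed (use assms in \<open>auto intro!: borel_measurable_diff truncation_measurable\<close>)

lemma fourier_L2_of_L1:
  fixes f :: "real^'n \<Rightarrow> real^'m"
  assumes f: "in_L2 f" "in_L1 f"
  shows "fourier_L2 f (fourier_L1 f)"
proof -
  have fi: "integrable lborel f" using f by (simp add: in_L1_def)
  have "in_L2 (fourier_L1 f)"
    using fourier_L1_Bessel[OF fi] f fourier_L1_measurable[OF fi] by (auto simp: in_L2_iff)
  moreover have "((\<lambda>R. nsq (\<lambda>\<xi>. fourier_L1 (\<lambda>x. indicat_real (cball 0 R) x *\<^sub>R f x) \<xi> - fourier_L1 f \<xi>)) \<longlongrightarrow> 0) at_top"
  proof (rule ennreal_tendsto_0_le)
    show "\<forall>\<^sub>F R in at_top. nsq (\<lambda>\<xi>. fourier_L1 (\<lambda>x. indicat_real (cball 0 R) x *\<^sub>R f x) \<xi> - fourier_L1 f \<xi>)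
        \<le> nsq (\<lambda>x. indicat_real (cball 0 R) x *\<^sub>R f x - f x)"
      by (intro always_eventually allI nsq_fourier_L1_diff truncation_integrable f(1) fi)
  qed (use f(1) in \<open>auto simp: in_L2_iff intro!: truncation_nsq_tendsto\<close>)
  ultimately show ?thesis using f(1) unfolding fourier_L2_def nsq_def by simp
qed

section \<open>Weak derivatives and the Fourier transform\<close>

lemma pderivs_simps:
  "pderivs [] \<phi> = \<phi>" "pderivs (j # js) \<phi> = pderiv_at j (pderivs js \<phi>)"
  "pderivs (js @ [j]) \<phi> = pderivs js (pderiv_at j \<phi>)"
  by (simp_all add: pderivs_def)

lemma pderiv_at_lincomb:
  assumes "test_function f" "test_function g"
  shows "pderiv_at j (\<lambda>x. c * f x + d * g x) = (\<lambda>x. c * pderiv_at j f x + d * pderiv_at j g x)"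
proof
  fix x
  have "((\<lambda>x. c * f x + d * g x) has_derivative
    (\<lambda>v. c * frechet_derivative f (at x) v + d * frechet_derivative g (at x) v)) (at x)"
    by (intro has_derivative_add has_derivative_mult_right test_function_has_derivative assms)
  from frechet_derivative_at[OF this, symmetric]
  show "pderiv_at j (\<lambda>x. c * f x + d * g x) x = c * pderiv_at j f x + d * pderiv_at j g x"
    by (simp add: pderiv_at_def)
qed

lemma pderivs_lincomb:
  assumes "test_function f" "test_function g"
  shows "pderivs js (\<lambda>x. c * f x + d * g x) = (\<lambda>x. c * pderivs js f x + d * pderivs js g x)"
  by (induction js) (simp_all add: pderivs_simps pderiv_at_lincomb test_function_pderivs assms)

text \<open>The innermost derivative is the one to peel off, because it acts on the wave itself,
  where the product rule yields two waves again.\<close>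

lemma pderivs_snoc_wave:
  assumes "test_function \<psi>" "R > 0"
  shows "pderivs (js @ [j]) (wave \<psi> R \<xi> a) x =
    (1 / R) * pderivs js (wave (pderiv_at j \<psi>) R \<xi> a) x + \<xi> $ j * pderivs js (wave \<psi> R \<xi> (a + pi / 2)) x"
proof -
  have "pderiv_at j (wave \<psi> R \<xi> a) = (\<lambda>x. (1 / R) * wave (pderiv_at j \<psi>) R \<xi> a x + \<xi> $ j * wave \<psi> R \<xi> (a + pi / 2) x)"
    by (rule ext) (rule pderiv_at_wave[OF assms(1)])
  then show ?thesis
    unfolding pderivs_simps
    by (simp only: pderivs_lincomb[OF test_function_wave[OF test_function_pderiv_at[OF assms(1)] assms(2)] test_function_wave[OF assms]])
qed

text \<open>The Fourier symbol of \<open>pderivs js\<close> without its factor i^k, k being the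
  length of the list.\<close>

definition freq :: "'n list \<Rightarrow> real^'n \<Rightarrow> real" where
  "freq js \<xi> = (\<Prod>j\<leftarrow>js. \<xi> $ j)"

lemma freq_measurable [measurable]: "(\<lambda>\<xi>::real^'n. freq js \<xi>) \<in> borel_measurable borel"
proof (induction js)
  case (Cons j js)
  then have "(\<lambda>\<xi>::real^'n. \<xi> $ j * freq js \<xi>) \<in> borel_measurable borel"
    by (intro borel_measurable_times borel_measurable_vec_nth) auto
  then show ?case by (simp add: freq_def)
qed (simp add: freq_def)

text \<open>A bound uniform in R \<ge> 1, needed as majorant in dominated convergence when R tends
  to infinity; derivatives of the cut-off only bring factors 1/R \<le> 1.\<close>

lemma pderivs_wave_bound:
  assumes "test_function \<psi>"
  shows "\<exists>M. \<forall>R\<ge>1. \<forall>a x. \<bar>pderivs js (wave \<psi> R \<xi> a) x\<bar> \<le> M"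
  using assms
proof (induction js arbitrary: \<psi> rule: rev_induct)
  case Nil
  obtain M where M: "M \<ge> 0" "\<And>x. \<bar>\<psi> x\<bar> \<le> M" using test_function_bounded[OF Nil] by blast
  have "\<bar>\<psi> y\<bar> * \<bar>cos z\<bar> \<le> M * 1" for y z by (intro mult_mono M abs_cos_le_one) auto
  then show ?case by (auto simp: pderivs_simps wave_def abs_mult intro!: exI[of _ M])
next
  case (snoc j js)
  obtain M1 where M1: "\<forall>R\<ge>1. \<forall>a x. \<bar>pderivs js (wave (pderiv_at j \<psi>) R \<xi> a) x\<bar> \<le> M1"
    using snoc.IH[OF test_function_pderiv_at[OF snoc.prems]] by blast
  obtain M2 where M2: "\<forall>R\<ge>1. \<forall>a x. \<bar>pderivs js (wave \<psi> R \<xi> a) x\<bar> \<le> M2"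
    using snoc.IH[OF snoc.prems] by blast
  have "\<bar>pderivs (js @ [j]) (wave \<psi> R \<xi> a) x\<bar> \<le> M1 + \<bar>\<xi> $ j\<bar> * M2" if R: "R \<ge> 1" for R a x
  proof -
    have "\<bar>(1 / R) * pderivs js (wave (pderiv_at j \<psi>) R \<xi> a) x\<bar> \<le> 1 * M1"
      unfolding abs_mult using M1 R by (intro mult_mono) auto
    moreover have "\<bar>\<xi> $ j * pderivs js (wave \<psi> R \<xi> (a + pi / 2)) x\<bar> \<le> \<bar>\<xi> $ j\<bar> * M2"
      unfolding abs_mult using M2 R by (intro mult_left_mono) auto
    moreover have "R > 0" using R by simp
    ultimately show ?thesis unfolding pderivs_snoc_wave[OF snoc.prems \<open>R > 0\<close>] by linarith
  qed
  then show ?case by blast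
qed

text \<open>Each derivative that hits the cut-off carries a factor 1/R, so in the limit all of them
  fall on the cosine, where each gives a coordinate of \<open>\<xi>\<close> and a phase shift by
  \<pi>/2.\<close>

lemma pderivs_wave_tendsto:
  assumes "test_function \<psi>"
  shows "((\<lambda>R. pderivs js (wave \<psi> R \<xi> a) x) \<longlongrightarrow> freq js \<xi> * \<psi> 0 * cos (x \<bullet> \<xi> + (a + real (length js) * (pi / 2)))) at_top"
  using assms
proof (induction js arbitrary: \<psi> a rule: rev_induct)
  case Nil
  have "((\<lambda>R. x /\<^sub>R R) \<longlongrightarrow> 0 *\<^sub>R x) at_top"
    by (intro tendsto_intros tendsto_inverse_0_at_top filterlim_ident)
  moreover have "isCont \<psi> (0 *\<^sub>R x)"
    using test_function_continuous[OF Nil] by (simp add: continuous_on_eq_continuous_at)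
  ultimately have "((\<lambda>R. \<psi> (x /\<^sub>R R)) \<longlongrightarrow> \<psi> (0 *\<^sub>R x)) at_top"
    by (intro isCont_tendsto_compose[where g=\<psi>])
  from tendsto_mult[OF this tendsto_const] show ?case
    by (simp add: pderivs_simps wave_def freq_def)
next
  case (snoc j js)
  let ?k = "real (length js) * (pi / 2)"
  have "((\<lambda>R. (1 / R) * pderivs js (wave (pderiv_at j \<psi>) R \<xi> a) x + \<xi> $ j * pderivs js (wave \<psi> R \<xi> (a + pi / 2)) x)
    \<longlongrightarrow> 0 * (freq js \<xi> * pderiv_at j \<psi> 0 * cos (x \<bullet> \<xi> + (a + ?k))) +
        \<xi> $ j * (freq js \<xi> * \<psi> 0 * cos (x \<bullet> \<xi> + ((a + pi / 2) + ?k)))) at_top"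
    by (intro tendsto_add tendsto_mult tendsto_const snoc.IH snoc.prems test_function_pderiv_at
        tendsto_divide_0[OF tendsto_const] filterlim_at_top_imp_at_infinity filterlim_ident)
  then have "((\<lambda>R. (1 / R) * pderivs js (wave (pderiv_at j \<psi>) R \<xi> a) x + \<xi> $ j * pderivs js (wave \<psi> R \<xi> (a + pi / 2)) x)
    \<longlongrightarrow> freq (js @ [j]) \<xi> * \<psi> 0 * cos (x \<bullet> \<xi> + (a + real (length (js @ [j])) * (pi / 2)))) at_top"
    by (simp add: freq_def algebra_simps add_divide_distrib)
  moreover have "\<forall>\<^sub>F R in at_top. (1 / R) * pderivs js (wave (pderiv_at j \<psi>) R \<xi> a) x + \<xi> $ j * pderivs js (wave \<psi> R \<xi> (a + pi / 2)) x
      = pderivs (js @ [j]) (wave \<psi> R \<xi> a) x"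
    using eventually_gt_at_top[of 0] by eventually_elim (simp add: pderivs_snoc_wave[OF snoc.prems])
  ultimately show ?case by (rule Lim_transform_eventually)
qed

text \<open>Each shift of the phase by \<pi>/2 multiplies the paired vector by - i, which preserves
  its norm.\<close>

lemma norm_wave_pair_shift:
  assumes "\<And>b. U (b + pi) = - U b"
  shows "norm (wave_pair (\<lambda>a. U (a + real k * (pi / 2)))) = norm (wave_pair U)"
proof (induction k)
  case (Suc k)
  define V where "V a = U (a + real k * (pi / 2))" for a
  have V: "V (b + pi) = - V b" for b
    using assms[of "b + real k * (pi / 2)"] by (simp add: V_def add_ac)
  have "U (a + real (Suc k) * (pi / 2)) = V (a + pi / 2)" for a
    by (simp add: V_def algebra_simps add_divide_distrib)
  then have "wave_pair (\<lambda>a. U (a + real (Suc k) * (pi / 2))) = cvec (V (pi / 2)) + \<i> *s cvec (V (0 + pi))"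
    by (simp add: wave_pair_def)
  also have "\<dots> = - (\<i> *s wave_pair V)"
    unfolding V by (simp add: wave_pair_def linear_add[OF i_smult_linear] i_i_smult linear_neg[OF cvec_linear] linear_neg[OF i_smult_linear])
  finally show ?case using Suc by (simp add: norm_i_smult V_def[abs_def])
qed simp

text \<open>Testing the weak derivative with cut-off waves and letting R grow shows that the
  transforms of \<open>cut bump R g\<close> converge in norm, at every frequency, to the symbol
  times the transform of \<open>f\<close>; dominated convergence applies because \<open>f\<close> is
  integrable. Bessel's inequality and Fatou's lemma then give the bound without identifying a
  transform of \<open>g\<close>.\<close>

lemma nsq_freq_le_weak_deriv:
  fixes f g :: "real^'n \<Rightarrow> real^'m"
  assumes f: "integrable lborel f" and g: "in_L2 g" and wd: "has_weak_deriv f js g"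
  shows "nsq (\<lambda>\<xi>. freq js \<xi> *\<^sub>R fourier_L1 f \<xi>) \<le> nsq g"
proof -
  define c where "c = (2 * pi) powr (- real CARD('n) / 2)"
  have c: "c \<ge> 0" by (simp add: c_def)
  have tb: "test_function (bump :: real^'n \<Rightarrow> real)" by (rule test_function_bump)
  have lim: "(\<lambda>k. norm (fourier_L1 (cut bump (real (Suc k)) g) \<xi>)) \<longlonglongrightarrow> norm (freq js \<xi> *\<^sub>R fourier_L1 f \<xi>)" for \<xi>
  proof -
    define U where "U b = (\<integral>x. cos (x \<bullet> \<xi> + b) *\<^sub>R f x \<partial>lborel)" for b
    define V where "V k a = (\<integral>x. pderivs js (wave bump (real (Suc k)) \<xi> a) x *\<^sub>R f x \<partial>lborel)" for k a
    let ?s = "real (length js) * (pi / 2)"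
    have U: "U (b + pi) = - U b" for b
      by (simp add: U_def flip: add.assoc)
    obtain M where M: "\<forall>R\<ge>1. \<forall>a x. \<bar>pderivs js (wave (bump :: real^'n \<Rightarrow> real) R \<xi> a) x\<bar> \<le> M"
      using pderivs_wave_bound[OF tb] by blast
    have "(\<lambda>k. V k a) \<longlonglongrightarrow> (\<integral>x. (freq js \<xi> * cos (x \<bullet> \<xi> + (a + ?s))) *\<^sub>R f x \<partial>lborel)" for a
      unfolding V_def
    proof (rule integral_dominated_convergence[where w="\<lambda>x. M * norm (f x)"])
      have [measurable]: "f \<in> borel_measurable borel" using f by (auto dest: borel_measurable_integrable)
      show "(\<lambda>x. pderivs js (wave bump (real (Suc k)) \<xi> a) x *\<^sub>R f x) \<in> borel_measurable lborel" for k
        using test_function_measurable[OF test_function_pderivs[OF test_function_wave[OF tb]], of "real (Suc k)"]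
        by simp
      show "(\<lambda>x. (freq js \<xi> * cos (x \<bullet> \<xi> + (a + ?s))) *\<^sub>R f x) \<in> borel_measurable lborel" by measurable
      show "AE x in lborel. (\<lambda>k. pderivs js (wave bump (real (Suc k)) \<xi> a) x *\<^sub>R f x) \<longlonglongrightarrow>
          (freq js \<xi> * cos (x \<bullet> \<xi> + (a + ?s))) *\<^sub>R f x"
      proof (intro AE_I2 tendsto_scaleR tendsto_const)
        fix x
        have "filterlim (\<lambda>k. real (Suc k)) at_top sequentially"
          using filterlim_real_sequentially filterlim_Suc filterlim_compose by blast
        from filterlim_compose[OF pderivs_wave_tendsto[OF tb, of js \<xi> a x] this]
        show "(\<lambda>k. pderivs js (wave bump (real (Suc k)) \<xi> a) x) \<longlonglongrightarrow> freq js \<xi> * cos (x \<bullet> \<xi> + (a + ?s))"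
          by simp
      qed
      show "AE x in lborel. norm (pderivs js (wave bump (real (Suc k)) \<xi> a) x *\<^sub>R f x) \<le> M * norm (f x)" for k
        using M by (intro AE_I2) (auto intro!: mult_right_mono)
    qed (use f in simp)
    also have "(\<integral>x. (freq js \<xi> * cos (x \<bullet> \<xi> + (a + ?s))) *\<^sub>R f x \<partial>lborel) = freq js \<xi> *\<^sub>R U (a + ?s)" for a
      by (simp add: U_def flip: scaleR_scaleR)
    finally have V: "(\<lambda>k. V k a) \<longlonglongrightarrow> freq js \<xi> *\<^sub>R U (a + ?s)" for a .
    have "(\<lambda>k. c *\<^sub>R wave_pair (V k)) \<longlonglongrightarrow> c *\<^sub>R wave_pair (\<lambda>a. freq js \<xi> *\<^sub>R U (a + ?s))"
      unfolding wave_pair_def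
      by (intro tendsto_scaleR tendsto_const tendsto_add bounded_linear.tendsto[OF i_smult_bounded_linear] bounded_linear.tendsto[OF cvec_bounded_linear] V)
    then have "(\<lambda>k. norm (c *\<^sub>R wave_pair (V k))) \<longlonglongrightarrow> norm (c *\<^sub>R wave_pair (\<lambda>a. freq js \<xi> *\<^sub>R U (a + ?s)))"
      by (rule tendsto_norm)
    moreover have "wave_pair (\<lambda>a. freq js \<xi> *\<^sub>R U (a + ?s)) = freq js \<xi> *\<^sub>R wave_pair (\<lambda>a. U (a + ?s))"
      by (simp add: wave_pair_def linear_scale[OF cvec_linear] linear_scale[OF i_smult_linear] scaleR_add_right)
    then have "norm (c *\<^sub>R wave_pair (\<lambda>a. freq js \<xi> *\<^sub>R U (a + ?s))) = norm (freq js \<xi> *\<^sub>R (c *\<^sub>R wave_pair U))"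
      using norm_wave_pair_shift[of U, OF U] by (simp add: abs_mult mult_ac)
    moreover have "c *\<^sub>R wave_pair U = fourier_L1 f \<xi>"
      unfolding fourier_L1_wave_pair[OF f] c_def U_def[abs_def] ..
    moreover have "norm (c *\<^sub>R wave_pair (V k)) = norm (fourier_L1 (cut bump (real (Suc k)) g) \<xi>)" for k
    proof -
      let ?W = "\<lambda>a. \<integral>x. wave bump (real (Suc k)) \<xi> a x *\<^sub>R g x \<partial>lborel"
      have "V k a = (-1) ^ length js *\<^sub>R ?W a" for a
        using wd test_function_wave[OF tb, of "real (Suc k)" \<xi> a] by (simp add: has_weak_deriv_def V_def)
      then have "wave_pair (V k) = (-1) ^ length js *\<^sub>R wave_pair ?W"
        by (simp add: wave_pair_def linear_scale[OF cvec_linear] linear_scale[OF i_smult_linear] scaleR_add_right)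
      then have "norm (c *\<^sub>R wave_pair (V k)) = norm (c *\<^sub>R wave_pair ?W)" by (simp add: abs_mult power_abs)
      also have "c *\<^sub>R wave_pair ?W = fourier_L1 (cut bump (real (Suc k)) g) \<xi>"
        unfolding c_def by (rule fourier_L1_cut[OF tb _ g, symmetric]) simp
      finally show ?thesis .
    qed
    ultimately show ?thesis by simp
  qed
  have ci: "integrable lborel (cut bump (real (Suc k)) g)" for k by (rule cut_integrable[OF tb _ g]) simp
  show ?thesis
    unfolding nsq_def[of "\<lambda>\<xi>. freq js \<xi> *\<^sub>R fourier_L1 f \<xi>"]
  proof (rule nn_integral_limit_le)
    show "(\<lambda>\<xi>. ennreal ((norm (fourier_L1 (cut bump (real (Suc k)) g) \<xi>))\<^sup>2)) \<in> borel_measurable lborel" for k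
      using fourier_L1_measurable[OF ci] by measurable
    show "AE \<xi> in lborel. (\<lambda>k. ennreal ((norm (fourier_L1 (cut bump (real (Suc k)) g) \<xi>))\<^sup>2)) \<longlonglongrightarrow>
        ennreal ((norm (freq js \<xi> *\<^sub>R fourier_L1 f \<xi>))\<^sup>2)"
      by (intro AE_I2 tendsto_ennrealI tendsto_power lim)
    have "nsq (fourier_L1 (cut bump (real (Suc k)) g)) \<le> nsq (cut bump (real (Suc k)) g)" for k
      by (rule fourier_L1_Bessel[OF ci])
    also have "nsq (cut bump (real (Suc k)) g) \<le> nsq g" for k
      using bump_nonneg bump_le_1 by (intro nsq_mono) (auto simp: cut_def abs_le_iff intro!: mult_left_le_one_le order_trans[OF _ bump_nonneg])
    finally show "(\<integral>\<^sup>+\<xi>. ennreal ((norm (fourier_L1 (cut bump (real (Suc k)) g) \<xi>))\<^sup>2) \<partial>lborel) \<le> nsq g" for k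
      by (simp only: nsq_def)
  qed
qed

section \<open>Fourier transforms of derivatives of test functions\<close>

lemma integral_lborel_translate:
  fixes f :: "'a::euclidean_space \<Rightarrow> real"
  assumes "f \<in> borel_measurable borel"
  shows "(\<integral>x. f (x + c) \<partial>lborel) = (\<integral>x. f x \<partial>lborel)"
proof -
  have "(\<integral>x. f x \<partial>lborel) = (\<integral>x. f x \<partial>distr lborel borel ((+) c))" by (simp add: lborel_distr_plus)
  also have "\<dots> = (\<integral>x. f (c + x) \<partial>lborel)" using assms by (intro integral_distr) auto
  finally show ?thesis by (simp add: add.commute)
qed

lemma test_function_integrable': "test_function \<phi> \<Longrightarrow> integrable lborel (\<phi> :: real^'n \<Rightarrow> real)"
proof -
  assume \<phi>: "test_function \<phi>"
  obtain B where B: "\<And>x. \<phi> x \<noteq> 0 \<Longrightarrow> norm x \<le> B" using \<phi> by (auto simp: test_function_iff)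
  have "nsq (indicat_real (cball (0::real^'n) B)) < \<infinity>"
    by (rule nsq_bounded_support_finite[where B=B and M=1]) (auto simp: indicator_def split: if_splits)
  then have "in_L2 (indicat_real (cball (0::real^'n) B))"
    by (auto simp: in_L2_iff intro!: borel_measurable_indicator borel_closed)
  from test_function_integrable[OF \<phi> this]
  have "integrable lborel (\<lambda>x. \<phi> x * indicat_real (cball 0 B) x)" by simp
  moreover have "\<phi> x * indicat_real (cball 0 B) x = \<phi> x" for x using B[of x] by (auto simp: indicator_def)
  ultimately show ?thesis by simp
qed

text \<open>The difference quotients have integral zero by translation invariance.\<close>

lemma integral_pderiv_at:
  fixes \<theta> :: "real^'n \<Rightarrow> real"
  assumes \<theta>: "test_function \<theta>" shows "(\<integral>x. pderiv_at j \<theta> x \<partial>lborel) = 0"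
proof -
  define e :: "real^'n" where "e = axis j 1"
  obtain B where B: "\<And>x. \<theta> x \<noteq> 0 \<Longrightarrow> norm x \<le> B" using \<theta> by (auto simp: test_function_iff)
  obtain M where M: "M \<ge> 0" "\<And>x. \<bar>pderiv_at j \<theta> x\<bar> \<le> M"
    using test_function_bounded[OF test_function_pderiv_at[OF \<theta>]] by blast
  have meas[measurable]: "\<theta> \<in> borel_measurable borel" by (rule test_function_measurable[OF \<theta>])
  define D where "D h x = (\<theta> (x + h *\<^sub>R e) - \<theta> x) / h" for h x
  have line: "((\<lambda>s. \<theta> (x + s *\<^sub>R e)) has_real_derivative pderiv_at j \<theta> (x + s *\<^sub>R e)) (at s)" for x s
  proof -
    interpret bounded_linear "frechet_derivative \<theta> (at (x + s *\<^sub>R e))"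
      using test_function_has_derivative[OF \<theta>] by (rule has_derivative_bounded_linear)
    have "((\<lambda>s. x + s *\<^sub>R e) has_derivative (\<lambda>h. h *\<^sub>R e)) (at s)" by (auto intro!: derivative_eq_intros)
    from has_derivative_compose[OF this test_function_has_derivative[OF \<theta>]]
    have "((\<lambda>s. \<theta> (x + s *\<^sub>R e)) has_derivative (\<lambda>h. h * frechet_derivative \<theta> (at (x + s *\<^sub>R e)) e)) (at s)"
      by (simp add: scaleR)
    then show ?thesis by (simp add: has_field_derivative_def pderiv_at_def mult_commute_abs flip: e_def)
  qed
  have D_bound: "\<bar>D h x\<bar> \<le> M * indicat_real (cball 0 (B + 1)) x" if h: "0 < h" "h \<le> 1" for h x
  proof (cases "norm x \<le> B + 1")
    case True
    obtain z where "\<theta> (x + h *\<^sub>R e) - \<theta> (x + 0 *\<^sub>R e) = (h - 0) * pderiv_at j \<theta> (x + z *\<^sub>R e)"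
      using MVT2[OF h(1) line] by blast
    then show ?thesis using h M(2) True by (simp add: D_def)
  next
    case False
    have "norm x \<le> norm (x + h *\<^sub>R e) + norm (h *\<^sub>R e)" by (metis add_diff_cancel_right' norm_triangle_ineq4)
    then have "norm (x + h *\<^sub>R e) > B" using False h by (simp add: e_def)
    then have "\<theta> (x + h *\<^sub>R e) = 0" "\<theta> x = 0" using B[of x] B[of "x + h *\<^sub>R e"] False by auto
    then show ?thesis using M by (simp add: D_def)
  qed
  have "(\<lambda>k. \<integral>x. D (1 / real (Suc k)) x \<partial>lborel) \<longlonglongrightarrow> (\<integral>x. pderiv_at j \<theta> x \<partial>lborel)"
  proof (rule integral_dominated_convergence[where w="\<lambda>x. M * indicat_real (cball 0 (B + 1)) x"])
    show "pderiv_at j \<theta> \<in> borel_measurable lborel"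
      using test_function_measurable[OF test_function_pderiv_at[OF \<theta>]] by simp
    show "integrable lborel (\<lambda>x::real^'n. M * indicat_real (cball 0 (B + 1)) x)"
      using emeasure_bounded_finite[OF bounded_cball, of "0::real^'n" "B + 1"]
      by (intro integrable_mult_right integrable_real_indicator) auto
    show "AE x in lborel. (\<lambda>k. D (1 / real (Suc k)) x) \<longlonglongrightarrow> pderiv_at j \<theta> x"
    proof (intro AE_I2)
      fix x
      have "((\<lambda>h. (\<theta> (x + (0 + h) *\<^sub>R e) - \<theta> (x + 0 *\<^sub>R e)) / h) \<longlongrightarrow> pderiv_at j \<theta> (x + 0 *\<^sub>R e)) (at 0)"
        using line[of x 0] unfolding DERIV_def .
      then have "((\<lambda>h. D h x) \<longlongrightarrow> pderiv_at j \<theta> x) (at 0)" by (simp add: D_def)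
      moreover have "filterlim (\<lambda>k. 1 / real (Suc k)) (at 0) sequentially"
        unfolding filterlim_at using LIMSEQ_inverse_real_of_nat by (simp add: inverse_eq_divide)
      ultimately show "(\<lambda>k. D (1 / real (Suc k)) x) \<longlonglongrightarrow> pderiv_at j \<theta> x" by (rule filterlim_compose)
    qed
    show "AE x in lborel. norm (D (1 / real (Suc k)) x) \<le> M * indicat_real (cball 0 (B + 1)) x" for k
      using D_bound[of "1 / real (Suc k)"] by (intro AE_I2) simp
  qed (simp add: D_def[abs_def])
  moreover have "(\<integral>x. D h x \<partial>lborel) = 0" for h
  proof -
    have i: "integrable lborel \<theta>" by (rule test_function_integrable'[OF \<theta>])
    have "(\<integral>x. \<theta> (x + h *\<^sub>R e) \<partial>lborel) = (\<integral>x. \<theta> x \<partial>lborel)" by (rule integral_lborel_translate) simp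
    moreover have "integrable lborel (\<lambda>x. \<theta> (x + h *\<^sub>R e))"
    proof -
      have "integrable (distr lborel borel ((+) (h *\<^sub>R e))) \<theta>" using i by (simp add: lborel_distr_plus)
      then show ?thesis by (subst (asm) integrable_distr_eq) (auto simp: add.commute)
    qed
    ultimately show ?thesis using i by (simp add: D_def)
  qed
  ultimately show ?thesis by (simp add: LIMSEQ_const_iff)
qed

text \<open>Integration by parts: the derivative of a wave at scale R = 1 has integral 0, and the
  product rule splits it into the two terms to be compared.\<close>

lemma ft_pderiv_at:
  fixes \<phi> :: "real^'n \<Rightarrow> real"
  assumes \<phi>: "test_function \<phi>"
  shows "ft (\<lambda>x. complex_of_real (pderiv_at j \<phi> x)) \<xi> = \<i> * complex_of_real (\<xi> $ j) * ft (\<lambda>x. complex_of_real (\<phi> x)) \<xi>"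
proof -
  define I where "I \<psi> a = (\<integral>x. cos (x \<bullet> \<xi> + a) * \<psi> x \<partial>lborel)" for \<psi> :: "real^'n \<Rightarrow> real" and a
  have wI: "(\<integral>x. wave \<psi> 1 \<xi> a x \<partial>lborel) = I \<psi> a" for \<psi> a
    by (simp add: I_def wave_def mult.commute)
  have I: "I (pderiv_at j \<phi>) a = - (\<xi> $ j * I \<phi> (a + pi / 2))" for a
  proof -
    have "(\<integral>x. pderiv_at j (wave \<phi> 1 \<xi> a) x \<partial>lborel) = 0"
      by (rule integral_pderiv_at[OF test_function_wave[OF \<phi>]]) simp
    then have "(\<integral>x. wave (pderiv_at j \<phi>) 1 \<xi> a x + \<xi> $ j * wave \<phi> 1 \<xi> (a + pi / 2) x \<partial>lborel) = 0"
      by (simp add: pderiv_at_wave[OF \<phi>])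
    then have "(\<integral>x. wave (pderiv_at j \<phi>) 1 \<xi> a x \<partial>lborel) + \<xi> $ j * (\<integral>x. wave \<phi> 1 \<xi> (a + pi / 2) x \<partial>lborel) = 0"
      using \<phi> by (subst (asm) Bochner_Integration.integral_add)
        (auto intro!: test_function_integrable' test_function_wave test_function_pderiv_at)
    then show ?thesis unfolding wI by simp
  qed
  have pi: "I \<phi> (pi / 2 + pi / 2) = - I \<phi> 0"
    by (simp add: I_def)
  have *: "ft (\<lambda>x. complex_of_real (\<psi> x)) \<xi> = of_real ((2 * pi) powr (- real CARD('n) / 2)) *
      (complex_of_real (I \<psi> 0) + \<i> * complex_of_real (I \<psi> (pi / 2)))" if "test_function \<psi>" for \<psi>
    using ft_of_real[OF test_function_integrable'[OF that], of \<xi>] by (simp add: I_def)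
  show ?thesis
    unfolding *[OF \<phi>] *[OF test_function_pderiv_at[OF \<phi>]] I pi by (simp add: algebra_simps)
qed

lemma ft_pderivs:
  fixes \<phi> :: "real^'n \<Rightarrow> real"
  assumes \<phi>: "test_function \<phi>"
  shows "ft (\<lambda>x. complex_of_real (pderivs js \<phi> x)) \<xi> = \<i> ^ length js * complex_of_real (freq js \<xi>) * ft (\<lambda>x. complex_of_real (\<phi> x)) \<xi>"
  by (induction js)
     (simp_all add: pderivs_simps ft_pderiv_at test_function_pderivs \<phi> freq_def mult_ac)

lemma freq_uminus: "freq js (- \<xi>) = (-1) ^ length js * freq js \<xi>"
  by (induction js) (simp_all add: freq_def)

section \<open>Completeness, inversion and Parseval in L^2\<close>

lemma ennreal_tendsto_0I:
  fixes f :: "'a \<Rightarrow> ennreal"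
  assumes "\<And>e::real. e > 0 \<Longrightarrow> \<forall>\<^sub>F x in F. f x \<le> ennreal e"
  shows "(f \<longlongrightarrow> 0) F"
proof (rule order_tendstoI)
  fix a :: ennreal assume "0 < a"
  obtain e where "e > 0" "ennreal e < a"
  proof (cases a rule: ennreal_cases)
    case (real r)
    then show ?thesis using that[of "r / 2"] \<open>0 < a\<close> by (auto simp: ennreal_less_iff)
  next
    case top
    then show ?thesis using that[of 1] by auto
  qed
  with assms[of e] show "\<forall>\<^sub>F x in F. f x < a" by (auto elim!: eventually_mono)
qed auto

lemma ennreal_tendsto_0D:
  fixes f :: "'a \<Rightarrow> ennreal"
  assumes "(f \<longlongrightarrow> 0) F" "e > 0" shows "\<forall>\<^sub>F x in F. f x \<le> ennreal e"
  using order_tendstoD(2)[OF assms(1), of "ennreal e"] assms(2) by (auto elim!: eventually_mono)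

text \<open>The increments are small enough to carry an additional weight 2^k: the weighted sum of
  squares has integral at most the sum of 4^{-k}, hence is finite almost everywhere, and there |d_k|
  \<le> sqrt C 2^{-k/2} is dominated by a geometric series.\<close>

lemma L2_fast_convergent_AE:
  fixes f :: "nat \<Rightarrow> 'a::euclidean_space \<Rightarrow> 'b::euclidean_space"
  assumes [measurable]: "\<And>k. f k \<in> borel_measurable borel"
    and le: "\<And>k. nsq (\<lambda>x. f (Suc k) x - f k x) \<le> ennreal ((1 / 8) ^ k)"
  shows "AE x in lborel. convergent (\<lambda>k. f k x)"
proof -
  define d where "d k x = f (Suc k) x - f k x" for k x
  have [measurable]: "d k \<in> borel_measurable borel" for k unfolding d_def by measurable
  have "(\<integral>\<^sup>+x. (\<Sum>k. ennreal (2 ^ k) * ennreal ((norm (d k x))\<^sup>2)) \<partial>lborel) = (\<Sum>k. \<integral>\<^sup>+x. ennreal (2 ^ k) * ennreal ((norm (d k x))\<^sup>2) \<partial>lborel)"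
    by (rule nn_integral_suminf) measurable
  also have "\<dots> \<le> (\<Sum>k. ennreal ((1 / 4) ^ k))"
  proof (rule suminf_le)
    fix k
    have "(\<integral>\<^sup>+x. ennreal (2 ^ k) * ennreal ((norm (d k x))\<^sup>2) \<partial>lborel) = ennreal (2 ^ k) * nsq (d k)"
      unfolding nsq_def by (rule nn_integral_cmult) measurable
    also have "\<dots> \<le> ennreal (2 ^ k) * ennreal ((1 / 8) ^ k)"
      using le[of k] by (intro mult_left_mono) (auto simp: d_def[abs_def])
    also have "\<dots> = ennreal ((1 / 4) ^ k)"
      by (simp add: ennreal_mult[symmetric] power_mult_distrib[symmetric])
    finally show "(\<integral>\<^sup>+x. ennreal (2 ^ k) * ennreal ((norm (d k x))\<^sup>2) \<partial>lborel) \<le> ennreal ((1 / 4) ^ k)" .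
  qed auto
  also have "\<dots> = ennreal (\<Sum>k. (1 / 4) ^ k)"
    by (rule suminf_ennreal2) (auto intro: summable_geometric)
  finally have "(\<integral>\<^sup>+x. (\<Sum>k. ennreal (2 ^ k) * ennreal ((norm (d k x))\<^sup>2)) \<partial>lborel) \<noteq> \<infinity>"
    by (auto simp: top_unique)
  then have "AE x in lborel. (\<Sum>k. ennreal (2 ^ k) * ennreal ((norm (d k x))\<^sup>2)) \<noteq> \<infinity>"
    by (intro nn_integral_PInf_AE) measurable
  then show ?thesis
  proof eventually_elim
    case (elim x)
    then obtain C where C: "C \<ge> 0" "(\<Sum>k. ennreal (2 ^ k) * ennreal ((norm (d k x))\<^sup>2)) = ennreal C"
      by (cases "(\<Sum>k. ennreal (2 ^ k) * ennreal ((norm (d k x))\<^sup>2))" rule: ennreal_cases) auto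
    have dk: "norm (d k x) \<le> sqrt C * (1 / sqrt 2) ^ k" for k
    proof -
      have "ennreal (2 ^ k) * ennreal ((norm (d k x))\<^sup>2) \<le> ennreal C"
        unfolding C(2)[symmetric] using sum_le_suminf[of "\<lambda>k. ennreal (2 ^ k) * ennreal ((norm (d k x))\<^sup>2)" "{k}"] by simp
      then have "2 ^ k * (norm (d k x))\<^sup>2 \<le> C" using C(1) by (simp add: ennreal_mult[symmetric])
      then have "(norm (d k x))\<^sup>2 \<le> C * (1 / 2) ^ k" by (simp add: field_simps)
      then have "norm (d k x) \<le> sqrt (C * (1 / 2) ^ k)" by (rule real_le_rsqrt)
      then show ?thesis by (simp add: real_sqrt_mult real_sqrt_power real_sqrt_divide)
    qed
    have "summable (\<lambda>k. sqrt C * (1 / sqrt 2) ^ k)"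
      by (intro summable_mult summable_geometric) simp
    then have "summable (\<lambda>k. d k x)" by (rule summable_comparison_test') (use dk in simp)
    then have "(\<lambda>n. \<Sum>k<n. d k x) \<longlonglongrightarrow> (\<Sum>k. d k x)" by (rule summable_LIMSEQ)
    moreover have "(\<Sum>k<n. d k x) = f n x - f 0 x" for n unfolding d_def by (rule sum_lessThan_telescope)
    ultimately have "(\<lambda>n. f n x - f 0 x + f 0 x) \<longlonglongrightarrow> (\<Sum>k. d k x) + f 0 x" by (intro tendsto_add) auto
    then show ?case by (auto simp: convergent_def)
  qed
qed

text \<open>The Riesz-Fischer theorem. The subsequence that converges almost everywhere is kept in
  the conclusion so that norm bounds can be passed to the limit by Fatou's lemma.\<close>

theorem L2_complete:
  fixes f :: "nat \<Rightarrow> 'a::euclidean_space \<Rightarrow> 'b::euclidean_space"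
  assumes meas: "\<And>k. f k \<in> borel_measurable borel"
    and cauchy: "\<And>e::real. e > 0 \<Longrightarrow> \<exists>N. \<forall>m\<ge>N. \<forall>n\<ge>N. nsq (\<lambda>x. f m x - f n x) \<le> ennreal e"
  obtains g r where "g \<in> borel_measurable borel" "(\<lambda>n. nsq (\<lambda>x. f n x - g x)) \<longlonglongrightarrow> 0"
    "AE x in lborel. (\<lambda>k. f (r k) x) \<longlonglongrightarrow> g x"
proof -
  have "\<exists>N. \<forall>k. \<forall>m\<ge>N k. \<forall>n\<ge>N k. nsq (\<lambda>x. f m x - f n x) \<le> ennreal ((1 / 8) ^ k)"
  proof (rule choice, rule allI)
    fix k show "\<exists>N. \<forall>m\<ge>N. \<forall>n\<ge>N. nsq (\<lambda>x. f m x - f n x) \<le> ennreal ((1 / 8) ^ k)" by (rule cauchy) simp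
  qed
  then obtain N where N: "\<And>k m n. m \<ge> N k \<Longrightarrow> n \<ge> N k \<Longrightarrow> nsq (\<lambda>x. f m x - f n x) \<le> ennreal ((1 / 8) ^ k)" by blast
  \<comment> \<open>Summing the successors gives r k \<ge> N k, monotonicity and r k \<ge> k at
    once.\<close>
  define r where "r k = (\<Sum>i\<le>k. Suc (N i))" for k
  have r_ge: "r k \<ge> N k" for k
  proof -
    have "Suc (N k) \<le> r k" unfolding r_def by (rule member_le_sum) auto
    then show ?thesis by simp
  qed
  have r_Suc: "r (Suc k) \<ge> r k" for k by (simp add: r_def)
  have r_k: "r k \<ge> k" for k by (induction k) (auto simp: r_def)
  have mr: "f (r k) \<in> borel_measurable borel" for k by (rule meas)
  have conv: "AE x in lborel. convergent (\<lambda>k. f (r k) x)"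
    by (rule L2_fast_convergent_AE[OF mr]) (intro N order_trans[OF r_ge r_Suc] r_ge)
  define g where "g x = lim (\<lambda>k. f (r k) x)" for x
  have g: "g \<in> borel_measurable borel" unfolding g_def[abs_def] by (rule borel_measurable_lim_metric[OF mr])
  have lim: "AE x in lborel. (\<lambda>k. f (r k) x) \<longlonglongrightarrow> g x"
    using conv by eventually_elim (simp add: g_def convergent_LIMSEQ_iff)
  have "(\<lambda>n. nsq (\<lambda>x. f n x - g x)) \<longlonglongrightarrow> 0"
  proof (rule ennreal_tendsto_0I)
    fix e :: real assume "e > 0"
    then obtain M where M: "\<And>m n. m \<ge> M \<Longrightarrow> n \<ge> M \<Longrightarrow> nsq (\<lambda>x. f m x - f n x) \<le> ennreal e" using cauchy by blast
    show "\<forall>\<^sub>F n in sequentially. nsq (\<lambda>x. f n x - g x) \<le> ennreal e"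
      using eventually_ge_at_top[of M]
    proof eventually_elim
      case (elim n)
      show ?case unfolding nsq_def
      proof (rule nn_integral_limit_le)
        \<comment> \<open>The shift by \<open>M\<close> puts every index of the subsequence beyond
          the Cauchy threshold for e, so the bound holds for all k and not only eventually.\<close>
        show "(\<lambda>x. ennreal ((norm (f n x - f (r (k + M)) x))\<^sup>2)) \<in> borel_measurable lborel" for k
          using meas by measurable
        show "AE x in lborel. (\<lambda>k. ennreal ((norm (f n x - f (r (k + M)) x))\<^sup>2)) \<longlonglongrightarrow> ennreal ((norm (f n x - g x))\<^sup>2)"
          using lim
        proof eventually_elim
          case (elim x)
          show ?case
            by (intro tendsto_ennrealI tendsto_power tendsto_norm tendsto_diff tendsto_const LIMSEQ_ignore_initial_segment[OF elim])
        qed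
        show "(\<integral>\<^sup>+x. ennreal ((norm (f n x - f (r (k + M)) x))\<^sup>2) \<partial>lborel) \<le> ennreal e" for k
          using M[OF elim, of "r (k + M)"] r_k[of "k + M"] by (simp add: nsq_def)
      qed
    qed
  qed
  with g lim show ?thesis using that by blast
qed

lemma norm_integral_mult_le:
  fixes a b :: "'a::euclidean_space \<Rightarrow> complex"
  assumes [measurable]: "a \<in> borel_measurable borel" "b \<in> borel_measurable borel"
    and fin: "nsq a < \<infinity>" "nsq b < \<infinity>"
  shows "norm (\<integral>x. a x * b x \<partial>lborel) \<le> sqrt (enn2real (nsq a)) * sqrt (enn2real (nsq b))"
proof -
  have i: "integrable lborel (\<lambda>x. (norm (a x))\<^sup>2)" "integrable lborel (\<lambda>x. (norm (b x))\<^sup>2)"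
    using fin by (simp_all add: nsq_integrable_iff)
  have "norm (\<integral>x. a x * b x \<partial>lborel) \<le> (\<integral>x. norm (a x * b x) \<partial>lborel)" by (rule integral_norm_bound)
  also have "\<dots> = (\<integral>x. \<bar>norm (a x) * norm (b x)\<bar> \<partial>lborel)" by (simp add: norm_mult)
  also have "\<dots> \<le> sqrt (\<integral>x. (norm (a x))\<^sup>2 \<partial>lborel) * sqrt (\<integral>x. (norm (b x))\<^sup>2 \<partial>lborel)"
    by (rule Cauchy_Schwarz_integral) (use i in auto)
  finally show ?thesis by (simp add: nsq_eq_integral[OF i(1)] nsq_eq_integral[OF i(2)])
qed

lemma integral_mult_L2_tendsto:
  fixes a b :: "'a::euclidean_space \<Rightarrow> complex" and B :: "'i \<Rightarrow> 'a \<Rightarrow> complex"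
  assumes a: "a \<in> borel_measurable borel" "nsq a < \<infinity>" and b: "b \<in> borel_measurable borel" "nsq b < \<infinity>"
    and B: "\<And>k. B k \<in> borel_measurable borel" "\<And>k. nsq (B k) < \<infinity>"
    and lim: "((\<lambda>k. nsq (\<lambda>x. B k x - b x)) \<longlongrightarrow> 0) F"
  shows "((\<lambda>k. \<integral>x. a x * B k x \<partial>lborel) \<longlongrightarrow> (\<integral>x. a x * b x \<partial>lborel)) F"
proof -
  have fin: "nsq (\<lambda>x. B k x - b x) < \<infinity>" for k
  proof -
    have "nsq (\<lambda>x. B k x - b x) \<le> 2 * nsq (B k) + 2 * nsq b"
      by (intro nsq_add_le B b norm_triangle_ineq4)
    also have "\<dots> < \<infinity>" using B(2)[of k] b(2) by (simp add: ennreal_mult_less_top)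
    finally show ?thesis .
  qed
  have meas: "(\<lambda>x. B k x - b x) \<in> borel_measurable borel" for k by (intro borel_measurable_diff B b)
  have "((\<lambda>k. sqrt (enn2real (nsq a)) * sqrt (enn2real (nsq (\<lambda>x. B k x - b x)))) \<longlongrightarrow> sqrt (enn2real (nsq a)) * sqrt 0) F"
    using lim by (intro tendsto_mult tendsto_const tendsto_real_sqrt tendsto_enn2real) auto
  then have lim': "((\<lambda>k. sqrt (enn2real (nsq a)) * sqrt (enn2real (nsq (\<lambda>x. B k x - b x)))) \<longlongrightarrow> 0) F" by simp
  have "((\<lambda>k. (\<integral>x. a x * B k x \<partial>lborel) - (\<integral>x. a x * b x \<partial>lborel)) \<longlongrightarrow> 0) F"
  proof (rule tendsto_norm_zero_cancel, rule tendsto_0_le[OF lim', of _ 1], intro always_eventually allI)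
    fix k
    have "(\<integral>x. a x * B k x \<partial>lborel) - (\<integral>x. a x * b x \<partial>lborel) = (\<integral>x. a x * (B k x - b x) \<partial>lborel)"
      using integrable_mult_L2[OF a(1) B(1) a(2) B(2), of k] integrable_mult_L2[OF a(1) b(1) a(2) b(2)]
      by (simp add: right_diff_distrib)
    also have "norm \<dots> \<le> sqrt (enn2real (nsq a)) * sqrt (enn2real (nsq (\<lambda>x. B k x - b x)))"
      by (rule norm_integral_mult_le[OF a(1) meas a(2) fin])
    finally show "norm (norm ((\<integral>x. a x * B k x \<partial>lborel) - (\<integral>x. a x * b x \<partial>lborel))) \<le>
        norm (sqrt (enn2real (nsq a)) * sqrt (enn2real (nsq (\<lambda>x. B k x - b x)))) * 1" by simp
  qed
  then show ?thesis by (simp add: LIM_zero_iff)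
qed

lemma integral_lborel_reflect:
  fixes f :: "'a::euclidean_space \<Rightarrow> complex"
  assumes [measurable]: "f \<in> borel_measurable borel"
  shows "(\<integral>x. f (- x) \<partial>lborel) = (\<integral>x. f x \<partial>lborel)"
proof -
  have "(\<integral>x. f x \<partial>lborel) = (\<integral>x. f x \<partial>density (distr lborel borel (\<lambda>x. 0 + (-1) *\<^sub>R x)) (\<lambda>_. ennreal (\<bar>-1::real\<bar> ^ DIM('a))))"
    using arg_cong[OF lborel_affine[of "-1" "0::'a"], of "\<lambda>M. integral\<^sup>L M f"] by simp
  also have "\<dots> = (\<integral>x. f (- x) \<partial>lborel)"
    by (subst integral_density) (auto simp: integral_distr)
  finally show ?thesis by simp
qed

lemma nsq_ft_reflect_le:
  fixes h :: "real^'n \<Rightarrow> complex"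
  assumes h: "integrable lborel h"
  shows "nsq (\<lambda>x. ft h (- x)) \<le> nsq h" and "(\<lambda>x. ft h (- x)) \<in> borel_measurable borel"
proof -
  have c: "integrable lborel (\<lambda>x. cnj (h x))" using h by simp
  have eq: "ft h (- x) = cnj (ft (\<lambda>x. cnj (h x)) x)" for x
    using ft_cnj[of "\<lambda>x. cnj (h x)" x] by simp
  have "nsq (\<lambda>x. ft h (- x)) = nsq (ft (\<lambda>x. cnj (h x)))" by (simp add: nsq_def eq)
  also have "\<dots> \<le> nsq (\<lambda>x. cnj (h x))" by (rule Bessel[OF c])
  also have "\<dots> = nsq h" by (simp add: nsq_def)
  finally show "nsq (\<lambda>x. ft h (- x)) \<le> nsq h" .
  show "(\<lambda>x. ft h (- x)) \<in> borel_measurable borel"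
    unfolding eq using ft_measurable[OF c]
    by (rule borel_measurable_continuous_on[OF continuous_on_cnj[OF continuous_on_id]])
qed

text \<open>The multiplication formula, by Fubini; with the reflected argument it says that the
  inverse transform is dual to itself.\<close>

lemma ft_exchange:
  fixes \<phi> h :: "real^'n \<Rightarrow> complex"
  assumes \<phi>: "integrable lborel \<phi>" and h: "integrable lborel h"
  shows "(\<integral>x. \<phi> x * ft h (- x) \<partial>lborel) = (\<integral>\<xi>. ft \<phi> (- \<xi>) * h \<xi> \<partial>lborel)"
proof -
  define c where "c = complex_of_real ((2 * pi) powr (- real CARD('n) / 2))"
  have [measurable]: "\<phi> \<in> borel_measurable borel" "h \<in> borel_measurable borel"
    using \<phi> h by (auto dest: borel_measurable_integrable)
  have cm: "(\<lambda>w. cis (fst w \<bullet> snd w)) \<in> borel_measurable (lborel \<Otimes>\<^sub>M (lborel :: (real^'n) measure))"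
  proof -
    have "(\<lambda>w. cis (fst w \<bullet> snd w)) \<in> borel_measurable (borel :: ((real^'n) \<times> (real^'n)) measure)"
      by (intro borel_measurable_continuous_onI continuous_intros)
    then show ?thesis by (simp add: lborel_prod)
  qed
  have H: "integrable (lborel \<Otimes>\<^sub>M lborel) (\<lambda>(x, \<xi>). cis (x \<bullet> \<xi>) * (\<phi> x * h \<xi>))"
  proof (rule Bochner_Integration.integrable_bound[OF integrable_pair_mult[OF \<phi> h]])
    show "(\<lambda>(x, \<xi>). cis (x \<bullet> \<xi>) * (\<phi> x * h \<xi>)) \<in> borel_measurable (lborel \<Otimes>\<^sub>M lborel)"
      using cm by (simp add: split_beta')
  qed (auto simp: norm_mult split_beta)
  have 1: "\<phi> x * ft h (- x) = c * (\<integral>\<xi>. cis (x \<bullet> \<xi>) * (\<phi> x * h \<xi>) \<partial>lborel)" for x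
  proof -
    have "(\<integral>\<xi>. cis (x \<bullet> \<xi>) * (\<phi> x * h \<xi>) \<partial>lborel) = (\<integral>\<xi>. \<phi> x * (cis (x \<bullet> \<xi>) * h \<xi>) \<partial>lborel)"
      by (simp add: mult_ac)
    then show ?thesis by (simp add: ft_def c_def inner_commute)
  qed
  have 2: "ft \<phi> (- \<xi>) * h \<xi> = c * (\<integral>x. cis (x \<bullet> \<xi>) * (\<phi> x * h \<xi>) \<partial>lborel)" for \<xi>
  proof -
    have "(\<integral>x. cis (x \<bullet> \<xi>) * (\<phi> x * h \<xi>) \<partial>lborel) = (\<integral>x. (cis (x \<bullet> \<xi>) * \<phi> x) * h \<xi> \<partial>lborel)"
      by (simp add: mult_ac)
    then show ?thesis by (simp add: ft_def c_def)
  qed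
  show ?thesis
    unfolding 1 2 using lborel_pair.Fubini_integral[OF H] by simp
qed

lemma test_function_complex:
  fixes \<phi> :: "real^'n \<Rightarrow> real"
  assumes \<phi>: "test_function \<phi>"
  shows "integrable lborel (\<lambda>x. complex_of_real (\<phi> x))" "nsq (\<lambda>x. complex_of_real (\<phi> x)) < \<infinity>"
    "(\<lambda>x. complex_of_real (\<phi> x)) \<in> borel_measurable borel"
  using test_function_integrable'[OF \<phi>] nsq_test_function[OF \<phi>] test_function_measurable[OF \<phi>]
  by (simp_all add: nsq_def)

text \<open>The inverse transforms of the truncations of \<open>h\<close> form a Cauchy sequence by
  Bessel's inequality. Their limit is recorded only through its pairings with test functions, which
  is all that a weak derivative asks for.\<close>

lemma inverse_fourier_L2:
  fixes h :: "real^'n \<Rightarrow> complex"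
  assumes h: "h \<in> borel_measurable borel" "nsq h < \<infinity>"
  obtains g where "g \<in> borel_measurable borel" "nsq g \<le> nsq h"
    "\<And>\<phi>. test_function \<phi> \<Longrightarrow> (\<integral>x. complex_of_real (\<phi> x) * g x \<partial>lborel) = (\<integral>\<xi>. ft (\<lambda>x. complex_of_real (\<phi> x)) (- \<xi>) * h \<xi> \<partial>lborel)"
proof -
  define H where "H N \<xi> = indicat_real (cball 0 (real N)) \<xi> *\<^sub>R h \<xi>" for N \<xi>
  define G where "G N x = ft (H N) (- x)" for N x
  have h_L2: "in_L2 h" using h by (simp add: in_L2_iff)
  have Hi: "integrable lborel (H N)" for N unfolding H_def[abs_def] by (rule truncation_integrable[OF h_L2])
  have Hm: "H N \<in> borel_measurable borel" for N unfolding H_def[abs_def] by (rule truncation_measurable[OF h(1)])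
  have Hle: "nsq (H N) \<le> nsq h" for N
    by (intro nsq_mono) (auto simp: H_def indicator_def)
  have Hlim: "(\<lambda>N. nsq (\<lambda>\<xi>. H N \<xi> - h \<xi>)) \<longlonglongrightarrow> 0"
    unfolding H_def by (rule filterlim_compose[OF truncation_nsq_tendsto[OF h] filterlim_real_sequentially])
  have Gm: "G N \<in> borel_measurable borel" for N unfolding G_def[abs_def] by (rule nsq_ft_reflect_le(2)[OF Hi])
  have Gle: "nsq (G N) \<le> nsq h" for N
    unfolding G_def[abs_def] by (rule order_trans[OF nsq_ft_reflect_le(1)[OF Hi] Hle])
  have Gdiff: "nsq (\<lambda>x. G M x - G N x) \<le> 2 * nsq (\<lambda>\<xi>. H M \<xi> - h \<xi>) + 2 * nsq (\<lambda>\<xi>. H N \<xi> - h \<xi>)" for M N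
  proof -
    have "nsq (\<lambda>x. G M x - G N x) = nsq (\<lambda>x. ft (\<lambda>\<xi>. H M \<xi> - H N \<xi>) (- x))"
      unfolding G_def by (simp add: ft_diff[OF Hi Hi])
    also have "\<dots> \<le> nsq (\<lambda>\<xi>. H M \<xi> - H N \<xi>)"
      by (rule nsq_ft_reflect_le(1)[OF Bochner_Integration.integrable_diff[OF Hi Hi]])
    also have "\<dots> \<le> 2 * nsq (\<lambda>\<xi>. H M \<xi> - h \<xi>) + 2 * nsq (\<lambda>\<xi>. H N \<xi> - h \<xi>)"
    proof (intro nsq_add_le borel_measurable_diff Hm h)
      fix \<xi> show "norm (H M \<xi> - H N \<xi>) \<le> norm (H M \<xi> - h \<xi>) + norm (H N \<xi> - h \<xi>)"
        using norm_triangle_ineq4[of "H M \<xi> - h \<xi>" "H N \<xi> - h \<xi>"] by simp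
    qed
    finally show ?thesis .
  qed
  obtain g r where g: "g \<in> borel_measurable borel" "(\<lambda>N. nsq (\<lambda>x. G N x - g x)) \<longlonglongrightarrow> 0"
    and lim: "AE x in lborel. (\<lambda>k. G (r k) x) \<longlonglongrightarrow> g x"
  proof (rule L2_complete[OF Gm])
    fix e :: real assume e: "e > 0"
    then have "\<forall>\<^sub>F N in sequentially. nsq (\<lambda>\<xi>. H N \<xi> - h \<xi>) \<le> ennreal (e / 4)"
      by (intro ennreal_tendsto_0D[OF Hlim]) auto
    then obtain N where N: "\<And>n. n \<ge> N \<Longrightarrow> nsq (\<lambda>\<xi>. H n \<xi> - h \<xi>) \<le> ennreal (e / 4)"
      by (auto simp: eventually_sequentially)
    have "nsq (\<lambda>x. G m x - G n x) \<le> ennreal e" if "m \<ge> N" "n \<ge> N" for m n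
    proof -
      have "nsq (\<lambda>x. G m x - G n x) \<le> 2 * ennreal (e / 4) + 2 * ennreal (e / 4)"
        by (rule order_trans[OF Gdiff]) (intro add_mono mult_left_mono N that, auto)
      also have "2 * ennreal (e / 4) = ennreal (2 * (e / 4))" using e by (subst ennreal_mult) auto
      also have "ennreal (2 * (e / 4)) + ennreal (2 * (e / 4)) = ennreal e" using e by (subst ennreal_plus[symmetric]) auto
      finally show ?thesis .
    qed
    then show "\<exists>N. \<forall>m\<ge>N. \<forall>n\<ge>N. nsq (\<lambda>x. G m x - G n x) \<le> ennreal e" by blast
  qed (use that in blast)
  show ?thesis
  proof (rule that[OF g(1)])
    show le: "nsq g \<le> nsq h"
      unfolding nsq_def[of g]
    proof (rule nn_integral_limit_le)
      show "(\<lambda>x. ennreal ((norm (G (r k) x))\<^sup>2)) \<in> borel_measurable lborel" for k using Gm by measurable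
      show "AE x in lborel. (\<lambda>k. ennreal ((norm (G (r k) x))\<^sup>2)) \<longlonglongrightarrow> ennreal ((norm (g x))\<^sup>2)"
        using lim by eventually_elim (intro tendsto_ennrealI tendsto_power tendsto_norm)
      show "(\<integral>\<^sup>+x. ennreal ((norm (G (r k) x))\<^sup>2) \<partial>lborel) \<le> nsq h" for k
        using Gle[of "r k"] by (simp only: nsq_def)
    qed
    fix \<phi> :: "real^'n \<Rightarrow> real" assume "test_function \<phi>"
    note \<phi> = test_function_complex[OF this]
    have "(\<lambda>N. \<integral>x. complex_of_real (\<phi> x) * G N x \<partial>lborel) \<longlonglongrightarrow> (\<integral>x. complex_of_real (\<phi> x) * g x \<partial>lborel)"
      by (rule integral_mult_L2_tendsto[OF \<phi>(3,2) g(1) _ Gm _ g(2)])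
         (use le Gle h(2) in \<open>auto intro: le_less_trans\<close>)
    moreover have "(\<lambda>N. \<integral>\<xi>. ft (\<lambda>x. complex_of_real (\<phi> x)) (- \<xi>) * H N \<xi> \<partial>lborel) \<longlonglongrightarrow>
        (\<integral>\<xi>. ft (\<lambda>x. complex_of_real (\<phi> x)) (- \<xi>) * h \<xi> \<partial>lborel)"
      by (rule integral_mult_L2_tendsto[OF nsq_ft_reflect_le(2)[OF \<phi>(1)] _ h Hm _ Hlim])
         (use nsq_ft_reflect_le(1)[OF \<phi>(1)] \<phi>(2) Hle h(2) in \<open>auto intro: le_less_trans\<close>)
    moreover have "(\<integral>x. complex_of_real (\<phi> x) * G N x \<partial>lborel) = (\<integral>\<xi>. ft (\<lambda>x. complex_of_real (\<phi> x)) (- \<xi>) * H N \<xi> \<partial>lborel)" for N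
      unfolding G_def by (rule ft_exchange[OF \<phi>(1) Hi])
    ultimately show "(\<integral>x. complex_of_real (\<phi> x) * g x \<partial>lborel) = (\<integral>\<xi>. ft (\<lambda>x. complex_of_real (\<phi> x)) (- \<xi>) * h \<xi> \<partial>lborel)"
      by (simp add: LIMSEQ_unique)
  qed
qed

text \<open>A test function has bounded support, so on the space side truncation of \<open>f\<close>
  to a ball changes nothing once R is large: the pairing is eventually constant. On the frequency
  side the transforms of the truncations converge in L^2.\<close>

lemma fourier_L2_Parseval:
  fixes f :: "real^'n \<Rightarrow> real^'m"
  assumes F: "fourier_L2 f F" and test: "test_function \<phi>"
  shows "(\<integral>\<xi>. ft (\<lambda>x. complex_of_real (\<phi> x)) (- \<xi>) * F \<xi> $ i \<partial>lborel) = complex_of_real (\<integral>x. \<phi> x * f x $ i \<partial>lborel)"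
proof -
  note \<phi> = test_function_complex[OF test]
  let ?\<phi> = "\<lambda>x. complex_of_real (\<phi> x)"
  have f: "in_L2 f" and FL2: "in_L2 F"
    and lim: "((\<lambda>R. nsq (\<lambda>\<xi>. fourier_L1 (\<lambda>x. indicat_real (cball 0 R) x *\<^sub>R f x) \<xi> - F \<xi>)) \<longlongrightarrow> 0) at_top"
    using F by (simp_all add: fourier_L2_def nsq_def)
  have fm[measurable]: "f \<in> borel_measurable borel" and Fm[measurable]: "F \<in> borel_measurable borel"
    using f FL2 by (auto simp: in_L2_iff)
  define fR where "fR R x = complex_of_real ((indicat_real (cball 0 R) x *\<^sub>R f x) $ i)" for R x
  have fRi: "integrable lborel (fR R)" for R
    unfolding fR_def[abs_def] by (rule integrable_component[OF truncation_integrable[OF f]])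
  have fRm[measurable]: "fR R \<in> borel_measurable borel" for R using fRi by (auto dest: borel_measurable_integrable)
  have fRn: "nsq (fR R) < \<infinity>" for R
  proof -
    have "nsq (fR R) \<le> nsq f"
    proof (rule nsq_mono)
      fix x
      have "norm (fR R x) \<le> norm (f x $ i)" by (simp add: fR_def indicator_def)
      then show "norm (fR R x) \<le> norm (f x)" using Finite_Cartesian_Product.norm_nth_le order_trans by blast
    qed
    then show ?thesis using f by (auto simp: in_L2_iff intro: le_less_trans)
  qed
  have ftR: "ft (fR R) \<xi> = fourier_L1 (\<lambda>x. indicat_real (cball 0 R) x *\<^sub>R f x) \<xi> $ i" for R \<xi>
    by (simp add: fourier_L1_nth fR_def[abs_def])
  have ftRn: "nsq (ft (fR R)) < \<infinity>" for R using Bessel[OF fRi] fRn le_less_trans by blast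
  have "((\<lambda>R. nsq (\<lambda>\<xi>. ft (fR R) \<xi> - F \<xi> $ i)) \<longlongrightarrow> 0) at_top"
  proof (rule ennreal_tendsto_0_le[OF _ lim], intro always_eventually allI nsq_mono)
    fix R \<xi>
    show "norm (ft (fR R) \<xi> - F \<xi> $ i) \<le> norm (fourier_L1 (\<lambda>x. indicat_real (cball 0 R) x *\<^sub>R f x) \<xi> - F \<xi>)"
      unfolding ftR vector_minus_component[symmetric] by (rule Finite_Cartesian_Product.norm_nth_le)
  qed
  moreover have "nsq (\<lambda>\<xi>. F \<xi> $ i) < \<infinity>"
  proof -
    have "nsq (\<lambda>\<xi>. F \<xi> $ i) \<le> nsq F" by (intro nsq_mono Finite_Cartesian_Product.norm_nth_le)
    then show ?thesis using FL2 by (auto simp: in_L2_iff intro: le_less_trans)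
  qed
  ultimately have 1: "((\<lambda>R. \<integral>\<xi>. ft ?\<phi> (- \<xi>) * ft (fR R) \<xi> \<partial>lborel) \<longlongrightarrow> (\<integral>\<xi>. ft ?\<phi> (- \<xi>) * F \<xi> $ i \<partial>lborel)) at_top"
    by (intro integral_mult_L2_tendsto nsq_ft_reflect_le(2)[OF \<phi>(1)] ft_measurable fRi ftRn
        le_less_trans[OF nsq_ft_reflect_le(1)[OF \<phi>(1)] \<phi>(2)]) simp_all
  obtain B where B: "\<And>x. \<phi> x \<noteq> 0 \<Longrightarrow> norm x \<le> B" using test by (auto simp: test_function_iff)
  have "(\<integral>\<xi>. ft ?\<phi> (- \<xi>) * ft (fR R) \<xi> \<partial>lborel) = complex_of_real (\<integral>x. \<phi> x * f x $ i \<partial>lborel)" if R: "R \<ge> B" for R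
  proof -
    obtain M where M: "\<And>x. \<bar>\<phi> x\<bar> \<le> M" using test_function_bounded[OF test] by blast
    have "(\<integral>\<xi>. ft ?\<phi> \<xi> * ft (fR R) (- \<xi>) \<partial>lborel) = (\<integral>x. ?\<phi> x * fR R x \<partial>lborel)"
    proof (rule Parseval[OF \<phi>(1) _ _ \<phi>(2) fRi fRn])
      show "continuous_on UNIV ?\<phi>" by (intro continuous_on_of_real test_function_continuous test)
      show "norm (?\<phi> x) \<le> M" for x using M by simp
    qed
    moreover have "(\<integral>\<xi>. ft ?\<phi> (- \<xi>) * ft (fR R) \<xi> \<partial>lborel) = (\<integral>\<xi>. ft ?\<phi> \<xi> * ft (fR R) (- \<xi>) \<partial>lborel)"
      using integral_lborel_reflect[of "\<lambda>\<xi>. ft ?\<phi> \<xi> * ft (fR R) (- \<xi>)"]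
        ft_measurable[OF \<phi>(1)] nsq_ft_reflect_le(2)[OF fRi] by (simp add: borel_measurable_times)
    moreover have "?\<phi> x * fR R x = complex_of_real (\<phi> x * f x $ i)" for x
      using B[of x] R by (cases "\<phi> x = 0") (auto simp: fR_def indicator_def)
    ultimately show ?thesis by (simp only: integral_complex_of_real)
  qed
  then have "\<forall>\<^sub>F R in at_top. (\<integral>\<xi>. ft ?\<phi> (- \<xi>) * ft (fR R) \<xi> \<partial>lborel) = complex_of_real (\<integral>x. \<phi> x * f x $ i \<partial>lborel)"
    using eventually_ge_at_top[of B] by (rule eventually_mono[rotated])
  then have "((\<lambda>R. \<integral>\<xi>. ft ?\<phi> (- \<xi>) * ft (fR R) \<xi> \<partial>lborel) \<longlongrightarrow> complex_of_real (\<integral>x. \<phi> x * f x $ i \<partial>lborel)) at_top"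
    by (rule tendsto_eventually)
  with 1 show ?thesis using tendsto_unique[OF trivial_limit_at_top_linorder] by blast
qed

text \<open>The weak derivative is the inverse transform of the symbol times \<open>F\<close>.
  Moving the symbol onto the test function makes it a derivative there, and
  \<open>fourier_L2_Parseval\<close> brings the pairing back to \<open>f\<close>.\<close>

theorem weak_deriv_exists:
  fixes f :: "real^'n \<Rightarrow> real^'m"
  assumes F: "fourier_L2 f F" and fin: "nsq (\<lambda>\<xi>. freq js \<xi> *\<^sub>R F \<xi>) < \<infinity>"
  obtains g where "in_L2 g" "has_weak_deriv f js g" "nsq g \<le> nsq (\<lambda>\<xi>. freq js \<xi> *\<^sub>R F \<xi>)"
proof -
  have f: "in_L2 f" and Fm: "F \<in> borel_measurable borel" using F by (auto simp: fourier_L2_def in_L2_iff)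
  let ?k = "length js"
  define h where "h i \<xi> = \<i> ^ ?k * complex_of_real (freq js \<xi>) * F \<xi> $ i" for i \<xi>
  have hm: "h i \<in> borel_measurable borel" for i
  proof -
    have [measurable]: "(\<lambda>\<xi>. F \<xi> $ i) \<in> borel_measurable borel" by (rule borel_measurable_vec_nth[OF Fm])
    show ?thesis unfolding h_def[abs_def] by measurable
  qed
  have hn: "norm (h i \<xi>) = norm ((freq js \<xi> *\<^sub>R F \<xi>) $ i)" for i \<xi>
    by (simp add: h_def norm_mult norm_power)
  have pFm: "(\<lambda>\<xi>. (freq js \<xi> *\<^sub>R F \<xi>) $ i) \<in> borel_measurable borel" for i
    using Fm by (intro borel_measurable_vec_nth borel_measurable_scaleR freq_measurable)
  have hsum: "(\<Sum>i\<in>UNIV. nsq (h i)) = nsq (\<lambda>\<xi>. freq js \<xi> *\<^sub>R F \<xi>)"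
    unfolding nsq_vec[OF pFm] by (simp only: nsq_def hn)
  have hfin: "nsq (h i) < \<infinity>" for i
  proof -
    have "nsq (h i) \<le> (\<Sum>i\<in>UNIV. nsq (h i))" by (rule member_le_sum) auto
    then show ?thesis using fin hsum by simp
  qed
  define Q where "Q i g \<longleftrightarrow> g \<in> borel_measurable borel \<and> nsq g \<le> nsq (h i) \<and> (\<forall>\<phi>. test_function \<phi> \<longrightarrow>
      (\<integral>x. complex_of_real (\<phi> x) * g x \<partial>lborel) = (\<integral>\<xi>. ft (\<lambda>x. complex_of_real (\<phi> x)) (- \<xi>) * h i \<xi> \<partial>lborel))" for i g
  have "\<exists>g. Q i g" for i
    by (rule inverse_fourier_L2[OF hm[of i] hfin[of i]]) (auto simp: Q_def)
  then obtain G where "\<And>i. Q i (G i)" by metis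
  then have Gm: "\<And>i. G i \<in> borel_measurable borel" and Gle: "\<And>i. nsq (G i) \<le> nsq (h i)"
    and Gint: "\<And>i \<phi>. test_function \<phi> \<Longrightarrow> (\<integral>x. complex_of_real (\<phi> x) * G i x \<partial>lborel) = (\<integral>\<xi>. ft (\<lambda>x. complex_of_real (\<phi> x)) (- \<xi>) * h i \<xi> \<partial>lborel)"
    by (simp_all add: Q_def)
  \<comment> \<open>The inverse transform is complex valued a priori. Taking real parts does not
    increase the norm, and since \<open>f\<close> and the test functions are real it keeps the
    required pairings.\<close>
  define g where "g x = (\<chi> i. Re (G i x))" for x
  have gc: "(\<lambda>x. g x $ i) \<in> borel_measurable borel" for i unfolding g_def using Gm by simp
  then have gm: "g \<in> borel_measurable borel" by (rule borel_measurable_vecI)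
  have gle: "nsq g \<le> nsq (\<lambda>\<xi>. freq js \<xi> *\<^sub>R F \<xi>)"
  proof -
    have "nsq g = (\<Sum>i\<in>UNIV. nsq (\<lambda>x. g x $ i))" by (rule nsq_vec[OF gc])
    also have "\<dots> \<le> (\<Sum>i\<in>UNIV. nsq (h i))"
    proof (rule sum_mono)
      fix i
      have "nsq (\<lambda>x. g x $ i) \<le> nsq (G i)" by (rule nsq_mono) (simp add: g_def abs_Re_le_cmod)
      then show "nsq (\<lambda>x. g x $ i) \<le> nsq (h i)" using Gle[of i] by simp
    qed
    finally show ?thesis by (simp only: hsum)
  qed
  show ?thesis
  proof (rule that)
    show gL2: "in_L2 g" using gm gle fin by (auto simp: in_L2_iff)
    show "has_weak_deriv f js g"
      unfolding has_weak_deriv_def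
    proof (intro allI impI)
      fix \<phi> :: "real^'n \<Rightarrow> real" assume \<phi>: "test_function \<phi>"
      have nth: "(\<integral>x. \<psi> x *\<^sub>R v x \<partial>lborel) $ i = (\<integral>x. \<psi> x * v x $ i \<partial>lborel)" if "test_function \<psi>" "in_L2 v"
        for \<psi> and v :: "real^'n \<Rightarrow> real^'m" and i
        using integral_bounded_linear[OF bounded_linear_vec_nth[of i] test_function_integrable[OF that]] by simp
      have "(\<integral>x. \<phi> x * g x $ i \<partial>lborel) = (-1) ^ ?k * (\<integral>x. pderivs js \<phi> x * f x $ i \<partial>lborel)" for i
      proof -
        have int: "integrable lborel (\<lambda>x. complex_of_real (\<phi> x) * G i x)"
          using Gle[of i] hfin[of i] by (intro integrable_mult_L2 test_function_complex[OF \<phi>] Gm) auto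
        have "ft (\<lambda>x. complex_of_real (\<phi> x)) (- \<xi>) * h i \<xi> =
           (-1) ^ ?k * (ft (\<lambda>x. complex_of_real (pderivs js \<phi> x)) (- \<xi>) * F \<xi> $ i)" for \<xi>
        proof -
          \<comment> \<open>One sign comes from the oddness of the symbol at - \<xi>, the other from
            the sign in the definition of a weak derivative; they cancel.\<close>
          have e: "(-1::complex) ^ ?k * (-1) ^ ?k = 1" by (simp flip: power_mult_distrib)
          have "x * (y * (x * z) * a * b) = (x * x) * (a * (y * z * b))" for x y z a b :: complex by (simp add: mult_ac)
          from this[of "(-1) ^ ?k"] show ?thesis
            by (simp add: ft_pderivs[OF \<phi>] freq_uminus h_def e)
        qed
        then have "(\<integral>x. complex_of_real (\<phi> x) * G i x \<partial>lborel) = complex_of_real ((-1) ^ ?k * (\<integral>x. pderivs js \<phi> x * f x $ i \<partial>lborel))"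
          using Gint[OF \<phi>, of i] fourier_L2_Parseval[OF F test_function_pderivs[OF \<phi>], of js i] by simp
        then have "Re (\<integral>x. complex_of_real (\<phi> x) * G i x \<partial>lborel) = (-1) ^ ?k * (\<integral>x. pderivs js \<phi> x * f x $ i \<partial>lborel)"
          by (simp only: Re_complex_of_real)
        moreover have "Re (\<integral>x. complex_of_real (\<phi> x) * G i x \<partial>lborel) = (\<integral>x. \<phi> x * g x $ i \<partial>lborel)"
          using integral_bounded_linear[OF bounded_linear_Re int] by (simp add: g_def)
        ultimately show ?thesis by simp
      qed
      note eq = this
      show "(\<integral>x. pderivs js \<phi> x *\<^sub>R f x \<partial>lborel) = (-1) ^ ?k *\<^sub>R (\<integral>x. \<phi> x *\<^sub>R g x \<partial>lborel)"
        unfolding vec_eq_iff vector_scaleR_component nth[OF \<phi> gL2] nth[OF test_function_pderivs[OF \<phi>] f] eq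
        by (simp flip: mult.assoc power_mult_distrib)
    qed
  qed (rule gle)
qed

section \<open>Uniqueness of weak derivatives\<close>

lemma Ck_on_real_polynomial_function:
  fixes p :: "'a::euclidean_space \<Rightarrow> real"
  assumes "real_polynomial_function p" shows "Ck_on k UNIV p"
  using assms by induction (auto intro: Ck_on_linear Ck_on_const Ck_on_add Ck_on_mult)

text \<open>The sign of \<open>d\<close> is an almost everywhere limit of continuous functions, which are uniformly
  approximated by polynomials on the support of the cut-off.\<close>

lemma AE_zero_of_test_functions:
  fixes d :: "real^'n \<Rightarrow> real"
  assumes d: "in_L2 d" and zero: "\<And>\<phi>. test_function \<phi> \<Longrightarrow> (\<integral>x. \<phi> x * d x \<partial>lborel) = 0"
  shows "AE x in lborel. d x = 0"
proof -
  have dm[measurable]: "d \<in> borel_measurable borel" using d by (simp add: in_L2_iff)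
  have sm: "(\<lambda>x. sgn (d x)) \<in> borel_measurable borel" by measurable
  then have "(\<lambda>x. sgn (d x)) \<in> borel_measurable lebesgue" by (simp add: measurable_completion)
  then have "(\<lambda>x. sgn (d x)) measurable_on UNIV" by (rule lebesgue_measurable_imp_measurable_on) simp
  then obtain N h where N: "negligible N" and h: "\<And>n. continuous_on UNIV (h n)"
    and hlim: "\<And>x. x \<notin> N \<Longrightarrow> (\<lambda>n. h n x) \<longlonglongrightarrow> sgn (d x)"
    unfolding measurable_on_def by auto
  have AE_N: "AE x in lborel. x \<notin> N"
  proof -
    have "N \<in> null_sets lebesgue" using N by (simp add: negligible_iff_null_sets)
    then have "AE x in lebesgue. x \<notin> N" by (rule AE_not_in)
    then show ?thesis by (simp add: AE_completion_iff)
  qed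
  have ball: "AE x in lborel. norm x < R \<longrightarrow> d x = 0" if R: "R > 0" for R
  proof -
    define b where "b x = bump (x /\<^sub>R R) * d x" for x
    have tb: "test_function (\<lambda>x::real^'n. bump (x /\<^sub>R R))" by (rule test_function_scale[OF test_function_bump R])
    have bi: "integrable lborel b" using test_function_integrable[OF tb d] by (simp add: b_def[abs_def])
    have supp: "b x = 0" if "norm x > R" for x
      using bump_eq_0[of "x /\<^sub>R R"] R that by (simp add: b_def field_simps)
    have cont0: "(\<integral>x. w x * b x \<partial>lborel) = 0" if w: "continuous_on UNIV w" and wb: "\<And>x. \<bar>w x\<bar> \<le> 1" for w
    proof -
      have wm[measurable]: "w \<in> borel_measurable borel" by (rule borel_measurable_continuous_onI[OF w])
      have wi: "integrable lborel (\<lambda>x. w x * b x)"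
      proof (rule Bochner_Integration.integrable_bound[OF bi])
        show "(\<lambda>x. w x * b x) \<in> borel_measurable lborel" using bi by measurable
      qed (use wb in \<open>auto simp: abs_mult intro!: AE_I2 mult_left_le_one_le\<close>)
      have "\<bar>\<integral>x. w x * b x \<partial>lborel\<bar> \<le> e * (\<integral>x. \<bar>b x\<bar> \<partial>lborel)" if e: "e > 0" for e
      proof -
        obtain p where p: "real_polynomial_function p" "\<And>x. x \<in> cball 0 R \<Longrightarrow> \<bar>w x - p x\<bar> < e"
          using Stone_Weierstrass_real_polynomial_function[OF compact_cball[of 0 R] continuous_on_subset[OF w subset_UNIV] e] by metis
        have tp: "test_function (\<lambda>x. bump (x /\<^sub>R R) * p x)"
          by (rule test_function_mult_smooth[OF tb Ck_on_real_polynomial_function[OF p(1)]])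
        have pb: "p x * b x = (bump (x /\<^sub>R R) * p x) * d x" for x by (simp add: b_def)
        have pi: "integrable lborel (\<lambda>x. p x * b x)"
          unfolding pb using test_function_integrable[OF tp d] by simp
        have "(\<integral>x. p x * b x \<partial>lborel) = 0" unfolding pb by (rule zero[OF tp])
        then have "(\<integral>x. w x * b x \<partial>lborel) = (\<integral>x. w x * b x - p x * b x \<partial>lborel)"
          using wi pi by simp
        also have "\<bar>\<dots>\<bar> \<le> (\<integral>x. \<bar>w x * b x - p x * b x\<bar> \<partial>lborel)" by (rule integral_abs_bound)
        also have "\<dots> \<le> (\<integral>x. e * \<bar>b x\<bar> \<partial>lborel)"
        proof (rule integral_mono)
          fix x
          show "\<bar>w x * b x - p x * b x\<bar> \<le> e * \<bar>b x\<bar>"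
          proof (cases "norm x \<le> R")
            case True
            then have "\<bar>w x - p x\<bar> * \<bar>b x\<bar> \<le> e * \<bar>b x\<bar>" using p(2)[of x] by (intro mult_right_mono) auto
            then show ?thesis by (simp add: left_diff_distrib flip: abs_mult)
          next
            case False
            then show ?thesis using supp[of x] by simp
          qed
        qed (use wi pi bi in auto)
        finally show ?thesis by simp
      qed
      note bound = this
      have "\<bar>\<integral>x. w x * b x \<partial>lborel\<bar> \<le> 0"
      proof (rule field_le_epsilon)
        fix e :: real assume e: "e > 0"
        define I where "I = (\<integral>x. \<bar>b x\<bar> \<partial>lborel)"
        have I: "I \<ge> 0" by (simp add: I_def)
        have "\<bar>\<integral>x. w x * b x \<partial>lborel\<bar> \<le> e / (I + 1) * I" unfolding I_def[symmetric]
          using bound[of "e / (I + 1)"] e I by (simp add: I_def[symmetric])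
        also have "\<dots> \<le> e" using e I by (simp add: field_simps)
        finally show "\<bar>\<integral>x. w x * b x \<partial>lborel\<bar> \<le> 0 + e" by simp
      qed
      then show ?thesis by simp
    qed
    \<comment> \<open>Clipping to [-1, 1] supplies the majorant |b| and leaves the limit alone,
      because a sign already lies in that interval.\<close>
    let ?w = "\<lambda>n x. max (-1) (min 1 (h n x))"
    have "(\<lambda>n. \<integral>x. ?w n x * b x \<partial>lborel) \<longlonglongrightarrow> (\<integral>x. sgn (d x) * b x \<partial>lborel)"
    proof (rule integral_dominated_convergence[where w="\<lambda>x. \<bar>b x\<bar>"])
      have bm[measurable]: "b \<in> borel_measurable borel" using bi by (auto dest: borel_measurable_integrable)
      have [measurable]: "h n \<in> borel_measurable borel" for n by (rule borel_measurable_continuous_onI[OF h])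
      show "(\<lambda>x. sgn (d x) * b x) \<in> borel_measurable lborel" by measurable
      show "(\<lambda>x. ?w n x * b x) \<in> borel_measurable lborel" for n by measurable
      show "AE x in lborel. (\<lambda>n. ?w n x * b x) \<longlonglongrightarrow> sgn (d x) * b x"
        using AE_N
      proof eventually_elim
        case (elim x)
        have "(\<lambda>n. ?w n x * b x) \<longlonglongrightarrow> max (-1) (min 1 (sgn (d x))) * b x"
          by (intro tendsto_intros hlim elim)
        moreover have "max (-1) (min 1 (sgn (d x))) = sgn (d x)" by (simp add: sgn_if)
        ultimately show ?case by simp
      qed
      have "\<bar>?w n x\<bar> \<le> 1" for n x by (auto simp: abs_le_iff)
      then show "AE x in lborel. norm (?w n x * b x) \<le> \<bar>b x\<bar>" for n
        by (intro AE_I2) (simp add: abs_mult mult_left_le_one_le)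
    qed (use bi in simp)
    moreover have "(\<integral>x. ?w n x * b x \<partial>lborel) = 0" for n
      by (rule cont0) (auto intro!: continuous_on_max continuous_on_min continuous_on_const h simp: abs_le_iff)
    ultimately have "(\<integral>x. sgn (d x) * b x \<partial>lborel) = 0" by (simp add: LIMSEQ_const_iff)
    moreover have "sgn (d x) * b x = \<bar>b x\<bar>" for x
      by (simp add: b_def abs_mult bump_nonneg abs_sgn[of "d x"])
    ultimately have "(\<integral>x. \<bar>b x\<bar> \<partial>lborel) = 0" by simp
    then have "AE x in lborel. \<bar>b x\<bar> = 0"
      using bi by (subst (asm) integral_nonneg_eq_0_iff_AE) auto
    then show ?thesis
    proof eventually_elim
      case (elim x)
      show ?case
      proof
        assume "norm x < R"
        then have "norm (x /\<^sub>R R) < 1" using R by (simp add: field_simps)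
        then have "(norm (x /\<^sub>R R))\<^sup>2 < 1" by (simp add: power_less_one_iff abs_square_less_1)
        then have "bump (x /\<^sub>R R) > 0" using flat_1_pos by (simp add: bump_def flat_def)
        then show "d x = 0" using elim by (simp add: b_def)
      qed
    qed
  qed
  have "AE x in lborel. \<forall>k. norm x < real (Suc k) \<longrightarrow> d x = 0"
    unfolding AE_all_countable using ball by simp
  then show ?thesis
  proof eventually_elim
    case (elim x)
    obtain k where "norm x < real k" using reals_Archimedean2 by blast
    then have "norm x < real (Suc k)" by simp
    then show ?case using elim by blast
  qed
qed

text \<open>\<open>weak_deriv\<close> is an arbitrary choice; this makes its norm independent of
  that choice, so a bound for any one weak derivative transfers to the chosen one.\<close>

lemma has_weak_deriv_unique:
  fixes f g h :: "real^'n \<Rightarrow> real^'m"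
  assumes "in_L2 g" "has_weak_deriv f js g" "in_L2 h" "has_weak_deriv f js h"
  shows "nsq g = nsq h"
proof -
  have "AE x in lborel. (g x - h x) $ i = 0" for i
  proof (rule AE_zero_of_test_functions)
    have gh: "in_L2 (\<lambda>x. g x - h x)" by (rule in_L2_diff[OF assms(1,3)])
    have "nsq (\<lambda>x. (g x - h x) $ i) \<le> nsq (\<lambda>x. g x - h x)"
      by (intro nsq_mono Finite_Cartesian_Product.norm_nth_le)
    moreover have "(\<lambda>x. (g x - h x) $ i) \<in> borel_measurable borel"
      by (rule borel_measurable_vec_nth) (use gh in \<open>simp add: in_L2_iff\<close>)
    ultimately show "in_L2 (\<lambda>x. (g x - h x) $ i)"
      using gh unfolding in_L2_iff by (meson le_less_trans)
    fix \<phi> :: "real^'n \<Rightarrow> real" assume \<phi>: "test_function \<phi>"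
    have "(-1) ^ length js *\<^sub>R (\<integral>x. \<phi> x *\<^sub>R g x \<partial>lborel) = (-1) ^ length js *\<^sub>R (\<integral>x. \<phi> x *\<^sub>R h x \<partial>lborel)"
      using assms \<phi> by (simp add: has_weak_deriv_def)
    then have "(\<integral>x. \<phi> x *\<^sub>R (g x - h x) \<partial>lborel) = 0"
      using test_function_integrable[OF \<phi> assms(1)] test_function_integrable[OF \<phi> assms(3)]
      by (simp add: scaleR_diff_right)
    moreover have "(\<integral>x. \<phi> x * (g x - h x) $ i \<partial>lborel) = (\<integral>x. \<phi> x *\<^sub>R (g x - h x) \<partial>lborel) $ i"
      using integral_bounded_linear[OF bounded_linear_vec_nth[of i] test_function_integrable[OF \<phi> gh]] by simp
    ultimately show "(\<integral>x. \<phi> x * (g x - h x) $ i \<partial>lborel) = 0" by simp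
  qed
  then have "AE x in lborel. \<forall>i. (g x - h x) $ i = 0" unfolding AE_all_countable by blast
  then have "AE x in lborel. ennreal ((norm (g x))\<^sup>2) = ennreal ((norm (h x))\<^sup>2)"
  proof eventually_elim
    case (elim x)
    then have "g x = h x" by (simp add: vec_eq_iff)
    then show ?case by simp
  qed
  then show ?thesis unfolding nsq_def by (rule nn_integral_cong_AE)
qed

section \<open>Decay of derivatives\<close>

lemma sum_lists_Suc:
  fixes F :: "'n::finite list \<Rightarrow> 'a::comm_monoid_add"
  shows "(\<Sum>js | length js = Suc k. F js) = (\<Sum>j\<in>UNIV. \<Sum>js | length js = k. F (j # js))"
proof -
  have "{js :: 'n list. length js = Suc k} = (\<lambda>(j, js). j # js) ` (UNIV \<times> {js. length js = k})"
    by (auto simp: length_Suc_conv)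
  moreover have "inj_on (\<lambda>(j, js). j # js) (UNIV \<times> {js :: 'n list. length js = k})"
    by (auto simp: inj_on_def)
  ultimately have "(\<Sum>js | length js = Suc k. F js) = (\<Sum>(j, js)\<in>UNIV \<times> {js. length js = k}. F (j # js))"
    by (simp add: sum.reindex split_beta')
  then show ?thesis by (simp add: sum.cartesian_product)
qed

lemma finite_lists_length: "finite {js :: 'n::finite list. length js = k}"
  using finite_lists_length_eq[of "UNIV :: 'n set" k] by simp

text \<open>Lists of directions are ordered, so the sum is the k-th power of the sum of the squared
  coordinates, with no multinomial coefficients.\<close>

lemma sum_freq_square:
  fixes \<xi> :: "real^'n"
  shows "(\<Sum>js | length js = k. (freq js \<xi>)\<^sup>2) = (norm \<xi> ^ k)\<^sup>2"
proof (induction k)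
  case (Suc k)
  have "(norm \<xi>)\<^sup>2 = (\<Sum>j\<in>UNIV. (\<xi> $ j)\<^sup>2)"
    unfolding power2_norm_eq_inner inner_vec_def by (simp add: power2_eq_square)
  then have "(\<Sum>js | length js = Suc k. (freq js \<xi>)\<^sup>2) = (norm \<xi>)\<^sup>2 * (\<Sum>js | length js = k. (freq js \<xi>)\<^sup>2)"
    by (simp add: sum_lists_Suc freq_def power_mult_distrib flip: sum_distrib_left sum_distrib_right)
  then show ?case by (simp add: Suc power_mult_distrib)
qed (simp add: freq_def)

lemma nsq_norm_power:
  fixes F :: "real^'n \<Rightarrow> 'b::euclidean_space"
  assumes [measurable]: "F \<in> borel_measurable borel"
  shows "nsq (\<lambda>\<xi>. norm \<xi> ^ k *\<^sub>R F \<xi>) = (\<Sum>js | length js = k. nsq (\<lambda>\<xi>. freq js \<xi> *\<^sub>R F \<xi>))"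
proof -
  have "(norm (norm \<xi> ^ k *\<^sub>R F \<xi>))\<^sup>2 = (\<Sum>js | length js = k. (norm (freq js \<xi> *\<^sub>R F \<xi>))\<^sup>2)" for \<xi>
    by (simp add: power_mult_distrib sum_freq_square[symmetric] sum_distrib_right)
  then have "nsq (\<lambda>\<xi>. norm \<xi> ^ k *\<^sub>R F \<xi>) = (\<integral>\<^sup>+\<xi>. (\<Sum>js | length js = k. ennreal ((norm (freq js \<xi> *\<^sub>R F \<xi>))\<^sup>2)) \<partial>lborel)"
    unfolding nsq_def by (simp add: sum_ennreal)
  also have "\<dots> = (\<Sum>js | length js = k. nsq (\<lambda>\<xi>. freq js \<xi> *\<^sub>R F \<xi>))"
    unfolding nsq_def by (rule nn_integral_sum) measurable
  finally show ?thesis .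
qed

lemma norm_L2_derivs_nsq:
  assumes "\<And>js. length js = k \<Longrightarrow> in_L2 (weak_deriv js f)"
  shows "ennreal ((norm_L2_derivs k f)\<^sup>2) = (\<Sum>js | length js = k. nsq (weak_deriv js f))"
proof -
  have "ennreal ((norm_L2_derivs k f)\<^sup>2) = ennreal (\<Sum>js | length js = k. (norm_L2 (weak_deriv js f))\<^sup>2)"
    by (simp add: norm_L2_derivs_def sum_nonneg)
  also have "\<dots> = (\<Sum>js | length js = k. ennreal ((norm_L2 (weak_deriv js f))\<^sup>2))"
    by (simp add: sum_ennreal)
  also have "\<dots> = (\<Sum>js | length js = k. nsq (weak_deriv js f))"
    by (intro sum.cong refl) (simp add: nsq_eq_norm_L2 assms)
  finally show ?thesis .
qed

lemma weak_deriv_props: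
  assumes "in_L2 g" "has_weak_deriv f js g"
  shows "in_L2 (weak_deriv js f)" "has_weak_deriv f js (weak_deriv js f)"
  using someI[of "\<lambda>g. in_L2 g \<and> has_weak_deriv f js g" g] assms by (simp_all add: weak_deriv_def)

lemma nsq_norm_power_le_derivs:
  fixes f :: "real^'n \<Rightarrow> real^'m"
  assumes Hs: "in_Hs s f" and f: "in_L1 f" and k: "k \<le> s"
  shows "nsq (\<lambda>\<xi>. norm \<xi> ^ k *\<^sub>R fourier_L1 f \<xi>) \<le> ennreal ((norm_L2_derivs k f)\<^sup>2)"
proof -
  have fi: "integrable lborel f" using f by (simp add: in_L1_def)
  have wd: "in_L2 (weak_deriv js f)" "has_weak_deriv f js (weak_deriv js f)" if "length js = k" for js
    using Hs k that weak_deriv_props by (metis in_Hs_def)+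
  have "nsq (\<lambda>\<xi>. norm \<xi> ^ k *\<^sub>R fourier_L1 f \<xi>) = (\<Sum>js | length js = k. nsq (\<lambda>\<xi>. freq js \<xi> *\<^sub>R fourier_L1 f \<xi>))"
    by (rule nsq_norm_power[OF fourier_L1_measurable[OF fi]])
  also have "\<dots> \<le> (\<Sum>js | length js = k. nsq (weak_deriv js f))"
    by (rule sum_mono) (auto intro!: nsq_freq_le_weak_deriv fi wd)
  also have "\<dots> = ennreal ((norm_L2_derivs k f)\<^sup>2)" using norm_L2_derivs_nsq wd by metis
  finally show ?thesis .
qed

text \<open>Together with \<open>nsq_norm_power_le_derivs\<close> this plays the part of
  Plancherel's identity for derivatives: there the derivatives of the datum bound its transform,
  here the transform of the solution bounds its derivatives. Finiteness for every order up to
  \<open>k\<close> is demanded because \<open>in_Hs\<close> includes all lower derivatives.\<close>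

lemma derivs_le_nsq_norm_power:
  fixes f :: "real^'n \<Rightarrow> real^'m"
  assumes F: "fourier_L2 f F" and fin: "\<And>i. i \<le> k \<Longrightarrow> nsq (\<lambda>\<xi>. norm \<xi> ^ i *\<^sub>R F \<xi>) < \<infinity>"
  shows "in_Hs k f" and "ennreal ((norm_L2_derivs k f)\<^sup>2) \<le> nsq (\<lambda>\<xi>. norm \<xi> ^ k *\<^sub>R F \<xi>)"
proof -
  have Fm: "F \<in> borel_measurable borel" and f: "in_L2 f" using F by (auto simp: fourier_L2_def in_L2_iff)
  have ex: "\<exists>g. in_L2 g \<and> has_weak_deriv f js g \<and> nsq g \<le> nsq (\<lambda>\<xi>. freq js \<xi> *\<^sub>R F \<xi>)" if js: "length js \<le> k" for js
  proof -
    have "nsq (\<lambda>\<xi>. freq js \<xi> *\<^sub>R F \<xi>) \<le> (\<Sum>is | length is = length js. nsq (\<lambda>\<xi>. freq is \<xi> *\<^sub>R F \<xi>))"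
      by (rule member_le_sum[where f="\<lambda>is. nsq (\<lambda>\<xi>. freq is \<xi> *\<^sub>R F \<xi>)"]) (auto simp: finite_lists_length)
    also have "\<dots> = nsq (\<lambda>\<xi>. norm \<xi> ^ length js *\<^sub>R F \<xi>)" by (rule nsq_norm_power[OF Fm, symmetric])
    also have "\<dots> < \<infinity>" by (rule fin[OF js])
    finally have "nsq (\<lambda>\<xi>. freq js \<xi> *\<^sub>R F \<xi>) < \<infinity>" .
    from weak_deriv_exists[OF F this] show ?thesis by blast
  qed
  then show "in_Hs k f" using f unfolding in_Hs_def by blast
  have wd: "in_L2 (weak_deriv js f)" "nsq (weak_deriv js f) \<le> nsq (\<lambda>\<xi>. freq js \<xi> *\<^sub>R F \<xi>)" if js: "length js = k" for js
  proof -
    obtain g where g: "in_L2 g" "has_weak_deriv f js g" "nsq g \<le> nsq (\<lambda>\<xi>. freq js \<xi> *\<^sub>R F \<xi>)"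
      using ex js by blast
    note w = weak_deriv_props[OF g(1,2)]
    show "in_L2 (weak_deriv js f)" by (rule w(1))
    show "nsq (weak_deriv js f) \<le> nsq (\<lambda>\<xi>. freq js \<xi> *\<^sub>R F \<xi>)"
      using has_weak_deriv_unique[OF w g(1,2)] g(3) by simp
  qed
  have "ennreal ((norm_L2_derivs k f)\<^sup>2) = (\<Sum>js | length js = k. nsq (weak_deriv js f))"
    by (rule norm_L2_derivs_nsq) (rule wd(1))
  also have "\<dots> \<le> (\<Sum>js | length js = k. nsq (\<lambda>\<xi>. freq js \<xi> *\<^sub>R F \<xi>))"
    by (rule sum_mono) (auto intro: wd(2))
  also have "\<dots> = nsq (\<lambda>\<xi>. norm \<xi> ^ k *\<^sub>R F \<xi>)" by (rule nsq_norm_power[OF Fm, symmetric])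
  finally show "ennreal ((norm_L2_derivs k f)\<^sup>2) \<le> nsq (\<lambda>\<xi>. norm \<xi> ^ k *\<^sub>R F \<xi>)" .
qed

section \<open>Decay factors at low and high frequencies\<close>

lemma power_le_exp:
  fixes a y :: real
  assumes "a > 0" "y \<ge> 0" shows "y ^ k \<le> fact k / a ^ k * exp (a * y)"
proof -
  have "(a * y) ^ k / fact k \<le> exp (a * y)"
  proof -
    have s: "(\<lambda>n. (a * y) ^ n /\<^sub>R fact n) sums exp (a * y)" by (rule exp_converges)
    have "(\<Sum>n\<in>{k}. (a * y) ^ n /\<^sub>R fact n) \<le> exp (a * y)"
      unfolding sums_unique[OF s] using sums_summable[OF s] assms by (intro sum_le_suminf) auto
    then show ?thesis by (simp add: field_simps)
  qed
  then show ?thesis using assms by (simp add: power_mult_distrib field_simps)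
qed

text \<open>The lower bound \<eta> \<ge> r^2/4 leaves exp (- (c/2) r^2 t), and since r \<le> 1 the
  factor exp (c/2) pays for replacing t by 1 + t. One half of the exponent absorbs the power of r^2
  (1 + t); the other half remains as a Gaussian whose integral gives the dimensional decay.\<close>

lemma low_frequency_bound:
  fixes r t c :: real
  assumes r: "0 \<le> r" "r \<le> 1" and t: "t \<ge> 0" and c: "c > 0"
  shows "(r ^ k)\<^sup>2 * exp (- 2 * c * (r\<^sup>2 / (1 + r\<^sup>2)\<^sup>2) * t) \<le>
    exp (c / 2) * (fact k / (c / 4) ^ k) / (1 + t) ^ k * exp (- (c / 4) * (1 + t) * r\<^sup>2)"
proof -
  have r2: "r\<^sup>2 \<le> 1" using r by (simp add: power_le_one)
  have "(1 + r\<^sup>2)\<^sup>2 \<le> 2\<^sup>2" using r2 by (intro power_mono) auto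
  moreover have p: "1 + r\<^sup>2 > 0" by (simp add: add_pos_nonneg)
  ultimately have "r\<^sup>2 / 4 \<le> r\<^sup>2 / (1 + r\<^sup>2)\<^sup>2"
    by (intro divide_left_mono mult_pos_pos zero_less_power) auto
  then have "2 * c * t * (r\<^sup>2 / 4) \<le> 2 * c * t * (r\<^sup>2 / (1 + r\<^sup>2)\<^sup>2)"
    using c t by (intro mult_left_mono) auto
  moreover have "c / 2 * r\<^sup>2 \<le> c / 2 * 1" using c r2 by (intro mult_left_mono) auto
  ultimately have e: "- 2 * c * (r\<^sup>2 / (1 + r\<^sup>2)\<^sup>2) * t \<le> c / 2 - c / 2 * (r\<^sup>2 * (1 + t))"
    by (simp add: algebra_simps)
  define y where "y = r\<^sup>2 * (1 + t)"
  have y: "y \<ge> 0" using t by (simp add: y_def)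
  have "(r ^ k)\<^sup>2 = y ^ k / (1 + t) ^ k"
    using t by (simp add: y_def power_mult_distrib power_mult[symmetric] mult.commute)
  also have "\<dots> \<le> fact k / (c / 4) ^ k * exp (c / 4 * y) / (1 + t) ^ k"
    using c y t by (intro divide_right_mono power_le_exp) auto
  finally have 1: "(r ^ k)\<^sup>2 \<le> fact k / (c / 4) ^ k * exp (c / 4 * y) / (1 + t) ^ k" .
  have "(r ^ k)\<^sup>2 * exp (- 2 * c * (r\<^sup>2 / (1 + r\<^sup>2)\<^sup>2) * t) \<le>
     fact k / (c / 4) ^ k * exp (c / 4 * y) / (1 + t) ^ k * exp (c / 2 - c / 2 * y)"
    using e c t by (intro mult_mono 1) (auto simp: y_def)
  also have "\<dots> = (fact k / (c / 4) ^ k) / (1 + t) ^ k * (exp (c / 4 * y) * exp (c / 2 - c / 2 * y))" by simp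
  also have "exp (c / 4 * y) * exp (c / 2 - c / 2 * y) = exp (c / 2) * exp (- (c / 4) * (1 + t) * r\<^sup>2)"
    unfolding exp_add[symmetric] by (simp add: y_def algebra_simps)
  finally show ?thesis by (simp add: mult_ac)
qed

text \<open>Here \<eta> \<ge> 1/(4 r^2) leaves only exp (- (c/2) t/r^2), which is not uniform in r.
  From 1 + t \<le> r^2 (1 + y) with y = t/r^2, a power (1 + t)^l of decay is bought with r^{2l},
  that is, with l derivatives of the datum.\<close>

lemma high_frequency_bound:
  fixes r t c :: real
  assumes r: "1 \<le> r" and t: "t \<ge> 0" and c: "c > 0"
  shows "(r ^ k)\<^sup>2 * exp (- 2 * c * (r\<^sup>2 / (1 + r\<^sup>2)\<^sup>2) * t) \<le>
    exp (c / 2) * (fact l / (c / 2) ^ l) / (1 + t) ^ l * (r ^ (k + l))\<^sup>2"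
proof -
  have r2: "r\<^sup>2 \<ge> 1" using r by (simp add: one_le_power)
  have "(1 + r\<^sup>2)\<^sup>2 \<le> (2 * r\<^sup>2)\<^sup>2" using r2 by (intro power_mono) auto
  then have "r\<^sup>2 / (2 * r\<^sup>2)\<^sup>2 \<le> r\<^sup>2 / (1 + r\<^sup>2)\<^sup>2"
    by (rule divide_left_mono) (use r in \<open>auto intro!: mult_pos_pos zero_less_power add_pos_nonneg\<close>)
  moreover have "r\<^sup>2 / (2 * r\<^sup>2)\<^sup>2 = 1 / (4 * r\<^sup>2)" using r by (simp add: power2_eq_square field_simps)
  ultimately have "2 * c * t * (1 / (4 * r\<^sup>2)) \<le> 2 * c * t * (r\<^sup>2 / (1 + r\<^sup>2)\<^sup>2)"
    using c t by (intro mult_left_mono) auto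
  define y where "y = t / r\<^sup>2"
  have y: "y \<ge> 0" using t by (simp add: y_def)
  have e: "exp (- 2 * c * (r\<^sup>2 / (1 + r\<^sup>2)\<^sup>2) * t) \<le> exp (- (c / 2) * y)"
    using \<open>2 * c * t * (1 / (4 * r\<^sup>2)) \<le> _\<close> by (simp add: y_def mult_ac)
  have "1 + t \<le> r\<^sup>2 * (1 + y)" using r r2 by (simp add: y_def distrib_left)
  then have "(1 + t) ^ l \<le> (r\<^sup>2 * (1 + y)) ^ l" using t by (intro power_mono) auto
  also have "\<dots> = (r ^ l)\<^sup>2 * (1 + y) ^ l" by (simp add: power_mult_distrib power_mult[symmetric] mult.commute)
  also have "\<dots> \<le> (r ^ l)\<^sup>2 * (fact l / (c / 2) ^ l * exp (c / 2 * (1 + y)))"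
    using c y by (intro mult_left_mono power_le_exp) auto
  finally have "(1 + t) ^ l * exp (- (c / 2) * y) \<le> (r ^ l)\<^sup>2 * (fact l / (c / 2) ^ l * exp (c / 2 * (1 + y))) * exp (- (c / 2) * y)"
    by (intro mult_right_mono) auto
  also have "\<dots> = exp (c / 2) * (fact l / (c / 2) ^ l) * (r ^ l)\<^sup>2"
    by (simp add: mult.assoc mult_exp_exp algebra_simps)
  finally have "exp (- (c / 2) * y) \<le> exp (c / 2) * (fact l / (c / 2) ^ l) * (r ^ l)\<^sup>2 / (1 + t) ^ l"
    using t by (subst pos_le_divide_eq) (simp_all only: mult.commute[of "exp (- (c / 2) * y)"] zero_less_power add_pos_nonneg zero_less_one)
  with e have "exp (- 2 * c * (r\<^sup>2 / (1 + r\<^sup>2)\<^sup>2) * t) \<le> exp (c / 2) * (fact l / (c / 2) ^ l) * (r ^ l)\<^sup>2 / (1 + t) ^ l"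
    by linarith
  then have "(r ^ k)\<^sup>2 * exp (- 2 * c * (r\<^sup>2 / (1 + r\<^sup>2)\<^sup>2) * t) \<le> (r ^ k)\<^sup>2 * (exp (c / 2) * (fact l / (c / 2) ^ l) * (r ^ l)\<^sup>2 / (1 + t) ^ l)"
    by (rule mult_left_mono) simp
  then show ?thesis by (simp add: power_add power_mult_distrib mult_ac)
qed

lemma nn_integral_gauss:
  assumes b: "b > 0"
  shows "(\<integral>\<^sup>+\<xi>. ennreal (exp (- b * (norm (\<xi>::'a::euclidean_space))\<^sup>2)) \<partial>lborel) = ennreal ((pi / b) powr (DIM('a) / 2))"
proof -
  have e: "2 * b > 0" using b by simp
  have i: "integrable lborel (\<lambda>\<xi>::'a. complex_of_real (exp (- b * (norm \<xi>)\<^sup>2)))"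
    and v: "(\<integral>\<xi>. complex_of_real (exp (- b * (norm (\<xi>::'a))\<^sup>2)) \<partial>lborel) = complex_of_real ((pi / b) powr (DIM('a) / 2))"
    using integrable_gauss[OF e, of "0::'a"] integral_gauss[OF e, of "0::'a"] by simp_all
  from i have i': "integrable lborel (\<lambda>\<xi>::'a. exp (- b * (norm \<xi>)\<^sup>2))" by (simp only: complex_of_real_integrable_eq)
  have "(\<integral>\<xi>. exp (- b * (norm (\<xi>::'a))\<^sup>2) \<partial>lborel) = (pi / b) powr (DIM('a) / 2)"
    using v by (simp only: integral_complex_of_real of_real_eq_iff)
  then show ?thesis using nn_integral_eq_integral[OF i'] by simp
qed

text \<open>At low frequencies the uniform bound \<open>K\<close> on the transform of the datum
  leaves a Gaussian integral of order (1 + t)^{-n/2}; at high frequencies the powers of |\<xi>| go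
  to the datum. Both bounds are added at every frequency, so the integral is never split.\<close>

lemma nsq_decay:
  fixes F F0 :: "real^'n \<Rightarrow> complex^'m" and k l :: nat
  assumes F: "\<And>\<xi>. norm (F \<xi>) \<le> C * exp (- c * eta \<xi> * t) * norm (F0 \<xi>)"
    and F0: "\<And>\<xi>. norm (F0 \<xi>) \<le> K" and F0m: "F0 \<in> borel_measurable borel"
    and c: "c > 0" and C: "C > 0" and t: "t \<ge> 0"
  defines "D1 \<equiv> C\<^sup>2 * (exp (c / 2) * (fact k / (c / 4) ^ k)) * (4 * pi / c) powr (real CARD('n) / 2)"
    and "D2 \<equiv> C\<^sup>2 * (exp (c / 2) * (fact l / (c / 2) ^ l))"
  shows "nsq (\<lambda>\<xi>. norm \<xi> ^ k *\<^sub>R F \<xi>) \<le> ennreal (D1 * (1 + t) powr (- real CARD('n) / 2 - real k) * K\<^sup>2) +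
    ennreal (D2 * (1 + t) powr (- real l)) * nsq (\<lambda>\<xi>. norm \<xi> ^ (k + l) *\<^sub>R F0 \<xi>)"
proof -
  define a where "a = C\<^sup>2 * (exp (c / 2) * (fact k / (c / 4) ^ k)) / (1 + t) ^ k * K\<^sup>2"
  define b where "b = c / 4 * (1 + t)"
  define d where "d = D2 / (1 + t) ^ l"
  have K: "K \<ge> 0" using order_trans[OF norm_ge_zero F0] .
  have a: "a \<ge> 0" and b: "b > 0" and d: "d \<ge> 0" using c t by (auto simp: a_def b_def d_def D2_def)
  have pointwise: "(norm (norm \<xi> ^ k *\<^sub>R F \<xi>))\<^sup>2 \<le> a * exp (- b * (norm \<xi>)\<^sup>2) + d * (norm (norm \<xi> ^ (k + l) *\<^sub>R F0 \<xi>))\<^sup>2" for \<xi>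
  proof -
    define r where "r = norm \<xi>"
    define X where "X = (r ^ k)\<^sup>2 * exp (- 2 * c * (r\<^sup>2 / (1 + r\<^sup>2)\<^sup>2) * t)"
    have r: "r \<ge> 0" by (simp add: r_def)
    have "(norm (norm \<xi> ^ k *\<^sub>R F \<xi>))\<^sup>2 \<le> (r ^ k * (C * exp (- c * eta \<xi> * t) * norm (F0 \<xi>)))\<^sup>2"
      using F[of \<xi>] r unfolding r_def by (intro power_mono) (auto intro!: mult_left_mono)
    also have "\<dots> = C\<^sup>2 * X * (norm (F0 \<xi>))\<^sup>2"
    proof -
      have "(exp (- c * eta \<xi> * t))\<^sup>2 = exp (- 2 * c * (r\<^sup>2 / (1 + r\<^sup>2)\<^sup>2) * t)"
        by (simp add: power2_eq_square[of "exp _"] eta_def r_def flip: exp_add)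
      then show ?thesis by (simp add: power_mult_distrib X_def mult_ac)
    qed
    also have "\<dots> \<le> a * exp (- b * r\<^sup>2) + d * ((r ^ (k + l))\<^sup>2 * (norm (F0 \<xi>))\<^sup>2)"
    proof (cases "r \<le> 1")
      case True
      have nk: "(norm (F0 \<xi>))\<^sup>2 \<le> K\<^sup>2" by (intro power_mono F0) auto
      have "C\<^sup>2 * X * (norm (F0 \<xi>))\<^sup>2 \<le> C\<^sup>2 * (exp (c / 2) * (fact k / (c / 4) ^ k) / (1 + t) ^ k * exp (- (c / 4) * (1 + t) * r\<^sup>2)) * K\<^sup>2"
        unfolding X_def
        by (rule mult_mono[OF mult_left_mono[OF low_frequency_bound[OF r True t c, of k]] nk]) (use c t in auto)
      also have "\<dots> = a * exp (- b * r\<^sup>2)" by (simp add: a_def b_def mult_ac)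
      finally show ?thesis using d by (simp add: add_increasing2)
    next
      case False
      then have "C\<^sup>2 * X * (norm (F0 \<xi>))\<^sup>2 \<le> C\<^sup>2 * (exp (c / 2) * (fact l / (c / 2) ^ l) / (1 + t) ^ l * (r ^ (k + l))\<^sup>2) * (norm (F0 \<xi>))\<^sup>2"
        unfolding X_def using high_frequency_bound[of r t c k l] t c
        by (intro mult_right_mono mult_left_mono) auto
      also have "\<dots> = d * ((r ^ (k + l))\<^sup>2 * (norm (F0 \<xi>))\<^sup>2)" by (simp add: d_def D2_def mult_ac)
      finally show ?thesis using a by (simp add: add_increasing)
    qed
    also have "(r ^ (k + l))\<^sup>2 * (norm (F0 \<xi>))\<^sup>2 = (norm (norm \<xi> ^ (k + l) *\<^sub>R F0 \<xi>))\<^sup>2"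
      by (simp add: r_def power_mult_distrib)
    finally show ?thesis by (simp add: r_def)
  qed
  have m: "(\<lambda>\<xi>. norm \<xi> ^ (k + l) *\<^sub>R F0 \<xi>) \<in> borel_measurable borel"
    using F0m by (intro borel_measurable_scaleR) measurable
  have "nsq (\<lambda>\<xi>. norm \<xi> ^ k *\<^sub>R F \<xi>) \<le> (\<integral>\<^sup>+\<xi>. ennreal a * ennreal (exp (- b * (norm \<xi>)\<^sup>2)) +
      ennreal d * ennreal ((norm (norm \<xi> ^ (k + l) *\<^sub>R F0 \<xi>))\<^sup>2) \<partial>lborel)"
    unfolding nsq_def
  proof (rule nn_integral_mono)
    fix \<xi> :: "real^'n"
    have "ennreal ((norm (norm \<xi> ^ k *\<^sub>R F \<xi>))\<^sup>2) \<le> ennreal (a * exp (- b * (norm \<xi>)\<^sup>2) + d * (norm (norm \<xi> ^ (k + l) *\<^sub>R F0 \<xi>))\<^sup>2)"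
      by (rule ennreal_leI[OF pointwise])
    also have "\<dots> = ennreal a * ennreal (exp (- b * (norm \<xi>)\<^sup>2)) + ennreal d * ennreal ((norm (norm \<xi> ^ (k + l) *\<^sub>R F0 \<xi>))\<^sup>2)"
      using a d by (simp only: ennreal_plus ennreal_mult mult_nonneg_nonneg exp_ge_zero zero_le_power2)
    finally show "ennreal ((norm (norm \<xi> ^ k *\<^sub>R F \<xi>))\<^sup>2) \<le> \<dots>" .
  qed
  also have "\<dots> = ennreal a * (\<integral>\<^sup>+\<xi>. ennreal (exp (- b * (norm (\<xi>::real^'n))\<^sup>2)) \<partial>lborel) + ennreal d * nsq (\<lambda>\<xi>. norm \<xi> ^ (k + l) *\<^sub>R F0 \<xi>)"
  proof -
    have m1: "(\<lambda>\<xi>::real^'n. ennreal (exp (- b * (norm \<xi>)\<^sup>2))) \<in> borel_measurable lborel" by measurable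
    have m2: "(\<lambda>\<xi>. ennreal ((norm (norm \<xi> ^ (k + l) *\<^sub>R F0 \<xi>))\<^sup>2)) \<in> borel_measurable lborel"
      using m by measurable
    show ?thesis
      unfolding nsq_def
        nn_integral_add[OF borel_measurable_times_ennreal[OF borel_measurable_const m1] borel_measurable_times_ennreal[OF borel_measurable_const m2]]
        nn_integral_cmult[OF m1] nn_integral_cmult[OF m2] ..
  qed
  also have "ennreal a * (\<integral>\<^sup>+\<xi>. ennreal (exp (- b * (norm (\<xi>::real^'n))\<^sup>2)) \<partial>lborel) =
      ennreal (D1 * (1 + t) powr (- real CARD('n) / 2 - real k) * K\<^sup>2)"
  proof -
    have "(pi / b) powr (real CARD('n) / 2) = (4 * pi / c) powr (real CARD('n) / 2) * (1 + t) powr (- real CARD('n) / 2)"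
    proof -
      have "pi / b = (4 * pi / c) * (1 / (1 + t))" using c t by (simp add: b_def field_simps)
      moreover have "(1 / (1 + t)) powr (real CARD('n) / 2) = (1 + t) powr (- real CARD('n) / 2)"
        using t by (simp add: powr_divide powr_minus_divide)
      ultimately show ?thesis using c t by (simp only: powr_mult)
    qed
    moreover have "(1 + t) powr (- real CARD('n) / 2 - real k) = (1 + t) powr (- real CARD('n) / 2) / (1 + t) ^ k"
      using t by (simp add: powr_diff powr_realpow)
    ultimately have "a * (pi / b) powr (real CARD('n) / 2) = D1 * (1 + t) powr (- real CARD('n) / 2 - real k) * K\<^sup>2"
      by (simp add: a_def D1_def mult_ac)
    then show ?thesis unfolding nn_integral_gauss[OF b] using a by (simp flip: ennreal_mult)
  qed
  also have "d = D2 * (1 + t) powr (- real l)"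
    using t by (simp add: d_def powr_minus_divide powr_realpow)
  finally show ?thesis .
qed

text \<open>The square root of \<open>nsq_decay\<close> halves the exponents. The constant depends
  on k and l only, not on s, the datum or the solution.\<close>

theorem derivative_decay:
  fixes A0 L S :: "real^'m^'m" and A :: "'n::finite \<Rightarrow> real^'m^'m"
  assumes A: "cond_A A0 A L" and S: "cond_S A0 L S" "cond_S1 A L S" and K: "cond_K A0 A L"
  obtains D :: "nat \<Rightarrow> nat \<Rightarrow> real" where "\<And>k l. D k l \<ge> 0"
    "\<And>s u0 u k l t. cauchy_solution A0 A L u0 u \<Longrightarrow> in_Hs s u0 \<Longrightarrow> in_L1 u0 \<Longrightarrow> k + l \<le> s \<Longrightarrow> t \<ge> 0 \<Longrightarrow>
      in_Hs k (u t) \<and> norm_L2_derivs k (u t)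
        \<le> D k l * ((1 + t) powr (- real CARD('n) / 4 - real k / 2) * norm_L1 u0
          + (1 + t) powr (- real l / 2) * norm_L2_derivs (k + l) u0)"
proof -
  obtain B where B: "A0 ** B = mat 1" "B ** A0 = mat 1" using cond_A_inverse[OF A] by blast
  obtain C c where C: "C > 0" "c > 0"
    and decay: "\<And>\<xi> v t. fourier_ode A0 A L \<xi> v \<Longrightarrow> t \<ge> 0 \<Longrightarrow> norm (v t) \<le> C * exp (- c * eta \<xi> * t) * norm (v 0)"
    using pointwise_decay[OF A S K] by blast
  define q where "q = (2 * pi) powr (- real CARD('n) / 2) * real CARD('m)"
  define D1 where "D1 k = C\<^sup>2 * (exp (c / 2) * (fact k / (c / 4) ^ k)) * (4 * pi / c) powr (real CARD('n) / 2)" for k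
  define D2 where "D2 l = C\<^sup>2 * (exp (c / 2) * (fact l / (c / 2) ^ l))" for l
  have D: "D1 k \<ge> 0" "D2 k \<ge> 0" for k using C by (auto simp: D1_def D2_def)
  have q: "q \<ge> 0" by (simp add: q_def)
  show ?thesis
  proof (rule that)
    show "sqrt (D1 k) * q + sqrt (D2 l) \<ge> 0" for k l using D q by simp
    fix s :: nat and u0 and u :: "real \<Rightarrow> real^'n \<Rightarrow> real^'m" and k l :: nat and t :: real
    assume sol: "cauchy_solution A0 A L u0 u" and Hs: "in_Hs s u0" and L1: "in_L1 u0" and kl: "k + l \<le> s" and t: "t \<ge> 0"
    define F0 where "F0 = fourier_L1 u0"
    define F where "F \<xi> = flow B A L \<xi> t (F0 \<xi>)" for \<xi>
    have i: "integrable lborel u0" using L1 by (simp add: in_L1_def)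
    have "in_L2 u0" using Hs by (simp add: in_Hs_def)
    then have "fourier_L2 u0 F0" unfolding F0_def by (rule fourier_L2_of_L1[OF _ L1])
    then have F: "fourier_L2 (u t) F"
      unfolding F_def[abs_def] by (rule fourier_L2_flow[OF A S K B sol _ t])
    have F0m: "F0 \<in> borel_measurable borel" unfolding F0_def by (rule fourier_L1_measurable[OF i])
    have F_le: "norm (F \<xi>) \<le> C * exp (- c * eta \<xi> * t) * norm (F0 \<xi>)" for \<xi>
      using decay[OF fourier_ode_flow[OF B(1)] t] unfolding F_def by (metis flow_0)
    have F_le': "norm (F \<xi>) \<le> C * norm (F0 \<xi>)" for \<xi>
    proof -
      have "C * exp (- c * eta \<xi> * t) * norm (F0 \<xi>) \<le> C * 1 * norm (F0 \<xi>)"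
        using C t by (intro mult_right_mono mult_left_mono) (auto simp: eta_def)
      then show ?thesis using F_le[of \<xi>] by simp
    qed
    \<comment> \<open>The flow is bounded uniformly in the frequency, so the regularity of the datum
      is inherited by u(t). This yields \<open>in_Hs k (u t)\<close>, without which the norm of the
      derivatives would have no meaning.\<close>
    have fin: "nsq (\<lambda>\<xi>. norm \<xi> ^ j *\<^sub>R F \<xi>) < \<infinity>" if "j \<le> k" for j
    proof -
      have "nsq (\<lambda>\<xi>. norm \<xi> ^ j *\<^sub>R F \<xi>) \<le> ennreal (C\<^sup>2) * nsq (\<lambda>\<xi>. norm \<xi> ^ j *\<^sub>R F0 \<xi>)"
      proof (rule nsq_cmult)
        show "(\<lambda>\<xi>. norm \<xi> ^ j *\<^sub>R F0 \<xi>) \<in> borel_measurable borel"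
          using F0m by (intro borel_measurable_scaleR) measurable
        show "norm (norm \<xi> ^ j *\<^sub>R F \<xi>) \<le> C * norm (norm \<xi> ^ j *\<^sub>R F0 \<xi>)" for \<xi>
          using mult_left_mono[OF F_le', of "norm \<xi> ^ j" \<xi>] by (simp add: mult_ac)
      qed (use C in simp)
      also have "\<dots> \<le> ennreal (C\<^sup>2) * ennreal ((norm_L2_derivs j u0)\<^sup>2)"
        unfolding F0_def using that kl by (intro mult_left_mono nsq_norm_power_le_derivs[OF Hs L1]) auto
      also have "\<dots> < \<infinity>" by (simp add: ennreal_mult_less_top)
      finally show ?thesis .
    qed
    note d = derivs_le_nsq_norm_power[OF F fin]
    define X where "X = D1 k * (1 + t) powr (- real CARD('n) / 2 - real k) * (q * norm_L1 u0)\<^sup>2"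
    define Y where "Y = D2 l * (1 + t) powr (- real l)"
    define N where "N = norm_L2_derivs (k + l) u0"
    have N: "N \<ge> 0" by (simp add: N_def norm_L2_derivs_def sum_nonneg)
    have N1: "norm_L1 u0 \<ge> 0" by (simp add: norm_L1_def)
    have XY: "X \<ge> 0" "Y \<ge> 0" using D by (auto simp: X_def Y_def)
    have "ennreal ((norm_L2_derivs k (u t))\<^sup>2) \<le> nsq (\<lambda>\<xi>. norm \<xi> ^ k *\<^sub>R F \<xi>)" by (rule d(2))
    also have "\<dots> \<le> ennreal X + ennreal Y * nsq (\<lambda>\<xi>. norm \<xi> ^ (k + l) *\<^sub>R F0 \<xi>)"
      unfolding X_def Y_def D1_def D2_def
    proof (rule nsq_decay[OF F_le _ F0m C(2,1) t])
      show "norm (F0 \<xi>) \<le> q * norm_L1 u0" for \<xi>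
        unfolding F0_def q_def by (rule fourier_L1_norm_le[OF i])
    qed
    also have "\<dots> \<le> ennreal X + ennreal Y * ennreal (N\<^sup>2)"
      unfolding F0_def N_def by (intro add_left_mono mult_left_mono nsq_norm_power_le_derivs[OF Hs L1 kl]) simp
    also have "\<dots> = ennreal (X + Y * N\<^sup>2)" using XY by (simp add: ennreal_mult ennreal_plus)
    finally have "(norm_L2_derivs k (u t))\<^sup>2 \<le> X + Y * N\<^sup>2" using XY by (subst (asm) ennreal_le_iff) auto
    then have "norm_L2_derivs k (u t) \<le> sqrt (X + Y * N\<^sup>2)" by (rule real_le_rsqrt)
    also have "\<dots> \<le> sqrt X + sqrt (Y * N\<^sup>2)" using XY by (intro sqrt_add_le_add_sqrt) auto
    also have "sqrt X = sqrt (D1 k) * q * ((1 + t) powr (- real CARD('n) / 4 - real k / 2) * norm_L1 u0)"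
    proof -
      have "sqrt ((1 + t) powr (- real CARD('n) / 2 - real k)) = (1 + t) powr (- real CARD('n) / 4 - real k / 2)"
        by (simp add: powr_half_sqrt[symmetric] powr_powr diff_divide_distrib)
      then show ?thesis using q N1 by (simp add: X_def real_sqrt_mult)
    qed
    also have "sqrt (Y * N\<^sup>2) = sqrt (D2 l) * ((1 + t) powr (- real l / 2) * N)"
    proof -
      have "sqrt ((1 + t) powr (- real l)) = (1 + t) powr (- real l / 2)"
        by (simp add: powr_half_sqrt[symmetric] powr_powr)
      then show ?thesis using N by (simp add: Y_def real_sqrt_mult)
    qed
    also have "sqrt (D1 k) * q * ((1 + t) powr (- real CARD('n) / 4 - real k / 2) * norm_L1 u0) + sqrt (D2 l) * ((1 + t) powr (- real l / 2) * N)
      \<le> (sqrt (D1 k) * q + sqrt (D2 l)) * ((1 + t) powr (- real CARD('n) / 4 - real k / 2) * norm_L1 u0 + (1 + t) powr (- real l / 2) * N)"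
    proof -
      have "x * a + y * b \<le> (x + y) * (a + b)" if "x \<ge> 0" "y \<ge> 0" "a \<ge> 0" "b \<ge> 0" for x y a b :: real
        using that by (simp add: distrib_left distrib_right)
      then show ?thesis using D q N N1 by simp
    qed
    finally show "in_Hs k (u t) \<and> norm_L2_derivs k (u t) \<le> (sqrt (D1 k) * q + sqrt (D2 l)) *
      ((1 + t) powr (- real CARD('n) / 4 - real k / 2) * norm_L1 u0 + (1 + t) powr (- real l / 2) * norm_L2_derivs (k + l) u0)"
      using d(1) by (simp add: N_def)
  qed
qed

theorem theorem2p1:
  fixes A0 L :: "real^'m^'m" and A :: "'n::finite \<Rightarrow> real^'m^'m"
  assumes "cond_A A0 A L"
    and "\<exists>S. cond_S A0 L S \<and> cond_S1 A L S"
    and "cond_K A0 A L"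
  shows "(\<exists>C>0. \<exists>c>0. \<forall>u0 u u0h.
            cauchy_solution A0 A L u0 u \<and> fourier_L2 u0 u0h \<longrightarrow>
            (\<exists>uh. fourier_image A0 A L u u0h uh) \<and>
            (\<forall>uh. fourier_image A0 A L u u0h uh \<longrightarrow>
               (\<forall>t\<ge>0. \<forall>\<xi>. norm (uh t \<xi>) \<le> C * exp (- c * eta \<xi> * t) * norm (u0h \<xi>))))
         \<and> (\<forall>s::nat. \<exists>C>0. \<forall>u0 u.
            cauchy_solution A0 A L u0 u \<and> in_Hs s u0 \<and> in_L1 u0 \<longrightarrow>
            (\<forall>k l. k + l \<le> s \<longrightarrow> (\<forall>t\<ge>0. in_Hs k (u t) \<and>
               norm_L2_derivs k (u t)
                 \<le> C * (1 + t) powr (- real CARD('n) / 4 - real k / 2) * norm_L1 u0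
                   + C * (1 + t) powr (- real l / 2) * norm_L2_derivs (k + l) u0)))"
proof -
  obtain S where S: "cond_S A0 L S" "cond_S1 A L S" using assms(2) by blast
  obtain B where B: "A0 ** B = mat 1" "B ** A0 = mat 1" using cond_A_inverse[OF assms(1)] by blast
  obtain C c where C: "C > 0" "c > 0"
    and decay: "\<And>\<xi> v t. fourier_ode A0 A L \<xi> v \<Longrightarrow> t \<ge> 0 \<Longrightarrow> norm (v t) \<le> C * exp (- c * eta \<xi> * t) * norm (v 0)"
    using pointwise_decay[OF assms(1) S assms(3)] by blast
  have "(\<exists>uh. fourier_image A0 A L u u0h uh) \<and>
      (\<forall>uh. fourier_image A0 A L u u0h uh \<longrightarrow>
         (\<forall>t\<ge>0. \<forall>\<xi>. norm (uh t \<xi>) \<le> C * exp (- c * eta \<xi> * t) * norm (u0h \<xi>)))"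
    if sol: "cauchy_solution A0 A L u0 u" and u0h: "fourier_L2 u0 u0h" for u0 u u0h
  proof (intro conjI allI impI)
    \<comment> \<open>The flow supplies one Fourier image, so the estimate is not vacuous. The
      estimate itself follows for every image from the decay of all solutions of the transformed
      system.\<close>
    have "fourier_image A0 A L u u0h (\<lambda>t \<xi>. flow B A L \<xi> t (u0h \<xi>))"
      unfolding fourier_image_def
      by (intro conjI allI impI fourier_L2_flow[OF assms(1) S assms(3) B sol u0h] fourier_ode_flow[OF B(1)] flow_0)
    then show "\<exists>uh. fourier_image A0 A L u u0h uh" by blast
  next
    fix uh and t :: real and \<xi>
    assume "fourier_image A0 A L u u0h uh" "t \<ge> 0"
    then have "fourier_ode A0 A L \<xi> (\<lambda>t. uh t \<xi>)" "uh 0 \<xi> = u0h \<xi>" by (auto simp: fourier_image_def)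
    from decay[OF this(1) \<open>t \<ge> 0\<close>] this(2)
    show "norm (uh t \<xi>) \<le> C * exp (- c * eta \<xi> * t) * norm (u0h \<xi>)" by simp
  qed
  then have part1: "\<exists>C>0. \<exists>c>0. \<forall>u0 u u0h.
            cauchy_solution A0 A L u0 u \<and> fourier_L2 u0 u0h \<longrightarrow>
            (\<exists>uh. fourier_image A0 A L u u0h uh) \<and>
            (\<forall>uh. fourier_image A0 A L u u0h uh \<longrightarrow>
               (\<forall>t\<ge>0. \<forall>\<xi>. norm (uh t \<xi>) \<le> C * exp (- c * eta \<xi> * t) * norm (u0h \<xi>)))"
    using C by blast
  obtain D :: "nat \<Rightarrow> nat \<Rightarrow> real" where D: "\<And>k l. D k l \<ge> 0"
    and est: "\<And>s u0 u k l t. cauchy_solution A0 A L u0 u \<Longrightarrow> in_Hs s u0 \<Longrightarrow> in_L1 u0 \<Longrightarrow> k + l \<le> s \<Longrightarrow> t \<ge> 0 \<Longrightarrow>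
      in_Hs k (u t) \<and> norm_L2_derivs k (u t)
        \<le> D k l * ((1 + t) powr (- real CARD('n) / 4 - real k / 2) * norm_L1 u0
          + (1 + t) powr (- real l / 2) * norm_L2_derivs (k + l) u0)"
    using derivative_decay[OF assms(1) S assms(3)] by blast
  have part2: "\<exists>C>0. \<forall>u0 u.
            cauchy_solution A0 A L u0 u \<and> in_Hs s u0 \<and> in_L1 u0 \<longrightarrow>
            (\<forall>k l. k + l \<le> s \<longrightarrow> (\<forall>t\<ge>0. in_Hs k (u t) \<and>
               norm_L2_derivs k (u t)
                 \<le> C * (1 + t) powr (- real CARD('n) / 4 - real k / 2) * norm_L1 u0
                   + C * (1 + t) powr (- real l / 2) * norm_L2_derivs (k + l) u0))" for s
  proof -
    \<comment> \<open>For given s finitely many pairs (k, l) occur, so the sum of their constants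
      serves all of them; the summand 1 makes it positive.\<close>
    define M where "M = 1 + (\<Sum>k\<le>s. \<Sum>l\<le>s. D k l)"
    have M_pos: "M > 0" unfolding M_def by (intro add_pos_nonneg sum_nonneg D) simp
    have M: "D k l \<le> M" if "k + l \<le> s" for k l
    proof -
      have "D k l \<le> (\<Sum>l\<le>s. D k l)" using that D by (intro member_le_sum) auto
      also have "\<dots> \<le> (\<Sum>k\<le>s. \<Sum>l\<le>s. D k l)"
        using that D by (intro member_le_sum[where f="\<lambda>k. \<Sum>l\<le>s. D k l"] sum_nonneg) auto
      finally show ?thesis by (simp add: M_def)
    qed
    show ?thesis
    proof (intro exI[of _ M] conjI M_pos allI impI)
      fix u0 and u :: "real \<Rightarrow> real^'n \<Rightarrow> real^'m" and k l :: nat and t :: real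
      assume *: "cauchy_solution A0 A L u0 u \<and> in_Hs s u0 \<and> in_L1 u0" and kl: "k + l \<le> s" and t: "0 \<le> t"
      note e = est[of u0 u s k l t]
      show "in_Hs k (u t)" using e * kl t by blast
      let ?Z = "(1 + t) powr (- real CARD('n) / 4 - real k / 2) * norm_L1 u0 + (1 + t) powr (- real l / 2) * norm_L2_derivs (k + l) u0"
      have "?Z \<ge> 0"
        by (intro add_nonneg_nonneg mult_nonneg_nonneg) (auto simp: norm_L1_def norm_L2_derivs_def sum_nonneg)
      then have "D k l * ?Z \<le> M * ?Z" by (intro mult_right_mono M kl)
      then have "norm_L2_derivs k (u t) \<le> M * ?Z" using e * kl t by linarith
      then show "norm_L2_derivs k (u t) \<le> M * (1 + t) powr (- real CARD('n) / 4 - real k / 2) * norm_L1 u0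
          + M * (1 + t) powr (- real l / 2) * norm_L2_derivs (k + l) u0"
        by (simp add: distrib_left mult.assoc)
    qed
  qed
  from part1 part2 show ?thesis by blast
qed

end
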